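(* Let $*$ be either $\{0\}$ or $\{1\}$. Then one can choose $F^*\colon A^*\to A^*$ with the Frobenius property (and $V^*=p(F^* )^{-1}$) such that the following hold. (i) If $I$ is a fractional $R_p^*$-ideal, then $W\otimes_{\mathbb Z_p}I$ is a $W_R^*\{F^*,V^*\}$-ideal. (ii) If $J$ is a $W_R^*\{F^*,V^*\}$-ideal, then $J=W\otimes_{\mathbb Z_p}(\Delta^* )^{-1}(J\cap\Delta^*(E_p^* ))$. (iii) For any $W_R^*\{F^*,V^*\}$-ideals $J_1,J_2$ there is a bijection $$\mathrm{Hom}_{\Delta^*}(J_1\cap\Delta^*(E_p^* ),\,J_2\cap\Delta^*(E_p^* ))\longleftrightarrow\mathrm{Hom}_{W_R^*\{F^*,V^*\}}(J_1,J_2).$$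
   Context: Let $q=p^a$ with $p$ prime, and let $h\in\mathbb Z[x]$ be the square-free characteristic polynomial of the Frobenius endomorphism $\pi$ of an abelian variety over $\mathbb F_q$. Put $E=\mathbb Q[\pi]=\mathbb Q[x]/(h)$, $R=\mathbb Z[\pi,q/\pi]$, $E_p=E\otimes_{\mathbb Q}\mathbb Q_p=\prod_{\nu\mid p}E_\nu$, $R_p=R\otimes_{\mathbb Z}\mathbb Z_p$. The slope of a place $\nu$ of $E_p$ is $s(\nu)=\mathrm{val}_\nu(\pi)/(ae_\nu)\in[0,1]$, with $\mathrm{val}_\nu$ the normalized valuation and $e_\nu$ the ramification index. Fractional ideals are finitely generated modules that are lattices of full rank. Each maximal ideal of $R_p$ lies below places whose slopes all belong to exactly one of $\{0\}$, $(0,1)$, $\{1\}$; for $*$ one of these, $R_p^*$ is the product of the completions of $R_p$ at the maximal ideals lying below places with slope in $*$ (the zero ring if there are none), so $R_p=R_p^{\{0\}}\times R_p^{(0,1)}\times R_p^{\{1\}}$. Put $E_p^*=\prod_{s(\nu)\in *}E_\nu$. Let $L$ be the unramified extension of $\mathbb Q_p$ of degree $a$, $W$ its ring of integers, $\sigma$ its Frobenius over $\mathbb Q_p$. Put $A^*=L\otimes_{\mathbb Q_p}E_p^*$, $W_R^*=W\otimes_{\mathbb Z_p}R_p^*\subseteq A^*$, $\Delta^*\colon E_p^*\to A^*$, $x\mapsto1\otimes x$, and let $\sigma$ act on $A^*$ as $\sigma\otimes\mathrm{id}$. A map $F^*=\alpha\circ\sigma$ (i.e. $z\mapsto\alpha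 z^\sigma$ for some $\alpha\in A^*$) has the Frobenius property if it is additive, $F^*\lambda=\lambda^\sigma F^*$ for all $\lambda\in L$, and $(F^* )^a$ is multiplication by $\Delta^*(\pi)$. A $W_R^*\{F^*,V^*\}$-ideal is a fractional $W_R^*$-ideal in $A^*$ stable under $F^*$ and $V^*=p(F^* )^{-1}$. $\mathrm{Hom}_{W_R^*\{F^*,V^*\}}(J_1,J_2)$ is the set of $W_R^*$-linear maps $J_1\to J_2$ commuting with $F^*$ and $V^*$. For subsets $N_1,N_2\subseteq A^*$, $\mathrm{Hom}_{\Delta^*}(N_1,N_2)=\{x\in E_p^*:\Delta^*(x)N_1\subseteq N_2\}$. *)

theory Defs
  imports
    "HOL-Library.Extended_Real"
    "HOL-Library.Cardinality"
    "HOL-Computational_Algebra.Squarefree"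
    "HOL-Algebra.Algebraic_Closure_Type"
    "HOL-Algebra.Generated_Rings"
    "HOL-Algebra.Ideal_Product"
    "Jordan_Normal_Form.Char_Poly"
begin

section \<open>Abelian varieties over a finite field\<close>

text \<open>
  The type \<open>'c\<close> is the finite field of \<open>q\<close> elements and \<open>'c alg_closure\<close> its algebraic closure.
  Since finite fields are perfect, a geometrically reduced projective variety over \<open>'c\<close> is given
  by its set of geometric points, cut out by forms with coefficients in \<open>'c\<close>.
  A point of projective \<open>n\<close>-space is represented by the homogeneous coordinate vector whose first
  nonzero entry is 1. As the algebraic closure is infinite, forms are identified with the
  functions they induce.
\<close>

definition proj_space :: "nat \<Rightarrow> (nat \<Rightarrow> 'b::field) set" where
  "proj_space n = {x. (\<exists>i\<le>n. x i = 1 \<and> (\<forall>j<i. x j = 0)) \<and> (\<forall>j>n. x j = 0)}"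

inductive form :: "'b::field set \<Rightarrow> nat \<Rightarrow> nat \<Rightarrow> ((nat \<Rightarrow> 'b) \<Rightarrow> 'b) \<Rightarrow> bool"
  for C :: "'b::field set" and n :: nat where
  coeff: "c \<in> C \<Longrightarrow> form C n 0 (\<lambda>x. c)"
| var: "i \<le> n \<Longrightarrow> form C n 1 (\<lambda>x. x i)"
| add: "form C n d f \<Longrightarrow> form C n d g \<Longrightarrow> form C n d (\<lambda>x. f x + g x)"
| mult: "form C n d f \<Longrightarrow> form C n e g \<Longrightarrow> form C n (d + e) (\<lambda>x. f x * g x)"

inductive biform ::
    "'b::field set \<Rightarrow> nat \<Rightarrow> nat \<Rightarrow> nat \<Rightarrow> ((nat \<Rightarrow> 'b) \<Rightarrow> (nat \<Rightarrow> 'b) \<Rightarrow> 'b) \<Rightarrow> bool"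
  for C :: "'b::field set" and n :: nat where
  coeff: "c \<in> C \<Longrightarrow> biform C n 0 0 (\<lambda>x y. c)"
| var1: "i \<le> n \<Longrightarrow> biform C n 1 0 (\<lambda>x y. x i)"
| var2: "i \<le> n \<Longrightarrow> biform C n 0 1 (\<lambda>x y. y i)"
| add: "biform C n d e f \<Longrightarrow> biform C n d e g \<Longrightarrow> biform C n d e (\<lambda>x y. f x y + g x y)"
| mult: "biform C n d e f \<Longrightarrow> biform C n d' e' g \<Longrightarrow>
    biform C n (d + d') (e + e') (\<lambda>x y. f x y * g x y)"

definition zariski_closed :: "'b::field set \<Rightarrow> nat \<Rightarrow> (nat \<Rightarrow> 'b) set \<Rightarrow> bool" where
  "zariski_closed C n G \<longleftrightarrow>
    (\<exists>T. (\<forall>f\<in>T. \<exists>d. form C n d f) \<and> G = {x \<in> proj_space n. \<forall>f\<in>T. f x = 0})"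

definition geom_irreducible :: "nat \<Rightarrow> (nat \<Rightarrow> 'b::field) set \<Rightarrow> bool" where
  "geom_irreducible n G \<longleftrightarrow> G \<noteq> {} \<and>
    (\<forall>Y Z. zariski_closed UNIV n Y \<and> zariski_closed UNIV n Z \<and> G = Y \<union> Z \<longrightarrow> G = Y \<or> G = Z)"

text \<open>
  A map to projective space is a morphism over \<open>C\<close> if near every point it is given by a tuple of
  (bi)homogeneous forms over \<open>C\<close> of equal (bi)degree. Where the whole tuple vanishes, the condition
  below is met by taking the proportionality factor 0, so nothing is asserted there.
\<close>

definition morphism1 ::
    "'b::field set \<Rightarrow> nat \<Rightarrow> (nat \<Rightarrow> 'b) set \<Rightarrow> ((nat \<Rightarrow> 'b) \<Rightarrow> (nat \<Rightarrow> 'b)) \<Rightarrow> bool" where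
  "morphism1 C n G \<phi> \<longleftrightarrow> (\<forall>x0\<in>G. \<exists>d f. (\<forall>i\<le>n. form C n d (f i)) \<and> (\<exists>i\<le>n. f i x0 \<noteq> 0) \<and>
      (\<forall>x\<in>G. \<exists>c. \<forall>i\<le>n. f i x = c * \<phi> x i))"

definition morphism2 ::
    "'b::field set \<Rightarrow> nat \<Rightarrow> (nat \<Rightarrow> 'b) set \<Rightarrow>
      ((nat \<Rightarrow> 'b) \<Rightarrow> (nat \<Rightarrow> 'b) \<Rightarrow> (nat \<Rightarrow> 'b)) \<Rightarrow> bool" where
  "morphism2 C n G \<phi> \<longleftrightarrow> (\<forall>x0\<in>G. \<forall>y0\<in>G. \<exists>d e f.
      (\<forall>i\<le>n. biform C n d e (f i)) \<and> (\<exists>i\<le>n. f i x0 y0 \<noteq> 0) \<and>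
      (\<forall>x\<in>G. \<forall>y\<in>G. \<exists>c. \<forall>i\<le>n. f i x y = c * \<phi> x y i))"

definition abelian_variety ::
    "nat \<Rightarrow> (nat \<Rightarrow> 'c::{field,finite} alg_closure) monoid \<Rightarrow> bool" where
  "abelian_variety n G \<longleftrightarrow>
    comm_group G \<and>
    zariski_closed (range to_ac) n (carrier G) \<and>
    geom_irreducible n (carrier G) \<and>
    morphism2 (range to_ac) n (carrier G) (\<lambda>x y. x \<otimes>\<^bsub>G\<^esub> y) \<and>
    morphism1 (range to_ac) n (carrier G) (\<lambda>x. inv\<^bsub>G\<^esub> x)"

definition frobenius_endo ::
    "(nat \<Rightarrow> 'c::{field,finite} alg_closure) \<Rightarrow> (nat \<Rightarrow> 'c alg_closure)" where
  "frobenius_endo x = (\<lambda>i. x i ^ CARD('c))"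

text \<open>
  \<open>h\<close> is the characteristic polynomial of Frobenius acting on the Tate module \<open>T\<^sub>\<ell> G\<close>, for all
  primes \<open>\<ell>\<close> not dividing \<open>q\<close>. This is expressed on the quotients \<open>T\<^sub>\<ell> G / \<ell>\<^sup>k = G[\<ell>\<^sup>k]\<close>, free over
  \<open>\<int>/\<ell>\<^sup>k\<close>: \<open>P\<close> is a basis of \<open>G[\<ell>\<^sup>k]\<close> and \<open>M\<close> represents Frobenius in this basis. A monic integer
  polynomial is determined by these congruences.
\<close>

definition frobenius_char_poly ::
    "(nat \<Rightarrow> 'c::{field,finite} alg_closure) monoid \<Rightarrow> int poly \<Rightarrow> bool" where
  "frobenius_char_poly G h \<longleftrightarrow> lead_coeff h = 1 \<and>
    (\<forall>l k. Factorial_Ring.prime (l::nat) \<and> \<not> l dvd CARD('c) \<longrightarrow>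
      (\<exists>P M. M \<in> carrier_mat (Polynomial.degree h) (Polynomial.degree h) \<and>
        (\<forall>i<Polynomial.degree h. P i \<in> carrier G) \<and>
        bij_betw (\<lambda>c. finprod G (\<lambda>i. P i [^]\<^bsub>G\<^esub> (c i :: nat)) {..<Polynomial.degree h})
          ({..<Polynomial.degree h} \<rightarrow>\<^sub>E {..<l ^ k})
          {x \<in> carrier G. x [^]\<^bsub>G\<^esub> (l ^ k) = \<one>\<^bsub>G\<^esub>} \<and>
        (\<forall>j<Polynomial.degree h. frobenius_endo (P j) =
          finprod G (\<lambda>i. P i [^]\<^bsub>G\<^esub> (M $$ (i, j) :: int)) {..<Polynomial.degree h}) \<and>
        (\<forall>i. Polynomial.coeff (char_poly M) i mod int (l ^ k) =
             Polynomial.coeff h i mod int (l ^ k))))"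

section \<open>The p-adic numbers and their unramified extensions\<close>

text \<open>
  Valuations take the value \<open>\<infinity>\<close> at 0. On a ring with zero divisors the set of elements of value
  \<open>\<infinity>\<close> is a prime ideal; on a field it is 0.
\<close>

definition normalized_valuation :: "('r, 'm) ring_scheme \<Rightarrow> ('r \<Rightarrow> ereal) \<Rightarrow> bool" where
  "normalized_valuation B w \<longleftrightarrow>
    w ` carrier B = insert \<infinity> (range (\<lambda>k::int. ereal (of_int k))) \<and>
    w \<zero>\<^bsub>B\<^esub> = \<infinity> \<and> w \<one>\<^bsub>B\<^esub> = 0 \<and>
    (\<forall>x\<in>carrier B. \<forall>y\<in>carrier B.
       w (x \<otimes>\<^bsub>B\<^esub> y) = w x + w y \<and> min (w x) (w y) \<le> w (x \<oplus>\<^bsub>B\<^esub> y))"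

text \<open>
  The field of p-adic numbers, up to unique isomorphism: the completion of the rationals for the
  p-adic valuation. On the rationals, a valuation with \<open>v p = 1\<close> is the p-adic one.
\<close>

definition padic_field :: "nat \<Rightarrow> ('k::field_char_0 \<Rightarrow> ereal) \<Rightarrow> bool" where
  "padic_field p v \<longleftrightarrow>
    normalized_valuation ring_of_type_algebra v \<and>
    v (of_nat p) = 1 \<and>
    (\<forall>x. \<forall>N::nat. \<exists>r. ereal (real N) \<le> v (x - of_rat r)) \<and>
    (\<forall>G :: nat \<Rightarrow> 'k.
      (\<forall>N::nat. \<exists>K. \<forall>i\<ge>K. \<forall>j\<ge>K. ereal (real N) \<le> v (G i - G j)) \<longrightarrow>
      (\<exists>x. \<forall>N::nat. \<exists>K. \<forall>i\<ge>K. ereal (real N) \<le> v (G i - x)))"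

text \<open>
  Residue fields are finite here, hence perfect, so an extension is unramified iff its
  ramification index is 1, that is, iff its normalized valuation extends \<open>v\<close>.
\<close>

definition unramified_extension ::
    "('k::field_char_0 \<Rightarrow> ereal) \<Rightarrow> ('k \<Rightarrow> 'l::field_char_0) \<Rightarrow> ('l \<Rightarrow> ereal) \<Rightarrow> nat \<Rightarrow> bool" where
  "unramified_extension v \<iota> vL d \<longleftrightarrow>
    field_hom \<iota> \<and> 0 < d \<and> vector_space.dim (\<lambda>c y. \<iota> c * y) UNIV = d \<and>
    normalized_valuation ring_of_type_algebra vL \<and> (\<forall>c. vL (\<iota> c) = v c)"

definition frobenius_automorphism ::
    "nat \<Rightarrow> ('k::field_char_0 \<Rightarrow> 'l::field_char_0) \<Rightarrow> ('l \<Rightarrow> ereal) \<Rightarrow> ('l \<Rightarrow> 'l) \<Rightarrow> bool" where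
  "frobenius_automorphism p \<iota> vL \<sigma> \<longleftrightarrow>
    field_hom \<sigma> \<and> bij \<sigma> \<and> (\<forall>c. \<sigma> (\<iota> c) = \<iota> c) \<and> (\<forall>y. 0 \<le> vL y \<longrightarrow> 0 < vL (\<sigma> y - y ^ p))"

definition val_ring :: "('b \<Rightarrow> ereal) \<Rightarrow> 'b set" where
  "val_ring v = {c. 0 \<le> v c}"

section \<open>The algebras \<open>E\<close>, \<open>E\<^sub>p\<close>, \<open>A\<close> and their places\<close>

text \<open>
  \<open>quot_alg h\<close> is \<open>K[x]/(h)\<close> for the field \<open>K\<close> that is the coefficient type, its elements being
  represented by their remainders modulo \<open>h\<close>. Over \<open>rat\<close> it is \<open>E\<close>, over \<open>\<rat>\<^sub>p\<close> it is
  \<open>E\<^sub>p = E \<otimes> \<rat>\<^sub>p\<close> and over \<open>L\<close> it is \<open>A = L \<otimes> E\<^sub>p\<close>. Under these identifications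
  \<open>map_poly \<iota>\<close> is the map \<open>x \<mapsto> 1 \<otimes> x\<close> and \<open>map_poly \<sigma>\<close> is \<open>\<sigma> \<otimes> id\<close>.
\<close>

definition quot_alg :: "int poly \<Rightarrow> 'b::field_char_0 poly ring" where
  "quot_alg h =
    \<lparr>carrier = {u. u mod map_poly of_int h = u},
     monoid.mult = (\<lambda>u v. (u * v) mod map_poly of_int h), one = 1 mod map_poly of_int h,
     ring.zero = 0, add = (+)\<rparr>"

definition scalar :: "int poly \<Rightarrow> 'b::field_char_0 \<Rightarrow> 'b poly" where
  "scalar h c = [:c:] mod map_poly of_int h"

definition frob :: "int poly \<Rightarrow> 'b::field_char_0 poly" where
  "frob h = [:0, 1:] mod map_poly of_int h"

inductive_set lin_span :: "('r, 'm) ring_scheme \<Rightarrow> 'r set \<Rightarrow> 'r set \<Rightarrow> 'r set"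
  for B C S where
  zero: "\<zero>\<^bsub>B\<^esub> \<in> lin_span B C S"
| step: "c \<in> C \<Longrightarrow> s \<in> S \<Longrightarrow> y \<in> lin_span B C S \<Longrightarrow> (c \<otimes>\<^bsub>B\<^esub> s) \<oplus>\<^bsub>B\<^esub> y \<in> lin_span B C S"

text \<open>
  A place of \<open>E\<^sub>p\<close> is given by its normalized valuation, read on \<open>E\<^sub>p\<close> through the projection
  \<open>E\<^sub>p \<rightarrow> E\<^sub>\<nu>\<close>; the kernel of this projection is the set of elements of value \<open>\<infinity>\<close>. The
  ramification index is the value of \<open>p\<close>.
\<close>

definition places :: "nat \<Rightarrow> ('k::field_char_0 \<Rightarrow> ereal) \<Rightarrow> int poly \<Rightarrow> ('k poly \<Rightarrow> ereal) set" where
  "places p v h = {w. normalized_valuation (quot_alg h) w \<and>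
     0 < w (scalar h (of_nat p)) \<and> (\<forall>c. w (scalar h c) = w (scalar h (of_nat p)) * v c)}"

definition slope :: "nat \<Rightarrow> nat \<Rightarrow> int poly \<Rightarrow> ('k::field_char_0 poly \<Rightarrow> ereal) \<Rightarrow> real" where
  "slope p a h w =
     real_of_ereal (w (frob h)) / (real a * real_of_ereal (w (scalar h (of_nat p))))"

text \<open>
  \<open>\<Prod>\<^bsub>s(\<nu>) \<in> S\<^esub> E\<^sub>\<nu>\<close> as a factor of \<open>E\<^sub>p\<close>, that is, as the ideal of the elements of \<open>E\<^sub>p\<close> whose
  components at the other places vanish.
\<close>

definition E_part ::
    "nat \<Rightarrow> nat \<Rightarrow> ('k::field_char_0 \<Rightarrow> ereal) \<Rightarrow> int poly \<Rightarrow> real set \<Rightarrow> 'k poly set" where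
  "E_part p a v h S =
     {x \<in> carrier (quot_alg h). \<forall>w \<in> places p v h. slope p a h w \<notin> S \<longrightarrow> w x = \<infinity>}"

definition R_order :: "nat \<Rightarrow> nat \<Rightarrow> int poly \<Rightarrow> rat poly set" where
  "R_order p a h = generate_ring (quot_alg h)
     {frob h, scalar h (of_nat (p ^ a)) \<otimes>\<^bsub>quot_alg h\<^esub> inv\<^bsub>quot_alg h\<^esub> (frob h)}"

text \<open>
  Since \<open>R\<close> is torsion-free, \<open>R \<otimes> \<int>\<^sub>p\<close> is the \<open>\<int>\<^sub>p\<close>-span of \<open>R\<close> in \<open>E\<^sub>p\<close>.
\<close>

definition R_p ::
    "nat \<Rightarrow> nat \<Rightarrow> ('k::field_char_0 \<Rightarrow> ereal) \<Rightarrow> int poly \<Rightarrow> 'k poly set" where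
  "R_p p a v h =
     lin_span (quot_alg h) (scalar h ` val_ring v) (map_poly of_rat ` R_order p a h)"

definition center :: "'r set \<Rightarrow> ('r \<Rightarrow> ereal) \<Rightarrow> 'r set" where
  "center R w = {x \<in> R. 0 < w x}"

text \<open>
  The product of the completions of \<open>R\<^sub>p\<close> at the maximal ideals below the places with slope in \<open>S\<close>,
  as a subring of \<open>\<Prod>\<^bsub>s(\<nu>) \<in> S\<^esub> E\<^sub>\<nu>\<close>. An element of the completion at \<open>m\<close>, i.e. of the inverse limit
  of the \<open>R\<^sub>p / m\<^sup>n\<close>, is given by a sequence \<open>r\<close> in \<open>R\<^sub>p\<close> with \<open>r (n + 1)\<close> congruent to \<open>r n\<close>
  modulo \<open>m\<^sup>n\<close>; its component in \<open>E\<^sub>\<nu>\<close>, for \<open>\<nu>\<close> above \<open>m\<close>, is the limit of \<open>r\<close>.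
\<close>

definition R_part ::
    "nat \<Rightarrow> nat \<Rightarrow> ('k::field_char_0 \<Rightarrow> ereal) \<Rightarrow> int poly \<Rightarrow> real set \<Rightarrow> 'k poly set" where
  "R_part p a v h S =
    (let Rp = (quot_alg h) \<lparr>carrier := R_p p a v h\<rparr> in
     {x \<in> E_part p a v h S.
       \<forall>m. maximalideal m Rp \<and>
           (\<exists>w \<in> places p v h. slope p a h w \<in> S \<and> m = center (carrier Rp) w) \<longrightarrow>
         (\<exists>r. (\<forall>n::nat. r n \<in> carrier Rp \<and> r (Suc n) \<ominus>\<^bsub>quot_alg h\<^esub> r n \<in> m [^]\<^bsub>ideals_set Rp\<^esub> n) \<and>
           (\<forall>w \<in> places p v h. m = center (carrier Rp) w \<longrightarrow>
             (\<lambda>n. w (x \<ominus>\<^bsub>quot_alg h\<^esub> r n)) \<longlonglongrightarrow> \<infinity>))})"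

text \<open>
  Inside \<open>A = L \<otimes> E\<^sub>p\<close>, the tensor product over \<open>\<int>\<^sub>p\<close> (or \<open>\<rat>\<^sub>p\<close>) of \<open>C \<subseteq> L\<close> with a submodule \<open>N\<close>
  of \<open>E\<^sub>p\<close> is the span of the \<open>c \<otimes> x\<close>.
\<close>

definition tensor ::
    "int poly \<Rightarrow> ('k::field_char_0 \<Rightarrow> 'l::field_char_0) \<Rightarrow> 'l set \<Rightarrow> 'k poly set \<Rightarrow> 'l poly set" where
  "tensor h \<iota> C N = lin_span (quot_alg h) (scalar h ` C) (map_poly \<iota> ` N)"

section \<open>Fractional ideals, Frobenius and Verschiebung\<close>

text \<open>
  Fractional \<open>R\<close>-ideals in \<open>V\<close>, where \<open>Z\<close> and \<open>Q\<close> are the images of \<open>\<int>\<^sub>p\<close> and \<open>\<rat>\<^sub>p\<close> in \<open>B\<close>: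
  finitely generated \<open>R\<close>-modules that are \<open>\<int>\<^sub>p\<close>-lattices of full rank in \<open>V\<close>.
\<close>

definition fractional_ideal ::
    "('r, 'm) ring_scheme \<Rightarrow> 'r set \<Rightarrow> 'r set \<Rightarrow> 'r set \<Rightarrow> 'r set \<Rightarrow> 'r set \<Rightarrow> bool" where
  "fractional_ideal B Z Q R V I \<longleftrightarrow>
    (\<exists>T. finite T \<and> T \<subseteq> V \<and> I = lin_span B R T) \<and>
    (\<exists>T. finite T \<and> T \<subseteq> V \<and> I = lin_span B Z T) \<and>
    lin_span B Q I = V"

text \<open>In the following definitions \<open>A\<close> is the factor \<open>A\<^sup>*\<close> and \<open>WR\<close> is \<open>W\<^sub>R\<^sup>*\<close>.\<close>

definition frobenius_property ::
    "nat \<Rightarrow> int poly \<Rightarrow> ('l::field_char_0 \<Rightarrow> 'l) \<Rightarrow> 'l poly set \<Rightarrow> ('l poly \<Rightarrow> 'l poly) \<Rightarrow> bool" where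
  "frobenius_property a h \<sigma> A F \<longleftrightarrow>
    (\<exists>\<alpha>\<in>A. \<forall>z\<in>A. F z = \<alpha> \<otimes>\<^bsub>quot_alg h\<^esub> map_poly \<sigma> z) \<and>
    (\<forall>y\<in>A. \<forall>z\<in>A. F (y \<oplus>\<^bsub>quot_alg h\<^esub> z) = F y \<oplus>\<^bsub>quot_alg h\<^esub> F z) \<and>
    (\<forall>c. \<forall>z\<in>A. F (scalar h c \<otimes>\<^bsub>quot_alg h\<^esub> z) = scalar h (\<sigma> c) \<otimes>\<^bsub>quot_alg h\<^esub> F z) \<and>
    (\<forall>z\<in>A. (F ^^ a) z = frob h \<otimes>\<^bsub>quot_alg h\<^esub> z)"

text \<open>\<open>V = p F\<^sup>-\<^sup>1\<close>; the Frobenius property makes \<open>F\<close> a bijection of \<open>A\<close>, as \<open>\<pi>\<close> is a unit.\<close>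

definition verschiebung ::
    "nat \<Rightarrow> int poly \<Rightarrow> 'l::field_char_0 poly set \<Rightarrow> ('l poly \<Rightarrow> 'l poly) \<Rightarrow> 'l poly \<Rightarrow> 'l poly" where
  "verschiebung p h A F z = scalar h (of_nat p) \<otimes>\<^bsub>quot_alg h\<^esub> inv_into A F z"

definition WFV_ideal ::
    "nat \<Rightarrow> ('k::field_char_0 \<Rightarrow> ereal) \<Rightarrow> ('k \<Rightarrow> 'l::field_char_0) \<Rightarrow> int poly \<Rightarrow>
      'l poly set \<Rightarrow> 'l poly set \<Rightarrow> ('l poly \<Rightarrow> 'l poly) \<Rightarrow> 'l poly set \<Rightarrow> bool" where
  "WFV_ideal p v \<iota> h WR A F J \<longleftrightarrow>
    fractional_ideal (quot_alg h) (scalar h ` \<iota> ` val_ring v) (scalar h ` range \<iota>) WR A J \<and>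
    (\<forall>z\<in>J. F z \<in> J) \<and> (\<forall>z\<in>J. verschiebung p h A F z \<in> J)"

definition WFV_hom ::
    "nat \<Rightarrow> int poly \<Rightarrow> 'l::field_char_0 poly set \<Rightarrow> 'l poly set \<Rightarrow> ('l poly \<Rightarrow> 'l poly) \<Rightarrow>
      'l poly set \<Rightarrow> 'l poly set \<Rightarrow> ('l poly \<Rightarrow> 'l poly) set" where
  "WFV_hom p h WR A F J1 J2 = {g \<in> J1 \<rightarrow>\<^sub>E J2.
    (\<forall>y\<in>J1. \<forall>z\<in>J1. g (y \<oplus>\<^bsub>quot_alg h\<^esub> z) = g y \<oplus>\<^bsub>quot_alg h\<^esub> g z) \<and>
    (\<forall>r\<in>WR. \<forall>z\<in>J1. g (r \<otimes>\<^bsub>quot_alg h\<^esub> z) = r \<otimes>\<^bsub>quot_alg h\<^esub> g z) \<and>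
    (\<forall>z\<in>J1. g (F z) = F (g z)) \<and>
    (\<forall>z\<in>J1. g (verschiebung p h A F z) = verschiebung p h A F (g z))}"

definition Delta_hom ::
    "int poly \<Rightarrow> ('k::field_char_0 \<Rightarrow> 'l::field_char_0) \<Rightarrow> 'k poly set \<Rightarrow>
      'l poly set \<Rightarrow> 'l poly set \<Rightarrow> 'k poly set" where
  "Delta_hom h \<iota> Ep N1 N2 = {x \<in> Ep. \<forall>z\<in>N1. map_poly \<iota> x \<otimes>\<^bsub>quot_alg h\<^esub> z \<in> N2}"

end

theory Submission
  imports Defs "HOL-Number_Theory.Residues" "Berlekamp_Zassenhaus.Square_Free_Int_To_Square_Free_GFp"
begin

text \<open>
  On the part of slope 0 the element \<open>\<pi>\<close> is a unit at all places, and on the part of slope 1 so is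
  \<open>q/\<pi>\<close>; call this unit \<open>zz\<close>. Write \<open>h = g k\<close>, where \<open>k\<close> collects the factors of \<open>h\<close> over \<open>\<rat>\<^sub>p\<close> that
  belong to places with slope in \<open>S\<close>, so that \<open>E\<^sub>p\<^sup>* = \<rat>\<^sub>p[x]/(k)\<close> and \<open>A\<^sup>* = L[x]/(k)\<close>. Since \<open>zz\<close> and its
  inverse are integral at every root of \<open>k\<close>, the ring \<open>B = W[zz]\<close> is a finite \<open>W\<close>-module in \<open>A\<^sup>*\<close>
  containing \<open>zz\<^sup>-\<^sup>1\<close>.

  The key point is that \<open>zz\<close> is the norm of a unit \<open>\<beta>\<close> of \<open>B\<close> for the action of \<open>\<sigma>\<close>. The extension
  \<open>B\<close> over \<open>\<int>\<^sub>p[zz]\<close> is Galois with cyclic group, because \<open>W\<close> over \<open>\<int>\<^sub>p\<close> is. Modulo \<open>p\<close> the rings are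
  finite, and for them surjectivity of the norm on units follows by counting (Herbrand quotient and
  Hilbert 90); the solution lifts to the \<open>p\<close>-adically complete ring \<open>B\<close> because the trace is
  surjective. This is \<open>norm_equation\<close>.

  Now take \<open>F z = \<beta> z\<^sup>\<sigma>\<close> for slope 0 and \<open>F z = p \<beta>\<^sup>-\<^sup>1 z\<^sup>\<sigma>\<close> for slope 1. Then \<open>F\<^sup>a\<close> is multiplication by
  \<open>N(\<beta>) = \<pi>\<close>, respectively by \<open>q N(\<beta>)\<^sup>-\<^sup>1 = \<pi>\<close>. In the first case \<open>F\<close> and in the second case \<open>V\<close> is,
  up to a unit of \<open>B\<close>, a power of \<open>\<sigma>\<close> that generates the Galois group. As every lattice in question is
  a module over \<open>B\<close>, stability under \<open>F\<close> and \<open>V\<close> amounts to stability under \<open>\<sigma>\<close>. Hence (i) holds, and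
  (ii) and (iii) are Galois descent along \<open>W\<close> over \<open>\<int>\<^sub>p\<close>: an element is recovered from the traces of its
  \<open>W\<close>-multiples (\<open>descent\<close>), and a \<open>W\<^sub>R\<close>-linear map, being multiplication by an element of \<open>A\<^sup>*\<close>,
  commutes with \<open>F\<close> iff this element is fixed by \<open>\<sigma>\<close> (\<open>WFV_hom_is_act\<close>).

  Two facts make these definitions fit together. The constant coefficient of \<open>h\<close> is nonzero, since the
  Frobenius endomorphism is injective on torsion points (\<open>frobenius_char_poly_coeff_0\<close>); so \<open>\<pi>\<close> is
  invertible. And the places, which are given only as valuations on \<open>E\<^sub>p\<close>, are as many as they should
  be: for every root of \<open>h\<close> at which an element fails to be integral there is a place that detects
  this (\<open>non_integral_place\<close>, from Chevalley's extension theorem), while a factor of \<open>h\<close> cannot carry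
  two places of different slope (\<open>wb_same_kernel\<close>). The latter is needed to see that the unit element
  of \<open>E\<^sub>p\<^sup>*\<close> lies in \<open>R\<^sub>p\<^sup>*\<close> and that \<open>zz\<close> maps \<open>R\<^sub>p\<^sup>*\<close> to itself.
\<close>

lemma coeff_one: "Polynomial.coeff 1 i = (if i = 0 then 1 else 0)"
  by (cases i) simp_all

lemma (in vector_space) family_relation:
  assumes "finite B" "\<And>i. i \<le> card B \<Longrightarrow> x i \<in> span B"
  shows "\<exists>c. (\<exists>i\<le>card B. c i \<noteq> 0) \<and> (\<Sum>i\<le>card B. scale (c i) (x i)) = 0"
proof (cases "inj_on x {..card B}")
  case True
  have "x ` {..card B} \<subseteq> span B" using assms by auto
  then have "dependent (x ` {..card B})"
    using independent_span_bound[OF assms(1), of "x ` {..card B}"] card_image[OF True] by auto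
  then obtain u where u: "\<exists>v\<in>x ` {..card B}. u v \<noteq> 0" "(\<Sum>v\<in>x ` {..card B}. scale (u v) v) = 0"
    using dependent_finite[of "x ` {..card B}"] by auto
  have "(\<Sum>i\<le>card B. scale (u (x i)) (x i)) = 0" using u(2) by (simp add: sum.reindex[OF True])
  then show ?thesis using u(1) by (intro exI[of _ "\<lambda>i. u (x i)"]) auto
next
  case False
  then obtain i j where ij: "i \<le> card B" "j \<le> card B" "i \<noteq> j" "x i = x j" unfolding inj_on_def by auto
  define c :: "nat \<Rightarrow> 'a" where "c = (\<lambda>k. if k = i then 1 else if k = j then - 1 else 0)"
  have "(\<Sum>k\<le>card B. scale (c k) (x k)) = (\<Sum>k\<in>{i, j}. scale (c k) (x k))"
    using ij by (intro sum.mono_neutral_right) (auto simp: c_def)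
  also have "\<dots> = 0" using ij by (simp add: c_def)
  finally show ?thesis using ij by (intro exI[of _ c]) (auto simp: c_def)
qed

section \<open>Discretely valued fields in which \<open>p\<close> is a uniformizer\<close>

locale p_valued_field =
  fixes p :: nat and v :: "'k::field_char_0 \<Rightarrow> ereal"
  assumes prime_p: "Factorial_Ring.prime p"
    and valuation: "normalized_valuation ring_of_type_algebra v"
    and v_p: "v (of_nat p) = 1"
begin

abbreviation "\<O> \<equiv> val_ring v"

lemma v_zero: "v 0 = \<infinity>" and v_one: "v 1 = 0" and v_mult: "v (x * y) = v x + v y"
  and v_add: "min (v x) (v y) \<le> v (x + y)"
  and v_range: "v x = \<infinity> \<or> (\<exists>k::int. v x = ereal (of_int k))"
proof -
  show "v 0 = \<infinity>" "v 1 = 0" "v (x * y) = v x + v y" "min (v x) (v y) \<le> v (x + y)"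
    using valuation unfolding normalized_valuation_def ring_of_type_algebra_def by auto
  have "v x \<in> insert \<infinity> (range (\<lambda>k::int. ereal (of_int k)))"
    using valuation unfolding normalized_valuation_def ring_of_type_algebra_def by auto
  then show "v x = \<infinity> \<or> (\<exists>k::int. v x = ereal (of_int k))" by auto
qed

lemma v_nonzero:
  assumes "x \<noteq> 0" obtains k :: int where "v x = ereal (of_int k)" "v (inverse x) = of_int (- k)"
proof -
  have "v x + v (inverse x) = 0" using assms v_mult[of x "inverse x"] v_one by simp
  then show ?thesis
    using v_range[of x] v_range[of "inverse x"] that by auto
qed

lemma v_power: "v (x ^ n) = ereal (real n) * v x"
proof (induction n)
  case (Suc n)
  show ?case
  proof (cases "x = 0")
    case False
    then obtain k :: int where "v x = ereal (of_int k)" using v_nonzero by blast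
    then show ?thesis using Suc v_mult[of x "x ^ n"] by (simp add: algebra_simps)
  qed (simp add: v_zero)
qed (simp add: v_one)

lemma v_minus: "v (- x) = v x"
proof -
  have "v (-1) = 0"
    using v_mult[of "-1" "-1"] v_one v_range[of "-1"] by auto
  then show ?thesis using v_mult[of "-1" x] by simp
qed

lemma v_diff: "min (v x) (v y) \<le> v (x - y)"
  using v_add[of x "- y"] v_minus by simp

lemma v_p_power: "v (of_nat p ^ n) = ereal (real n)"
  using v_power[of "of_nat p" n] v_p by simp

lemma p_pos [simp]: "p > 0"
  using prime_p by (simp add: prime_gt_0_nat)

lemma O_zero [simp]: "0 \<in> \<O>" and O_one [simp]: "1 \<in> \<O>"
  by (simp_all add: val_ring_def v_zero v_one)

lemma O_add [intro]: "x \<in> \<O> \<Longrightarrow> y \<in> \<O> \<Longrightarrow> x + y \<in> \<O>"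
  using v_add[of x y] unfolding val_ring_def by (auto simp: min_def split: if_splits)

lemma O_mult [intro]: "x \<in> \<O> \<Longrightarrow> y \<in> \<O> \<Longrightarrow> x * y \<in> \<O>"
  unfolding val_ring_def by (auto simp: v_mult)

lemma O_minus [intro]: "x \<in> \<O> \<Longrightarrow> - x \<in> \<O>"
  unfolding val_ring_def by (auto simp: v_minus)

lemma O_diff [intro]: "x \<in> \<O> \<Longrightarrow> y \<in> \<O> \<Longrightarrow> x - y \<in> \<O>"
  using O_add[of x "- y"] by auto

lemma O_power [intro]: "x \<in> \<O> \<Longrightarrow> x ^ n \<in> \<O>"
  by (induction n) auto

lemma O_of_nat [simp]: "of_nat n \<in> \<O>"
  by (induction n) auto

lemma O_of_int [simp]: "of_int n \<in> \<O>"
  by (cases n rule: int_cases2) (auto intro: O_minus)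

lemma O_sum [intro]: "(\<And>i. i \<in> I \<Longrightarrow> f i \<in> \<O>) \<Longrightarrow> sum f I \<in> \<O>"
  by (induction I rule: infinite_finite_induct) auto

lemma O_prod [intro]: "(\<And>i. i \<in> I \<Longrightarrow> f i \<in> \<O>) \<Longrightarrow> prod f I \<in> \<O>"
  by (induction I rule: infinite_finite_induct) auto

lemma O_unit: "v x = 0 \<Longrightarrow> inverse x \<in> \<O>" and O_unit': "v x = 0 \<Longrightarrow> x \<in> \<O>"
proof -
  assume x: "v x = 0"
  then have "x \<noteq> 0" using v_zero by auto
  then show "inverse x \<in> \<O>" using x v_nonzero[of x] unfolding val_ring_def by force
  show "x \<in> \<O>" using x by (simp add: val_ring_def)
qed

lemma v_ge_iff: "ereal (real n) \<le> v x \<longleftrightarrow> (\<exists>t\<in>\<O>. x = of_nat p ^ n * t)"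
proof
  assume *: "ereal (real n) \<le> v x"
  show "\<exists>t\<in>\<O>. x = of_nat p ^ n * t"
  proof (intro bexI)
    show x: "x = of_nat p ^ n * (x / of_nat p ^ n)" by simp
    have "v x = ereal (real n) + v (x / of_nat p ^ n)"
      using v_mult[of "of_nat p ^ n" "x / of_nat p ^ n"] v_p_power by simp
    then show "x / of_nat p ^ n \<in> \<O>" using * v_range[of "x / of_nat p ^ n"] v_range[of x]
      unfolding val_ring_def by auto
  qed
next
  assume "\<exists>t\<in>\<O>. x = of_nat p ^ n * t"
  then obtain t where t: "0 \<le> v t" "x = of_nat p ^ n * t" unfolding val_ring_def by blast
  then show "ereal (real n) \<le> v x"
    using v_mult[of "of_nat p ^ n" t] v_p_power[of n] add_left_mono[of 0 "v t" "ereal (real n)"] by simp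
qed

lemma v_pos_iff: "0 < v x \<longleftrightarrow> (\<exists>t\<in>\<O>. x = of_nat p * t)"
proof -
  have "0 < v x \<longleftrightarrow> ereal (real 1) \<le> v x" using v_range[of x] by (auto simp: one_ereal_def)
  then show ?thesis using v_ge_iff[of 1 x] by simp
qed

lemma O_cases: "x \<in> \<O> \<Longrightarrow> v x = 0 \<or> (\<exists>t\<in>\<O>. x = of_nat p * t)"
  using v_pos_iff[of x] unfolding val_ring_def by (auto simp: order.order_iff_strict)

lemma v_p_mult: "t \<in> \<O> \<Longrightarrow> 0 < v (of_nat p * t)"
  using v_pos_iff by blast

lemma v_unit_perturb:
  assumes "v x = 0" "0 < v (x - y)" shows "v y = 0"
proof -
  have "y \<in> \<O>" using O_diff[of x "x - y"] assms by (auto simp: val_ring_def)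
  moreover have "\<not> 0 < v y" using v_add[of "x - y" y] assms by (auto simp: min_def split: if_splits)
  ultimately show ?thesis by (auto simp: val_ring_def)
qed

lemma clear_denominator: "\<exists>N. of_nat p ^ N * x \<in> \<O>"
proof (cases "x = 0")
  case False
  then obtain k :: int where k: "v x = ereal (of_int k)" using v_nonzero by blast
  have "v (of_nat p ^ nat \<bar>k\<bar> * x) = ereal (real (nat \<bar>k\<bar>)) + v x" by (simp add: v_mult v_p_power)
  then have "v (of_nat p ^ nat \<bar>k\<bar> * x) \<ge> 0" using k by simp
  then show ?thesis unfolding val_ring_def by blast
qed simp

lemma clear_denominators:
  assumes "finite Y" shows "\<exists>N. \<forall>x\<in>Y. of_nat p ^ N * x \<in> \<O>"
  using assms
proof (induction Y rule: finite_induct)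
  case (insert x Y)
  obtain N where N: "\<forall>x\<in>Y. of_nat p ^ N * x \<in> \<O>" using insert by blast
  obtain M where M: "of_nat p ^ M * x \<in> \<O>" using clear_denominator by blast
  have "of_nat p ^ (M + N) * y \<in> \<O>" if "y \<in> insert x Y" for y
  proof (cases "y = x")
    case True
    then show ?thesis using O_mult[OF O_power[OF O_of_nat] M, of p N] by (simp add: power_add mult_ac)
  next
    case False
    then show ?thesis using that N O_mult[OF O_power[OF O_of_nat[of p]], of "of_nat p ^ N * y" M]
      by (auto simp: power_add mult_ac)
  qed
  then show ?case by blast
qed simp

lemma v_of_int:
  assumes "\<not> int p dvd m" shows "v (of_int m) = 0"
proof -
  have "coprime m (int p)" using assms prime_p
    by (metis coprime_commute prime_imp_coprime prime_nat_int_transfer)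
  then obtain r s where "r * m + s * int p = 1" by (metis bezout_int coprime_imp_gcd_eq_1)
  then have 1: "of_int r * of_int m + of_nat p * of_int s = (1 :: 'k)"
    by (metis (no_types) mult.commute of_int_1 of_int_add of_int_mult of_int_of_nat_eq)
  have "\<not> 0 < v (of_int m)"
  proof
    assume "0 < v (of_int m)"
    then obtain t where t: "t \<in> \<O>" "(of_int m :: 'k) = of_nat p * t" using v_pos_iff by blast
    have "(1 :: 'k) = of_nat p * (of_int r * t + of_int s)" using 1 t(2) by (simp add: algebra_simps)
    then have "0 < v 1" using v_pos_iff t(1) by (metis O_add O_mult O_of_int)
    then show False by (simp add: v_one)
  qed
  then show ?thesis using O_of_int[of m] by (auto simp: val_ring_def)
qed

lemma v_of_int_pos: "0 < v (of_int m) \<longleftrightarrow> int p dvd m"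
proof
  assume "int p dvd m"
  then obtain k where "m = int p * k" by blast
  then have "(of_int m :: 'k) = of_nat p * of_int k" by simp
  then show "0 < v (of_int m)" using v_p_mult[of "of_int k"] by simp
qed (use v_of_int in force)

text \<open>
  If an element is separated from 0, the ultrametric inequality forces it to vanish: the
  valuation is bounded only on nonzero elements.
\<close>

lemma zero_if_divisible: "(\<And>n. \<exists>t\<in>\<O>. x = of_nat p ^ n * t) \<Longrightarrow> x = 0"
proof (rule ccontr)
  assume *: "\<And>n. \<exists>t\<in>\<O>. x = of_nat p ^ n * t" and "x \<noteq> 0"
  then obtain k :: int where k: "v x = ereal (of_int k)" using v_nonzero by blast
  have "ereal (real (nat (\<bar>k\<bar> + 1))) \<le> v x" using * v_ge_iff by blast
  then show False using k by simp
qed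

lemma O_poly: "(\<And>i. Polynomial.coeff P i \<in> \<O>) \<Longrightarrow> x \<in> \<O> \<Longrightarrow> poly P x \<in> \<O>"
  unfolding poly_altdef by auto

lemma O_synthetic_div:
  "(\<And>i. Polynomial.coeff P i \<in> \<O>) \<Longrightarrow> x \<in> \<O> \<Longrightarrow> Polynomial.coeff (synthetic_div P x) i \<in> \<O>"
proof (induction P arbitrary: i)
  case (pCons c P)
  have "Polynomial.coeff P i \<in> \<O>" for i using pCons.prems(1)[of "Suc i"] by simp
  then have "poly P x \<in> \<O>" "Polynomial.coeff (synthetic_div P x) j \<in> \<O>" for j
    using pCons.IH pCons.prems(2) O_poly by blast+
  then show ?case by (cases i) simp_all
qed simp

text \<open>A polynomial of degree \<open>d\<close> has at most \<open>d\<close> roots in the residue field.\<close>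

lemma few_roots_mod_p:
  assumes "Polynomial.degree P \<le> d" "Polynomial.coeff P d = 1" "\<And>i. Polynomial.coeff P i \<in> \<O>"
    and "finite Y" "Y \<subseteq> \<O>" "\<And>x y. x \<in> Y \<Longrightarrow> y \<in> Y \<Longrightarrow> x \<noteq> y \<Longrightarrow> v (x - y) = 0"
    and "\<And>x. x \<in> Y \<Longrightarrow> 0 < v (poly P x)"
  shows "card Y \<le> d"
  using assms
proof (induction d arbitrary: P Y)
  case 0
  obtain c where "P = [:c:]" using 0(1) degree_eq_zeroE by (metis le_zero_eq)
  then have P: "P = 1" using 0(2) by (metis coeff_pCons_0 one_pCons)
  have "x \<notin> Y" for x using 0(7)[of x] unfolding P by (auto simp: v_one)
  then have "Y = {}" by blast
  then show ?case by simp
next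
  case (Suc d)
  show ?case
  proof (cases "Y = {}")
    case False
    then obtain x where x: "x \<in> Y" by blast
    define Q where "Q = synthetic_div P x"
    have eq: "[:- x, 1:] * Q + [:poly P x:] = P" unfolding Q_def by (rule synthetic_div_correct')
    have dQ: "Polynomial.degree Q \<le> d" unfolding Q_def using Suc(2) by (simp add: degree_synthetic_div)
    have "1 = Polynomial.coeff ([:- x, 1:] * Q + [:poly P x:]) (Suc d)" using eq Suc(3) by simp
    also have "\<dots> = Polynomial.coeff Q d" using dQ by (simp add: coeff_eq_0)
    finally have lQ: "Polynomial.coeff Q d = 1" by simp
    have "0 < v (poly Q y)" if y: "y \<in> Y - {x}" for y
    proof -
      have "poly P y = (y - x) * poly Q y + poly P x"
        using arg_cong[OF eq, of "\<lambda>P. poly P y"] by (simp add: algebra_simps)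
      then have "(y - x) * poly Q y = poly P y - poly P x" by simp
      then have "0 < v ((y - x) * poly Q y)"
        using v_diff[of "poly P y" "poly P x"] Suc(8)[of y] Suc(8)[OF x] y
        by (auto simp: min_def split: if_splits)
      then show ?thesis using Suc(7)[of y x] x y by (simp add: v_mult)
    qed
    moreover have "Polynomial.coeff Q i \<in> \<O>" for i
      unfolding Q_def using O_synthetic_div[of P x i] Suc(4) Suc(6) x by blast
    ultimately have "card (Y - {x}) \<le> d"
      using Suc(5,6,7) by (intro Suc.IH[OF dQ lQ]) auto
    then show ?thesis using x Suc(5) by (simp add: card_Diff_singleton)
  qed simp
qed

end

locale padic_numbers =
  fixes p :: nat and v :: "'k::field_char_0 \<Rightarrow> ereal"
  assumes prime_p': "Factorial_Ring.prime p" and padic: "padic_field p v"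
begin

sublocale p_valued_field p v
  using prime_p' padic unfolding padic_field_def by unfold_locales auto

lemma residue_representative:
  assumes c: "c \<in> \<O>"
  shows "\<exists>i<p. \<exists>t\<in>\<O>. c = of_nat i + of_nat p * t"
proof -
  obtain r where r: "ereal (real 1) \<le> v (c - of_rat r)"
    using padic unfolding padic_field_def by blast
  then have *: "0 < v (c - of_rat r)" by (metis ereal_less(2) less_le_trans less_numeral_extra(1) of_nat_1)
  then have rO: "of_rat r \<in> \<O>" using c O_diff[of c "c - of_rat r"] by (auto simp: val_ring_def)
  obtain m n where mn: "r = of_int m / of_int n" "0 < n" "coprime m n"
    by (metis Fract_of_int_quotient Rat_cases)
  have eq: "of_rat r * of_int n = (of_int m :: 'k)" using mn by (simp add: of_rat_divide)
  have pn: "\<not> int p dvd n"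
  proof
    assume "int p dvd n"
    then have "\<not> int p dvd m"
      using mn(3) prime_p by (metis coprime_common_divisor not_prime_unit prime_nat_int_transfer)
    then have "v (of_int m) = 0" using v_of_int by blast
    moreover have "0 < v (of_int n)" using v_of_int_pos \<open>int p dvd n\<close> by blast
    then have "0 < v (of_rat r * of_int n)"
      using rO unfolding val_ring_def by (auto simp: v_mult add_nonneg_pos)
    ultimately show False using eq by simp
  qed
  then have "coprime n (int p)" using prime_p
    by (metis coprime_commute prime_imp_coprime prime_nat_int_transfer)
  then obtain n' s where b: "n' * n + s * int p = 1" by (metis bezout_int coprime_imp_gcd_eq_1)
  define i where "i = nat (m * n' mod int p)"
  have p0: "0 < p" using prime_p by (simp add: prime_gt_0_nat)
  have i: "i < p" "int i = m * n' mod int p" unfolding i_def using p0 by (auto simp: nat_less_iff)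
  have "int p dvd m - int i * n"
  proof -
    have "[int i * n = m * n' * n] (mod int p)" using i by (simp add: cong_def mod_mult_left_eq)
    also have "m * n' * n = m - m * s * int p" using b by (simp add: algebra_simps) (metis distrib_left mult.commute mult.left_commute mult.right_neutral)
    also have "[\<dots> = m] (mod int p)" by (simp add: cong_iff_dvd_diff)
    finally show ?thesis using cong_iff_dvd_diff cong_sym by metis
  qed
  then obtain k where k: "m - int i * n = int p * k" by blast
  have vn: "v (of_int n) = 0" using pn v_of_int by blast
  have n0: "(of_int n :: 'k) \<noteq> 0" using mn by simp
  have "of_rat r - of_nat i = of_nat p * (of_int k * inverse (of_int n :: 'k))"
  proof -
    have "(of_rat r - of_nat i) * of_int n = (of_int (m - int i * n) :: 'k)" using eq by (simp add: algebra_simps)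
    then show ?thesis using k n0 by (simp add: field_simps)
  qed
  moreover obtain t where "t \<in> \<O>" "c - of_rat r = of_nat p * t" using * v_pos_iff by blast
  ultimately have "c = of_nat i + of_nat p * (t + of_int k * inverse (of_int n))"
    by (simp add: algebra_simps)
  moreover have "t + of_int k * inverse (of_int n) \<in> \<O>"
    using \<open>t \<in> \<O>\<close> O_unit[OF vn] by (intro O_add O_mult) auto
  ultimately show ?thesis using i(1) by blast
qed

lemma series_converges:
  assumes s: "\<And>m. s m \<in> \<O>"
  shows "\<exists>x\<in>\<O>. \<forall>n. \<exists>t\<in>\<O>. x - (\<Sum>m<n. of_nat p ^ m * s m) = of_nat p ^ n * t"
proof -
  define S where "S = (\<lambda>n. \<Sum>m<n. of_nat p ^ m * s m)"
  have tail: "ereal (real n) \<le> v (S i - S n)" if "n \<le> i" for i n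
  proof -
    have "S i - S n = (\<Sum>m=n..<i. of_nat p ^ m * s m)"
      unfolding S_def using sum_diff_nat_ivl[of 0 n i "\<lambda>m. of_nat p ^ m * s m"] that
      by (simp add: atLeast0LessThan)
    also have "\<dots> = of_nat p ^ n * (\<Sum>m=n..<i. of_nat p ^ (m - n) * s m)"
      unfolding sum_distrib_left by (intro sum.cong) (auto simp: mult.assoc[symmetric] simp flip: power_add)
    finally show ?thesis using v_ge_iff s by (metis (no_types, lifting) O_mult O_of_nat O_power O_sum)
  qed
  have "\<exists>K. \<forall>i\<ge>K. \<forall>j\<ge>K. ereal (real N) \<le> v (S i - S j)" for N
  proof (intro exI allI impI)
    fix i j assume "N \<le> i" "N \<le> j"
    then show "ereal (real N) \<le> v (S i - S j)"
      using tail[of N i] tail[of N j] v_diff[of "S i - S N" "S j - S N"]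
      by (simp add: min_def split: if_splits)
  qed
  then obtain x where x: "\<forall>N::nat. \<exists>K. \<forall>i\<ge>K. ereal (real N) \<le> v (S i - x)"
    using padic unfolding padic_field_def by blast
  have *: "ereal (real n) \<le> v (x - S n)" for n
  proof -
    obtain K where "\<forall>i\<ge>K. ereal (real n) \<le> v (S i - x)" using x by blast
    then have "ereal (real n) \<le> v (S (max K n) - x)" by simp
    then show ?thesis using tail[of n "max K n"] v_diff[of "S (max K n) - S n" "S (max K n) - x"]
      by (simp add: min_def split: if_splits)
  qed
  have "x \<in> \<O>" using *[of 0] by (simp add: S_def val_ring_def zero_ereal_def)
  then show ?thesis using * v_ge_iff unfolding S_def by blast
qed

end

section \<open>Galois theory of the unramified extension\<close>

locale unramified = padic_numbers p v for p and v :: "'k::field_char_0 \<Rightarrow> ereal" +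
  fixes \<iota> :: "'k \<Rightarrow> 'l::field_char_0" and vL :: "'l \<Rightarrow> ereal" and a :: nat and \<sigma> :: "'l \<Rightarrow> 'l"
  assumes unram: "unramified_extension v \<iota> vL a" and frobenius: "frobenius_automorphism p \<iota> vL \<sigma>"
begin

sublocale \<iota>: field_hom \<iota>
  using unram unfolding unramified_extension_def by blast

sublocale \<iota>p: map_poly_inj_idom_hom \<iota> ..

sublocale \<sigma>: field_hom \<sigma>
  using frobenius unfolding frobenius_automorphism_def by blast

declare \<iota>.hom_of_nat [simp] \<iota>.hom_of_int [simp] \<sigma>.hom_of_nat [simp] \<sigma>.hom_of_int [simp]

lemma vL_\<iota> [simp]: "vL (\<iota> c) = v c" and a_pos: "0 < a" and \<sigma>_\<iota> [simp]: "\<sigma> (\<iota> c) = \<iota> c"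
  and dim_L: "vector_space.dim (\<lambda>c y. \<iota> c * y) UNIV = a" and bij_\<sigma>: "bij \<sigma>"
  using unram frobenius unfolding unramified_extension_def frobenius_automorphism_def by auto

sublocale L: p_valued_field p vL
proof
  show "normalized_valuation ring_of_type_algebra vL"
    using unram unfolding unramified_extension_def by blast
  show "vL (of_nat p) = 1" using vL_\<iota>[of "of_nat p"] v_p \<iota>.hom_of_nat[of p] by metis
qed (rule prime_p')

abbreviation "W \<equiv> val_ring vL"

lemma W_\<iota> [simp]: "\<iota> c \<in> W \<longleftrightarrow> c \<in> \<O>"
  by (simp add: val_ring_def)

sublocale VS: vector_space "\<lambda>c y. \<iota> c * y"
  by unfold_locales (simp_all add: algebra_simps \<iota>.hom_add \<iota>.hom_mult)

lemma basis_L: obtains B where "finite B" "card B = a" "VS.span B = UNIV"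
proof -
  obtain B where B: "VS.independent B" "VS.span B = UNIV"
    using VS.maximal_independent_subset[of UNIV] by (metis top.extremum_uniqueI)
  have "card B = a" using VS.basis_card_eq_dim[of B UNIV] B dim_L by simp
  moreover from this have "finite B" using a_pos card_ge_0_finite by auto
  ultimately show ?thesis using that B(2) by blast
qed

lemma sum_relation:
  obtains c where "\<exists>i\<le>a. c i \<noteq> 0" "(\<Sum>i\<le>a. \<iota> (c i) * y i) = 0"
proof -
  obtain B where "finite B" "card B = a" "VS.span B = UNIV" by (rule basis_L)
  note B = this
  have "\<exists>c. (\<exists>i\<le>card B. c i \<noteq> 0) \<and> (\<Sum>i\<le>card B. \<iota> (c i) * y i) = 0"
    by (rule VS.family_relation) (use B in simp_all)
  then show ?thesis using that unfolding B(2) by blast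
qed

text \<open>
  Lifts of generators of the residue field generate \<open>L\<close>: the remainders can be expanded again and
  again, and the coefficients converge because \<open>\<rat>\<^sub>p\<close> is complete.
\<close>

lemma residue_generators:
  assumes u: "\<And>i. i < f \<Longrightarrow> u i \<in> W"
    and gen: "\<And>w. w \<in> W \<Longrightarrow> \<exists>c::nat \<Rightarrow> int. 0 < vL (w - (\<Sum>i<f. of_int (c i) * u i))"
  shows "a \<le> f"
proof -
  have "w \<in> VS.span (u ` {..<f})" if w: "w \<in> W" for w
  proof -
    have "\<exists>c r. r \<in> W \<and> w = (\<Sum>i<f. of_int (c i :: int) * u i) + of_nat p * r" if w': "w \<in> W" for w
    proof -
      obtain c :: "nat \<Rightarrow> int" where "0 < vL (w - (\<Sum>i<f. of_int (c i) * u i))" using gen[OF w'] by blast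
      then obtain r where "r \<in> W" "w - (\<Sum>i<f. of_int (c i) * u i) = of_nat p * r"
        using L.v_pos_iff by blast
      then have "w = (\<Sum>i<f. of_int (c i) * u i) + of_nat p * r" by (simp add: algebra_simps)
      then show ?thesis using \<open>r \<in> W\<close> by blast
    qed
    then obtain c r where cr: "\<And>w. w \<in> W \<Longrightarrow>
        r w \<in> W \<and> w = (\<Sum>i<f. of_int (c w i :: int) * u i) + of_nat p * r w" by metis
    define z where "z = (\<lambda>n. (r ^^ n) w)"
    have zW: "z n \<in> W" for n by (induction n) (use w cr in \<open>auto simp: z_def\<close>)
    have zS: "z n = (\<Sum>i<f. of_int (c (z n) i) * u i) + of_nat p * z (Suc n)" for n
      using cr[OF zW[of n]] by (simp add: z_def)
    have "\<exists>x\<in>\<O>. \<forall>n. \<exists>t\<in>\<O>. x - (\<Sum>m<n. of_nat p ^ m * of_int (c (z m) i)) = of_nat p ^ n * t" for i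
      by (rule series_converges) simp
    then obtain x t where x: "\<And>i n. t i n \<in> \<O>"
      "\<And>i n. x i - (\<Sum>m<n. of_nat p ^ m * of_int (c (z m) i)) = of_nat p ^ n * t i n" by metis
    have exp: "w = (\<Sum>i<f. (\<Sum>m<n. of_nat p ^ m * of_int (c (z m) i)) * u i) + of_nat p ^ n * z n" for n
    proof (induction n)
      case 0
      then show ?case by (simp add: z_def)
    next
      case (Suc n)
      have "of_nat p ^ n * z n = (\<Sum>i<f. of_nat p ^ n * of_int (c (z n) i) * u i) + of_nat p ^ Suc n * z (Suc n)"
        by (subst zS) (simp add: algebra_simps sum_distrib_left)
      then show ?case by (subst Suc) (simp add: algebra_simps sum.distrib)
    qed
    have "w - (\<Sum>i<f. \<iota> (x i) * u i) = 0"
    proof (rule L.zero_if_divisible)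
      fix n
      have "\<iota> (x i) = (\<Sum>m<n. of_nat p ^ m * of_int (c (z m) i)) + of_nat p ^ n * \<iota> (t i n)" for i
        using arg_cong[OF x(2)[of i n], of \<iota>]
        by (simp add: \<iota>.hom_minus \<iota>.hom_sum \<iota>.hom_mult \<iota>.hom_power algebra_simps)
      then have "w - (\<Sum>i<f. \<iota> (x i) * u i) = of_nat p ^ n * (z n - (\<Sum>i<f. \<iota> (t i n) * u i))"
        by (subst exp[of n]) (simp add: algebra_simps sum.distrib sum_distrib_left)
      moreover have "z n - (\<Sum>i<f. \<iota> (t i n) * u i) \<in> W"
        using zW u x(1) by (intro L.O_diff L.O_sum L.O_mult) auto
      ultimately show "\<exists>t\<in>W. w - (\<Sum>i<f. \<iota> (x i) * u i) = of_nat p ^ n * t" by blast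
    qed
    then have "w = (\<Sum>i<f. \<iota> (x i) * u i)" by simp
    also have "\<dots> \<in> VS.span (u ` {..<f})"
      by (intro VS.span_sum VS.span_scale VS.span_base) auto
    finally show ?thesis .
  qed
  moreover have "\<exists>N. of_nat p ^ N * y \<in> W" for y by (rule L.clear_denominator)
  ultimately have "y \<in> VS.span (u ` {..<f})" for y
  proof -
    obtain N where "of_nat p ^ N * y \<in> W" using L.clear_denominator by blast
    then have "of_nat p ^ N * y \<in> VS.span (u ` {..<f})" using \<open>\<And>w. w \<in> W \<Longrightarrow> w \<in> VS.span (u ` {..<f})\<close> by blast
    then have "\<iota> (inverse (of_nat p ^ N)) * (of_nat p ^ N * y) \<in> VS.span (u ` {..<f})"
      by (rule VS.span_scale)
    moreover have "\<iota> (inverse (of_nat p ^ N)) * (of_nat p ^ N * y) = y"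
      by (simp add: \<iota>.hom_inverse \<iota>.hom_power mult.assoc[symmetric])
    ultimately show ?thesis by simp
  qed
  then have "a \<le> card (u ` {..<f})"
    using VS.dim_le_card[of UNIV "u ` {..<f}"] dim_L by auto
  also have "\<dots> \<le> f" using card_image_le[of "{..<f}" u] by simp
  finally show ?thesis .
qed

lemma residue_independent:
  "f \<le> a \<Longrightarrow> \<exists>u. (\<forall>i<f. u i \<in> W) \<and>
    (\<forall>c::nat \<Rightarrow> int. 0 < vL (\<Sum>i<f. of_int (c i) * u i) \<longrightarrow> (\<forall>i<f. int p dvd c i))"
proof (induction f)
  case (Suc f)
  then obtain u where u: "\<forall>i<f. u i \<in> W"
    "\<forall>c::nat \<Rightarrow> int. 0 < vL (\<Sum>i<f. of_int (c i) * u i) \<longrightarrow> (\<forall>i<f. int p dvd c i)" by auto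
  then obtain w where w: "w \<in> W" "\<And>c::nat \<Rightarrow> int. \<not> 0 < vL (w - (\<Sum>i<f. of_int (c i) * u i))"
    using residue_generators[of f u] Suc.prems by fastforce
  define u' where "u' = (\<lambda>i. if i = f then w else u i)"
  have "\<forall>i<Suc f. int p dvd c i" if c: "0 < vL (\<Sum>i<Suc f. of_int (c i) * u' i)" for c :: "nat \<Rightarrow> int"
  proof -
    have c': "0 < vL ((\<Sum>i<f. of_int (c i) * u i) + of_int (c f) * w)"
      using c by (simp add: u'_def)
    have "int p dvd c f"
    proof (rule ccontr)
      assume "\<not> int p dvd c f"
      then have "coprime (c f) (int p)" using prime_p
        by (metis coprime_commute prime_imp_coprime prime_nat_int_transfer)
      then obtain r s where "r * c f + s * int p = 1" by (metis bezout_int coprime_imp_gcd_eq_1)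
      then have 1: "of_int r * of_int (c f) = (1 :: 'l) - of_nat p * of_int s"
        by (metis (no_types, lifting) add_diff_cancel_right' mult.commute of_int_1 of_int_add of_int_mult of_int_of_nat_eq)
      obtain t where t: "t \<in> W" "(\<Sum>i<f. of_int (c i) * u i) + of_int (c f) * w = of_nat p * t"
        using c' L.v_pos_iff by blast
      have "w - (\<Sum>i<f. of_int (- r * c i) * u i) =
          of_int r * ((\<Sum>i<f. of_int (c i) * u i) + of_int (c f) * w) + (1 - of_int r * of_int (c f)) * w"
        by (simp add: algebra_simps sum_distrib_left sum_negf)
      also have "\<dots> = of_nat p * (of_int r * t + of_int s * w)" unfolding t(2) 1 by (simp add: algebra_simps)
      finally have "0 < vL (w - (\<Sum>i<f. of_int (- r * c i) * u i))"
        using t w(1) L.v_p_mult by (metis L.O_add L.O_mult L.O_of_int)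
      then show False using w(2)[of "\<lambda>i. - r * c i"] by blast
    qed
    then have "0 < vL (of_int (c f) * w)"
      using L.v_of_int_pos w(1) by (auto simp: L.v_mult val_ring_def add_pos_nonneg)
    then have "0 < vL (\<Sum>i<f. of_int (c i) * u i)"
      using c' L.v_diff[of "(\<Sum>i<f. of_int (c i) * u i) + of_int (c f) * w" "of_int (c f) * w"]
      by (auto simp: min_def split: if_splits)
    then show ?thesis using u(2) \<open>int p dvd c f\<close> less_Suc_eq by auto
  qed
  moreover have "\<forall>i<Suc f. u' i \<in> W" using u(1) w(1) by (auto simp: u'_def)
  ultimately show ?case by blast
qed simp

lemma many_residues:
  obtains Y where "finite Y" "Y \<subseteq> W" "card Y = p ^ a"
    "\<And>x y. x \<in> Y \<Longrightarrow> y \<in> Y \<Longrightarrow> x \<noteq> y \<Longrightarrow> vL (x - y) = 0"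
proof -
  obtain u where u: "\<And>i. i < a \<Longrightarrow> u i \<in> W"
    "\<And>c::nat \<Rightarrow> int. 0 < vL (\<Sum>i<a. of_int (c i) * u i) \<Longrightarrow> (\<forall>i<a. int p dvd c i)"
    using residue_independent[of a] by auto
  define D where "D = (\<lambda>n::nat \<Rightarrow> nat. \<Sum>i<a. of_nat (n i) * u i)"
  define I where "I = {..<a} \<rightarrow>\<^sub>E {..<p}"
  have DW: "D n \<in> W" for n unfolding D_def using u(1) by (intro L.O_sum L.O_mult) auto
  have *: "n = m" if nm: "n \<in> I" "m \<in> I" "0 < vL (D n - D m)" for n m
  proof -
    have "D n - D m = (\<Sum>i<a. of_int (int (n i) - int (m i)) * u i)"
      unfolding D_def by (simp add: algebra_simps sum_subtractf)
    then have "\<forall>i<a. int p dvd int (n i) - int (m i)" using u(2)[of "\<lambda>i. int (n i) - int (m i)"] nm(3) by simp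
    moreover have "n i < p" "m i < p" if "i < a" for i using nm that unfolding I_def by auto
    ultimately have "n i = m i" if "i < a" for i
      using that by (metis mod_less of_nat_mod mod_eq_dvd_iff nat_int)
    then show ?thesis using nm unfolding I_def by (intro PiE_ext) auto
  qed
  have inj: "inj_on D I"
    by (rule inj_onI) (use * L.v_zero in auto)
  show ?thesis
  proof
    show "finite (D ` I)" unfolding I_def by (simp add: finite_PiE)
    show "D ` I \<subseteq> W" using DW by blast
    show "card (D ` I) = p ^ a" using card_image[OF inj] unfolding I_def by (simp add: card_PiE)
    fix x y assume xy: "x \<in> D ` I" "y \<in> D ` I" "x \<noteq> y"
    then have "\<not> 0 < vL (x - y)" using * by blast
    moreover have "x - y \<in> W" using xy DW by auto
    ultimately show "vL (x - y) = 0" by (auto simp: val_ring_def)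
  qed
qed

lemma \<sigma>_W [intro]: "x \<in> W \<Longrightarrow> \<sigma> x \<in> W"
proof -
  assume x: "x \<in> W"
  then have "0 < vL (\<sigma> x - x ^ p)"
    using frobenius unfolding frobenius_automorphism_def val_ring_def by auto
  then have "\<sigma> x - x ^ p \<in> W" by (auto simp: val_ring_def)
  then have "(\<sigma> x - x ^ p) + x ^ p \<in> W" using x by blast
  then show ?thesis by simp
qed

lemma \<sigma>_power_add: "(\<sigma> ^^ i) ((\<sigma> ^^ j) x) = (\<sigma> ^^ (i + j)) x"
  by (simp add: funpow_add)

lemma \<sigma>_power_hom:
  "(\<sigma> ^^ j) (x + y) = (\<sigma> ^^ j) x + (\<sigma> ^^ j) y" "(\<sigma> ^^ j) (x * y) = (\<sigma> ^^ j) x * (\<sigma> ^^ j) y"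
  "(\<sigma> ^^ j) 0 = 0" "(\<sigma> ^^ j) 1 = 1" "(\<sigma> ^^ j) (\<iota> c) = \<iota> c" "(\<sigma> ^^ j) (x - y) = (\<sigma> ^^ j) x - (\<sigma> ^^ j) y"
  by (induction j) (auto simp: \<sigma>.hom_add \<sigma>.hom_mult \<sigma>.hom_minus)

lemma \<sigma>_power_sum: "(\<sigma> ^^ j) (sum f I) = (\<Sum>i\<in>I. (\<sigma> ^^ j) (f i))"
  by (induction I rule: infinite_finite_induct) (auto simp: \<sigma>_power_hom)

lemma \<sigma>_power_power: "(\<sigma> ^^ j) (x ^ n) = (\<sigma> ^^ j) x ^ n"
  by (induction n) (auto simp: \<sigma>_power_hom)

lemma \<sigma>_power_W [intro]: "x \<in> W \<Longrightarrow> (\<sigma> ^^ j) x \<in> W"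
  by (induction j) auto

lemma \<sigma>_power_inj: "(\<sigma> ^^ j) x = (\<sigma> ^^ j) y \<longleftrightarrow> x = y"
  by (induction j) auto

lemma poly_\<sigma>: "(\<sigma> ^^ j) (poly (map_poly \<iota> m) y) = poly (map_poly \<iota> m) ((\<sigma> ^^ j) y)"
  by (simp add: poly_altdef \<sigma>_power_sum \<sigma>_power_hom \<sigma>_power_power)

lemma \<sigma>_residue: "x \<in> W \<Longrightarrow> 0 < vL ((\<sigma> ^^ j) x - x ^ (p ^ j))"
proof (induction j)
  case (Suc j)
  obtain t where t: "t \<in> W" "(\<sigma> ^^ j) x - x ^ (p ^ j) = of_nat p * t"
    using Suc L.v_pos_iff by blast
  have "(\<sigma> ^^ Suc j) x - \<sigma> (x ^ (p ^ j)) = \<sigma> ((\<sigma> ^^ j) x - x ^ (p ^ j))" by (simp add: \<sigma>.hom_minus)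
  also have "\<dots> = of_nat p * \<sigma> t" unfolding t(2) by (simp add: \<sigma>.hom_mult)
  finally have 1: "0 < vL ((\<sigma> ^^ Suc j) x - \<sigma> (x ^ (p ^ j)))"
    using L.v_p_mult[OF \<sigma>_W[OF t(1)]] by simp
  have "0 < vL (\<sigma> (x ^ (p ^ j)) - (x ^ (p ^ j)) ^ p)"
    using frobenius L.O_power[OF Suc.prems, of "p ^ j"] unfolding frobenius_automorphism_def val_ring_def by auto
  then have "0 < vL (\<sigma> (x ^ (p ^ j)) - x ^ (p ^ Suc j))" by (simp flip: power_mult add: mult.commute)
  then have "0 < vL (((\<sigma> ^^ Suc j) x - \<sigma> (x ^ (p ^ j))) + (\<sigma> (x ^ (p ^ j)) - x ^ (p ^ Suc j)))"
    using 1 L.v_add[of "(\<sigma> ^^ Suc j) x - \<sigma> (x ^ (p ^ j))" "\<sigma> (x ^ (p ^ j)) - x ^ (p ^ Suc j)"]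
    by (auto simp: min_def split: if_splits)
  then show ?case by simp
qed (simp add: L.v_zero)

text \<open>
  The residues fixed by \<open>\<sigma>\<^sup>j\<close> are roots of \<open>x\<^sup>q - x\<close> with \<open>q = p\<^sup>j\<close>. For \<open>j < a\<close> these are too
  few to exhaust the at least \<open>p\<^sup>a\<close> residues.
\<close>

lemma residue_generator:
  obtains \<theta> where "\<theta> \<in> W" "\<And>j. 0 < j \<Longrightarrow> j < a \<Longrightarrow> vL ((\<sigma> ^^ j) \<theta> - \<theta>) = 0"
proof -
  obtain Y where Y: "finite Y" "Y \<subseteq> W" "card Y = p ^ a"
    "\<And>x y. x \<in> Y \<Longrightarrow> y \<in> Y \<Longrightarrow> x \<noteq> y \<Longrightarrow> vL (x - y) = 0" by (rule many_residues) blast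
  define bad where "bad = (\<lambda>j. {x \<in> Y. 0 < vL ((\<sigma> ^^ j) x - x)})"
  have p1: "1 < p" by (rule prime_gt_1_nat[OF prime_p])
  have "card (bad j) \<le> p ^ j" if j: "0 < j" for j
  proof -
    define P where "P = Polynomial.monom 1 (p ^ j) - [:0, 1 :: 'l:]"
    have pj: "1 < p ^ j" by (rule one_less_power[OF p1 j])
    show ?thesis
    proof (rule L.few_roots_mod_p[of P])
      show "Polynomial.degree P \<le> p ^ j" unfolding P_def using pj
        by (intro degree_diff_le) (auto simp: degree_monom_le)
      show "Polynomial.coeff P (p ^ j) = 1" unfolding P_def using pj by (auto simp: coeff_eq_0)
      show "Polynomial.coeff P i \<in> W" for i unfolding P_def
        by (auto simp: coeff_pCons split: nat.splits)
      fix x assume "x \<in> bad j"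
      then have x: "x \<in> W" "0 < vL ((\<sigma> ^^ j) x - x)" using Y unfolding bad_def by auto
      have "0 < vL (((\<sigma> ^^ j) x - x) - ((\<sigma> ^^ j) x - x ^ (p ^ j)))"
        using x(2) \<sigma>_residue[OF x(1), of j] L.v_diff[of "(\<sigma> ^^ j) x - x" "(\<sigma> ^^ j) x - x ^ (p ^ j)"]
        by (auto simp: min_def split: if_splits)
      then show "0 < vL (poly P x)" unfolding P_def by (simp add: poly_monom)
    qed (use Y in \<open>auto simp: bad_def\<close>)
  qed
  have "card (\<Union>j\<in>{1..<a}. bad j) \<le> (\<Sum>j\<in>{1..<a}. card (bad j))" by (rule card_UN_le) simp
  also have "\<dots> \<le> (\<Sum>j\<in>{1..<a}. p ^ j)" by (intro sum_mono) (use \<open>\<And>j. 0 < j \<Longrightarrow> card (bad j) \<le> p ^ j\<close> in auto)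
  also have "\<dots> < p ^ a"
  proof -
    have "(\<Sum>j<n. p ^ j) < p ^ n" for n
    proof (induction n)
      case (Suc n)
      have "(\<Sum>j<Suc n. p ^ j) < 2 * p ^ n" using Suc by simp
      also have "\<dots> \<le> p ^ Suc n" using p1 by simp
      finally show ?case .
    qed simp
    then show ?thesis by (rule le_less_trans[rotated]) (intro sum_mono2, auto)
  qed
  finally have "Y \<noteq> (\<Union>j\<in>{1..<a}. bad j)" using Y(3) by auto
  moreover have "(\<Union>j\<in>{1..<a}. bad j) \<subseteq> Y" unfolding bad_def by auto
  ultimately obtain \<theta> where \<theta>: "\<theta> \<in> Y" "\<And>j. 0 < j \<Longrightarrow> j < a \<Longrightarrow> \<theta> \<notin> bad j" by fastforce
  show ?thesis
  proof
    show W: "\<theta> \<in> W" using \<theta> Y by blast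
    fix j assume j: "0 < j" "j < a"
    have "\<not> 0 < vL ((\<sigma> ^^ j) \<theta> - \<theta>)" using \<theta>(1) \<theta>(2)[OF j] unfolding bad_def by blast
    moreover have "(\<sigma> ^^ j) \<theta> - \<theta> \<in> W" using W by blast
    ultimately show "vL ((\<sigma> ^^ j) \<theta> - \<theta>) = 0" by (auto simp: val_ring_def)
  qed
qed

definition \<theta> where "\<theta> = (SOME t. t \<in> W \<and> (\<forall>j. 0 < j \<longrightarrow> j < a \<longrightarrow> vL ((\<sigma> ^^ j) t - t) = 0))"

lemma \<theta>_W: "\<theta> \<in> W" and \<theta>_separated: "0 < j \<Longrightarrow> j < a \<Longrightarrow> vL ((\<sigma> ^^ j) \<theta> - \<theta>) = 0"
proof -
  have "\<exists>t. t \<in> W \<and> (\<forall>j. 0 < j \<longrightarrow> j < a \<longrightarrow> vL ((\<sigma> ^^ j) t - t) = 0)"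
    using residue_generator by metis
  from someI_ex[OF this] show "\<theta> \<in> W" "0 < j \<Longrightarrow> j < a \<Longrightarrow> vL ((\<sigma> ^^ j) \<theta> - \<theta>) = 0"
    unfolding \<theta>_def[symmetric] by auto
qed

lemma conjugates_distinct: "inj_on (\<lambda>j. (\<sigma> ^^ j) \<theta>) {..<a}"
proof (rule linorder_inj_onI)
  fix i j assume ij: "i < j" "j \<in> {..<a}"
  show "(\<sigma> ^^ i) \<theta> \<noteq> (\<sigma> ^^ j) \<theta>"
  proof
    assume "(\<sigma> ^^ i) \<theta> = (\<sigma> ^^ j) \<theta>"
    also have "\<dots> = (\<sigma> ^^ i) ((\<sigma> ^^ (j - i)) \<theta>)" using ij by (simp add: \<sigma>_power_add)
    finally have "(\<sigma> ^^ (j - i)) \<theta> = \<theta>" by (metis \<sigma>_power_inj)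
    moreover have "0 < j - i" "j - i < a" using ij by auto
    ultimately show False using \<theta>_separated[of "j - i"] L.v_zero by simp
  qed
qed auto

lemma zero_if_conjugate_roots:
  assumes "Polynomial.degree g < a" "\<And>j. j < a \<Longrightarrow> poly g ((\<sigma> ^^ j) \<theta>) = 0"
  shows "g = 0"
proof (rule ccontr)
  assume "g \<noteq> 0"
  have "a = card ((\<lambda>j. (\<sigma> ^^ j) \<theta>) ` {..<a})" using card_image[OF conjugates_distinct] by simp
  also have "\<dots> \<le> card {x. poly g x = 0}"
    using assms(2) poly_roots_finite[OF \<open>g \<noteq> 0\<close>] by (intro card_mono) auto
  also have "\<dots> \<le> Polynomial.degree g" using card_poly_roots_bound[OF \<open>g \<noteq> 0\<close>] .
  finally show False using assms(1) by simp
qed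

lemma \<theta>_generates: obtains g where "Polynomial.degree g < a" "y = poly (map_poly \<iota> g) \<theta>"
proof -
  obtain c where c: "\<exists>i\<le>a. c i \<noteq> 0" "(\<Sum>i\<le>a. \<iota> (c i) * (if i < a then \<theta> ^ i else y)) = 0"
    using sum_relation[of "\<lambda>i. if i < a then \<theta> ^ i else y"] by blast
  define P where "P = (\<Sum>i<a. Polynomial.monom (c i) i)"
  have dP: "Polynomial.degree P < a" using a_pos unfolding P_def
    by (intro degree_sum_less) (auto intro: le_less_trans[OF degree_monom_le])
  have cP: "Polynomial.coeff P i = c i" if "i < a" for i
    using that unfolding P_def by (simp add: coeff_sum if_distrib cong: if_cong)
  have "map_poly \<iota> P = (\<Sum>i<a. Polynomial.monom (\<iota> (c i)) i)" unfolding P_def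
    by (simp add: \<iota>p.hom_sum)
  then have "poly (map_poly \<iota> P) \<theta> = (\<Sum>i<a. \<iota> (c i) * \<theta> ^ i)" by (simp add: poly_sum poly_monom)
  then have *: "poly (map_poly \<iota> P) \<theta> + \<iota> (c a) * y = 0"
    using c(2) by (simp flip: lessThan_Suc_atMost)
  have "c a \<noteq> 0"
  proof
    assume ca: "c a = 0"
    have "map_poly \<iota> P = 0"
    proof (rule zero_if_conjugate_roots)
      show "poly (map_poly \<iota> P) ((\<sigma> ^^ j) \<theta>) = 0" for j
        using * ca poly_\<sigma>[of j P \<theta>] by (simp add: \<sigma>_power_hom)
    qed (use dP in auto)
    then have "P = 0" by simp
    then have "c i = 0" if "i \<le> a" for i using cP[of i] ca that by (cases "i = a") auto
    then show False using c(1) by blast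
  qed
  show ?thesis
  proof
    show "Polynomial.degree (Polynomial.smult (- inverse (c a)) P) < a" using dP by (simp add: degree_smult_eq)
    have "y = - inverse (\<iota> (c a)) * poly (map_poly \<iota> P) \<theta>"
      using * \<open>c a \<noteq> 0\<close> by (simp add: field_simps eq_neg_iff_add_eq_0)
    also have "\<dots> = poly (map_poly \<iota> (Polynomial.smult (- inverse (c a)) P)) \<theta>"
      by (simp add: \<iota>.map_poly_hom_smult \<iota>p.hom_uminus \<iota>.hom_inverse)
    finally show "y = poly (map_poly \<iota> (Polynomial.smult (- inverse (c a)) P)) \<theta>" .
  qed
qed

lemma \<sigma>_order [simp]: "(\<sigma> ^^ a) y = y"
proof -
  obtain c where c: "\<exists>i\<le>a. c i \<noteq> 0" "(\<Sum>i\<le>a. \<iota> (c i) * \<theta> ^ i) = 0"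
    using sum_relation[of "\<lambda>i. \<theta> ^ i"] by blast
  define P where "P = (\<Sum>i\<le>a. Polynomial.monom (\<iota> (c i)) i)"
  have "Polynomial.degree P \<le> a" unfolding P_def
    by (intro degree_sum_le) (auto intro: order_trans[OF degree_monom_le])
  have cP: "Polynomial.coeff P i = \<iota> (c i)" if "i \<le> a" for i
    using that unfolding P_def by (simp add: coeff_sum if_distrib cong: if_cong)
  then have P0: "P \<noteq> 0" using c(1) by fastforce
  have root: "poly P ((\<sigma> ^^ j) \<theta>) = 0" for j
  proof -
    have "poly P ((\<sigma> ^^ j) \<theta>) = (\<sigma> ^^ j) (\<Sum>i\<le>a. \<iota> (c i) * \<theta> ^ i)"
      unfolding P_def by (simp add: poly_sum poly_monom \<sigma>_power_sum \<sigma>_power_hom \<sigma>_power_power)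
    then show ?thesis using c(2) by (simp add: \<sigma>_power_hom)
  qed
  have "\<not> inj_on (\<lambda>j. (\<sigma> ^^ j) \<theta>) {..a}"
  proof
    assume "inj_on (\<lambda>j. (\<sigma> ^^ j) \<theta>) {..a}"
    then have "Suc a = card ((\<lambda>j. (\<sigma> ^^ j) \<theta>) ` {..a})" using card_image by fastforce
    also have "\<dots> \<le> card {x. poly P x = 0}"
      using root poly_roots_finite[OF P0] by (intro card_mono) auto
    also have "\<dots> \<le> a" using card_poly_roots_bound[OF P0] \<open>Polynomial.degree P \<le> a\<close> by simp
    finally show False by simp
  qed
  then obtain i j where ij: "i < j" "j \<le> a" "(\<sigma> ^^ i) \<theta> = (\<sigma> ^^ j) \<theta>"
    unfolding inj_on_def by (metis atMost_iff linorder_neqE_nat)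
  then have "(\<sigma> ^^ i) \<theta> = (\<sigma> ^^ i) ((\<sigma> ^^ (j - i)) \<theta>)" by (simp add: \<sigma>_power_add)
  then have fx: "(\<sigma> ^^ (j - i)) \<theta> = \<theta>" by (metis \<sigma>_power_inj)
  then have "j - i = a" using \<theta>_separated[of "j - i"] ij L.v_zero by (cases "j - i < a") auto
  then have "(\<sigma> ^^ a) \<theta> = \<theta>" using fx by simp
  moreover obtain g where "y = poly (map_poly \<iota> g) \<theta>" by (rule \<theta>_generates)
  ultimately show ?thesis by (simp add: poly_\<sigma>)
qed

lemma \<sigma>_fixed: assumes "\<sigma> y = y" shows "y \<in> range \<iota>"
proof -
  obtain g where g: "Polynomial.degree g < a" "y = poly (map_poly \<iota> g) \<theta>" by (rule \<theta>_generates)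
  have fx: "(\<sigma> ^^ j) y = y" for j by (induction j) (use assms in auto)
  have "map_poly \<iota> g - [:y:] = 0"
  proof (rule zero_if_conjugate_roots)
    show "Polynomial.degree (map_poly \<iota> g - [:y:]) < a"
      using g(1) a_pos by (intro degree_diff_less) auto
    show "poly (map_poly \<iota> g - [:y:]) ((\<sigma> ^^ j) \<theta>) = 0" for j
      using poly_\<sigma>[of j g \<theta>] fx[of j] g(2) by simp
  qed
  then have "y = Polynomial.coeff (map_poly \<iota> g) 0" by simp
  then show ?thesis by simp
qed

text \<open>
  The sums \<open>\<Sum> b\<^sub>i \<sigma>\<^sup>j(c\<^sub>i)\<close> are, as functions of \<open>j\<close>, closed under products. The product of the
  functions \<open>\<theta> - \<sigma>\<^sup>j(\<sigma>\<^sup>-\<^sup>s \<theta>)\<close> for \<open>0 < s < a\<close> vanishes except at \<open>j = 0\<close>, where it is a unit.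
\<close>

lemma galois_basis:
  obtains xs :: "('l \<times> 'l) list" where "set xs \<subseteq> W \<times> W"
    "\<And>j. j < a \<Longrightarrow> (\<Sum>(b, c)\<leftarrow>xs. b * (\<sigma> ^^ j) c) = (if j = 0 then 1 else 0)"
proof -
  define D where "D = (\<lambda>f. \<exists>xs. set xs \<subseteq> W \<times> W \<and> (\<forall>j. (\<Sum>(b, c)\<leftarrow>xs. b * (\<sigma> ^^ j) c) = f j))"
  have D_mult: "D (\<lambda>j. f j * g j)" if fg: "D f" "D g" for f g
  proof -
    obtain xs ys where xs: "set xs \<subseteq> W \<times> W" "\<And>j. (\<Sum>(b, c)\<leftarrow>xs. b * (\<sigma> ^^ j) c) = f j"
      and ys: "set ys \<subseteq> W \<times> W" "\<And>j. (\<Sum>(b, c)\<leftarrow>ys. b * (\<sigma> ^^ j) c) = g j"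
      using fg unfolding D_def by blast
    define zs where "zs = (\<lambda>xs. concat (map (\<lambda>(b, c). map (\<lambda>(b', c'). (b * b', c * c')) ys) xs))"
    have "(\<Sum>(b, c)\<leftarrow>zs xs. b * (\<sigma> ^^ j) c) =
        (\<Sum>(b, c)\<leftarrow>xs. b * (\<sigma> ^^ j) c) * (\<Sum>(b, c)\<leftarrow>ys. b * (\<sigma> ^^ j) c)" for j and xs :: "('l \<times> 'l) list"
    proof (induction xs)
      case (Cons x xs)
      have "(\<Sum>(b', c')\<leftarrow>map (\<lambda>(b', c'). (b * b', c * c')) ys. b' * (\<sigma> ^^ j) c') =
          b * (\<sigma> ^^ j) c * (\<Sum>(b, c)\<leftarrow>ys. b * (\<sigma> ^^ j) c)" for b c
        by (induction ys) (auto simp: \<sigma>_power_hom algebra_simps)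
      then show ?case using Cons by (cases x) (simp add: zs_def algebra_simps)
    qed (simp add: zs_def)
    moreover have "set (zs xs) \<subseteq> W \<times> W" using xs(1) ys(1) unfolding zs_def by fastforce
    ultimately show ?thesis unfolding D_def using xs ys by (intro exI[of _ "zs xs"]) simp
  qed
  have D_const: "D (\<lambda>j. w)" if "w \<in> W" for w
    unfolding D_def using that by (intro exI[of _ "[(w, 1)]"]) (auto simp: \<sigma>_power_hom)
  have D_diff: "D (\<lambda>j. w - (\<sigma> ^^ j) w')" if "w \<in> W" "w' \<in> W" for w w'
    unfolding D_def using that L.O_minus[OF L.O_one]
    by (intro exI[of _ "[(w, 1), (- 1, w')]"]) (auto simp: \<sigma>_power_hom)
  have D_prod: "D (\<lambda>j. \<Prod>s\<in>I. f s j)" if "finite I" "\<And>s. s \<in> I \<Longrightarrow> D (f s)" for f and I :: "nat set"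
    using that by (induction I rule: finite_induct) (auto simp: D_const D_mult)
  define e where "e = (\<lambda>j. \<Prod>s\<in>{1..<a}. \<theta> - (\<sigma> ^^ j) ((\<sigma> ^^ (a - s)) \<theta>))"
  have "D e" unfolding e_def using \<theta>_W by (intro D_prod D_diff) auto
  have "vL (e 0) = 0"
  proof -
    have "vL (\<Prod>s\<in>I. \<theta> - (\<sigma> ^^ (a - s)) \<theta>) = 0" if "finite I" "I \<subseteq> {1..<a}" for I
      using that
    proof (induction I rule: finite_induct)
      case (insert s I)
      then have "vL ((\<sigma> ^^ (a - s)) \<theta> - \<theta>) = 0" by (intro \<theta>_separated) auto
      then have "vL (\<theta> - (\<sigma> ^^ (a - s)) \<theta>) = 0" using L.v_minus by (metis minus_diff_eq)
      then show ?case using insert by (simp add: L.v_mult)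
    qed (simp add: L.v_one)
    then show ?thesis unfolding e_def by simp
  qed
  have e0: "e 0 \<noteq> 0" using \<open>vL (e 0) = 0\<close> L.v_zero by auto
  have ej: "e j = 0" if "0 < j" "j < a" for j
  proof -
    have "(\<sigma> ^^ j) ((\<sigma> ^^ (a - j)) \<theta>) = \<theta>" using that \<sigma>_order
      by (simp add: \<sigma>_power_add)
    then show ?thesis unfolding e_def using that by (intro prod_zero bexI[of _ j]) auto
  qed
  have "D (\<lambda>j. inverse (e 0) * e j)"
    using D_mult[OF D_const \<open>D e\<close>] L.O_unit[OF \<open>vL (e 0) = 0\<close>] by blast
  then obtain xs where xs: "set xs \<subseteq> W \<times> W"
    "\<And>j. (\<Sum>(b, c)\<leftarrow>xs. b * (\<sigma> ^^ j) c) = inverse (e 0) * e j"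
    unfolding D_def by blast
  show ?thesis
  proof (rule that[OF xs(1)])
    fix j assume "j < a"
    then show "(\<Sum>(b, c)\<leftarrow>xs. b * (\<sigma> ^^ j) c) = (if j = 0 then 1 else 0)"
      unfolding xs(2) using e0 ej[of j] by (cases "j = 0") simp_all
  qed
qed

end

section \<open>Valuation rings and places\<close>

definition subring_set :: "'b::comm_ring_1 set \<Rightarrow> bool" where
  "subring_set B \<longleftrightarrow> 1 \<in> B \<and> (\<forall>x\<in>B. \<forall>y\<in>B. x - y \<in> B \<and> x * y \<in> B)"

lemma subring_setD:
  assumes "subring_set B"
  shows "1 \<in> B" "0 \<in> B" "x \<in> B \<Longrightarrow> y \<in> B \<Longrightarrow> x - y \<in> B" "x \<in> B \<Longrightarrow> y \<in> B \<Longrightarrow> x * y \<in> B"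
    "x \<in> B \<Longrightarrow> - x \<in> B" "x \<in> B \<Longrightarrow> y \<in> B \<Longrightarrow> x + y \<in> B" "x \<in> B \<Longrightarrow> x ^ n \<in> B"
proof -
  show 1: "1 \<in> B" and sub: "\<And>x y. x \<in> B \<Longrightarrow> y \<in> B \<Longrightarrow> x - y \<in> B"
    and mult: "\<And>x y. x \<in> B \<Longrightarrow> y \<in> B \<Longrightarrow> x * y \<in> B"
    using assms unfolding subring_set_def by auto
  show 0: "0 \<in> B" using sub[OF 1 1] by simp
  show neg: "\<And>x. x \<in> B \<Longrightarrow> - x \<in> B" using sub[OF 0] by simp
  show "x \<in> B \<Longrightarrow> y \<in> B \<Longrightarrow> x + y \<in> B" using sub[OF _ neg, of x y] by simp
  show "x \<in> B \<Longrightarrow> x ^ n \<in> B" by (induction n) (auto intro: 1 mult)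
qed

lemma subring_set_sum:
  "subring_set B \<Longrightarrow> (\<And>i. i \<in> I \<Longrightarrow> f i \<in> B) \<Longrightarrow> sum f I \<in> B"
  by (induction I rule: infinite_finite_induct) (auto intro: subring_setD)

lemma subring_set_prod:
  "subring_set B \<Longrightarrow> (\<And>i. i \<in> I \<Longrightarrow> f i \<in> B) \<Longrightarrow> prod f I \<in> B"
  by (induction I rule: infinite_finite_induct) (auto intro: subring_setD)

lemma subring_set_coeff_mult:
  assumes "subring_set B" "\<And>i. Polynomial.coeff f i \<in> B" "\<And>i. Polynomial.coeff g i \<in> B"
  shows "Polynomial.coeff (f * g) i \<in> B"
  unfolding coeff_mult using assms by (intro subring_set_sum subring_setD(4)) auto

definition adjoin :: "'b::field set \<Rightarrow> 'b \<Rightarrow> 'b set" where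
  "adjoin B x = {poly g x |g. \<forall>i. Polynomial.coeff g i \<in> B}"

lemma subring_set_adjoin: assumes "subring_set B" shows "subring_set (adjoin B x)"
  unfolding subring_set_def
proof (intro conjI ballI)
  show "1 \<in> adjoin B x" unfolding adjoin_def
    by (rule CollectI, rule exI[of _ "1"]) (auto simp: coeff_one intro: subring_setD[OF assms])
  fix y z assume "y \<in> adjoin B x" "z \<in> adjoin B x"
  then obtain f g where fg: "y = poly f x" "z = poly g x"
    "\<And>i. Polynomial.coeff f i \<in> B" "\<And>i. Polynomial.coeff g i \<in> B" unfolding adjoin_def by blast
  show "y - z \<in> adjoin B x" unfolding adjoin_def
    by (rule CollectI, rule exI[of _ "f - g"]) (auto simp: fg intro: subring_setD[OF assms])
  show "y * z \<in> adjoin B x" unfolding adjoin_def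
    by (rule CollectI, rule exI[of _ "f * g"]) (auto simp: fg intro: subring_set_coeff_mult[OF assms])
qed

lemma adjoin_contains: assumes "subring_set B" shows "B \<subseteq> adjoin B x" "x \<in> adjoin B x"
proof -
  show "x \<in> adjoin B x" unfolding adjoin_def
    by (rule CollectI, rule exI[of _ "[:0, 1:]"]) (auto simp: coeff_pCons split: nat.splits intro: subring_setD[OF assms])
  show "B \<subseteq> adjoin B x"
  proof
    fix b assume "b \<in> B"
    then show "b \<in> adjoin B x" unfolding adjoin_def
      by (intro CollectI exI[of _ "[:b:]"]) (auto simp: coeff_pCons split: nat.splits intro: subring_setD[OF assms])
  qed
qed

locale valuation_ring =
  fixes V :: "'b::field set"
  assumes subring: "subring_set V" and total: "x \<in> V \<or> inverse x \<in> V"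
begin

lemmas V_rules = subring_setD[OF subring]

definition "units = {x. x \<noteq> 0 \<and> x \<in> V \<and> inverse x \<in> V}"

lemma units_mult: "x \<in> units \<Longrightarrow> y \<in> units \<Longrightarrow> x * y \<in> units"
  and units_inverse: "x \<in> units \<Longrightarrow> inverse x \<in> units" and units_one: "1 \<in> units"
  unfolding units_def by (auto intro: V_rules)

lemma units_divide: "x \<in> units \<Longrightarrow> y \<in> units \<Longrightarrow> x / y \<in> units"
  unfolding divide_inverse by (intro units_mult units_inverse)

lemma units_power: "x \<in> units \<Longrightarrow> x ^ n \<in> units"
  by (induction n) (auto intro: units_mult units_one)

lemma nonunits_add:
  assumes "x \<in> V - units" "y \<in> V - units" shows "x + y \<in> V - units"
proof -
  have "x + y \<notin> units" if x: "x \<in> V - units" and y: "y \<in> V - units" and xy: "x / y \<in> V" for x y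
  proof
    assume u: "x + y \<in> units"
    show False
    proof (cases "y = 0")
      case False
      have "(1 + x / y) * inverse (x + y) \<in> V" using u xy unfolding units_def by (auto intro: V_rules)
      moreover have "(1 + x / y) * inverse (x + y) = inverse y"
        using False u unfolding units_def by (simp add: field_simps)
      ultimately show False using y False unfolding units_def by auto
    qed (use u x in auto)
  qed
  moreover have "x / y \<in> V \<or> y / x \<in> V" using total[of "x / y"] by simp
  ultimately have "x + y \<notin> units" using assms add.commute by metis
  then show ?thesis using assms by (auto intro: V_rules)
qed

lemma nonunits_sum:
  "finite I \<Longrightarrow> (\<And>i. i \<in> I \<Longrightarrow> f i \<in> V - units) \<Longrightarrow> sum f I \<in> V - units"
proof (induction I rule: finite_induct)
  case empty
  then show ?case by (auto simp: units_def intro: V_rules)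
next
  case (insert i I)
  then show ?case using nonunits_add[of "f i" "sum f I"] by simp
qed

lemma dominant_term:
  "finite I \<Longrightarrow> I \<noteq> {} \<Longrightarrow> (\<And>i. i \<in> I \<Longrightarrow> T i \<noteq> 0) \<Longrightarrow> \<exists>k\<in>I. \<forall>i\<in>I. T i / T k \<in> V"
proof (induction I rule: finite_ne_induct)
  case (singleton i)
  then show ?case by (auto intro: V_rules)
next
  case (insert j I)
  then obtain k where k: "k \<in> I" "\<forall>i\<in>I. T i / T k \<in> V" by auto
  show ?case
  proof (cases "T j / T k \<in> V")
    case False
    then have jk: "T k / T j \<in> V" using total[of "T j / T k"] by simp
    have "T i / T j \<in> V" if "i \<in> insert j I" for i
    proof (cases "i = j")
      case False
      then have "(T i / T k) * (T k / T j) \<in> V" using that k jk by (intro V_rules(4)) auto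
      then show ?thesis using insert.prems k by simp
    qed (use insert.prems in \<open>auto intro: V_rules\<close>)
    then show ?thesis by blast
  qed (use k in auto)
qed

text \<open>In a vanishing sum, two terms have the same value.\<close>

lemma two_terms_of_equal_value:
  assumes I: "finite I" "I \<noteq> {}" and T: "\<And>i. i \<in> I \<Longrightarrow> T i \<noteq> 0" and sum: "(\<Sum>i\<in>I. T i) = 0"
  obtains i k where "i \<in> I" "k \<in> I" "i \<noteq> k" "T i / T k \<in> units"
proof -
  obtain k where k: "k \<in> I" "\<forall>i\<in>I. T i / T k \<in> V" using dominant_term[OF I] T by blast
  have "(\<Sum>i\<in>I. T i / T k) = 0" using sum by (simp flip: sum_divide_distrib)
  moreover have "(\<Sum>i\<in>I. T i / T k) = 1 + (\<Sum>i\<in>I - {k}. T i / T k)"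
    using I(1) k(1) T[OF k(1)] by (simp add: sum.remove)
  ultimately have *: "(\<Sum>i\<in>I - {k}. T i / T k) = - 1" by (simp add: add_eq_0_iff)
  have "\<exists>i\<in>I - {k}. T i / T k \<in> units"
  proof (rule ccontr)
    assume "\<not> ?thesis"
    then have "(\<Sum>i\<in>I - {k}. T i / T k) \<in> V - units" using k I by (intro nonunits_sum) auto
    then show False unfolding * by (auto simp: units_def intro: V_rules)
  qed
  then show ?thesis using that k by blast
qed

end

text \<open>
  Chevalley's extension theorem for the ideal generated by \<open>b\<close> and \<open>c\<close>: a subring maximal among those
  in which \<open>b\<close> and \<open>c\<close> do not generate the unit ideal is a valuation ring.
\<close>

context
  fixes b c :: "'b::field"
begin

definition gen :: "'b set \<Rightarrow> 'b set" where
  "gen B = {b * x + c * y |x y. x \<in> B \<and> y \<in> B}"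

context
  fixes V :: "'b set"
  assumes V: "subring_set V" and bV: "b \<in> V" and cV: "c \<in> V" and proper: "1 \<notin> gen V"
    and maximal: "\<And>B. subring_set B \<Longrightarrow> V \<subseteq> B \<Longrightarrow> 1 \<notin> gen B \<Longrightarrow> B = V"
begin

lemma gen_add: "x \<in> gen V \<Longrightarrow> y \<in> gen V \<Longrightarrow> x + y \<in> gen V"
  unfolding gen_def
proof safe
  fix x y x' y' assume "x \<in> V" "y \<in> V" "x' \<in> V" "y' \<in> V"
  then show "\<exists>xa ya. b * x + c * y + (b * x' + c * y') = b * xa + c * ya \<and> xa \<in> V \<and> ya \<in> V"
    by (intro exI[of _ "x + x'"] exI[of _ "y + y'"]) (auto simp: algebra_simps intro: subring_setD[OF V])
qed

lemma gen_mult: "x \<in> V \<Longrightarrow> y \<in> gen V \<Longrightarrow> x * y \<in> gen V"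
  unfolding gen_def
proof safe
  fix r s assume "x \<in> V" "r \<in> V" "s \<in> V"
  then show "\<exists>xa y. x * (b * r + c * s) = b * xa + c * y \<and> xa \<in> V \<and> y \<in> V"
    by (intro exI[of _ "x * r"] exI[of _ "x * s"]) (auto simp: algebra_simps intro: subring_setD[OF V])
qed

lemma gen_zero: "0 \<in> gen V"
  unfolding gen_def using subring_setD(2)[OF V] by force

lemma gen_sum: "(\<And>i. i \<in> I \<Longrightarrow> f i \<in> gen V) \<Longrightarrow> sum f I \<in> gen V"
  by (induction I rule: infinite_finite_induct) (auto intro: gen_add gen_zero)

abbreviation "gen_poly g \<equiv> (\<forall>i. Polynomial.coeff g i \<in> gen V)"

lemma outside_relation:
  assumes "x \<notin> V" obtains g where "gen_poly g" "poly g x = 1"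
proof -
  have "1 \<in> gen (adjoin V x)"
    using maximal[of "adjoin V x"] subring_set_adjoin[OF V] adjoin_contains[OF V, of x] assms by blast
  then obtain f g where fg: "\<And>i. Polynomial.coeff f i \<in> V" "\<And>i. Polynomial.coeff g i \<in> V"
    "1 = b * poly f x + c * poly g x" unfolding gen_def adjoin_def by blast
  have "gen_poly (Polynomial.smult b f + Polynomial.smult c g)"
    using fg(1,2) unfolding gen_def by auto
  then show ?thesis using that fg(3) by (metis poly_add poly_smult)
qed

lemma gen_subset: "gen V \<subseteq> V"
  unfolding gen_def using bV cV by (auto intro: subring_setD[OF V])

lemma one_minus_gen_unit: assumes i: "i \<in> gen V" shows "1 - i \<noteq> 0" "inverse (1 - i) \<in> V"
proof -
  show nz: "1 - i \<noteq> 0" using i proper by auto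
  have pV: "(1 - i) ^ n \<in> V" for n using i gen_subset by (auto intro: subring_setD[OF V])
  show "inverse (1 - i) \<in> V"
  proof (rule ccontr)
    assume "inverse (1 - i) \<notin> V"
    then obtain g where g: "gen_poly g" "poly g (inverse (1 - i)) = 1" by (rule outside_relation)
    have "poly (reflect_poly g) (1 - i) = (1 - i) ^ Polynomial.degree g"
      using poly_reflect_poly_nz[OF nz, of g] g(2) by simp
    moreover have "poly (reflect_poly g) (1 - i) \<in> gen V"
      unfolding poly_altdef
    proof (rule gen_sum)
      fix k
      have "Polynomial.coeff (reflect_poly g) k \<in> gen V" using g(1) gen_zero by (simp add: coeff_reflect_poly)
      then show "Polynomial.coeff (reflect_poly g) k * (1 - i) ^ k \<in> gen V"
        using gen_mult[OF pV] by (simp add: mult.commute)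
    qed
    ultimately have *: "(1 - i) ^ Polynomial.degree g \<in> gen V" by simp
    have "1 - (1 - i) ^ n \<in> gen V" for n
    proof (induction n)
      case (Suc n)
      have eq: "1 - (1 - i) ^ Suc n = (1 - (1 - i) ^ n) + (1 - i) ^ n * i" by (simp add: algebra_simps)
      show ?case unfolding eq by (rule gen_add[OF Suc gen_mult[OF pV i]])
    qed (simp add: gen_zero)
    from gen_add[OF this[of "Polynomial.degree g"] *] show False using proper by simp
  qed
qed

lemma lower_degree:
  assumes f: "gen_poly f" "poly f (inverse x) = 1" and g: "gen_poly g" "poly g x = 1"
    and le: "Polynomial.degree f \<le> Polynomial.degree g" and x: "x \<noteq> 0"
  obtains g' where "gen_poly g'" "poly g' x = 1" "Polynomial.degree g' < Polynomial.degree g"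
proof -
  define m n f0 where "m = Polynomial.degree f" and "n = Polynomial.degree g" and "f0 = Polynomial.coeff f 0"
  note defs = m_def n_def f0_def
  have m0: "m > 0"
  proof (rule ccontr)
    assume "\<not> m > 0"
    then obtain d where "f = [:d:]" unfolding m_def using degree_eq_zeroE by auto
    then show False using f proper by (auto simp: coeff_pCons split: nat.splits)
  qed
  define F where "F = f - [:f0:]"
  have dF: "Polynomial.degree F = m"
    unfolding F_def diff_conv_add_uminus using m0 by (subst degree_add_eq_left) (auto simp: m_def)
  have F: "gen_poly F" "Polynomial.coeff F 0 = 0"
    using f(1) gen_zero unfolding F_def f0_def by (auto simp: coeff_pCons split: nat.splits)
  have u: "1 - f0 \<noteq> 0" "inverse (1 - f0) \<in> V" using one_minus_gen_unit[of f0] f(1) unfolding f0_def by auto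
  define r where "r = Polynomial.smult (inverse (1 - f0)) (reflect_poly F)"
  have rx: "poly r x = x ^ m"
    using poly_reflect_poly_nz[OF x, of F] f(2) u(1) dF unfolding r_def by (simp add: F_def)
  have r: "gen_poly r" using gen_mult[OF u(2)] F(1) gen_zero unfolding r_def
    by (auto simp: coeff_reflect_poly)
  have r0: "Polynomial.coeff r i = 0" if "i \<ge> m" for i
    using that F(2) dF unfolding r_def by (cases "i = m") (auto simp: coeff_reflect_poly)
  define l where "l = Polynomial.lead_coeff g"
  have l: "l \<in> V" using g(1) gen_subset unfolding l_def by blast
  define g' where "g' = (g - Polynomial.monom l n) + Polynomial.smult l (Polynomial.monom 1 (n - m) * r)"
  have nm: "m \<le> n" using le unfolding defs .
  have cg': "Polynomial.coeff g' i = (if i = n then 0 else Polynomial.coeff g i) +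
      l * (if n - m \<le> i then Polynomial.coeff r (i - (n - m)) else 0)" for i
    unfolding g'_def by (simp add: coeff_monom_mult l_def n_def)
  show ?thesis
  proof
    show "gen_poly g'"
    proof
      fix i show "Polynomial.coeff g' i \<in> gen V"
        unfolding cg' using g(1) r l gen_zero by (intro gen_add gen_mult) auto
    qed
    have "poly g' x = 1 - l * x ^ n + l * (x ^ (n - m) * x ^ m)"
      unfolding g'_def using g(2) rx by (simp add: poly_monom)
    then show "poly g' x = 1" using nm by (simp flip: power_add)
    have "Polynomial.coeff g' i = 0" if "i > n - 1" for i
      unfolding cg' using that m0 nm r0[of "i - (n - m)"] by (auto simp: n_def coeff_eq_0)
    then have "Polynomial.degree g' \<le> n - 1" by (intro degree_le) auto
    then show "Polynomial.degree g' < Polynomial.degree g" using m0 nm unfolding n_def by auto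
  qed
qed

lemma maximal_imp_valuation_ring: "valuation_ring V"
proof
  have no: False if "gen_poly f" "poly f (inverse x) = 1" "gen_poly g" "poly g x = 1" "x \<noteq> 0" for f g x
    using that
  proof (induction "Polynomial.degree f + Polynomial.degree g" arbitrary: f g rule: less_induct)
    case less
    show False
    proof (cases "Polynomial.degree f \<le> Polynomial.degree g")
      case True
      obtain g' where "gen_poly g'" "poly g' x = 1" "Polynomial.degree g' < Polynomial.degree g"
        using lower_degree[OF less.prems(1-4) True less.prems(5)] .
      then show False using less.hyps[of f g'] less.prems by simp
    next
      case False
      obtain f' where "gen_poly f'" "poly f' (inverse x) = 1" "Polynomial.degree f' < Polynomial.degree f"
        using lower_degree[of g "inverse x" f] less.prems False by auto
      then show False using less.hyps[of f' g] less.prems by simp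
    qed
  qed
  fix x show "x \<in> V \<or> inverse x \<in> V"
  proof (rule ccontr)
    assume "\<not> ?thesis"
    then have "x \<notin> V" "inverse x \<notin> V" by auto
    moreover have "x \<noteq> 0" using \<open>x \<notin> V\<close> subring_setD(2)[OF V] by auto
    ultimately show False using no outside_relation by metis
  qed
qed (rule V)

end

lemma chevalley_extension:
  assumes B: "subring_set B" "b \<in> B" "c \<in> B" "1 \<notin> gen B"
  obtains V where "valuation_ring V" "B \<subseteq> V" "1 \<notin> gen V"
proof -
  define \<A> where "\<A> = {V. subring_set V \<and> B \<subseteq> V \<and> 1 \<notin> gen V}"
  have "\<exists>M\<in>\<A>. \<forall>V\<in>\<A>. M \<subseteq> V \<longrightarrow> V = M"
  proof (rule subset_Zorn_nonempty)
    show "\<A> \<noteq> {}" using B unfolding \<A>_def by blast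
    fix \<C> assume C: "\<C> \<noteq> {}" "subset.chain \<A> \<C>"
    then have CA: "\<C> \<subseteq> \<A>" and ch: "\<And>X' Y. X' \<in> \<C> \<Longrightarrow> Y \<in> \<C> \<Longrightarrow> X' \<subseteq> Y \<or> Y \<subseteq> X'"
      unfolding subset_chain_def by auto
    have two: "\<exists>D\<in>\<C>. x \<in> D \<and> y \<in> D" if "x \<in> \<Union>\<C>" "y \<in> \<Union>\<C>" for x y
      using that ch by (meson UnionE subsetD)
    show "\<Union>\<C> \<in> \<A>" unfolding \<A>_def
    proof (intro CollectI conjI)
      show "subring_set (\<Union>\<C>)" unfolding subring_set_def
      proof (intro conjI ballI)
        show "1 \<in> \<Union>\<C>" using C(1) CA unfolding \<A>_def subring_set_def by blast
        fix x y assume "x \<in> \<Union>\<C>" "y \<in> \<Union>\<C>"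
        then obtain D where "D \<in> \<C>" "x \<in> D" "y \<in> D" using two by blast
        then show "x - y \<in> \<Union>\<C>" "x * y \<in> \<Union>\<C>" using CA unfolding \<A>_def subring_set_def by blast+
      qed
      show "B \<subseteq> \<Union>\<C>" using C(1) CA unfolding \<A>_def by blast
      show "1 \<notin> gen (\<Union>\<C>)"
      proof
        assume "1 \<in> gen (\<Union>\<C>)"
        then obtain x y where xy: "1 = b * x + c * y" "x \<in> \<Union>\<C>" "y \<in> \<Union>\<C>" unfolding gen_def by blast
        then obtain D where "D \<in> \<C>" "x \<in> D" "y \<in> D" using two by blast
        then show False using CA xy(1) unfolding \<A>_def gen_def by blast
      qed
    qed
  qed
  then obtain V where V: "V \<in> \<A>" "\<forall>V'\<in>\<A>. V \<subseteq> V' \<longrightarrow> V' = V" by blast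
  have "valuation_ring V"
    by (rule maximal_imp_valuation_ring) (use V B in \<open>auto simp: \<A>_def\<close>)
  then show ?thesis using that V unfolding \<A>_def by blast
qed

end

interpretation to_ac: field_hom "to_ac :: 'k::field \<Rightarrow> 'k alg_closure"
  by unfold_locales auto

interpretation to_acp: map_poly_inj_idom_hom "to_ac :: 'k::field \<Rightarrow> 'k alg_closure" ..

context p_valued_field
begin

lemma v_power_int: "v (of_nat p powi n) = ereal (of_int n)"
proof (cases "n \<ge> 0")
  case True
  then show ?thesis using v_p_power[of "nat n"] by (simp add: power_int_def)
next
  case False
  define m where "m = nat (- n)"
  have "v (of_nat p ^ m * inverse (of_nat p ^ m)) = ereal (real m) + v (inverse (of_nat p ^ m))"
    by (simp only: v_mult v_p_power)
  moreover have "of_nat p ^ m * inverse (of_nat p ^ m) = (1 :: 'k)" by simp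
  ultimately have "ereal (real m) + v (inverse (of_nat p ^ m)) = 0" using v_one by simp
  then have "v (inverse (of_nat p ^ m)) = ereal (- real m)"
    by (cases "v (inverse (of_nat p ^ m))") (auto simp: zero_ereal_def)
  then show ?thesis using False by (simp add: power_int_def m_def power_inverse)
qed

definition integral :: "'k alg_closure \<Rightarrow> bool" where
  "integral y \<longleftrightarrow> (\<exists>P. Polynomial.lead_coeff P = 1 \<and> (\<forall>i. Polynomial.coeff P i \<in> \<O>) \<and>
    poly (map_poly to_ac P) y = 0)"

lemma subring_set_O: "subring_set (to_ac ` \<O>)"
  unfolding subring_set_def
proof (intro conjI ballI)
  show "1 \<in> to_ac ` \<O>" by (rule image_eqI[of _ _ 1]) auto
  fix x y assume "x \<in> to_ac ` \<O>" "y \<in> to_ac ` \<O>"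
  then obtain c d where "c \<in> \<O>" "d \<in> \<O>" "x = to_ac c" "y = to_ac d" by blast
  then show "x - y \<in> to_ac ` \<O>" "x * y \<in> to_ac ` \<O>"
    using O_diff[of c d] O_mult[of c d] by (metis imageI to_ac_diff, metis imageI to_ac_mult)
qed

lemma adjoin_O:
  assumes "x \<in> adjoin (to_ac ` \<O>) z"
  obtains g where "\<And>i. Polynomial.coeff g i \<in> \<O>" "x = poly (map_poly to_ac g) z"
proof -
  obtain g where g: "\<forall>i. Polynomial.coeff g i \<in> to_ac ` \<O>" "x = poly g z"
    using assms unfolding adjoin_def by blast
  define r where "r = inv_into \<O> (to_ac :: 'k \<Rightarrow> _)"
  have inj: "inj_on (to_ac :: 'k \<Rightarrow> _) \<O>" using inj_to_ac inj_on_subset by blast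
  have r0: "r 0 = 0" using inv_into_f_f[OF inj O_zero] unfolding r_def by simp
  have "map_poly to_ac (map_poly r g) = g"
  proof (rule poly_eqI)
    fix i show "Polynomial.coeff (map_poly to_ac (map_poly r g)) i = Polynomial.coeff g i"
      using g(1) f_inv_into_f[of "Polynomial.coeff g i" to_ac \<O>] r0 by (simp add: coeff_map_poly r_def)
  qed
  moreover have "Polynomial.coeff (map_poly r g) i \<in> \<O>" for i
    using g(1) inv_into_into[of "Polynomial.coeff g i" to_ac \<O>] r0 by (simp add: coeff_map_poly r_def)
  ultimately show ?thesis using that[of "map_poly r g"] g(2) by simp
qed

text \<open>
  If \<open>p\<close> and \<open>1/y\<close> generate the unit ideal of \<open>\<int>\<^sub>p[1/y]\<close>, a relation expressing this is, multiplied
  by a power of \<open>y\<close>, an equation of integral dependence for \<open>y\<close>.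
\<close>

lemma non_integral_valuation_ring:
  assumes "\<not> integral y"
  obtains V where "valuation_ring V" "to_ac ` \<O> \<subseteq> V" "\<And>t. t \<in> V \<Longrightarrow> of_nat p * t \<noteq> 1"
    "inverse y \<in> V" "y \<notin> V" "y \<noteq> 0"
proof -
  have y0: "y \<noteq> 0"
  proof
    assume "y = 0"
    then have "integral y" unfolding integral_def
      by (intro exI[of _ "[:0, 1:]"]) (auto simp: coeff_pCons split: nat.splits)
    then show False using assms by blast
  qed
  define z where "z = inverse y"
  define B where "B = adjoin (to_ac ` \<O>) z"
  have sB: "subring_set B" unfolding B_def by (rule subring_set_adjoin[OF subring_set_O])
  have OB: "to_ac ` \<O> \<subseteq> B" "z \<in> B" unfolding B_def using adjoin_contains[OF subring_set_O] by auto
  have pB: "of_nat p \<in> B" using OB(1) O_of_nat[of p] to_ac_of_nat by (metis image_subset_iff)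
  have "1 \<notin> gen (of_nat p) z B"
  proof
    assume "1 \<in> gen (of_nat p) z B"
    then obtain x1 x2 where x: "1 = of_nat p * x1 + z * x2" "x1 \<in> B" "x2 \<in> B" unfolding gen_def by blast
    obtain f where f: "\<And>i. Polynomial.coeff f i \<in> \<O>" "x1 = poly (map_poly to_ac f) z"
      using adjoin_O x(2) unfolding B_def by metis
    obtain g where g: "\<And>i. Polynomial.coeff g i \<in> \<O>" "x2 = poly (map_poly to_ac g) z"
      using adjoin_O x(3) unfolding B_def by metis
    define P where "P = 1 - Polynomial.smult (of_nat p) f - pCons 0 g"
    define c where "c = Polynomial.coeff P 0"
    have c: "c = 1 - of_nat p * Polynomial.coeff f 0" unfolding c_def P_def by simp
    have "v c = 0"
      by (rule v_unit_perturb[of 1]) (use v_one v_p_mult f(1) in \<open>auto simp: c\<close>)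
    then have c0: "c \<noteq> 0" "inverse c \<in> \<O>" using v_zero O_unit by auto
    have PO: "Polynomial.coeff P i \<in> \<O>" for i
    proof -
      have "Polynomial.coeff (pCons 0 g) i \<in> \<O>" "Polynomial.coeff 1 i \<in> \<O>"
        using g(1) by (auto simp: coeff_pCons coeff_one split: nat.splits)
      then show ?thesis unfolding P_def coeff_diff coeff_smult using f(1) by (intro O_diff O_mult) auto
    qed
    have "poly (map_poly to_ac P) z = 1 - of_nat p * poly (map_poly to_ac f) z - z * poly (map_poly to_ac g) z"
      unfolding P_def by (simp add: to_acp.hom_minus to_ac.map_poly_hom_smult to_ac.map_poly_pCons_hom)
    also have "\<dots> = 0" using x(1) f(2) g(2) by (metis add_diff_cancel_left' cancel_comm_monoid_add_class.diff_cancel diff_diff_eq)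
    finally have Pz: "poly (map_poly to_ac P) z = 0" .
    define Q where "Q = Polynomial.smult (inverse c) (reflect_poly P)"
    have "Polynomial.lead_coeff Q = 1"
      unfolding Q_def using c0 by (simp add: c_def lead_coeff_smult coeff_reflect_poly)
    moreover have "Polynomial.coeff Q i \<in> \<O>" for i
      unfolding Q_def using PO c0 by (auto simp: coeff_reflect_poly)
    moreover have "poly (map_poly to_ac Q) y = 0"
    proof -
      have "map_poly to_ac (reflect_poly P) = reflect_poly (map_poly to_ac P)"
        by (rule poly_eqI) (simp add: coeff_reflect_poly)
      moreover have "poly (reflect_poly (map_poly to_ac P)) y = 0"
        using poly_reflect_poly_nz[OF y0, of "map_poly to_ac P"] Pz unfolding z_def by simp
      ultimately show ?thesis unfolding Q_def by (simp add: to_ac.map_poly_hom_smult)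
    qed
    ultimately show False using assms unfolding integral_def by blast
  qed
  then obtain V where V: "valuation_ring V" "B \<subseteq> V" "1 \<notin> gen (of_nat p) z V"
    using chevalley_extension[OF sB pB OB(2)] by blast
  interpret valuation_ring V by fact
  have "of_nat p * t \<noteq> 1" if "t \<in> V" for t
    using V(3) that V_rules(2) unfolding gen_def by (metis (mono_tags, lifting) add.right_neutral mem_Collect_eq mult_zero_right)
  moreover have "y \<notin> V"
  proof
    assume "y \<in> V"
    then have "of_nat p * 0 + z * y \<in> gen (of_nat p) z V" using V_rules(2) unfolding gen_def by blast
    then show False using V(3) y0 unfolding z_def by simp
  qed
  ultimately show ?thesis using that[OF V(1)] OB V(2) y0 unfolding z_def by blast
qed

end

locale root_of_modulus = padic_numbers p v for p and v :: "'k::field_char_0 \<Rightarrow> ereal" +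
  fixes h :: "int poly" and \<rho> :: "'k alg_closure"
  assumes h: "h \<noteq> 0" and root: "poly (map_poly to_ac (map_poly of_int h)) \<rho> = 0"
begin

abbreviation H :: "'k poly" where "H \<equiv> map_poly of_int h"
definition ev :: "'k poly \<Rightarrow> 'k alg_closure" where "ev u = poly (map_poly to_ac u) \<rho>"
definition d :: nat where "d = Polynomial.degree H"

lemma ev_simps [simp]: "ev (x + y) = ev x + ev y" "ev (x - y) = ev x - ev y" "ev (x * y) = ev x * ev y"
  "ev 0 = 0" "ev 1 = 1" "ev [:c:] = to_ac c" "ev (Polynomial.smult c x) = to_ac c * ev x" "ev (x ^ n) = ev x ^ n"
  "ev H = 0"
  unfolding ev_def using root
  by (simp_all add: to_acp.hom_add to_acp.hom_minus to_acp.hom_mult to_ac.map_poly_hom_smult to_acp.hom_power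
      to_ac.map_poly_pCons_hom)

lemma ev_mod [simp]: "ev (u mod H) = ev u"
proof -
  have "ev (u div H * H + u mod H) = ev (u div H) * ev H + ev (u mod H)" by (simp only: ev_simps)
  moreover have "u div H * H + u mod H = u" by (rule div_mult_mod_eq)
  ultimately show ?thesis by simp
qed

lemma ev_sum: "ev (sum f I) = (\<Sum>i\<in>I. ev (f i))"
  by (induction I rule: infinite_finite_induct) auto

lemma H_nonzero: "H \<noteq> 0"
  using h by simp

lemma d_pos: "d > 0"
proof (rule ccontr)
  assume "\<not> d > 0"
  then obtain c where "H = [:c:]" unfolding d_def by (metis degree_eq_zeroE gr0I)
  then show False using H_nonzero ev_simps(9) ev_simps(6)[of c] by simp
qed

lemma polynomial_relation:
  obtains c where "\<exists>i\<le>d. c i \<noteq> 0" "(\<Sum>i\<le>d. to_ac (c i) * ev u ^ i) = 0"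
proof -
  interpret vector_space "Polynomial.smult :: 'k \<Rightarrow> 'k poly \<Rightarrow> 'k poly"
    by unfold_locales (simp_all add: smult_add_right smult_add_left)
  define B where "B = (\<lambda>i. Polynomial.monom (1 :: 'k) i) ` {..<d}"
  have "inj_on (\<lambda>i. Polynomial.monom (1 :: 'k) i) {..<d}"
    by (rule inj_onI) (metis degree_monom_eq one_neq_zero)
  then have B: "finite B" "card B = d" unfolding B_def by (simp_all add: card_image)
  have "x \<in> span B" if "Polynomial.degree x < d" for x
  proof -
    have "x = (\<Sum>i\<le>Polynomial.degree x. Polynomial.smult (Polynomial.coeff x i) (Polynomial.monom 1 i))"
      using poly_as_sum_of_monoms[of x] by (simp add: smult_monom)
    also have "\<dots> \<in> span B" using that unfolding B_def
      by (intro span_sum span_scale span_base) auto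
    finally show ?thesis .
  qed
  then have "u ^ i mod H \<in> span B" for i
    using degree_mod_less'[of H "u ^ i"] H_nonzero d_pos unfolding d_def by (cases "u ^ i mod H = 0") auto
  then obtain c where c: "\<exists>i\<le>d. c i \<noteq> 0" "(\<Sum>i\<le>d. Polynomial.smult (c i) (u ^ i mod H)) = 0"
    using family_relation[of B "\<lambda>i. u ^ i mod H"] B by auto
  have "ev (\<Sum>i\<le>d. Polynomial.smult (c i) (u ^ i mod H)) = (\<Sum>i\<le>d. to_ac (c i) * ev u ^ i)"
    by (simp add: ev_sum)
  then show ?thesis using that c by simp
qed

lemma range_ev_inverse: assumes "ev u \<noteq> 0" shows "\<exists>u'. inverse (ev u) = ev u'"
proof -
  obtain c where c: "\<exists>i\<le>d. c i \<noteq> 0" "(\<Sum>i\<le>d. to_ac (c i) * ev u ^ i) = 0" by (rule polynomial_relation)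
  define Q where "Q = (\<lambda>P. P \<noteq> 0 \<and> poly (map_poly to_ac P) (ev u) = 0)"
  have "Q (\<Sum>i\<le>d. Polynomial.monom (c i) i)"
  proof -
    have "Polynomial.coeff (\<Sum>i\<le>d. Polynomial.monom (c i) i) k = c k" if "k \<le> d" for k
      using that by (simp add: coeff_sum if_distrib cong: if_cong)
    then have "(\<Sum>i\<le>d. Polynomial.monom (c i) i) \<noteq> 0" using c(1) by fastforce
    then show ?thesis unfolding Q_def using c(2) by (simp add: to_acp.hom_sum poly_sum poly_monom)
  qed
  then obtain P where P: "Q P" "\<And>P'. Q P' \<Longrightarrow> Polynomial.degree P \<le> Polynomial.degree P'"
    using exists_least_iff[of "\<lambda>n. \<exists>P. Q P \<and> Polynomial.degree P = n"] by (metis not_less)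
  obtain k P' where PP: "P = pCons k P'" by (cases P)
  have eq: "to_ac k + ev u * poly (map_poly to_ac P') (ev u) = 0"
    using P(1) unfolding Q_def PP by (simp add: to_ac.map_poly_pCons_hom)
  have k: "k \<noteq> 0"
  proof
    assume "k = 0"
    then have "Q P'" using P(1) eq assms unfolding Q_def PP by auto
    then show False using P(2)[of P'] P(1) \<open>k = 0\<close> unfolding Q_def PP by (simp split: if_splits)
  qed
  have "inverse (ev u) = - (poly (map_poly to_ac P') (ev u) / to_ac k)"
    using eq k assms by (simp add: field_simps eq_neg_iff_add_eq_0)
  also have "\<dots> = ev (Polynomial.smult (- inverse k) (pcompose P' u))"
    unfolding ev_def by (simp add: to_ac.map_poly_hom_smult to_acp.hom_uminus to_ac.map_poly_pcompose poly_pcompose divide_inverse)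
  finally show ?thesis by blast
qed

end

locale dominating_valuation_ring = root_of_modulus p v h \<rho> + valuation_ring V
  for p and v :: "'k::field_char_0 \<Rightarrow> ereal" and h \<rho> and V :: "'k alg_closure set" +
  assumes dominates: "to_ac ` \<O> \<subseteq> V" and p_nonunit: "\<And>t. t \<in> V \<Longrightarrow> of_nat p * t \<noteq> 1"
begin

abbreviation pp :: "int \<Rightarrow> 'k alg_closure" where "pp n \<equiv> of_nat p powi n"

lemma pp_nonzero: "pp n \<noteq> 0"
proof -
  have "to_ac (of_nat p :: 'k) \<noteq> 0" using to_ac.hom_0_iff by simp
  then show ?thesis by (simp add: power_int_not_zero)
qed

lemma p_nonzero: "(of_nat p :: 'k alg_closure) \<noteq> 0"
  using pp_nonzero[of 1] by simp

lemma pp_add: "pp (m + n) = pp m * pp n" and pp_diff: "pp (m - n) = pp m / pp n"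
  using p_nonzero by (simp_all add: power_int_add power_int_diff)

lemma pp_V_iff: "pp n \<in> V \<longleftrightarrow> 0 \<le> n"
proof
  have pV: "of_nat p \<in> V" using dominates O_of_nat[of p] to_ac_of_nat by (metis image_subset_iff)
  show "pp n \<in> V" if "0 \<le> n" using that pV by (auto simp: power_int_def intro: V_rules)
  show "0 \<le> n" if "pp n \<in> V"
  proof (rule ccontr)
    assume "\<not> 0 \<le> n"
    then have "of_nat p * (of_nat p ^ nat (- n - 1) * pp n) = pp (1 + (- n - 1) + n)"
      using p_nonzero by (simp only: pp_add) (simp add: power_int_def)
    then show False using p_nonunit[of "of_nat p ^ nat (- n - 1) * pp n"] pV that by (auto intro: V_rules)
  qed
qed

lemma pp_units: "pp n \<in> units \<Longrightarrow> n = 0"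
  using pp_V_iff[of n] pp_V_iff[of "- n"] unfolding units_def by (auto simp: power_int_minus)

lemma to_ac_value:
  assumes "c \<noteq> 0" obtains n where "v c = ereal (of_int n)" "to_ac c / pp n \<in> units"
proof -
  obtain n :: int where n: "v c = ereal (of_int n)" using v_nonzero assms by blast
  define x where "x = c / of_nat p powi n"
  have "c = x * of_nat p powi n" unfolding x_def by simp
  then have "ereal (of_int n) = v x + ereal (of_int n)" using n v_mult v_power_int by metis
  then have "v x = 0" by (cases "v x") (auto simp: zero_ereal_def)
  then have "x \<in> \<O>" "inverse x \<in> \<O>" "x \<noteq> 0" using O_unit O_unit' v_zero by auto
  then have "to_ac x \<in> V" "to_ac (inverse x) \<in> V" "to_ac x \<noteq> 0" using dominates by auto
  then have "to_ac x \<in> units" unfolding units_def by simp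
  moreover have "to_ac x = to_ac c / pp n" unfolding x_def by (simp add: power_int_def)
  ultimately show ?thesis using that n by simp
qed

definition N :: nat where "N = fact d"

text \<open>
  In a polynomial relation of degree at most \<open>d\<close> over the \<open>p\<close>-adic numbers two terms have the same
  value, so a power of \<open>x\<close> with exponent at most \<open>d\<close> has the value of a \<open>p\<close>-adic number.
\<close>

lemma value_exists:
  assumes x: "ev u \<noteq> 0" shows "\<exists>n. ev u ^ N / pp n \<in> units"
proof -
  obtain c where c: "\<exists>i\<le>d. c i \<noteq> 0" "(\<Sum>i\<le>d. to_ac (c i) * ev u ^ i) = 0" by (rule polynomial_relation)
  define I where "I = {i. i \<le> d \<and> c i \<noteq> 0}"
  have "(\<Sum>i\<in>I. to_ac (c i) * ev u ^ i) = (\<Sum>i\<le>d. to_ac (c i) * ev u ^ i)"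
    unfolding I_def by (intro sum.mono_neutral_left) auto
  then have "(\<Sum>i\<in>I. to_ac (c i) * ev u ^ i) = 0" using c(2) by simp
  then obtain i k where "i \<in> I" "k \<in> I" "i \<noteq> k" "(to_ac (c i) * ev u ^ i) / (to_ac (c k) * ev u ^ k) \<in> units"
    using two_terms_of_equal_value[of I "\<lambda>i. to_ac (c i) * ev u ^ i"] c(1) x unfolding I_def by auto
  then obtain i k where ik: "i \<le> d" "c i \<noteq> 0" "c k \<noteq> 0" "k < i"
    and un: "(to_ac (c i) * ev u ^ i) / (to_ac (c k) * ev u ^ k) \<in> units"
    using units_inverse[of "(to_ac (c i) * ev u ^ i) / (to_ac (c k) * ev u ^ k)"]
    unfolding I_def by (cases "k < i") (auto simp: linorder_neq_iff)
  define e where "e = i - k"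
  have e: "0 < e" "e \<le> d" using ik unfolding e_def by auto
  have "c k / c i \<noteq> 0" using ik by simp
  then obtain n where n: "to_ac (c k / c i) / pp n \<in> units" using to_ac_value by blast
  have "ev u ^ i = ev u ^ e * ev u ^ k" using ik unfolding e_def by (simp flip: power_add)
  then have "(to_ac (c i) * ev u ^ i) / (to_ac (c k) * ev u ^ k) * (to_ac (c k / c i) / pp n) = ev u ^ e / pp n"
    using x ik pp_nonzero[of n] by simp
  then have "ev u ^ e / pp n \<in> units" using units_mult[OF un n] by simp
  then have "(ev u ^ e / pp n) ^ (N div e) \<in> units" by (rule units_power)
  moreover have "e dvd N" using e unfolding N_def by (simp add: dvd_fact)
  ultimately have "ev u ^ N / pp (n * int (N div e)) \<in> units"
    by (simp add: power_divide power_int_mult flip: power_mult)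
  then show ?thesis by blast
qed

definition ord_of :: "'k alg_closure \<Rightarrow> int" where
  "ord_of x = (THE n. x ^ N / pp n \<in> units)"

lemma ord_eqI: assumes "x ^ N / pp n \<in> units" shows "ord_of x = n"
  unfolding ord_of_def
proof (rule the_equality)
  fix m assume m: "x ^ N / pp m \<in> units"
  then have x: "x ^ N \<noteq> 0" unfolding units_def by auto
  have "(x ^ N / pp n) / (x ^ N / pp m) \<in> units" using assms m by (rule units_divide)
  moreover have "(y / pp n) / (y / pp m) = pp (m - n)" if "y \<noteq> 0" for y
    using that pp_nonzero by (simp add: pp_diff)
  ultimately have "pp (m - n) \<in> units" using x by metis
  then show "m = n" using pp_units by force
qed (rule assms)

definition M where "M = range ev - {0}"

lemma ord_unit: assumes "x \<in> M" shows "x ^ N / pp (ord_of x) \<in> units"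
proof -
  obtain u where u: "x = ev u" "ev u \<noteq> 0" using assms unfolding M_def by blast
  obtain n where n: "ev u ^ N / pp n \<in> units" using value_exists[OF u(2)] by blast
  then show ?thesis using ord_eqI[OF n] u(1) by simp
qed

lemma M_mult: assumes "x \<in> M" "y \<in> M" shows "x * y \<in> M"
proof -
  obtain u u' where "x = ev u" "y = ev u'" using assms unfolding M_def by blast
  then have "x * y = ev (u * u')" by simp
  then have "x * y \<in> range ev" by (metis rangeI)
  then show ?thesis using assms unfolding M_def by simp
qed

lemma M_add: assumes "x \<in> M" "y \<in> M" "x + y \<noteq> 0" shows "x + y \<in> M"
proof -
  obtain u u' where "x = ev u" "y = ev u'" using assms unfolding M_def by blast
  then have "x + y = ev (u + u')" by simp
  then have "x + y \<in> range ev" by (metis rangeI)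
  then show ?thesis using assms unfolding M_def by simp
qed

lemma M_inverse: "x \<in> M \<Longrightarrow> inverse x \<in> M"
  using range_ev_inverse unfolding M_def by auto

lemma M_nonzero: "x \<in> M \<Longrightarrow> x \<noteq> 0"
  unfolding M_def by blast

lemma M_to_ac: "c \<noteq> 0 \<Longrightarrow> to_ac c \<in> M"
  unfolding M_def using rangeI[of ev "[:c:]"] by simp

lemma ord_mult: assumes "x \<in> M" "y \<in> M" shows "ord_of (x * y) = ord_of x + ord_of y"
proof (rule ord_eqI)
  have "(x * y) ^ N / pp (ord_of x + ord_of y) = (x ^ N / pp (ord_of x)) * (y ^ N / pp (ord_of y))"
    by (simp add: power_mult_distrib pp_add)
  then show "(x * y) ^ N / pp (ord_of x + ord_of y) \<in> units"
    using units_mult[OF ord_unit[OF assms(1)] ord_unit[OF assms(2)]] by simp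
qed

lemma ord_one: "ord_of 1 = 0"
  by (rule ord_eqI) (simp add: units_one)

lemma ord_inverse: "x \<in> M \<Longrightarrow> ord_of (inverse x) = - ord_of x"
  using ord_mult[of x "inverse x"] M_inverse[of x] M_nonzero[of x] ord_one by simp

lemma ord_nonneg_iff: assumes "x \<in> M" shows "0 \<le> ord_of x \<longleftrightarrow> x \<in> V"
proof -
  have N: "N > 0" unfolding N_def by simp
  have u: "x ^ N / pp (ord_of x) \<in> units" using ord_unit[OF assms] .
  have "x \<in> V" if "0 \<le> ord_of x"
  proof (rule ccontr)
    assume x: "x \<notin> V"
    then have ix: "inverse x \<in> V" using total by blast
    have "x ^ N / pp (ord_of x) * pp (ord_of x) \<in> V"
      using u that pp_V_iff unfolding units_def by (intro V_rules(4)) auto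
    then have "x ^ N \<in> V" using pp_nonzero by simp
    then have "x ^ N * inverse x ^ (N - 1) \<in> V" using ix by (rule V_rules(4)[OF _ V_rules(7)])
    moreover have "x ^ N * inverse x ^ (N - 1) = x"
      using N M_nonzero[OF assms] by (cases N) (simp_all add: power_inverse)
    ultimately show False using x by simp
  qed
  moreover have "0 \<le> ord_of x" if "x \<in> V"
  proof -
    have "x ^ N * inverse (x ^ N / pp (ord_of x)) \<in> V"
      using u that unfolding units_def by (intro V_rules(4) V_rules(7)) auto
    then have "pp (ord_of x) \<in> V" using M_nonzero[OF assms] by simp
    then show ?thesis using pp_V_iff by blast
  qed
  ultimately show ?thesis by blast
qed

lemma ord_add: assumes "x \<in> M" "y \<in> M" "x + y \<noteq> 0" shows "min (ord_of x) (ord_of y) \<le> ord_of (x + y)"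
proof -
  have *: "ord_of y \<le> ord_of (x + y)"
    if x: "x \<in> M" and y: "y \<in> M" and nz: "x + y \<noteq> 0" and xy: "x / y \<in> V" for x y
  proof -
    have y0: "y \<noteq> 0" using M_nonzero y by blast
    have "1 + x / y = (x + y) * inverse y" using y0 by (simp add: field_simps)
    then have "1 + x / y \<in> M" using M_mult[OF M_add[OF x y nz] M_inverse[OF y]] by simp
    moreover have "1 + x / y \<in> V" using xy by (auto intro: V_rules)
    ultimately have "0 \<le> ord_of (1 + x / y)" using ord_nonneg_iff by blast
    moreover have "ord_of (x + y) = ord_of ((1 + x / y) * y)" using y0 by (simp add: field_simps)
    ultimately show ?thesis using ord_mult[OF \<open>1 + x / y \<in> M\<close> y] by simp
  qed
  have "x / y \<in> V \<or> y / x \<in> V" using total[of "x / y"] by simp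
  then show ?thesis using *[of x y] *[of y x] assms by (auto simp: add.commute)
qed

lemma ord_to_ac: assumes "c \<noteq> 0" shows "v c = ereal (of_int m) \<Longrightarrow> ord_of (to_ac c) = int N * m"
proof (rule ord_eqI)
  assume m: "v c = ereal (of_int m)"
  obtain n where n: "v c = ereal (of_int n)" "to_ac c / pp n \<in> units" using to_ac_value assms by blast
  then have "m = n" using m by simp
  then have "(to_ac c / pp m) ^ N \<in> units" using n units_power by blast
  moreover have "pp (int N * m) = pp m ^ N" by (metis mult.commute power_int_mult power_int_of_nat)
  ultimately show "to_ac c ^ N / pp (int N * m) \<in> units" by (simp add: power_divide)
qed

lemma ord_power_int: assumes "x \<in> M" shows "x powi k \<in> M \<and> ord_of (x powi k) = k * ord_of x"
proof -
  have *: "y ^ n \<in> M \<and> ord_of (y ^ n) = int n * ord_of y" if "y \<in> M" for y n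
  proof (induction n)
    case 0
    then show ?case using M_to_ac[of 1] ord_one by simp
  next
    case (Suc n)
    then show ?case using M_mult that ord_mult[of y "y ^ n"] by (simp add: algebra_simps)
  qed
  show ?thesis
    using *[OF assms, of "nat k"] *[OF M_inverse[OF assms], of "nat (- k)"] ord_inverse[OF assms]
    by (auto simp: power_int_def)
qed

lemma value_group:
  obtains g x where "0 < g" "x \<in> M" "ord_of x = g" "\<And>y. y \<in> M \<Longrightarrow> g dvd ord_of y"
proof -
  have "ord_of (to_ac (of_nat p)) = int N * 1"
    by (rule ord_to_ac) (use v_p in \<open>auto simp: one_ereal_def\<close>)
  then have "\<exists>n. 0 < n \<and> (\<exists>x\<in>M. ord_of x = int n)"
    using M_to_ac[of "of_nat p"] by (intro exI[of _ N]) (auto simp: N_def)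
  then obtain n where n: "0 < n" "\<exists>x\<in>M. ord_of x = int n" and least: "\<And>m. m < n \<Longrightarrow> \<not> (0 < m \<and> (\<exists>x\<in>M. ord_of x = int m))"
    using exists_least_iff[of "\<lambda>n. 0 < n \<and> (\<exists>x\<in>M. ord_of x = int n)"] by blast
  then obtain x where x: "x \<in> M" "ord_of x = int n" by blast
  show ?thesis
  proof (rule that[of "int n" x])
    fix y assume y: "y \<in> M"
    define k where "k = - (ord_of y div int n)"
    have "y * x powi k \<in> M" "ord_of (y * x powi k) = ord_of y mod int n"
      using M_mult[OF y] ord_mult[OF y] ord_power_int[OF x(1), of k] x(2)
      unfolding k_def by (auto simp: minus_div_mult_eq_mod[symmetric])
    moreover have "0 \<le> ord_of y mod int n" "ord_of y mod int n < int n" using n(1) by auto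
    ultimately have "ord_of y mod int n = 0"
      using least[of "nat (ord_of y mod int n)"] by (metis int_nat_eq nat_less_iff order_le_less zero_less_nat_eq)
    then show "int n dvd ord_of y" by auto
  qed (use n x in auto)
qed

lemma dominating_place:
  obtains w where "w \<in> places p v h" "\<And>u. u \<in> carrier (quot_alg h) \<Longrightarrow> w u = \<infinity> \<longleftrightarrow> ev u = 0"
    "\<And>u. ev u \<notin> V \<Longrightarrow> w (u mod H) < 0"
proof -
  obtain g x where g: "0 < g" "x \<in> M" "ord_of x = g" and dvd: "\<And>y. y \<in> M \<Longrightarrow> g dvd ord_of y"
    using value_group by blast
  define w where "w = (\<lambda>u. if ev u = 0 then \<infinity> else ereal (of_int (ord_of (ev u) div g)))"
  have evM: "ev u \<in> M" if "ev u \<noteq> 0" for u using that unfolding M_def by simp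
  have w_mod: "w (u mod H) = w u" for u unfolding w_def by simp
  have w_mult: "w (u1 * u2) = w u1 + w u2" for u1 u2
    unfolding w_def using ord_mult[OF evM evM, of u1 u2] dvd[OF evM] by (auto simp: div_plus_div_distrib_dvd_left)
  have w_add: "min (w u1) (w u2) \<le> w (u1 + u2)" for u1 u2
  proof (cases "ev u1 = 0 \<or> ev u2 = 0 \<or> ev u1 + ev u2 = 0")
    case True
    then show ?thesis unfolding w_def by auto
  next
    case False
    then have "min (ord_of (ev u1)) (ord_of (ev u2)) \<le> ord_of (ev u1 + ev u2)"
      using ord_add evM by auto
    then have "min (ord_of (ev u1)) (ord_of (ev u2)) div g \<le> ord_of (ev u1 + ev u2) div g"
      using g(1) zdiv_mono1 by blast
    then have "min (ord_of (ev u1) div g) (ord_of (ev u2) div g) \<le> ord_of (ev u1 + ev u2) div g"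
      by (auto simp: min_def split: if_splits)
    then show ?thesis using False unfolding w_def by (auto simp: min_def split: if_splits)
  qed
  have carr: "carrier (quot_alg h :: 'k poly ring) = {u. u mod H = u}"
    by (simp add: quot_alg_def)
  have "normalized_valuation (quot_alg h) w"
    unfolding normalized_valuation_def
  proof (intro conjI ballI)
    show "w \<zero>\<^bsub>quot_alg h\<^esub> = \<infinity>" by (simp add: quot_alg_def w_def)
    show "w \<one>\<^bsub>quot_alg h\<^esub> = 0" using ord_one by (simp add: quot_alg_def w_def zero_ereal_def)
    fix u1 u2 :: "'k poly"
    show "w (u1 \<otimes>\<^bsub>quot_alg h\<^esub> u2) = w u1 + w u2" using w_mod w_mult by (simp add: quot_alg_def)
    show "min (w u1) (w u2) \<le> w (u1 \<oplus>\<^bsub>quot_alg h\<^esub> u2)" using w_add by (simp add: quot_alg_def)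
  next
    show "w ` carrier (quot_alg h) = insert \<infinity> (range (\<lambda>k::int. ereal (of_int k)))"
    proof
      show "w ` carrier (quot_alg h) \<subseteq> insert \<infinity> (range (\<lambda>k::int. ereal (of_int k)))"
        unfolding w_def by auto
      show "insert \<infinity> (range (\<lambda>k::int. ereal (of_int k))) \<subseteq> w ` carrier (quot_alg h)"
      proof (intro insert_subsetI subsetI)
        show "\<infinity> \<in> w ` carrier (quot_alg h)" unfolding carr
          by (rule image_eqI[of _ _ 0]) (auto simp: w_def)
        fix e assume "e \<in> range (\<lambda>k::int. ereal (of_int k))"
        then obtain k :: int where k: "e = ereal (of_int k)" by blast
        have "x powi k \<in> M" "ord_of (x powi k) = k * g" using ord_power_int[OF g(2)] g(3) by auto
        then obtain u where u: "ev u = x powi k" "ev u \<noteq> 0" unfolding M_def by auto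
        have "w (u mod H) = e" unfolding w_mod unfolding w_def k using u \<open>ord_of (x powi k) = k * g\<close> g(1) by simp
        then show "e \<in> w ` carrier (quot_alg h)" unfolding carr by (intro image_eqI[of _ _ "u mod H"]) auto
      qed
    qed
  qed
  moreover have p: "w (scalar h (of_nat p)) = ereal (of_int (int N div g))" and gN: "g dvd int N"
  proof -
    have o: "ord_of (to_ac (of_nat p)) = int N * 1"
      by (rule ord_to_ac) (use v_p in \<open>auto simp: one_ereal_def\<close>)
    then show "w (scalar h (of_nat p)) = ereal (of_int (int N div g))"
      using p_nonzero unfolding scalar_def w_mod by (simp add: w_def)
    show "g dvd int N" using dvd[OF M_to_ac[of "of_nat p"]] o by simp
  qed
  moreover have pos: "0 < int N div g"
  proof -
    have "0 < int N" unfolding N_def by simp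
    moreover obtain k where k: "int N = g * k" using gN by blast
    ultimately have "0 < k" using g(1) by (simp add: zero_less_mult_iff)
    then show ?thesis using k g(1) by simp
  qed
  moreover have "w (scalar h c) = w (scalar h (of_nat p)) * v c" for c
  proof (cases "c = 0")
    case True
    then show ?thesis using pos v_zero unfolding p by (simp add: scalar_def w_def)
  next
    case False
    then obtain m :: int where m: "v c = ereal (of_int m)" using v_nonzero by blast
    have "ord_of (to_ac c) = int N * m" using ord_to_ac[OF False m] .
    then have "ord_of (to_ac c) div g = (int N div g) * m"
      using gN g(1) by (metis div_mult_swap mult.commute)
    then show ?thesis using False m unfolding p unfolding scalar_def w_mod by (simp add: w_def)
  qed
  moreover have "0 < w (scalar h (of_nat p))" unfolding p using pos by simp
  ultimately have "w \<in> places p v h" unfolding places_def by blast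
  moreover have "w (u mod H) < 0" if "ev u \<notin> V" for u
  proof -
    have u0: "ev u \<noteq> 0" using that V_rules(2) by auto
    then have "ord_of (ev u) < 0" using ord_nonneg_iff[OF evM[OF u0]] that by (metis not_le)
    then have "ord_of (ev u) div g < 0" using g(1) by (simp add: pos_imp_zdiv_neg_iff)
    then show ?thesis unfolding w_mod unfolding w_def using u0 by simp
  qed
  moreover have "w u = \<infinity> \<longleftrightarrow> ev u = 0" for u unfolding w_def by simp
  ultimately show ?thesis using that[of w] by blast
qed

end

lemma (in root_of_modulus) non_integral_place:
  assumes "\<not> integral (ev u)"
  obtains w where "w \<in> places p v h" "w (u mod H) < 0"
    "\<And>u. u \<in> carrier (quot_alg h) \<Longrightarrow> w u = \<infinity> \<longleftrightarrow> ev u = 0"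
proof -
  obtain V where V: "valuation_ring V" "to_ac ` \<O> \<subseteq> V" "\<And>t. t \<in> V \<Longrightarrow> of_nat p * t \<noteq> 1" "ev u \<notin> V"
    using non_integral_valuation_ring[OF assms] by metis
  interpret valuation_ring V by fact
  interpret dominating_valuation_ring p v h \<rho> V
    using V by unfold_locales auto
  show ?thesis using dominating_place that V(4) by metis
qed

section \<open>Norms from the unramified extension\<close>

lemma (in group_hom) card_image_kernel:
  assumes "finite (carrier G)"
  shows "card (h ` carrier G) * card (kernel G H h) = card (carrier G)"
proof -
  have fibre: "card {x \<in> carrier G. h x = y} = card (kernel G H h)" if y: "y \<in> h ` carrier G" for y
  proof -
    from y obtain x where x: "x \<in> carrier G" "y = h x" by (elim imageE) (rule that)
    have "bij_betw (\<lambda>k. x \<otimes> k) (kernel G H h) {x \<in> carrier G. h x = y}"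
    proof (rule bij_betwI[where g = "\<lambda>z. inv x \<otimes> z"])
      show "(\<lambda>k. x \<otimes> k) \<in> kernel G H h \<rightarrow> {x \<in> carrier G. h x = y}"
        using x by (auto simp: kernel_def)
      show "(\<lambda>z. inv x \<otimes> z) \<in> {x \<in> carrier G. h x = y} \<rightarrow> kernel G H h"
        using x by (auto simp: kernel_def)
    qed (use x in \<open>auto simp: kernel_def G.m_assoc[symmetric]\<close>)
    then show ?thesis by (simp add: bij_betw_same_card)
  qed
  have "card (carrier G) = (\<Sum>y\<in>h ` carrier G. card {x \<in> carrier G. h x = y})"
    using sum.image_gen[OF assms, of "\<lambda>_. 1 :: nat" h] by simp
  also have "\<dots> = card (h ` carrier G) * card (kernel G H h)" using fibre by simp
  finally show ?thesis by simp
qed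

text \<open>
  For two endomorphisms \<open>f\<close> and \<open>g\<close> of a finite group, exactness at one place of the periodic complex
  with differentials \<open>f, g, f, g, \<dots>\<close> implies exactness at the other: the Herbrand quotient is 1.
\<close>

lemma herbrand:
  assumes "group G" "finite (carrier G)" "f \<in> hom G G" "g \<in> hom G G"
    and exact: "f ` carrier G = kernel G G g" and complex: "g ` carrier G \<subseteq> kernel G G f"
  shows "g ` carrier G = kernel G G f"
proof -
  interpret f: group_hom G G f using assms by (simp add: group_hom_def group_hom_axioms_def)
  interpret g: group_hom G G g using assms by (simp add: group_hom_def group_hom_axioms_def)
  have fin: "finite (kernel G G f)" using assms(2) by (simp add: kernel_def)
  have pos: "card (kernel G G g) > 0"
    using assms(2) by (auto simp: card_gt_0_iff kernel_def intro!: exI[of _ "\<one>\<^bsub>G\<^esub>"])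
  have "card (kernel G G g) * card (kernel G G f) = card (g ` carrier G) * card (kernel G G g)"
    using f.card_image_kernel[OF assms(2)] g.card_image_kernel[OF assms(2)] exact by simp
  then have "card (g ` carrier G) = card (kernel G G f)" using pos by (simp add: mult.commute)
  then show ?thesis using card_subset_eq[OF fin complex] by blast
qed

text \<open>
  A subring \<open>B\<close> with an automorphism \<open>s\<close> of order \<open>a\<close> is, by the elements listed in \<open>xs\<close>, a Galois
  extension of its fixed ring; \<open>Q\<close> is an invariant ideal, and the object of interest is \<open>B / Q\<close>.
\<close>

locale galois_quotient =
  fixes B Q :: "'r::comm_ring_1 set" and s :: "'r \<Rightarrow> 'r" and a :: nat and xs :: "('r \<times> 'r) list"
  assumes B: "subring_set B" and QB: "Q \<subseteq> B" and Q0: "0 \<in> Q"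
    and Q_add: "\<And>x y. x \<in> Q \<Longrightarrow> y \<in> Q \<Longrightarrow> x + y \<in> Q"
    and Q_mult: "\<And>x y. x \<in> B \<Longrightarrow> y \<in> Q \<Longrightarrow> x * y \<in> Q"
    and s_add: "\<And>x y. s (x + y) = s x + s y" and s_mult: "\<And>x y. s (x * y) = s x * s y" and s_one: "s 1 = 1"
    and s_B: "\<And>x. x \<in> B \<Longrightarrow> s x \<in> B" and s_Q: "\<And>x. x \<in> Q \<Longrightarrow> s x \<in> Q"
    and a_pos: "0 < a" and s_order: "\<And>x. (s ^^ a) x = x"
    and xs_B: "set xs \<subseteq> B \<times> B"
    and xs_galois: "\<And>j. j < a \<Longrightarrow> (\<Sum>(b, c)\<leftarrow>xs. b * (s ^^ j) c) = (if j = 0 then 1 else 0)"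
begin

lemmas B_rules = subring_setD[OF B] s_B

lemma Q_minus: "x \<in> Q \<Longrightarrow> - x \<in> Q"
  using Q_mult[of "- 1" x] B_rules by simp

lemma Q_diff: "x \<in> Q \<Longrightarrow> y \<in> Q \<Longrightarrow> x - y \<in> Q"
  using Q_add[OF _ Q_minus, of x y] by simp

lemma s_zero: "s 0 = 0" using s_add[of 0 0] by simp
lemma s_minus: "s (- x) = - s x" using s_add[of x "- x"] s_zero by (simp add: eq_neg_iff_add_eq_0 add.commute)
lemma s_diff: "s (x - y) = s x - s y" using s_add[of x "- y"] s_minus by simp
lemma s_power: "s (x ^ n) = s x ^ n" by (induction n) (auto simp: s_one s_mult)
lemma s_sum: "s (sum f I) = (\<Sum>i\<in>I. s (f i))"
  by (induction I rule: infinite_finite_induct) (auto simp: s_zero s_add)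
lemma s_prod: "s (prod f I) = (\<Prod>i\<in>I. s (f i))"
  by (induction I rule: infinite_finite_induct) (auto simp: s_one s_mult)
lemma s_pow_mult: "(s ^^ j) (x * y) = (s ^^ j) x * (s ^^ j) y" by (induction j) (auto simp: s_mult)
lemma s_pow_B: "x \<in> B \<Longrightarrow> (s ^^ j) x \<in> B" by (induction j) (auto intro: s_B)

definition eqv (infix "\<approx>" 50) where "x \<approx> y \<longleftrightarrow> x - y \<in> Q"

lemma eqv_refl [simp]: "x \<approx> x" and eqv_sym: "x \<approx> y \<Longrightarrow> y \<approx> x"
  and eqv_trans [trans]: "x \<approx> y \<Longrightarrow> y \<approx> z \<Longrightarrow> x \<approx> z"
  using Q0 Q_minus[of "x - y"] Q_add[of "x - y" "y - z"] by (auto simp: eqv_def)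

lemma eqv_eq_trans [trans]: "x \<approx> y \<Longrightarrow> y = z \<Longrightarrow> x \<approx> z" "x = y \<Longrightarrow> y \<approx> z \<Longrightarrow> x \<approx> z"
  by auto

lemma eqv_add: "x \<approx> x' \<Longrightarrow> y \<approx> y' \<Longrightarrow> x + y \<approx> x' + y'"
  using Q_add[of "x - x'" "y - y'"] by (simp add: eqv_def algebra_simps)

lemma eqv_diff: "x \<approx> x' \<Longrightarrow> y \<approx> y' \<Longrightarrow> x - y \<approx> x' - y'"
  using Q_diff[of "x - x'" "y - y'"] by (simp add: eqv_def algebra_simps)

lemma eqv_mult: assumes "x \<approx> x'" "y \<approx> y'" "x \<in> B" "y' \<in> B" shows "x * y \<approx> x' * y'"
proof -
  have "x * (y - y') + y' * (x - x') \<in> Q" using assms by (intro Q_add Q_mult) (auto simp: eqv_def)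
  then show ?thesis by (simp add: eqv_def algebra_simps)
qed

lemma eqv_mult_left: "x \<in> B \<Longrightarrow> y \<approx> y' \<Longrightarrow> x * y \<approx> x * y'"
  using Q_mult[of x "y - y'"] by (simp add: eqv_def algebra_simps)

lemma eqv_power: assumes "x \<approx> x'" "x \<in> B" "x' \<in> B" shows "x ^ n \<approx> x' ^ n"
proof (induction n)
  case (Suc n)
  have "x * x ^ n \<approx> x' * x' ^ n" using assms Suc by (intro eqv_mult) (auto intro: B_rules)
  then show ?case by simp
qed simp

lemma eqv_s: "x \<approx> y \<Longrightarrow> s x \<approx> s y"
  using s_Q[of "x - y"] by (simp add: eqv_def s_diff)

lemma eqv_prod:
  "finite I \<Longrightarrow> (\<And>i. i \<in> I \<Longrightarrow> f i \<approx> g i) \<Longrightarrow> (\<And>i. i \<in> I \<Longrightarrow> f i \<in> B \<and> g i \<in> B) \<Longrightarrow> prod f I \<approx> prod g I"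
proof (induction I rule: finite_induct)
  case (insert i I)
  have "prod g I \<in> B" using insert by (intro subring_set_prod[OF B]) auto
  then show ?case using insert by (auto intro!: eqv_mult)
qed simp

definition rep where "rep x = (SOME y. y \<in> B \<and> x \<approx> y)"

lemma rep_B: "x \<in> B \<Longrightarrow> rep x \<in> B" and eqv_rep: "x \<in> B \<Longrightarrow> x \<approx> rep x"
proof -
  assume "x \<in> B"
  then have "\<exists>y. y \<in> B \<and> x \<approx> y" by (intro exI[of _ x]) simp
  from someI_ex[OF this] show "rep x \<in> B" "x \<approx> rep x" unfolding rep_def[symmetric] by auto
qed

lemma rep_eq_iff: assumes "x \<in> B" "y \<in> B" shows "rep x = rep y \<longleftrightarrow> x \<approx> y"
proof
  assume "rep x = rep y"
  then show "x \<approx> y" using eqv_rep[OF assms(1)] eqv_rep[OF assms(2)] eqv_sym eqv_trans by metis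
next
  assume "x \<approx> y"
  then have "(\<lambda>z. z \<in> B \<and> x \<approx> z) = (\<lambda>z. z \<in> B \<and> y \<approx> z)" using eqv_sym eqv_trans by blast
  then show "rep x = rep y" unfolding rep_def by simp
qed

definition norm_s where "norm_s x = (\<Prod>j<a. (s ^^ j) x)"

lemma norm_B: "x \<in> B \<Longrightarrow> norm_s x \<in> B"
  unfolding norm_s_def by (intro subring_set_prod[OF B] s_pow_B)

lemma norm_mult: "norm_s (x * y) = norm_s x * norm_s y"
  unfolding norm_s_def by (simp add: s_pow_mult prod.distrib)

lemma norm_shift: "norm_s (s x) = norm_s x" "s (norm_s x) = norm_s x"
proof -
  have "(\<Prod>j<a. (s ^^ Suc j) x) = (\<Prod>j<a. (s ^^ j) x)"
  proof -
    obtain m where m: "a = Suc m" using a_pos by (cases a) auto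
    have "(\<Prod>j<a. (s ^^ Suc j) x) = (\<Prod>j<m. (s ^^ Suc j) x) * (s ^^ a) x" unfolding m by simp
    also have "\<dots> = (\<Prod>j<a. (s ^^ j) x)" unfolding s_order unfolding m
      by (subst prod.lessThan_Suc_shift) (simp add: mult.commute)
    finally show ?thesis .
  qed
  then show "norm_s (s x) = norm_s x" "s (norm_s x) = norm_s x"
    unfolding norm_s_def by (simp_all add: s_prod funpow_swap1)
qed

lemma norm_one: "norm_s 1 = 1"
proof -
  have "(s ^^ j) 1 = 1" for j by (induction j) (auto simp: s_one)
  then show ?thesis by (simp add: norm_s_def)
qed

lemma s_pow_eqv: "x \<approx> y \<Longrightarrow> (s ^^ j) x \<approx> (s ^^ j) y"
  by (induction j) (auto intro: eqv_s)

lemma norm_eqv: "x \<approx> y \<Longrightarrow> x \<in> B \<Longrightarrow> y \<in> B \<Longrightarrow> norm_s x \<approx> norm_s y"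
  unfolding norm_s_def by (intro eqv_prod s_pow_eqv) (auto intro: s_pow_B)

lemma norm_factor: "x \<in> B \<Longrightarrow> \<exists>y\<in>B. norm_s x = x * y"
proof -
  assume x: "x \<in> B"
  obtain m where m: "a = Suc m" using a_pos by (cases a) auto
  have "norm_s x = x * (\<Prod>j<m. (s ^^ Suc j) x)"
    unfolding norm_s_def unfolding m by (subst prod.lessThan_Suc_shift) simp
  moreover have "(\<Prod>j<m. (s ^^ Suc j) x) \<in> B" using x by (intro subring_set_prod[OF B] s_pow_B)
  ultimately show ?thesis by blast
qed

end

locale finite_galois_quotient = galois_quotient B Q s a xs
  for B Q :: "'r::comm_ring_1 set" and s a xs +
  assumes finite_quotient: "\<exists>Y. finite Y \<and> (\<forall>x\<in>B. \<exists>y\<in>Y. x - y \<in> Q)"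
begin

lemma finite_rep: "finite (rep ` B)"
proof -
  obtain Y where Y: "finite Y" "\<forall>x\<in>B. \<exists>y\<in>Y. x - y \<in> Q" using finite_quotient by blast
  have "rep ` B \<subseteq> rep ` (Y \<inter> B)"
  proof
    fix r assume "r \<in> rep ` B"
    then obtain x where x: "x \<in> B" "r = rep x" by blast
    then obtain y where y: "y \<in> Y" "x - y \<in> Q" using Y(2) by blast
    have "y \<in> B" using B_rules(3)[OF x(1), of "x - y"] y QB by auto
    then have "rep x = rep y" using rep_eq_iff[OF x(1)] y by (simp add: eqv_def)
    then show "r \<in> rep ` (Y \<inter> B)" using x y \<open>y \<in> B\<close> by blast
  qed
  then show ?thesis using Y(1) finite_subset by blast
qed

lemma idempotent_power:
  assumes y: "y \<in> B" shows "\<exists>k>0. y ^ k * y ^ k \<approx> y ^ k"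
proof -
  have "\<not> inj (\<lambda>i. rep (y ^ i))"
    using finite_rep y B_rules(7) by (metis (no_types, lifting) finite_imageD finite_subset image_subsetI infinite_UNIV_nat rev_image_eqI)
  then obtain i j where ij: "i < j" "rep (y ^ i) = rep (y ^ j)"
    unfolding inj_on_def by (metis linorder_neqE_nat)
  then have eq: "y ^ i \<approx> y ^ j" using rep_eq_iff y B_rules(7) by blast
  define t where "t = j - i"
  have step: "y ^ (n + i) \<approx> y ^ (n + i + t)" for n
    using eqv_mult_left[OF B_rules(7)[OF y] eq, of n] ij by (simp add: t_def flip: power_add)
  have steps: "y ^ (n + i) \<approx> y ^ (n + i + m * t)" for n m
  proof (induction m)
    case (Suc m)
    note Suc
    also have "y ^ (n + i + m * t) \<approx> y ^ (n + i + m * t + t)"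
      using step[of "n + m * t"] by (simp add: ac_simps)
    finally show ?case by (simp add: ac_simps)
  qed simp
  define k where "k = t * (i + 1)"
  have "t \<ge> 1" using ij by (simp add: t_def)
  then have k: "0 < k" "i \<le> k" unfolding k_def by (simp, metis Suc_eq_plus1 Suc_leD mult_le_mono mult_1 order_refl)
  then have "y ^ k \<approx> y ^ (k + (i + 1) * t)" using steps[of "k - i" "i + 1"] by simp
  then have "y ^ k * y ^ k \<approx> y ^ k" using eqv_sym by (simp add: k_def mult.commute flip: power_add)
  then show ?thesis using k by blast
qed

definition nilp where "nilp z \<longleftrightarrow> (\<exists>n. z ^ n \<in> Q)"

lemma nilp_add: assumes "nilp y" "nilp z" "y \<in> B" "z \<in> B" shows "nilp (y + z)"
proof -
  obtain m n where mn: "y ^ m \<in> Q" "z ^ n \<in> Q" using assms unfolding nilp_def by blast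
  have "(y + z) ^ (m + n) = (\<Sum>k\<le>m + n. of_nat (m + n choose k) * y ^ k * z ^ (m + n - k))"
    by (rule binomial_ring)
  also have "\<dots> \<in> Q"
  proof -
    have ofB: "of_nat k \<in> B" for k by (induction k) (auto intro: B_rules)
    have "of_nat (m + n choose k) * y ^ k * z ^ (m + n - k) \<in> Q" for k
    proof (cases "m \<le> k")
      case True
      then have "y ^ k = y ^ (k - m) * y ^ m" by (simp flip: power_add)
      then have "of_nat (m + n choose k) * y ^ k * z ^ (m + n - k) =
          (of_nat (m + n choose k) * y ^ (k - m) * z ^ (m + n - k)) * y ^ m" by (simp add: algebra_simps)
      also have "\<dots> \<in> Q" using assms mn ofB by (intro Q_mult B_rules) auto
      finally show ?thesis .
    next
      case False
      then have "z ^ (m + n - k) = z ^ (m - k) * z ^ n" by (simp flip: power_add)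
      then have "of_nat (m + n choose k) * y ^ k * z ^ (m + n - k) =
          (of_nat (m + n choose k) * y ^ k * z ^ (m - k)) * z ^ n" by (simp add: algebra_simps)
      also have "\<dots> \<in> Q" using assms mn ofB by (intro Q_mult B_rules) auto
      finally show ?thesis .
    qed
    then have "(\<Sum>k\<in>I. of_nat (m + n choose k) * y ^ k * z ^ (m + n - k)) \<in> Q" for I
      by (induction I rule: infinite_finite_induct) (auto intro: Q0 Q_add)
    then show ?thesis .
  qed
  finally show ?thesis unfolding nilp_def by blast
qed

lemma nilp_mult: "nilp z \<Longrightarrow> b \<in> B \<Longrightarrow> nilp (b * z)"
  unfolding nilp_def by (metis Q_mult B_rules(7) power_mult_distrib)


definition cocycle where "cocycle x j = (\<Prod>i<j. (s ^^ i) x)"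
definition twisted_trace where "twisted_trace x z = (\<Sum>j<a. cocycle x j * (s ^^ j) z)"

lemma cocycle_Suc: "x * s (cocycle x j) = cocycle x (Suc j)"
  unfolding cocycle_def by (subst prod.lessThan_Suc_shift) (simp add: s_prod)

lemma twisted_trace_B: "x \<in> B \<Longrightarrow> z \<in> B \<Longrightarrow> twisted_trace x z \<in> B"
  unfolding twisted_trace_def cocycle_def
  by (intro subring_set_sum[OF B] B_rules(4) subring_set_prod[OF B] s_pow_B)

lemma twisted_trace_fixed:
  assumes "norm_s x \<approx> 1" "z \<in> B" shows "x * s (twisted_trace x z) \<approx> twisted_trace x z"
proof -
  have "x * s (twisted_trace x z) = (\<Sum>j<a. cocycle x (Suc j) * (s ^^ Suc j) z)"
    unfolding twisted_trace_def by (simp add: s_sum s_mult sum_distrib_left cocycle_Suc[symmetric] mult.assoc)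
  also have "\<dots> = (\<Sum>j<Suc a. cocycle x j * (s ^^ j) z) - cocycle x 0 * z"
    by (subst sum.lessThan_Suc_shift) simp
  also have "\<dots> = twisted_trace x z + z * (norm_s x - 1)"
    by (simp add: twisted_trace_def s_order cocycle_def norm_s_def algebra_simps)
  finally show ?thesis using Q_mult assms by (simp add: eqv_def)
qed

lemma twisted_trace_span: "(\<Sum>(b, c)\<leftarrow>xs. b * twisted_trace x c) = 1"
proof -
  have "(\<Sum>(b, c)\<leftarrow>ys. b * twisted_trace x c) = (\<Sum>j<a. cocycle x j * (\<Sum>(b, c)\<leftarrow>ys. b * (s ^^ j) c))" for ys
    unfolding twisted_trace_def
    by (induction ys) (auto simp: sum.distrib sum_distrib_left algebra_simps)
  also have "(\<Sum>j<a. cocycle x j * (\<Sum>(b, c)\<leftarrow>xs. b * (s ^^ j) c)) = (\<Sum>j<a. if j = 0 then cocycle x j else 0)"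
    using xs_galois by (intro sum.cong) auto
  also have "\<dots> = 1" using a_pos by (simp add: cocycle_def)
  finally show ?thesis .
qed

text \<open>
  Among the twisted-invariant elements, take one whose idempotent power \<open>e\<close> is as large as possible.
  If \<open>1 - e\<close> were not zero, some twisted-invariant element would not be nilpotent on the part cut out
  by \<open>1 - e\<close>, because the twisted-invariant elements generate the unit ideal; adding it there
  enlarges the idempotent. So \<open>e = 1\<close> and the element is a unit.
\<close>

lemma hilbert_90:
  assumes x: "x \<in> B" and norm: "norm_s x \<approx> 1"
  obtains y t where "y \<in> B" "t \<in> B" "y * t \<approx> 1" "x * s y \<approx> y"
proof -
  define P where "P = (\<lambda>e y k. y \<in> B \<and> x * s y \<approx> y \<and> (k::nat) > 0 \<and> e \<in> B \<and> y ^ k \<approx> e \<and> e * e \<approx> e)"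
  define size where "size = (\<lambda>e. card {r \<in> rep ` B. e * r \<approx> r})"
  define A where "A = (\<lambda>m. \<exists>e y k. P e y k \<and> size e = m)"
  have "P 0 0 1" unfolding P_def using B_rules by (simp add: s_zero)
  then have A0: "A (size 0)" unfolding A_def by blast
  have "size e \<le> card (rep ` B)" for e
    unfolding size_def using finite_rep by (intro card_mono) auto
  then have "\<forall>m. A m \<longrightarrow> m \<le> card (rep ` B)" unfolding A_def by blast
  from Nat.ex_has_greatest_nat[OF A0 this] obtain n where n: "A n" and maximal: "\<forall>m. A m \<longrightarrow> m \<le> n" by blast
  have max: "m \<le> n" if "\<exists>e y k. P e y k \<and> size e = m" for m using maximal that unfolding A_def by blast
  from n have "\<exists>e y k. P e y k \<and> size e = n" unfolding A_def .
  then obtain e y k where y: "y \<in> B" "x * s y \<approx> y" "k > 0" and e: "e \<in> B" "y ^ k \<approx> e" "e * e \<approx> e"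
    and size: "size e = n" unfolding P_def by blast
  obtain x' where x': "x' \<in> B" "norm_s x = x * x'" using norm_factor[OF x] by blast
  then have xx': "x' * x \<approx> 1" using norm by (simp add: mult.commute)
  note cl = B_rules x x' y(1) e(1)
  have se: "s e \<approx> e"
  proof -
    have "x ^ k * s e \<approx> x ^ k * s (y ^ k)"
      using e(2) by (intro eqv_mult_left eqv_s eqv_sym[OF e(2)] cl)
    also have "x ^ k * s (y ^ k) = (x * s y) ^ k" by (simp add: s_power power_mult_distrib)
    also have "\<dots> \<approx> y ^ k" using y by (intro eqv_power cl)
    also have "\<dots> \<approx> e" by (rule e(2))
    finally have 1: "x ^ k * s e \<approx> e" .
    have inv: "x' ^ k * x ^ k \<approx> 1"
      using eqv_power[OF xx', of k] by (auto simp: power_mult_distrib intro: cl)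
    have 2: "s e \<approx> x' ^ k * e"
    proof -
      have "s e = 1 * s e" by simp
      also have "1 * s e \<approx> (x' ^ k * x ^ k) * s e" by (intro eqv_mult eqv_sym[OF inv] eqv_refl cl)
      also have "(x' ^ k * x ^ k) * s e = x' ^ k * (x ^ k * s e)" by (simp add: mult.assoc)
      also have "\<dots> \<approx> x' ^ k * e" by (intro eqv_mult_left 1 cl)
      finally show ?thesis .
    qed
    have "e \<approx> x ^ k * (s e * s e)"
    proof -
      have "s e * s e \<approx> s e" using eqv_s[OF e(3)] by (simp add: s_mult)
      then have "x ^ k * (s e * s e) \<approx> x ^ k * s e" by (intro eqv_mult_left cl)
      then show ?thesis using 1 eqv_sym eqv_trans by blast
    qed
    also have "x ^ k * (s e * s e) = (x ^ k * s e) * s e" by (simp add: mult.assoc)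
    also have "\<dots> \<approx> e * s e" by (intro eqv_mult 1 eqv_refl cl)
    finally have 3: "e \<approx> e * s e" .
    have "s e \<approx> x' ^ k * e" by (rule 2)
    also have "\<dots> \<approx> x' ^ k * (e * e)" by (intro eqv_mult_left eqv_sym[OF e(3)] cl)
    also have "x' ^ k * (e * e) = e * (x' ^ k * e)" by (simp add: algebra_simps)
    also have "\<dots> \<approx> e * s e" by (intro eqv_mult_left eqv_sym[OF 2] cl)
    also have "\<dots> \<approx> e" by (rule eqv_sym[OF 3])
    finally show ?thesis .
  qed
  define f where "f = 1 - e"
  have f: "f \<in> B" "f * f \<approx> f" "e * f \<approx> 0" "s f \<approx> f"
  proof -
    show fB: "f \<in> B" unfolding f_def by (intro cl)
    have "f * f = 1 - e - e + e * e" unfolding f_def by (simp add: algebra_simps)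
    also have "\<dots> \<approx> 1 - e - e + e" by (intro eqv_add eqv_refl e(3))
    finally show "f * f \<approx> f" by (simp add: f_def)
    have "e * f = e - e * e" unfolding f_def by (simp add: algebra_simps)
    also have "\<dots> \<approx> e - e" by (intro eqv_diff eqv_refl e(3))
    finally show "e * f \<approx> 0" by simp
    show "s f \<approx> f" unfolding f_def s_diff s_one by (intro eqv_diff eqv_refl se)
  qed
  have "f \<in> Q"
  proof (rule ccontr)
    assume fQ: "f \<notin> Q"
    have "\<exists>c\<in>B. \<not> nilp (f * twisted_trace x c)"
    proof (rule ccontr)
      assume "\<not> ?thesis"
      then have nil: "nilp (f * twisted_trace x c)" if "c \<in> B" for c using that by blast
      have "(\<Sum>(b, c)\<leftarrow>ys. b * (f * twisted_trace x c)) \<in> B \<and> nilp (\<Sum>(b, c)\<leftarrow>ys. b * (f * twisted_trace x c))"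
        if "set ys \<subseteq> B \<times> B" for ys
        using that
      proof (induction ys)
        case Nil
        then show ?case using Q0 by (auto simp: nilp_def intro: cl exI[of _ 1])
      next
        case (Cons z ys)
        then obtain b c where z: "z = (b, c)" "b \<in> B" "c \<in> B" by auto
        have zB: "b * (f * twisted_trace x c) \<in> B" using z f twisted_trace_B[OF x z(3)] by (intro cl) auto
        have "nilp (b * (f * twisted_trace x c))" by (rule nilp_mult[OF nil[OF z(3)] z(2)])
        then show ?case using Cons z zB by (auto intro: nilp_add cl)
      qed
      from this[OF xs_B] have "nilp (\<Sum>(b, c)\<leftarrow>xs. b * (f * twisted_trace x c))" by blast
      moreover have "(\<Sum>(b, c)\<leftarrow>ys. b * (f * twisted_trace x c)) = f * (\<Sum>(b, c)\<leftarrow>ys. b * twisted_trace x c)" for ys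
        by (induction ys) (auto simp: algebra_simps)
      ultimately obtain m where m: "f ^ m \<in> Q" by (auto simp: nilp_def twisted_trace_span)
      have "f ^ m * f \<approx> f" for m
      proof (induction m)
        case (Suc m)
        have "f ^ Suc m * f = f * (f ^ m * f)" by (simp add: mult.assoc)
        also have "\<dots> \<approx> f * f" using Suc f by (intro eqv_mult_left)
        also have "\<dots> \<approx> f" by (rule f)
        finally show ?case .
      qed simp
      from eqv_sym[OF this[of m]] have "f - f ^ m * f \<in> Q" by (simp add: eqv_def)
      moreover have "f ^ m * f \<in> Q" using Q_mult[OF f(1) m] by (simp add: mult.commute)
      ultimately have "(f - f ^ m * f) + f ^ m * f \<in> Q" by (rule Q_add)
      then show False using fQ by simp
    qed
    then obtain c where c: "c \<in> B" "\<not> nilp (f * twisted_trace x c)" by blast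
    define y' where "y' = twisted_trace x c"
    have y': "y' \<in> B" "x * s y' \<approx> y'" "\<not> nilp (f * y')"
      using twisted_trace_B[OF x c(1)] twisted_trace_fixed[OF norm c(1)] c(2) unfolding y'_def by auto
    obtain k' where k': "k' > 0" "y' ^ k' * y' ^ k' \<approx> y' ^ k'" using idempotent_power[OF y'(1)] by blast
    define e' where "e' = y' ^ k'"
    define z where "z = e * y + f * y'"
    define e'' where "e'' = e + f * e'"
    note cl = cl f(1) y'(1)
    have e'B: "e' \<in> B" and zB: "z \<in> B" and e''B: "e'' \<in> B" unfolding e'_def z_def e''_def by (intro cl)+
    have e'e': "e' * e' \<approx> e'" using k' by (simp add: e'_def)
    have zM: "x * s z \<approx> z"
    proof -
      have "x * s z = s e * (x * s y) + s f * (x * s y')"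
        unfolding z_def by (simp add: s_add s_mult algebra_simps)
      also have "\<dots> \<approx> z" unfolding z_def using y y' se f by (intro eqv_add eqv_mult cl) auto
      finally show ?thesis .
    qed
    have idem_pow: "g ^ m \<approx> g" if "g \<in> B" "g * g \<approx> g" "m > 0" for g m
      using that(3)
    proof (induction m rule: nat_induct_non_zero)
      case (Suc m)
      have "g * g ^ m \<approx> g * g" using Suc that by (intro eqv_mult_left)
      also have "\<dots> \<approx> g" by (rule that)
      finally show ?case by simp
    qed simp
    have split: "z ^ m \<approx> e * y ^ m + f * y' ^ m" for m
    proof (induction m)
      case 0
      then show ?case by (simp add: f_def)
    next
      case (Suc m)
      have "z ^ Suc m = z * z ^ m" by simp
      also have "\<dots> \<approx> z * (e * y ^ m + f * y' ^ m)" by (intro eqv_mult_left Suc zB)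
      also have "z * (e * y ^ m + f * y' ^ m) =
          (e * e) * y ^ Suc m + (e * f) * (y * y' ^ m + y' * y ^ m) + (f * f) * y' ^ Suc m"
        unfolding z_def by (simp add: algebra_simps)
      also have "\<dots> \<approx> e * y ^ Suc m + 0 * (y * y' ^ m + y' * y ^ m) + f * y' ^ Suc m"
        using e f by (intro eqv_add eqv_mult eqv_refl cl)
      finally show ?case by simp
    qed
    define K where "K = k * k'"
    have yK: "y ^ K \<approx> e"
    proof -
      have "(y ^ k) ^ k' \<approx> e ^ k'" using e(2) by (intro eqv_power cl)
      also have "\<dots> \<approx> e" using idem_pow e k' by blast
      finally show ?thesis by (simp add: K_def power_mult)
    qed
    have y'K: "y' ^ K \<approx> e'"
      using idem_pow[OF e'B e'e' y(3)] by (simp add: K_def e'_def mult.commute flip: power_mult)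
    have zK: "z ^ K \<approx> e''"
    proof -
      note split
      also have "e * y ^ K + f * y' ^ K \<approx> e * e + f * e'"
        using yK y'K by (intro eqv_add eqv_mult_left cl)
      also have "\<dots> \<approx> e''" unfolding e''_def by (intro eqv_add e eqv_refl)
      finally show ?thesis .
    qed
    have e''e'': "e'' * e'' \<approx> e''"
    proof -
      have "e'' * e'' = e * e + (e * f) * (e' + e') + (f * f) * (e' * e')"
        unfolding e''_def by (simp add: algebra_simps)
      also have "\<dots> \<approx> e + 0 * (e' + e') + f * e'"
        using e f e'e' by (intro eqv_add eqv_mult eqv_refl cl e'B)
      finally show ?thesis by (simp add: e''_def)
    qed
    have "P e'' z K" unfolding P_def using zB zM y(3) k'(1) e''B zK e''e'' by (simp add: K_def)
    then have "size e'' \<le> n" using max by blast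
    moreover have "size e < size e''"
    proof -
      have ee'': "e * e'' \<approx> e" "e'' * e \<approx> e"
      proof -
        have "e * e'' = e * e + (e * f) * e'" unfolding e''_def by (simp add: algebra_simps)
        also have "\<dots> \<approx> e + 0 * e'" using e f by (intro eqv_add eqv_mult eqv_refl cl e'B)
        finally show "e * e'' \<approx> e" by simp
        then show "e'' * e \<approx> e" by (simp add: mult.commute)
      qed
      have sub: "e'' * r \<approx> r" if r: "r \<in> B" "e * r \<approx> r" for r
      proof -
        have "e'' * r \<approx> e'' * (e * r)" by (intro eqv_mult_left eqv_sym[OF r(2)] e''B)
        also have "\<dots> = (e'' * e) * r" by (simp add: mult.assoc)
        also have "\<dots> \<approx> e * r" using ee'' r by (intro eqv_mult eqv_refl cl e''B)
        also have "\<dots> \<approx> r" by (rule r)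
        finally show ?thesis .
      qed
      have in'': "e'' * rep e'' \<approx> rep e''"
      proof -
        have "e'' * rep e'' \<approx> e'' * e''" using eqv_sym[OF eqv_rep[OF e''B]] e''B by (intro eqv_mult_left)
        also have "\<dots> \<approx> e''" by (rule e''e'')
        also have "\<dots> \<approx> rep e''" by (rule eqv_rep[OF e''B])
        finally show ?thesis .
      qed
      have notin: "\<not> e * rep e'' \<approx> rep e''"
      proof
        assume *: "e * rep e'' \<approx> rep e''"
        have "e'' \<approx> rep e''" by (rule eqv_rep[OF e''B])
        also have "\<dots> \<approx> e * rep e''" by (rule eqv_sym[OF *])
        also have "\<dots> \<approx> e * e''" using eqv_sym[OF eqv_rep[OF e''B]] by (intro eqv_mult_left cl)
        also have "\<dots> \<approx> e" by (rule ee'')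
        finally have "e'' - e \<in> Q" by (simp add: eqv_def)
        then have fe': "f * e' \<in> Q" by (simp add: e''_def)
        have "(f * y') ^ k' \<approx> f * e'" unfolding power_mult_distrib e'_def
          using idem_pow[OF f(1,2) k'(1)] by (intro eqv_mult eqv_refl cl)
        then have "(f * y') ^ k' - f * e' \<in> Q" by (simp add: eqv_def)
        from Q_add[OF this fe'] show False using y'(3) by (auto simp: nilp_def)
      qed
      have "{r \<in> rep ` B. e * r \<approx> r} \<subset> {r \<in> rep ` B. e'' * r \<approx> r}"
        using sub in'' notin rep_B e''B by blast
      then show ?thesis unfolding size_def using finite_rep by (intro psubset_card_mono) auto
    qed
    ultimately show False using size by simp
  qed
  then have "e \<approx> 1" using Q_minus[of f] by (simp add: eqv_def f_def)
  then have "y ^ k \<approx> 1" using e(2) eqv_trans by blast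
  moreover have "y ^ k = y * y ^ (k - 1)" using y(3) by (cases k) auto
  ultimately show ?thesis using that[of y "y ^ (k - 1)"] y cl(7)[of y "k - 1"] by simp
qed

definition unit_group :: "'r monoid" where
  "unit_group = \<lparr>carrier = {r \<in> rep ` B. \<exists>t\<in>B. r * t \<approx> 1}, monoid.mult = (\<lambda>x y. rep (x * y)), one = rep 1\<rparr>"

lemma rep_rep: "x \<in> B \<Longrightarrow> rep (rep x) = rep x"
  using rep_eq_iff[OF rep_B] eqv_sym[OF eqv_rep] by blast

lemma unit_groupI: assumes "x \<in> B" "t \<in> B" "x * t \<approx> 1" shows "rep x \<in> carrier unit_group"
proof -
  have "rep x * t \<approx> x * t" using assms eqv_sym[OF eqv_rep[OF assms(1)]] rep_B by (intro eqv_mult) auto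
  then have "rep x * t \<approx> 1" using assms(3) eqv_trans by blast
  then show ?thesis using assms unfolding unit_group_def by auto
qed

lemma unit_groupD: "x \<in> carrier unit_group \<Longrightarrow> x \<in> B \<and> rep x = x \<and> (\<exists>t\<in>B. x * t \<approx> 1)"
  unfolding unit_group_def using rep_B rep_rep by auto

lemma rep_mult: assumes "x \<in> B" "y \<in> B" shows "rep (rep x * y) = rep (x * y)" "rep (x * rep y) = rep (x * y)"
proof -
  have "rep x * y \<approx> x * y" using assms eqv_sym[OF eqv_rep] rep_B by (intro eqv_mult) auto
  then show "rep (rep x * y) = rep (x * y)" using assms rep_B by (intro iffD2[OF rep_eq_iff]) (auto intro: B_rules)
  have "x * rep y \<approx> x * y" using assms eqv_sym[OF eqv_rep] by (intro eqv_mult_left) auto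
  then show "rep (x * rep y) = rep (x * y)" using assms rep_B by (intro iffD2[OF rep_eq_iff]) (auto intro: B_rules)
qed

lemma comm_group_unit_group: "comm_group unit_group"
proof (rule comm_groupI)
  have mult: "x \<otimes>\<^bsub>unit_group\<^esub> y = rep (x * y)" for x y by (simp add: unit_group_def)
  have one: "\<one>\<^bsub>unit_group\<^esub> = rep 1" by (simp add: unit_group_def)
  have one_B: "1 \<in> B" by (rule B_rules)
  show "\<one>\<^bsub>unit_group\<^esub> \<in> carrier unit_group" unfolding one
    by (rule unit_groupI[of 1 1]) (auto intro: B_rules)
  fix x y assume x: "x \<in> carrier unit_group" and y: "y \<in> carrier unit_group"
  obtain t where t: "t \<in> B" "x * t \<approx> 1" and xB: "x \<in> B" "rep x = x" using unit_groupD[OF x] by blast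
  obtain t' where t': "t' \<in> B" "y * t' \<approx> 1" and yB: "y \<in> B" "rep y = y" using unit_groupD[OF y] by blast
  show "x \<otimes>\<^bsub>unit_group\<^esub> y \<in> carrier unit_group" unfolding mult
  proof (rule unit_groupI[of _ "t * t'"])
    have "(x * t) * (y * t') \<approx> 1 * 1" using t t' xB yB one_B by (intro eqv_mult) (auto intro: B_rules)
    then show "x * y * (t * t') \<approx> 1" by (simp add: ac_simps)
  qed (use t t' xB yB in \<open>auto intro: B_rules\<close>)
  show "x \<otimes>\<^bsub>unit_group\<^esub> y = y \<otimes>\<^bsub>unit_group\<^esub> x" unfolding mult by (simp add: mult.commute)
  show "\<one>\<^bsub>unit_group\<^esub> \<otimes>\<^bsub>unit_group\<^esub> x = x" unfolding mult one using rep_mult(1)[OF one_B xB(1)] xB by simp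
  show "\<exists>y\<in>carrier unit_group. y \<otimes>\<^bsub>unit_group\<^esub> x = \<one>\<^bsub>unit_group\<^esub>"
  proof (rule bexI[of _ "rep t"])
    have "rep (t * x) = rep 1" using t xB one_B by (intro iffD2[OF rep_eq_iff]) (auto simp: mult.commute intro: B_rules)
    then show "rep t \<otimes>\<^bsub>unit_group\<^esub> x = \<one>\<^bsub>unit_group\<^esub>" unfolding mult one rep_mult(1)[OF t(1) xB(1)] .
    show "rep t \<in> carrier unit_group" by (rule unit_groupI[of t x]) (use t xB in \<open>auto simp: mult.commute\<close>)
  qed
  fix z assume z: "z \<in> carrier unit_group"
  then have zB: "z \<in> B" using unit_groupD by blast
  show "x \<otimes>\<^bsub>unit_group\<^esub> y \<otimes>\<^bsub>unit_group\<^esub> z = x \<otimes>\<^bsub>unit_group\<^esub> (y \<otimes>\<^bsub>unit_group\<^esub> z)" unfolding mult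
    using rep_mult(1)[OF B_rules(4)[OF xB(1) yB(1)] zB] rep_mult(2)[OF xB(1) B_rules(4)[OF yB(1) zB]]
    by (simp add: mult.assoc)
qed

text \<open>Hilbert 90 determines the kernel of the norm; counting then determines its image.\<close>

lemma norm_surjective:
  assumes u: "u \<in> B" "t \<in> B" "u * t \<approx> 1" and fixed: "s u \<approx> u"
  shows "\<exists>\<beta>\<in>B. norm_s \<beta> \<approx> u"
proof -
  let ?G = unit_group
  interpret G: comm_group ?G by (rule comm_group_unit_group)
  have mult: "x \<otimes>\<^bsub>?G\<^esub> y = rep (x * y)" and one: "\<one>\<^bsub>?G\<^esub> = rep 1" for x y
    by (simp_all add: unit_group_def)
  have fin: "finite (carrier ?G)" unfolding unit_group_def using finite_rep by simp
  have one_B: "1 \<in> B" by (rule B_rules)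
  define g where "g = (\<lambda>y. rep (norm_s y))"
  define S where "S = (\<lambda>y. rep (s y))"
  have S_in: "S y \<in> carrier ?G" if y: "y \<in> carrier ?G" for y
  proof -
    obtain t where "t \<in> B" "y * t \<approx> 1" "y \<in> B" using unit_groupD[OF y] by blast
    then have "s y * s t \<approx> 1" using eqv_s[of "y * t" 1] by (simp add: s_mult s_one)
    then show ?thesis unfolding S_def using \<open>y \<in> B\<close> \<open>t \<in> B\<close> by (intro unit_groupI[of "s y" "s t"] s_B)
  qed
  have g_in: "g y \<in> carrier ?G" if y: "y \<in> carrier ?G" for y
  proof -
    obtain t where t: "t \<in> B" "y * t \<approx> 1" "y \<in> B" using unit_groupD[OF y] by blast
    have "norm_s (y * t) \<approx> norm_s 1" using t one_B by (intro norm_eqv) (auto intro: B_rules)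
    then show ?thesis unfolding g_def using t by (intro unit_groupI[of _ "norm_s t"] norm_B) (auto simp: norm_mult norm_one)
  qed
  have S_hom: "S \<in> hom ?G ?G"
  proof (rule homI)
    fix x y assume "x \<in> carrier ?G" "y \<in> carrier ?G"
    then have xy: "x \<in> B" "y \<in> B" using unit_groupD by auto
    have "s (rep (x * y)) \<approx> s (x * y)" using xy by (intro eqv_s eqv_sym[OF eqv_rep] B_rules)
    then have "S (x \<otimes>\<^bsub>?G\<^esub> y) = rep (s x * s y)" unfolding S_def mult s_mult using xy
      by (intro iffD2[OF rep_eq_iff] B_rules rep_B)
    also have "\<dots> = rep (rep (s x) * rep (s y))" using xy rep_B by (simp add: rep_mult B_rules)
    finally show "S (x \<otimes>\<^bsub>?G\<^esub> y) = S x \<otimes>\<^bsub>?G\<^esub> S y" by (simp add: S_def mult)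
  qed (rule S_in)
  have g_hom: "g \<in> hom ?G ?G"
  proof (rule homI)
    fix x y assume "x \<in> carrier ?G" "y \<in> carrier ?G"
    then have xy: "x \<in> B" "y \<in> B" using unit_groupD by auto
    have "norm_s (rep (x * y)) \<approx> norm_s (x * y)" using xy by (intro norm_eqv eqv_sym[OF eqv_rep] B_rules rep_B)
    then have "g (x \<otimes>\<^bsub>?G\<^esub> y) = rep (norm_s x * norm_s y)" unfolding g_def mult norm_mult using xy
      by (intro iffD2[OF rep_eq_iff] B_rules norm_B rep_B)
    also have "\<dots> = rep (rep (norm_s x) * rep (norm_s y))" using xy rep_B norm_B by (simp add: rep_mult)
    finally show "g (x \<otimes>\<^bsub>?G\<^esub> y) = g x \<otimes>\<^bsub>?G\<^esub> g y" by (simp add: g_def mult)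
  qed (rule g_in)
  define f where "f = (\<lambda>y. y \<otimes>\<^bsub>?G\<^esub> inv\<^bsub>?G\<^esub> (S y))"
  interpret gS: group_hom ?G ?G S using S_hom by unfold_locales
  interpret gg: group_hom ?G ?G g using g_hom by unfold_locales
  have f_hom: "f \<in> hom ?G ?G"
  proof (rule homI)
    fix x y assume xy: "x \<in> carrier ?G" "y \<in> carrier ?G"
    then have "f (x \<otimes>\<^bsub>?G\<^esub> y) = (x \<otimes>\<^bsub>?G\<^esub> y) \<otimes>\<^bsub>?G\<^esub> (inv\<^bsub>?G\<^esub> (S x) \<otimes>\<^bsub>?G\<^esub> inv\<^bsub>?G\<^esub> (S y))"
      unfolding f_def by (simp add: G.inv_mult)
    then show "f (x \<otimes>\<^bsub>?G\<^esub> y) = f x \<otimes>\<^bsub>?G\<^esub> f y" unfolding f_def using xy by (simp add: G.m_ac)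
  qed (simp add: f_def)
  have gS: "g (S y) = g y" if "y \<in> carrier ?G" for y
  proof -
    have yB: "y \<in> B" using unit_groupD that by blast
    have "norm_s (rep (s y)) \<approx> norm_s (s y)" using yB by (intro norm_eqv eqv_sym[OF eqv_rep] rep_B s_B)
    then show ?thesis unfolding g_def S_def norm_shift using yB
      by (intro iffD2[OF rep_eq_iff] norm_B rep_B s_B)
  qed
  have kernel_f: "y \<in> kernel ?G ?G f \<longleftrightarrow> y \<in> carrier ?G \<and> s y \<approx> y" for y
  proof -
    have "f y = \<one>\<^bsub>?G\<^esub> \<longleftrightarrow> S y = y" if "y \<in> carrier ?G"
      unfolding f_def using that G.inv_equality[of y "inv\<^bsub>?G\<^esub> S y"]
      by (metis G.inv_closed G.inv_inv G.r_inv S_in)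
    moreover have "S y = y \<longleftrightarrow> s y \<approx> y" if "y \<in> carrier ?G"
      unfolding S_def using unit_groupD[OF that] rep_eq_iff[of "s y" y] s_B by auto
    ultimately show ?thesis unfolding kernel_def by auto
  qed
  have "g ` carrier ?G = kernel ?G ?G f"
  proof (rule herbrand[OF G.is_group fin f_hom g_hom])
    show "f ` carrier ?G = kernel ?G ?G g"
    proof
      show "f ` carrier ?G \<subseteq> kernel ?G ?G g"
        unfolding kernel_def f_def by (auto simp: gS)
      show "kernel ?G ?G g \<subseteq> f ` carrier ?G"
      proof
        fix x assume "x \<in> kernel ?G ?G g"
        then have x: "x \<in> carrier ?G" "rep (norm_s x) = rep 1" unfolding kernel_def g_def one by auto
        then have xB: "x \<in> B" using unit_groupD by blast
        have "norm_s x \<approx> 1" using x(2) rep_eq_iff[OF norm_B[OF xB] one_B] by blast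
        then obtain y t where y: "y \<in> B" "t \<in> B" "y * t \<approx> 1" "x * s y \<approx> y" using hilbert_90[OF xB] by blast
        have ry: "rep y \<in> carrier ?G" using unit_groupI y by blast
        have "x \<otimes>\<^bsub>?G\<^esub> S (rep y) = rep y"
        proof -
          have "x * rep (s (rep y)) \<approx> x * s (rep y)"
            using xB y by (intro eqv_mult_left eqv_sym[OF eqv_rep] rep_B s_B)
          also have "\<dots> \<approx> x * s y" using xB y by (intro eqv_mult_left eqv_s eqv_sym[OF eqv_rep])
          also have "\<dots> \<approx> y" by (rule y)
          finally show ?thesis unfolding mult S_def using xB y
            by (intro iffD2[OF rep_eq_iff] B_rules rep_B)
        qed
        then have "f (rep y) = x" unfolding f_def using x(1) ry S_in
          by (metis G.inv_closed G.m_assoc G.r_inv G.r_one)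
        then show "x \<in> f ` carrier ?G" using ry by blast
      qed
    qed
    show "g ` carrier ?G \<subseteq> kernel ?G ?G f"
    proof (rule image_subsetI)
      fix y assume y: "y \<in> carrier ?G"
      then have yB: "y \<in> B" using unit_groupD by blast
      have "s (rep (norm_s y)) \<approx> s (norm_s y)" using yB by (intro eqv_s eqv_sym[OF eqv_rep] norm_B)
      also have "s (norm_s y) = norm_s y" by (rule norm_shift)
      also have "\<dots> \<approx> rep (norm_s y)" using yB by (intro eqv_rep norm_B)
      finally show "g y \<in> kernel ?G ?G f" unfolding kernel_f using g_in[OF y] by (simp add: g_def)
    qed
  qed
  moreover have "rep u \<in> kernel ?G ?G f"
  proof -
    have "s (rep u) \<approx> s u" using u by (intro eqv_s eqv_sym[OF eqv_rep])
    also have "\<dots> \<approx> u" by (rule fixed)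
    also have "\<dots> \<approx> rep u" using u by (intro eqv_rep)
    finally show ?thesis unfolding kernel_f using unit_groupI u by blast
  qed
  ultimately have "rep u \<in> g ` carrier ?G" by simp
  then obtain y where y: "y \<in> carrier ?G" "rep (norm_s y) = rep u" unfolding g_def by (elim imageE) (rule that, auto)
  then have "y \<in> B" using unit_groupD by blast
  then show ?thesis using y(2) rep_eq_iff[OF norm_B u(1)] by blast
qed

end

text \<open>
  The ring \<open>B / Q\<close> is complete and separated for its \<open>p\<close>-adic topology, and finite modulo \<open>p\<close>. The
  element \<open>t0\<close> of trace 1 serves to solve the linearized norm equation.
\<close>

locale complete_galois_ring = galois_quotient B Q s a xs
  for B Q :: "'r::comm_ring_1 set" and s a xs +
  fixes p :: nat and t0 :: 'r
  assumes p_cancel: "\<And>x. x \<in> B \<Longrightarrow> of_nat p * x \<in> Q \<Longrightarrow> x \<in> Q"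
    and t0_B: "t0 \<in> B" and t0_trace: "(\<Sum>j<a. (s ^^ j) t0) = 1"
    and finite_mod_p: "\<exists>Y. finite Y \<and> (\<forall>x\<in>B. \<exists>y\<in>Y. \<exists>b\<in>B. \<exists>z\<in>Q. x - y = of_nat p * b + z)"
    and complete: "\<And>f. (\<And>n. f n \<in> B) \<Longrightarrow>
      \<exists>x\<in>B. \<forall>n. \<exists>b\<in>B. \<exists>z\<in>Q. x - (\<Sum>m<n. of_nat p ^ m * f m) = of_nat p ^ n * b + z"
    and separated: "\<And>x. x \<in> B \<Longrightarrow> (\<And>n. \<exists>b\<in>B. \<exists>z\<in>Q. x = of_nat p ^ n * b + z) \<Longrightarrow> x \<in> Q"
begin

definition I where "I n = {of_nat p ^ n * b + z |b z. b \<in> B \<and> z \<in> Q}"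

lemma of_nat_B: "of_nat k \<in> B"
  by (induction k) (auto intro: B_rules)

lemma IE: assumes "x \<in> I n" obtains b z where "b \<in> B" "z \<in> Q" "x = of_nat p ^ n * b + z"
  using assms unfolding I_def by blast

lemma II: "b \<in> B \<Longrightarrow> z \<in> Q \<Longrightarrow> of_nat p ^ n * b + z \<in> I n"
  unfolding I_def by blast

lemma I_antimono: assumes "m \<le> n" "x \<in> I n" shows "x \<in> I m"
proof -
  obtain b z where bz: "b \<in> B" "z \<in> Q" "x = of_nat p ^ n * b + z" using assms(2) by (rule IE)
  have "x = of_nat p ^ m * (of_nat p ^ (n - m) * b) + z"
    using assms(1) bz(3) by (simp add: mult.assoc[symmetric] flip: power_add)
  then show ?thesis using II[of "of_nat p ^ (n - m) * b" z m] bz of_nat_B by (auto intro: B_rules)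
qed

lemma s_of_nat: "s (of_nat k) = of_nat k"
  by (induction k) (auto simp: s_zero s_one s_add)

lemma galois_I: "galois_quotient B (I n) s a xs"
proof
  show "I n \<subseteq> B" unfolding I_def using QB of_nat_B by (auto intro!: B_rules)
  show "0 \<in> I n" using II[of 0 0 n] Q0 B_rules(2) by simp
  show "x + y \<in> I n" if xI: "x \<in> I n" and yI: "y \<in> I n" for x y
  proof -
    obtain b z where bz: "b \<in> B" "z \<in> Q" "x = of_nat p ^ n * b + z" using xI by (rule IE)
    obtain b' z' where bz': "b' \<in> B" "z' \<in> Q" "y = of_nat p ^ n * b' + z'" using yI by (rule IE)
    have "of_nat p ^ n * (b + b') + (z + z') \<in> I n" using bz bz' by (intro II B_rules Q_add)
    then show ?thesis using bz bz' by (simp add: algebra_simps)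
  qed
  show "x * y \<in> I n" if xB: "x \<in> B" and yI: "y \<in> I n" for x y
  proof -
    obtain b z where bz: "b \<in> B" "z \<in> Q" "y = of_nat p ^ n * b + z" using yI by (rule IE)
    have "of_nat p ^ n * (x * b) + x * z \<in> I n" using bz xB by (intro II B_rules Q_mult)
    then show ?thesis using bz by (simp add: algebra_simps)
  qed
  show "s x \<in> I n" if xI: "x \<in> I n" for x
  proof -
    obtain b z where bz: "b \<in> B" "z \<in> Q" "x = of_nat p ^ n * b + z" using xI by (rule IE)
    have "of_nat p ^ n * s b + s z \<in> I n" using bz by (intro II s_B s_Q)
    then show ?thesis using bz by (simp add: s_add s_mult s_power s_of_nat)
  qed
qed (use s_add s_mult s_one s_B a_pos s_order xs_B xs_galois B in auto)

lemma I_Z: "z \<in> Q \<Longrightarrow> z \<in> I n"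
  using II[of 0 z n] B_rules(2) by simp

lemma pw: "of_nat p ^ (2 * n) = (of_nat p ^ n * of_nat p ^ n :: 'r)"
  by (simp add: mult_2 power_add)

lemma prod_one_plus:
  assumes "\<And>j. j \<in> J \<Longrightarrow> w j \<in> B"
  shows "\<exists>r\<in>B. (\<Prod>j\<in>J. 1 + of_nat p ^ n * w j) = 1 + of_nat p ^ n * (\<Sum>j\<in>J. w j) + of_nat p ^ (2 * n) * r"
  using assms
proof (induction J rule: infinite_finite_induct)
  case (insert j J)
  then obtain r where r: "r \<in> B"
    "(\<Prod>j\<in>J. 1 + of_nat p ^ n * w j) = 1 + of_nat p ^ n * (\<Sum>j\<in>J. w j) + of_nat p ^ (2 * n) * r" by auto
  have pn: "of_nat p ^ n \<in> B" using of_nat_B by (rule B_rules)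
  have SB: "(\<Sum>j\<in>J. w j) \<in> B" using insert.prems by (intro subring_set_sum[OF B]) auto
  have "(\<Prod>j\<in>insert j J. 1 + of_nat p ^ n * w j) =
     (1 + of_nat p ^ n * w j) * (1 + of_nat p ^ n * (\<Sum>j\<in>J. w j) + of_nat p ^ (2 * n) * r)"
    using insert(1,2) r(2) by simp
  also have "\<dots> = 1 + of_nat p ^ n * (\<Sum>j\<in>insert j J. w j) +
      of_nat p ^ (2 * n) * (r + w j * (\<Sum>j\<in>J. w j) + of_nat p ^ n * w j * r)"
    unfolding pw using insert(1,2) by (simp add: algebra_simps)
  finally have eq: "(\<Prod>j\<in>insert j J. 1 + of_nat p ^ n * w j) = 1 + of_nat p ^ n * (\<Sum>j\<in>insert j J. w j) +
      of_nat p ^ (2 * n) * (r + w j * (\<Sum>j\<in>J. w j) + of_nat p ^ n * w j * r)" .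
  show ?case
    by (rule bexI, rule eq) (use r(1) insert.prems SB pn in \<open>auto intro!: B_rules(4,6)\<close>)
qed (auto intro!: bexI[of _ 0] B_rules(2))

lemma s_pow_fixed: assumes "s x \<approx> x" shows "(s ^^ j) x \<approx> x"
proof (induction j)
  case (Suc j)
  then have "s ((s ^^ j) x) \<approx> s x" by (rule eqv_s)
  from eqv_trans[OF this assms] show ?case by simp
qed simp

lemma norm_lift:
  assumes u: "u \<in> B" "t \<in> B" "u * t \<approx> 1" and fixed: "s u \<approx> u"
    and \<beta>: "\<beta> \<in> B" "norm_s \<beta> - u \<in> I n" and n: "0 < n"
  shows "\<exists>y\<in>B. norm_s (\<beta> + of_nat p ^ n * y) - u \<in> I (Suc n)"
proof -
  obtain d0 z0 where dz: "d0 \<in> B" "z0 \<in> Q" "norm_s \<beta> - u = of_nat p ^ n * d0 + z0" using \<beta>(2) by (rule IE)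
  define d z where "d = - d0" and "z = - z0"
  have d: "d \<in> B" and z: "z \<in> Q" and eq: "norm_s \<beta> = u - of_nat p ^ n * d - z"
    using dz Q_minus B_rules(5) by (auto simp: d_def z_def algebra_simps)
  have pn: "of_nat p ^ n \<in> B" using of_nat_B by (rule B_rules)
  have sd: "s d \<approx> d"
  proof -
    have "of_nat p ^ n * (s d - d) = (s u - u) - (s z - z) - (s (norm_s \<beta>) - norm_s \<beta>)"
      unfolding eq by (simp add: s_diff s_add s_minus s_mult s_power s_of_nat algebra_simps)
    also have "\<dots> \<in> Q" using fixed z s_Q unfolding norm_shift by (auto simp: eqv_def intro!: Q_diff)
    finally have "of_nat p ^ n * (s d - d) \<in> Q" .
    moreover have cancel: "of_nat p ^ m * x \<in> Q \<Longrightarrow> x \<in> Q" if "x \<in> B" for m x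
      using that
    proof (induction m)
      case (Suc m)
      have "of_nat p * (of_nat p ^ m * x) \<in> Q" using Suc.prems(1) by (simp add: mult.assoc)
      then have "of_nat p ^ m * x \<in> Q" 
        by (rule p_cancel[OF B_rules(4)[OF B_rules(7)[OF of_nat_B] Suc.prems(2)]])
      then show ?case using Suc by blast
    qed simp
    ultimately show ?thesis unfolding eqv_def using cancel[of "s d - d" n] B_rules(3)[OF s_B[OF d] d] by blast
  qed
  have st: "s t \<approx> t"
  proof -
    have sut: "s u * s t \<approx> 1" using eqv_s[OF u(3)] by (simp add: s_mult s_one)
    have "s t = s t * 1" by simp
    also have "\<dots> \<approx> s t * (u * t)" using u by (intro eqv_mult_left eqv_sym[OF u(3)] s_B)
    also have "\<dots> \<approx> s t * (s u * t)" using u by (intro eqv_mult_left eqv_mult eqv_sym[OF fixed] eqv_refl s_B)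
    also have "\<dots> = (s u * s t) * t" by (simp add: ac_simps)
    also have "\<dots> \<approx> 1 * t" using u by (intro eqv_mult sut eqv_refl B_rules)
    finally show ?thesis by simp
  qed
  define w where "w = t0 * (d * t)"
  have wB: "w \<in> B" unfolding w_def using t0_B d u by (intro B_rules)
  have "s (d * t) \<approx> d * t" unfolding s_mult using sd st d u by (intro eqv_mult s_B)
  then have fx: "(s ^^ j) (d * t) \<approx> d * t" for j by (rule s_pow_fixed)
  have tr: "(\<Sum>j<a. (s ^^ j) w) \<approx> d * t"
  proof -
    have "(\<Sum>j\<in>J. (s ^^ j) w) \<approx> (\<Sum>j\<in>J. (s ^^ j) t0 * (d * t))" for J
    proof (induction J rule: infinite_finite_induct)
      case (insert j J)
      have "(s ^^ j) w \<approx> (s ^^ j) t0 * (d * t)" unfolding w_def s_pow_mult[of j t0 "d * t"]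
        using fx t0_B by (intro eqv_mult_left s_pow_B)
      then show ?case using insert eqv_add by simp
    qed auto
    then have "(\<Sum>j<a. (s ^^ j) w) \<approx> (\<Sum>j<a. (s ^^ j) t0) * (d * t)" unfolding sum_distrib_right .
    then show ?thesis by (simp add: t0_trace)
  qed
  then have trZ: "(\<Sum>j<a. (s ^^ j) w) - d * t \<in> Q" by (simp add: eqv_def)
  have one_w: "(s ^^ j) (1 + of_nat p ^ n * w) = 1 + of_nat p ^ n * (s ^^ j) w" for j
    by (induction j) (auto simp: s_one s_add s_mult s_power s_of_nat)
  obtain r where r: "r \<in> B" "norm_s (1 + of_nat p ^ n * w) =
      1 + of_nat p ^ n * (\<Sum>j<a. (s ^^ j) w) + of_nat p ^ (2 * n) * r"
    using prod_one_plus[of "{..<a}" "\<lambda>j. (s ^^ j) w" n] s_pow_B[OF wB] unfolding norm_s_def one_w by blast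
  define S where "S = (\<Sum>j<a. (s ^^ j) w)"
  have SB: "S \<in> B" unfolding S_def using s_pow_B[OF wB] by (intro subring_set_sum[OF B])
  have zB: "z \<in> B" using z QB by blast
  have "norm_s (\<beta> * (1 + of_nat p ^ n * w)) - u =
      of_nat p ^ (2 * n) * (norm_s \<beta> * r - d * S) +
      (of_nat p ^ n * (u * (S - d * t)) + of_nat p ^ n * (d * (u * t - 1)) - (1 + of_nat p ^ n * S) * z)"
    unfolding norm_mult r(2) S_def[symmetric] eq pw by (simp add: algebra_simps)
  also have "\<dots> \<in> I (2 * n)"
  proof (rule II)
    show "norm_s \<beta> * r - d * S \<in> B" using norm_B \<beta> r d SB by (intro B_rules)
    have utZ: "u * t - 1 \<in> Q" using u(3) by (simp add: eqv_def)
    show "of_nat p ^ n * (u * (S - d * t)) + of_nat p ^ n * (d * (u * t - 1)) - (1 + of_nat p ^ n * S) * z \<in> Q"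
      by (rule Q_diff[OF Q_add[OF Q_mult[OF pn Q_mult[OF u(1) trZ[folded S_def]]] Q_mult[OF pn Q_mult[OF d utZ]]]
            Q_mult[OF B_rules(6)[OF B_rules(1) B_rules(4)[OF pn SB]] z]])
  qed
  also have "I (2 * n) \<subseteq> I (Suc n)" using I_antimono[of "Suc n" "2 * n"] n by auto
  finally have "norm_s (\<beta> + of_nat p ^ n * (\<beta> * w)) - u \<in> I (Suc n)" by (simp add: algebra_simps)
  then show ?thesis using \<beta> wB by (intro bexI[of _ "\<beta> * w"] B_rules)
qed

theorem norm_surjective_complete:
  assumes u: "u \<in> B" "t \<in> B" "u * t \<approx> 1" and fixed: "s u \<approx> u"
  obtains \<beta> where "\<beta> \<in> B" "norm_s \<beta> \<approx> u"
proof -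
  have "\<exists>\<beta>\<in>B. norm_s \<beta> - u \<in> I 1"
  proof -
    interpret I1: galois_quotient B "I 1" s a xs by (rule galois_I)
    interpret I1: finite_galois_quotient B "I 1" s a xs
    proof
      obtain Y where Y: "finite Y" "\<forall>x\<in>B. \<exists>y\<in>Y. \<exists>b\<in>B. \<exists>z\<in>Q. x - y = of_nat p * b + z"
        using finite_mod_p by blast
      have "\<forall>x\<in>B. \<exists>y\<in>Y. x - y \<in> I 1" using Y(2) unfolding I_def by fastforce
      then show "\<exists>Y. finite Y \<and> (\<forall>x\<in>B. \<exists>y\<in>Y. x - y \<in> I 1)" using Y(1) by blast
    qed
    have "I1.eqv (u * t) 1" "I1.eqv (s u) u"
      using u(3) fixed I_Z unfolding eqv_def I1.eqv_def by auto
    then show ?thesis using I1.norm_surjective[OF u(1,2)] unfolding I1.eqv_def by blast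
  qed
  then obtain \<beta>0 where \<beta>0: "\<beta>0 \<in> B" "norm_s \<beta>0 - u \<in> I 1" by blast
  have step: "\<exists>y. (y \<in> B \<and> norm_s y - u \<in> I (Suc (Suc n))) \<and> (\<exists>c\<in>B. y = x + of_nat p ^ Suc n * c)"
    if "x \<in> B \<and> norm_s x - u \<in> I (Suc n)" for x n
  proof -
    have x: "x \<in> B" "norm_s x - u \<in> I (Suc n)" using that by auto
    obtain y where y: "y \<in> B" "norm_s (x + of_nat p ^ Suc n * y) - u \<in> I (Suc (Suc n))"
      using norm_lift[OF u fixed x] by blast
    have "x + of_nat p ^ Suc n * y \<in> B" using x y of_nat_B by (intro B_rules)
    then show ?thesis using y by blast
  qed
  have start: "\<exists>x. x \<in> B \<and> norm_s x - u \<in> I (Suc 0)" using \<beta>0 by auto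
  from dependent_nat_choice[of "\<lambda>n x. x \<in> B \<and> norm_s x - u \<in> I (Suc n)"
      "\<lambda>n x y. \<exists>c\<in>B. y = x + of_nat p ^ Suc n * c", OF start step]
  obtain \<gamma> where \<gamma>: "\<And>n. \<gamma> n \<in> B" "\<And>n. norm_s (\<gamma> n) - u \<in> I (Suc n)"
    "\<And>n. \<exists>c\<in>B. \<gamma> (Suc n) = \<gamma> n + of_nat p ^ Suc n * c" by blast
  obtain c where c: "\<And>n. c n \<in> B" "\<And>n. \<gamma> (Suc n) = \<gamma> n + of_nat p ^ Suc n * c n"
    using \<gamma>(3) by metis
  define f where "f = (\<lambda>n. case n of 0 \<Rightarrow> \<gamma> 0 | Suc m \<Rightarrow> c m)"
  have fB: "f n \<in> B" for n unfolding f_def using \<gamma>(1) c(1) by (cases n) auto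
  have sum_f: "(\<Sum>m<Suc n. of_nat p ^ m * f m) = \<gamma> n" for n
    by (induction n) (auto simp: f_def c(2))
  obtain x where x: "x \<in> B" "\<And>n. \<exists>b\<in>B. \<exists>z\<in>Q. x - (\<Sum>m<n. of_nat p ^ m * f m) = of_nat p ^ n * b + z"
    using complete[of f] fB by blast
  have "norm_s x - u \<in> I n" for n
  proof -
    interpret In: galois_quotient B "I (Suc n)" s a xs by (rule galois_I)
    have "x - \<gamma> n \<in> I (Suc n)" using x(2)[of "Suc n"] unfolding sum_f I_def by blast
    then have "In.eqv x (\<gamma> n)" by (simp add: In.eqv_def)
    then have "In.eqv (norm_s x) (norm_s (\<gamma> n))" using x(1) \<gamma>(1) by (intro In.norm_eqv)
    moreover have "In.eqv (norm_s (\<gamma> n)) u" using \<gamma>(2) by (simp add: In.eqv_def)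
    ultimately have "In.eqv (norm_s x) u" by (rule In.eqv_trans)
    then show ?thesis using I_antimono[of n "Suc n"] by (simp add: In.eqv_def)
  qed
  then have "\<exists>b\<in>B. \<exists>z\<in>Q. norm_s x - u = of_nat p ^ n * b + z" for n unfolding I_def by blast
  then have "norm_s x - u \<in> Q" using x(1) u(1) by (intro separated B_rules norm_B) auto
  then show ?thesis using that x(1) by (auto simp: eqv_def)
qed

end

section \<open>Frobenius is invertible on torsion\<close>

lemma proj_space_unique:
  fixes x y :: "nat \<Rightarrow> 'b::field"
  assumes x: "x \<in> proj_space n" and y: "y \<in> proj_space n"
    and eq: "\<And>i. i \<le> n \<Longrightarrow> c * x i = d * y i" and nz: "j \<le> n" "c * x j \<noteq> 0"
  shows "x = y"
proof -
  obtain i where i: "i \<le> n" "x i = 1" "\<forall>j<i. x j = 0" and xn: "\<forall>j>n. x j = 0"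
    using x unfolding proj_space_def by auto
  obtain k where k: "k \<le> n" "y k = 1" "\<forall>j<k. y j = 0" and yn: "\<forall>j>n. y j = 0"
    using y unfolding proj_space_def by auto
  have c: "c \<noteq> 0" and d: "d \<noteq> 0" using nz eq[of j] by auto
  have "\<not> i < k" using eq[OF i(1)] i k c by auto
  moreover have "\<not> k < i" using eq[OF k(1)] i k d by auto
  ultimately have "i = k" by simp
  then have "c = d" using eq[OF i(1)] i k by simp
  then have "x m = y m" for m
    using eq[of m] c xn yn by (cases "m \<le> n") auto
  then show ?thesis by blast
qed

lemma power_card_field: "(c :: 'c::{field,finite}) ^ CARD('c) = c"
proof (cases "c = 0")
  case False
  have bij: "bij_betw ((*) c) (UNIV - {0}) (UNIV - {0})"
    by (rule bij_betwI[of _ _ _ "(*) (inverse c)"]) (use False in auto)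
  have "c ^ card (UNIV - {0 :: 'c}) * \<Prod>(UNIV - {0}) = \<Prod>(UNIV - {0})"
    using prod.reindex_bij_betw[OF bij, of "\<lambda>y. y"] by (simp add: prod.distrib)
  then have "c ^ card (UNIV - {0 :: 'c}) = 1" by simp
  moreover have "Suc (card (UNIV - {0 :: 'c})) = CARD('c)"
    by (rule card_Suc_Diff1) auto
  ultimately show ?thesis by (metis power_Suc mult.right_neutral)
qed simp

context
  fixes p a :: nat and dummy :: "'c::{field,finite} itself"
  assumes p: "Factorial_Ring.prime p" and card: "CARD('c) = p ^ a"
begin

lemma char_alg_closure: "CHAR('c alg_closure) = p"
proof -
  have pr: "Factorial_Ring.prime CHAR('c)"
    by (rule prime_CHAR_semidom) (simp add: finite_imp_CHAR_pos)
  have "CHAR('c) dvd p ^ a"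
    using CHAR_dvd_CARD[where 'a = 'c] card by simp
  then have "CHAR('c) dvd p" using pr prime_dvd_power by blast
  then show ?thesis using pr p by (simp add: primes_dvd_imp_eq CHAR_alg_closure)
qed

lemma power_card_add:
  "(x + y :: 'c alg_closure) ^ CARD('c) = x ^ CARD('c) + y ^ CARD('c)"
  by (rule freshmans_dream'[where n = a]) (use char_alg_closure p card in auto)

lemma power_card_constant: "c \<in> range to_ac \<Longrightarrow> (c :: 'c alg_closure) ^ CARD('c) = c"
  by (auto simp flip: to_ac_power simp: power_card_field)

lemma power_card_inj: "(x :: 'c alg_closure) ^ CARD('c) = y ^ CARD('c) \<Longrightarrow> x = y"
proof -
  assume "x ^ CARD('c) = y ^ CARD('c)"
  then have "(x - y) ^ CARD('c) = 0"
    using power_card_add[of "x - y" y] by simp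
  then show "x = y" by simp
qed

lemma form_frobenius:
  "form (range to_ac) n d f \<Longrightarrow> f (frobenius_endo x) = f (x :: nat \<Rightarrow> 'c alg_closure) ^ CARD('c)"
  by (induction rule: form.induct)
    (simp_all only: power_card_constant power_card_add power_mult_distrib frobenius_endo_def)

lemma biform_frobenius:
  "biform (range to_ac) n d e f \<Longrightarrow>
    f (frobenius_endo x) (frobenius_endo y) = f (x :: nat \<Rightarrow> 'c alg_closure) y ^ CARD('c)"
  by (induction rule: biform.induct)
    (simp_all only: power_card_constant power_card_add power_mult_distrib frobenius_endo_def)

lemma frobenius_proj_space:
  "x \<in> proj_space n \<Longrightarrow> frobenius_endo (x :: nat \<Rightarrow> 'c alg_closure) \<in> proj_space n"
  unfolding proj_space_def frobenius_endo_def by (auto simp: power_0_left)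

lemma frobenius_closed:
  assumes "zariski_closed (range to_ac) n Y" and "x \<in> Y"
  shows "frobenius_endo (x :: nat \<Rightarrow> 'c alg_closure) \<in> Y"
proof -
  obtain T where T: "\<forall>f\<in>T. \<exists>d. form (range to_ac) n d f" "Y = {x \<in> proj_space n. \<forall>f\<in>T. f x = 0}"
    using assms(1) unfolding zariski_closed_def by blast
  have "f (frobenius_endo x) = 0" if f: "f \<in> T" for f
  proof -
    obtain d where "form (range to_ac) n d f" using bspec[OF T(1) f] by (elim exE) (rule that)
    from form_frobenius[OF this, of x] show ?thesis using assms(2) f T(2) by simp
  qed
  then show ?thesis using T(2) assms(2) frobenius_proj_space by auto
qed

text \<open>
  The group law is given by forms over the finite field, and raising the coordinates to the
  \<open>q\<close>-th power fixes the coefficients of these forms.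
\<close>

lemma frobenius_hom:
  fixes G :: "(nat \<Rightarrow> 'c alg_closure) monoid"
  assumes G: "abelian_variety n G"
  shows "frobenius_endo \<in> hom G G"
proof (rule homI)
  have cl: "zariski_closed (range to_ac) n (carrier G)"
    and mor: "morphism2 (range to_ac) n (carrier G) (\<lambda>x y. x \<otimes>\<^bsub>G\<^esub> y)" and cg: "comm_group G"
    using G unfolding abelian_variety_def by auto
  interpret comm_group G by fact
  have sub: "carrier G \<subseteq> proj_space n" using cl unfolding zariski_closed_def by auto
  show "frobenius_endo x \<in> carrier G" if "x \<in> carrier G" for x
    using frobenius_closed[OF cl that] .
  fix x y assume xy: "x \<in> carrier G" "y \<in> carrier G"
  obtain d e f where def: "(\<forall>i\<le>n. biform (range to_ac) n d e (f i)) \<and> (\<exists>i\<le>n. f i x y \<noteq> 0) \<and>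
      (\<forall>x\<in>carrier G. \<forall>y\<in>carrier G. \<exists>c. \<forall>i\<le>n. f i x y = c * (x \<otimes>\<^bsub>G\<^esub> y) i)"
    using bspec[OF bspec[OF mor[unfolded morphism2_def] xy(1)] xy(2)] by (elim exE) (rule that)
  note f = conjunct1[OF def] and nz = conjunct1[OF conjunct2[OF def]] and eq = conjunct2[OF conjunct2[OF def]]
  let ?Fx = "frobenius_endo x" and ?Fy = "frobenius_endo y"
  have F: "?Fx \<in> carrier G" "?Fy \<in> carrier G" using frobenius_closed[OF cl] xy by auto
  obtain c where c: "\<forall>i\<le>n. f i x y = c * (x \<otimes>\<^bsub>G\<^esub> y) i" using bspec[OF bspec[OF eq xy(1)] xy(2)] by (elim exE) (rule that)
  obtain c' where c': "\<forall>i\<le>n. f i ?Fx ?Fy = c' * (?Fx \<otimes>\<^bsub>G\<^esub> ?Fy) i" using bspec[OF bspec[OF eq F(1)] F(2)] by (elim exE) (rule that)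
  obtain j where j: "j \<le> n" "f j x y \<noteq> 0" using nz by blast
  have fr: "f i ?Fx ?Fy = f i x y ^ CARD('c)" if "i \<le> n" for i
    using biform_frobenius[OF f[rule_format, OF that]] .
  show "frobenius_endo (x \<otimes>\<^bsub>G\<^esub> y) = ?Fx \<otimes>\<^bsub>G\<^esub> ?Fy"
  proof (rule proj_space_unique[where n = n and c = "c ^ CARD('c)" and d = c' and j = j])
    show "c ^ CARD('c) * frobenius_endo (x \<otimes>\<^bsub>G\<^esub> y) i = c' * (?Fx \<otimes>\<^bsub>G\<^esub> ?Fy) i" if "i \<le> n" for i
      using c c' fr[OF that] that by (simp add: frobenius_endo_def power_mult_distrib)
    show "c ^ CARD('c) * frobenius_endo (x \<otimes>\<^bsub>G\<^esub> y) j \<noteq> 0"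
      using c j by (simp add: frobenius_endo_def power_mult_distrib)
  qed (use j sub xy F frobenius_proj_space in auto)
qed

lemma frobenius_inj: "inj (frobenius_endo :: (nat \<Rightarrow> 'c alg_closure) \<Rightarrow> _)"
proof (rule injI)
  fix x y :: "nat \<Rightarrow> 'c alg_closure" assume *: "frobenius_endo x = frobenius_endo y"
  have "x i = y i" for i
    using fun_cong[OF *, of i] power_card_inj unfolding frobenius_endo_def by blast
  then show "x = y" by blast
qed

end

lemma (in comm_group) endo_finprod:
  assumes "g \<in> hom G G" "\<And>i. i \<in> I \<Longrightarrow> f i \<in> carrier G"
  shows "g (finprod G f I) = finprod G (\<lambda>i. g (f i)) I"
proof -
  interpret g: group_hom G G g using assms(1) by unfold_locales
  show ?thesis using assms(2)
    by (induction I rule: infinite_finite_induct) (auto simp: Pi_def)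
qed

lemma (in comm_group) int_pow_finprod:
  assumes "\<And>i. i \<in> I \<Longrightarrow> P i \<in> carrier G"
  shows "finprod G (\<lambda>i. P i [^] (s i :: int)) I [^] (z :: int) = finprod G (\<lambda>i. P i [^] (z * s i)) I"
proof (cases "finite I")
  case True
  then show ?thesis using assms
    by (induction I rule: finite_induct)
      (auto simp: int_pow_distrib int_pow_pow mult.commute Pi_def int_pow_one)
next
  case False
  then show ?thesis by (simp add: int_pow_one)
qed

lemma (in comm_group) finprod_finprod_int_pow:
  assumes "finite J" "\<And>i. i \<in> I \<Longrightarrow> P i \<in> carrier G"
  shows "finprod G (\<lambda>j. finprod G (\<lambda>i. P i [^] (s i j :: int)) I) J =
    finprod G (\<lambda>i. P i [^] (\<Sum>j\<in>J. s i j)) I"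
  using assms(1)
proof (induction J rule: finite_induct)
  case empty
  then show ?case using assms by (simp add: finprod_one_eqI)
next
  case (insert j J)
  have "finprod G (\<lambda>j. finprod G (\<lambda>i. P i [^] (s i j :: int)) I) (insert j J) =
     finprod G (\<lambda>i. P i [^] s i j) I \<otimes> finprod G (\<lambda>i. P i [^] (\<Sum>j\<in>J. s i j)) I"
    using insert assms(2) by (simp add: Pi_def)
  also have "\<dots> = finprod G (\<lambda>i. P i [^] s i j \<otimes> P i [^] (\<Sum>j\<in>J. s i j)) I"
    using assms(2) by (intro finprod_multf[symmetric]) auto
  also have "\<dots> = finprod G (\<lambda>i. P i [^] (\<Sum>j\<in>insert j J. s i j)) I"
    using assms(2) insert(1,2) by (intro finprod_cong) (auto simp: int_pow_mult simp_implies_def)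
  finally show ?case .
qed

lemma det_mod_cong:
  fixes A B :: "int mat"
  assumes "A \<in> carrier_mat d d" "B \<in> carrier_mat d d"
    and "\<And>i j. i < d \<Longrightarrow> j < d \<Longrightarrow> [A $$ (i, j) = B $$ (i, j)] (mod l)"
  shows "[det A = det B] (mod l)"
proof -
  have "[(\<Sum>p\<in>{p. p permutes {0..<d}}. signof p * (\<Prod>i = 0..<d. A $$ (i, p i))) =
         (\<Sum>p\<in>{p. p permutes {0..<d}}. signof p * (\<Prod>i = 0..<d. B $$ (i, p i)))] (mod l)"
    by (intro cong_sum cong_mult cong_prod cong_refl assms(3)) (auto simp: permutes_in_image)
  then show ?thesis using assms(1,2) by (simp add: det_def)
qed

lemma coeff_0_char_poly:
  fixes M :: "'b::comm_ring_1 mat"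
  assumes "M \<in> carrier_mat d d"
  shows "Polynomial.coeff (char_poly M) 0 = (-1) ^ d * det M"
proof -
  have "poly (char_poly M) 0 = det ((-1) \<cdot>\<^sub>m M)"
    unfolding char_poly_def using assms
    by (intro poly_det_cong[where n = d]) (auto simp: char_poly_matrix_def)
  also have "\<dots> = (-1) ^ d * det M" using assms by simp
  finally show ?thesis by (simp add: poly_0_coeff_0)
qed

text \<open>
  On the \<open>\<ell>\<close>-torsion Frobenius is an injective endomorphism of a finite group, so its matrix is
  invertible modulo \<open>\<ell>\<close>, while its determinant is \<open>h(0)\<close> up to sign.
\<close>

lemma frobenius_char_poly_coeff_0:
  fixes G :: "(nat \<Rightarrow> 'c::{field,finite} alg_closure) monoid" (structure)
  assumes p: "Factorial_Ring.prime p" and card: "CARD('c) = p ^ a"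
    and G: "abelian_variety n G" and h: "frobenius_char_poly G h"
  shows "Polynomial.coeff h 0 \<noteq> 0"
proof
  assume h0: "Polynomial.coeff h 0 = 0"
  have "comm_group G" using G unfolding abelian_variety_def by auto
  then interpret comm_group G .
  let ?F = "frobenius_endo :: (nat \<Rightarrow> 'c alg_closure) \<Rightarrow> _"
  have hom: "?F \<in> hom G G" using frobenius_hom[OF p card G] .
  interpret F: group_hom G G ?F using hom by unfold_locales
  obtain l :: nat where l: "Factorial_Ring.prime l" "l > p" using bigger_prime by blast
  have l1: "l > 1" using l prime_gt_1_nat by blast
  have "\<not> l dvd CARD('c)"
    using l p card by (metis prime_dvd_power nat_dvd_not_less prime_gt_0_nat)
  then have lq: "Factorial_Ring.prime l \<and> \<not> l dvd CARD('c)" using l by blast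
  obtain P M where PM: "M \<in> carrier_mat (Polynomial.degree h) (Polynomial.degree h) \<and>
        (\<forall>i<Polynomial.degree h. P i \<in> carrier G) \<and>
        bij_betw (\<lambda>c. finprod G (\<lambda>i. P i [^]\<^bsub>G\<^esub> (c i :: nat)) {..<Polynomial.degree h})
          ({..<Polynomial.degree h} \<rightarrow>\<^sub>E {..<l ^ 1})
          {x \<in> carrier G. x [^]\<^bsub>G\<^esub> (l ^ 1) = \<one>\<^bsub>G\<^esub>} \<and>
        (\<forall>j<Polynomial.degree h. ?F (P j) =
          finprod G (\<lambda>i. P i [^]\<^bsub>G\<^esub> (M $$ (i, j) :: int)) {..<Polynomial.degree h}) \<and>
        (\<forall>i. Polynomial.coeff (char_poly M) i mod int (l ^ 1) = Polynomial.coeff h i mod int (l ^ 1))"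
    using conjunct2[OF h[unfolded frobenius_char_poly_def], THEN spec, THEN spec, THEN mp, OF lq, of 1]
    by (elim exE) (rule that)
  note M = conjunct1[OF PM] and P = conjunct1[OF conjunct2[OF PM]]
    and bij = conjunct1[OF conjunct2[OF conjunct2[OF PM]]]
    and FP = conjunct1[OF conjunct2[OF conjunct2[OF conjunct2[OF PM]]]]
    and cp = conjunct2[OF conjunct2[OF conjunct2[OF conjunct2[OF PM]]]]
  define d where "d = Polynomial.degree h"
  define \<Phi> where "\<Phi> = (\<lambda>c. finprod G (\<lambda>i. P i [^] (c i :: nat)) {..<d})"
  define \<Psi> where "\<Psi> = (\<lambda>c. finprod G (\<lambda>i. P i [^] (c i :: int)) {..<d})"
  define T where "T = {x \<in> carrier G. x [^] l = \<one>}"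
  note [folded d_def, simplified] = M P bij FP cp
  note M = this(1) and P = this(2) and bij = this(3)[folded \<Phi>_def T_def]
    and FP = this(4) and cp = this(5)
  have \<Phi>\<Psi>: "\<Phi> c = \<Psi> (\<lambda>i. int (c i))" for c
    unfolding \<Phi>_def \<Psi>_def using P by (intro finprod_cong) (auto simp: int_pow_int)
  have finT: "finite T" using bij_betw_finite[OF bij] by (simp add: finite_PiE)
  have FT: "?F ` T \<subseteq> T" unfolding T_def by (auto simp flip: F.hom_nat_pow)
  have surj: "?F ` T = T"
    using FT finT frobenius_inj[OF p card] by (metis endo_inj_surj inj_on_subset top_greatest)
  have PT: "P j \<in> T" and P\<Phi>: "P j = \<Phi> (\<lambda>i\<in>{..<d}. if i = j then 1 else 0)" if "j < d" for j
  proof -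
    have "\<Phi> (\<lambda>i\<in>{..<d}. if i = j then 1 else 0) = finprod G (\<lambda>i. if j = i then P i else \<one>) {..<d}"
      unfolding \<Phi>_def using P by (intro finprod_cong) (auto simp: simp_implies_def)
    also have "\<dots> = P j" using P that by (intro finprod_singleton) auto
    finally show *: "P j = \<Phi> (\<lambda>i\<in>{..<d}. if i = j then 1 else 0)" by simp
    have "(\<lambda>i\<in>{..<d}. if i = j then 1 else 0) \<in> {..<d} \<rightarrow>\<^sub>E {..<l}" using l1 by auto
    then show "P j \<in> T" using bij_betwE[OF bij] * by auto
  qed
  have "\<exists>c. \<forall>i<d. [(\<Sum>k<d. M $$ (i, k) * int (c k)) = (if i = j then 1 else 0)] (mod int l)"
    if j: "j < d" for j
  proof -
    have "P j \<in> ?F ` T" using PT[OF j] unfolding surj .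
    then obtain t where t: "t \<in> T" "?F t = P j" by (elim imageE) (rule that, auto)
    obtain c where c: "c \<in> {..<d} \<rightarrow>\<^sub>E {..<l}" "t = \<Phi> c"
      using t(1) unfolding bij_betw_imp_surj_on[OF bij, symmetric] by (elim imageE) (rule that)
    define s where "s = (\<lambda>i. \<Sum>k<d. M $$ (i, k) * int (c k))"
    have "P j = ?F (finprod G (\<lambda>i. P i [^] c i) {..<d})" using t c unfolding \<Phi>_def by simp
    also have "\<dots> = finprod G (\<lambda>k. ?F (P k) [^] c k) {..<d}"
      using P by (subst endo_finprod[OF hom]) (auto simp: F.hom_nat_pow simp_implies_def intro!: finprod_cong)
    also have "\<dots> = finprod G (\<lambda>k. \<Psi> (\<lambda>i. M $$ (i, k) * int (c k))) {..<d}"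
    proof (intro finprod_cong' refl)
      fix k assume k: "k \<in> {..<d}"
      have "?F (P k) [^] c k = \<Psi> (\<lambda>i. M $$ (i, k)) [^] int (c k)" using FP k by (simp add: int_pow_int \<Psi>_def)
      also have "\<dots> = \<Psi> (\<lambda>i. M $$ (i, k) * int (c k))"
        unfolding \<Psi>_def using P by (subst int_pow_finprod) (auto simp: mult.commute)
      finally show "?F (P k) [^] c k = \<Psi> (\<lambda>i. M $$ (i, k) * int (c k))" .
    qed (use P in \<open>auto simp: \<Psi>_def\<close>)
    also have "\<dots> = \<Psi> s"
      unfolding \<Psi>_def s_def using P by (intro finprod_finprod_int_pow) auto
    also have "\<dots> = \<Phi> (\<lambda>i\<in>{..<d}. nat (s i mod int l))"
      unfolding \<Psi>_def \<Phi>_def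
    proof (intro finprod_cong' refl)
      fix i assume i: "i \<in> {..<d}"
      then have Pi: "P i \<in> carrier G" "P i [^] int l = \<one>" using P PT unfolding T_def by (auto simp: int_pow_int)
      have "P i [^] s i = P i [^] (int l * (s i div int l) + s i mod int l)" by simp
      also have "\<dots> = (P i [^] int l) [^] (s i div int l) \<otimes> P i [^] (s i mod int l)"
        by (simp only: int_pow_mult[OF Pi(1)] int_pow_pow[OF Pi(1), symmetric])
      also have "\<dots> = P i [^] int (nat (s i mod int l))" using Pi l1 by (simp add: int_pow_one)
      finally show "P i [^] s i = P i [^] (\<lambda>i\<in>{..<d}. nat (s i mod int l)) i"
        using i by (simp add: int_pow_int)
    qed (use P in auto)
    finally have eq: "\<Phi> (\<lambda>i\<in>{..<d}. nat (s i mod int l)) = \<Phi> (\<lambda>i\<in>{..<d}. if i = j then 1 else 0)"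
      using P\<Phi>[OF j] by simp
    have eqf: "(\<lambda>i\<in>{..<d}. nat (s i mod int l)) = (\<lambda>i\<in>{..<d}. if i = j then 1 else 0)"
      using bij eq unfolding bij_betw_def
      by (rule_tac inj_onD[of \<Phi> "{..<d} \<rightarrow>\<^sub>E {..<l}"]) (use l1 in \<open>auto simp: nat_less_iff\<close>)
    have res: "nat (s i mod int l) = (if i = j then 1 else 0)" if "i < d" for i
      using fun_cong[OF eqf, of i] that by simp
    have "s i mod int l = (if i = j then 1 else 0)" if "i < d" for i
    proof -
      have "0 \<le> s i mod int l" using l1 by simp
      then have "s i mod int l = int (nat (s i mod int l))" by simp
      then show ?thesis unfolding res[OF that] by simp
    qed
    moreover have "(if i = j then 1 else 0) mod int l = (if i = j then 1 else 0)" for i using l1 by simp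
    ultimately have "\<forall>i<d. [s i = (if i = j then 1 else 0)] (mod int l)"
      unfolding Cong.cong_def by simp
    then show ?thesis unfolding s_def by (rule exI[of _ c])
  qed
  then obtain c where c: "\<And>i j. j < d \<Longrightarrow> i < d \<Longrightarrow>
      [(\<Sum>k<d. M $$ (i, k) * int (c j k)) = (if i = j then 1 else 0)] (mod int l)" by metis
  define N where "N = mat d d (\<lambda>(k, j). int (c j k))"
  have N: "N \<in> carrier_mat d d" by (simp add: N_def)
  have "[det (M * N) = det (1\<^sub>m d)] (mod int l)"
    using c M N by (intro det_mod_cong) (auto simp: N_def scalar_prod_def atLeast0LessThan)
  then have 1: "[det M * det N = 1] (mod int l)" using det_mult[OF M N] by simp
  have "int l dvd (-1) ^ d * det M"
    using cp[rule_format, of 0] h0 coeff_0_char_poly[OF M] by (auto simp: mod_eq_0_iff_dvd)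
  then have "int l dvd det M" by (metis dvd_mult_unit_iff' is_unit_power_iff dvd_minus_iff dvd_refl)
  then have "[det M * det N = 0] (mod int l)" by (simp add: cong_0_iff)
  then have "[1 = 0] (mod int l)" using 1 by (metis cong_sym cong_trans)
  then show False using l1 by (simp add: cong_0_iff)
qed

section \<open>The norm equation in the unit-root part\<close>

context unramified
begin

sublocale \<sigma>p: map_poly_inj_idom_hom \<sigma> ..

lemma indexed_galois_basis:
  obtains m :: nat and b c where "\<And>i. i < m \<Longrightarrow> b i \<in> W" "\<And>i. i < m \<Longrightarrow> c i \<in> W"
    "\<And>j. j < a \<Longrightarrow> (\<Sum>i<m. b i * (\<sigma> ^^ j) (c i)) = (if j = 0 then 1 else 0)"
proof -
  obtain xs :: "('l \<times> 'l) list" where xs: "set xs \<subseteq> W \<times> W"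
    "\<And>j. j < a \<Longrightarrow> (\<Sum>(b, c)\<leftarrow>xs. b * (\<sigma> ^^ j) c) = (if j = 0 then 1 else 0)"
    using galois_basis by blast
  show ?thesis
  proof (rule that[of "length xs" "\<lambda>i. fst (xs ! i)" "\<lambda>i. snd (xs ! i)"])
    show "fst (xs ! i) \<in> W" "snd (xs ! i) \<in> W" if "i < length xs" for i
      using xs(1) nth_mem[OF that] by (auto simp: mem_Times_iff)
    show "(\<Sum>i<length xs. fst (xs ! i) * (\<sigma> ^^ j) (snd (xs ! i))) = (if j = 0 then 1 else 0)" if "j < a" for j
      using xs(2)[OF that] by (simp add: sum_list_sum_nth atLeast0LessThan case_prod_unfold)
  qed
qed

definition trace :: "'l \<Rightarrow> 'l" where "trace y = (\<Sum>j<a. (\<sigma> ^^ j) y)"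

lemma trace_fixed: "\<sigma> (trace y) = trace y"
proof -
  obtain m where m: "a = Suc m" using a_pos by (cases a) auto
  have "\<sigma> (trace y) = (\<Sum>j<a. (\<sigma> ^^ Suc j) y)" unfolding trace_def by (simp add: \<sigma>.hom_sum)
  also have "\<dots> = (\<Sum>j<m. (\<sigma> ^^ Suc j) y) + (\<sigma> ^^ a) y" unfolding m by simp
  also have "\<dots> = trace y" unfolding \<sigma>_order unfolding trace_def unfolding m
    by (subst sum.lessThan_Suc_shift) simp
  finally show ?thesis .
qed

lemma trace_O: assumes "w \<in> W" obtains d where "d \<in> \<O>" "trace w = \<iota> d"
proof -
  obtain d where d: "trace w = \<iota> d" using \<sigma>_fixed[OF trace_fixed] by blast
  have "trace w \<in> W" unfolding trace_def using assms by (intro L.O_sum) auto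
  then show ?thesis using that[of d] d by simp
qed

lemma trace_expansion:
  assumes "\<And>j. j < a \<Longrightarrow> (\<Sum>i<m. b i * (\<sigma> ^^ j) (c i)) = (if j = 0 then 1 else 0)"
  shows "y = (\<Sum>i<m. b i * trace (c i * y))"
proof -
  have "(\<Sum>i<m. b i * trace (c i * y)) = (\<Sum>i<m. \<Sum>j<a. b i * (\<sigma> ^^ j) (c i) * (\<sigma> ^^ j) y)"
    unfolding trace_def by (simp add: sum_distrib_left \<sigma>_power_hom mult.assoc)
  also have "\<dots> = (\<Sum>j<a. (\<Sum>i<m. b i * (\<sigma> ^^ j) (c i)) * (\<sigma> ^^ j) y)"
    by (subst sum.swap) (simp add: sum_distrib_right)
  also have "\<dots> = (\<Sum>j<a. if j = 0 then (\<sigma> ^^ j) y else 0)" using assms by (intro sum.cong) auto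
  also have "\<dots> = y" using a_pos by simp
  finally show ?thesis by simp
qed

text \<open>\<open>W\<close> is generated by finitely many elements over \<open>\<int>\<^sub>p\<close>.\<close>

lemma W_generators:
  obtains m :: nat and b where "\<And>i. i < m \<Longrightarrow> b i \<in> W"
    "\<And>w. w \<in> W \<Longrightarrow> \<exists>d. (\<forall>i. d i \<in> \<O>) \<and> w = (\<Sum>i<m. b i * \<iota> (d i))"
proof -
  obtain m :: nat and b c where bc: "\<And>i. i < m \<Longrightarrow> b i \<in> W" "\<And>i. i < m \<Longrightarrow> c i \<in> W"
    "\<And>j. j < a \<Longrightarrow> (\<Sum>i<m. b i * (\<sigma> ^^ j) (c i)) = (if j = 0 then 1 else 0)"
    using indexed_galois_basis by blast
  have "\<exists>d. (\<forall>i. d i \<in> \<O>) \<and> w = (\<Sum>i<m. b i * \<iota> (d i))" if w: "w \<in> W" for w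
  proof -
    have "\<exists>d\<in>\<O>. i < m \<longrightarrow> trace (c i * w) = \<iota> d" for i
    proof (cases "i < m")
      case True
      then have "c i * w \<in> W" using bc(2) w by blast
      then show ?thesis by (metis trace_O)
    qed (use O_zero in blast)
    then obtain d where d: "\<And>i. d i \<in> \<O>" "\<And>i. i < m \<Longrightarrow> trace (c i * w) = \<iota> (d i)" by metis
    have "w = (\<Sum>i<m. b i * trace (c i * w))" using bc(3) by (rule trace_expansion)
    then show ?thesis using d by (intro exI[of _ d]) simp
  qed
  then show ?thesis using that[of m b] bc(1) by blast
qed

lemma trace_one: obtains t where "t \<in> W" "trace t = 1"
proof -
  obtain m :: nat and b c where bc: "\<And>i. i < m \<Longrightarrow> b i \<in> W" "\<And>i. i < m \<Longrightarrow> c i \<in> W"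
    "\<And>j. j < a \<Longrightarrow> (\<Sum>i<m. b i * (\<sigma> ^^ j) (c i)) = (if j = 0 then 1 else 0)"
    using indexed_galois_basis by blast
  have "\<exists>i<m. vL (trace (c i)) = 0"
  proof (rule ccontr)
    assume no: "\<not> ?thesis"
    have "\<exists>t\<in>W. trace (c i) = of_nat p * t" if i: "i < m" for i
    proof -
      have "trace (c i) \<in> W" unfolding trace_def using bc(2)[OF i] by (intro L.O_sum) auto
      then show ?thesis using L.O_cases no i by blast
    qed
    then have "\<forall>i. \<exists>t\<in>W. i < m \<longrightarrow> trace (c i) = of_nat p * t" using L.O_zero by blast
    then obtain t where t: "\<And>i. t i \<in> W" "\<And>i. i < m \<Longrightarrow> trace (c i) = of_nat p * t i" by metis
    have "1 = (\<Sum>i<m. b i * trace (c i * 1))" using bc(3) by (rule trace_expansion)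
    also have "\<dots> = of_nat p * (\<Sum>i<m. b i * t i)" using t(2) by (simp add: sum_distrib_left ac_simps)
    finally have "1 = of_nat p * (\<Sum>i<m. b i * t i)" .
    moreover have "0 < vL (of_nat p * (\<Sum>i<m. b i * t i))"
      using bc(1) t(1) by (intro L.v_p_mult L.O_sum) auto
    ultimately show False using L.v_one by simp
  qed
  then obtain i where i: "i < m" "vL (trace (c i)) = 0" by blast
  obtain d where d: "d \<in> \<O>" "trace (c i) = \<iota> d" using trace_O[OF bc(2)[OF i(1)]] by blast
  have d0: "d \<noteq> 0" using i(2) d(2) v_zero vL_\<iota>[of d] by auto
  have "v d = 0" using i(2) d(2) by simp
  show ?thesis
  proof
    show "\<iota> (inverse d) * c i \<in> W" using O_unit[OF \<open>v d = 0\<close>] bc(2)[OF i(1)] by (intro L.O_mult) auto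
    have "trace (\<iota> (inverse d) * c i) = \<iota> (inverse d) * trace (c i)"
      unfolding trace_def by (simp add: \<sigma>_power_hom sum_distrib_left)
    also have "\<dots> = 1" unfolding d(2) using d0 by (simp flip: \<iota>.hom_mult)
    finally show "trace (\<iota> (inverse d) * c i) = 1" .
  qed
qed

lemma W_finite_mod_p: obtains Y where "finite Y" "\<And>w. w \<in> W \<Longrightarrow> \<exists>y\<in>Y. \<exists>t\<in>W. w = y + of_nat p * t" "0 \<in> Y"
proof -
  obtain m :: nat and b where b: "\<And>i. i < m \<Longrightarrow> b i \<in> W"
    "\<And>w. w \<in> W \<Longrightarrow> \<exists>d. (\<forall>i. d i \<in> \<O>) \<and> w = (\<Sum>i<m. b i * \<iota> (d i))" using W_generators by blast
  define Y where "Y = insert 0 ((\<lambda>n. \<Sum>i<m. b i * of_nat (n i)) ` ({..<m} \<rightarrow>\<^sub>E {..<p}))"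
  show ?thesis
  proof (rule that[of Y])
    show "finite Y" unfolding Y_def by (simp add: finite_PiE)
    fix w assume "w \<in> W"
    then obtain d where d: "\<And>i. d i \<in> \<O>" "w = (\<Sum>i<m. b i * \<iota> (d i))" using b(2) by blast
    have "\<forall>i. \<exists>n t. n < p \<and> t \<in> \<O> \<and> d i = of_nat n + of_nat p * t"
      using residue_representative[OF d(1)] by blast
    then obtain n t where nt: "\<And>i. n i < p" "\<And>i. t i \<in> \<O>" "\<And>i. d i = of_nat (n i) + of_nat p * t i" by metis
    have "w = (\<Sum>i<m. b i * of_nat ((\<lambda>i\<in>{..<m}. n i) i)) + of_nat p * (\<Sum>i<m. b i * \<iota> (t i))"
      unfolding d(2) by (simp add: nt(3) \<iota>.hom_add \<iota>.hom_mult sum.distrib sum_distrib_left algebra_simps)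
    moreover have "(\<Sum>i<m. b i * \<iota> (t i)) \<in> W" using b(1) nt(2) by (intro L.O_sum L.O_mult) auto
    moreover have "(\<lambda>i\<in>{..<m}. n i) \<in> {..<m} \<rightarrow>\<^sub>E {..<p}" using nt(1) by auto
    ultimately show "\<exists>y\<in>Y. \<exists>t\<in>W. w = y + of_nat p * t" unfolding Y_def by blast
  qed (simp add: Y_def)
qed

lemma W_complete:
  assumes f: "\<And>n. f n \<in> W"
  shows "\<exists>x\<in>W. \<forall>n. \<exists>t\<in>W. x - (\<Sum>m<n. of_nat p ^ m * f m) = of_nat p ^ n * t"
proof -
  obtain m :: nat and b where b: "\<And>i. i < m \<Longrightarrow> b i \<in> W"
    "\<And>w. w \<in> W \<Longrightarrow> \<exists>d. (\<forall>i. d i \<in> \<O>) \<and> w = (\<Sum>i<m. b i * \<iota> (d i))" using W_generators by blast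
  have "\<forall>n. \<exists>d. (\<forall>i. d i \<in> \<O>) \<and> f n = (\<Sum>i<m. b i * \<iota> (d i))" using b(2) f by blast
  then obtain d where d: "\<And>n i. d n i \<in> \<O>" "\<And>n. f n = (\<Sum>i<m. b i * \<iota> (d n i))" by metis
  have "\<forall>i. \<exists>x\<in>\<O>. \<forall>n. \<exists>t\<in>\<O>. x - (\<Sum>k<n. of_nat p ^ k * d k i) = of_nat p ^ n * t"
    using series_converges[of "\<lambda>k. d k _"] d(1) by blast
  then obtain x t where x: "\<And>i. x i \<in> \<O>" "\<And>i n. t i n \<in> \<O>"
    "\<And>i n. x i - (\<Sum>k<n. of_nat p ^ k * d k i) = of_nat p ^ n * t i n" by metis
  show ?thesis
  proof (rule bexI[of _ "\<Sum>i<m. b i * \<iota> (x i)"], intro allI)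
    show "(\<Sum>i<m. b i * \<iota> (x i)) \<in> W" using b(1) x(1) by (intro L.O_sum L.O_mult) auto
    fix n
    have "(\<Sum>i<m. b i * \<iota> (t i n)) \<in> W" using b(1) x(2) by (intro L.O_sum L.O_mult) auto
    have "(\<Sum>k<n. of_nat p ^ k * f k) = (\<Sum>i<m. b i * \<iota> (\<Sum>k<n. of_nat p ^ k * d k i))"
      unfolding d(2) by (simp add: \<iota>.hom_sum \<iota>.hom_mult \<iota>.hom_power sum_distrib_left ac_simps sum.swap[of _ "{..<m}"])
    then have "(\<Sum>i<m. b i * \<iota> (x i)) - (\<Sum>k<n. of_nat p ^ k * f k) =
        (\<Sum>i<m. b i * \<iota> (x i - (\<Sum>k<n. of_nat p ^ k * d k i)))"
      by (simp add: \<iota>.hom_minus right_diff_distrib sum_subtractf)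
    also have "\<dots> = of_nat p ^ n * (\<Sum>i<m. b i * \<iota> (t i n))"
      unfolding x(3) by (simp add: \<iota>.hom_mult \<iota>.hom_power sum_distrib_left ac_simps)
    finally show "\<exists>t\<in>W. (\<Sum>i<m. b i * \<iota> (x i)) - (\<Sum>k<n. of_nat p ^ k * f k) = of_nat p ^ n * t"
      using \<open>(\<Sum>i<m. b i * \<iota> (t i n)) \<in> W\<close> by blast
  qed
qed

lemma coeff_\<sigma>_power: "Polynomial.coeff ((map_poly \<sigma> ^^ j) u) i = (\<sigma> ^^ j) (Polynomial.coeff u i)"
  by (induction j) auto

lemma \<sigma>p_order: "(map_poly \<sigma> ^^ a) u = u"
  by (rule poly_eqI) (simp add: coeff_\<sigma>_power)

lemma \<sigma>p_\<iota>: "map_poly \<sigma> (map_poly \<iota> u) = map_poly \<iota> u"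
  by (rule poly_eqI) simp

end

lemma poly_sum_mod: "sum f I mod q = (\<Sum>i\<in>I. f i mod (q :: 'b::field poly))"
  by (induction I rule: infinite_finite_induct) (auto simp: poly_mod_add_left)

lemma pcompose_truncated:
  fixes r :: "'b::comm_ring_1 poly"
  assumes "\<And>i. i \<ge> N \<Longrightarrow> Polynomial.coeff r i = 0"
  shows "pcompose r q = (\<Sum>i<N. Polynomial.smult (Polynomial.coeff r i) (q ^ i))"
proof -
  have monom: "pcompose (Polynomial.monom c i) q = Polynomial.smult c (q ^ i)" for c i
    by (induction i) (auto simp: monom_Suc pcompose_pCons monom_0)
  have "r = (\<Sum>i<N. Polynomial.monom (Polynomial.coeff r i) i)"
    by (rule poly_eqI) (use assms in \<open>auto simp: coeff_sum if_distrib not_less cong: if_cong\<close>)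
  then have "pcompose r q = (\<Sum>i<N. pcompose (Polynomial.monom (Polynomial.coeff r i) i) q)"
    by (metis pcompose_sum)
  then show ?thesis by (simp add: monom)
qed

text \<open>
  \<open>k\<close> cuts out a factor of \<open>E\<^sub>p\<close> on which \<open>yy\<close> is a unit, integral with its inverse \<open>yi\<close>.
\<close>

locale unit_root_factor = unramified p v \<iota> vL a \<sigma>
  for p and v :: "'k::field_char_0 \<Rightarrow> ereal" and \<iota> :: "'k \<Rightarrow> 'l::field_char_0" and vL a \<sigma> +
  fixes k yy yi :: "'k poly"
  assumes k_nonzero: "k \<noteq> 0" and unit: "k dvd yy * yi - 1"
    and integral_yy: "\<exists>P. Polynomial.lead_coeff P = 1 \<and> (\<forall>i. Polynomial.coeff P i \<in> \<O>) \<and> k dvd pcompose P yy"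
    and integral_yi: "\<exists>P. Polynomial.lead_coeff P = 1 \<and> (\<forall>i. Polynomial.coeff P i \<in> \<O>) \<and> k dvd pcompose P yi"
begin

definition kL where "kL = map_poly \<iota> k"
definition Y where "Y = map_poly \<iota> yy"
definition BW :: "'l poly set" where
  "BW = {u. \<exists>g. (\<forall>i. Polynomial.coeff g i \<in> W) \<and> kL dvd u - pcompose g Y}"
definition ZW :: "'l poly set" where "ZW = {u. kL dvd u}"

lemma \<sigma>_kL: "map_poly \<sigma> kL = kL" and \<sigma>_Y: "map_poly \<sigma> Y = Y"
  unfolding kL_def Y_def by (simp_all add: \<sigma>p_\<iota>)

lemma BWI: "(\<And>i. Polynomial.coeff g i \<in> W) \<Longrightarrow> kL dvd u - pcompose g Y \<Longrightarrow> u \<in> BW"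
  unfolding BW_def by blast

lemma subring_BW: "subring_set BW"
  unfolding subring_set_def
proof (intro conjI ballI)
  show "1 \<in> BW" by (rule BWI[of 1]) (auto simp: coeff_one pcompose_1)
  fix u u' assume "u \<in> BW" "u' \<in> BW"
  then obtain g g' where g: "\<And>i. Polynomial.coeff g i \<in> W" "kL dvd u - pcompose g Y"
    and g': "\<And>i. Polynomial.coeff g' i \<in> W" "kL dvd u' - pcompose g' Y" unfolding BW_def by blast
  show "u - u' \<in> BW"
  proof (rule BWI[of "g - g'"])
    have "u - u' - pcompose (g - g') Y = (u - pcompose g Y) - (u' - pcompose g' Y)" by (simp add: pcompose_diff)
    then show "kL dvd u - u' - pcompose (g - g') Y" using g g' by (simp only: dvd_diff)
  qed (use g g' in auto)
  show "u * u' \<in> BW"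
  proof (rule BWI[of "g * g'"])
    have "u * u' - pcompose (g * g') Y = (u - pcompose g Y) * u' + pcompose g Y * (u' - pcompose g' Y)"
      by (simp add: pcompose_mult algebra_simps)
    then show "kL dvd u * u' - pcompose (g * g') Y" using g g' by (simp only: dvd_add dvd_mult dvd_mult2)
    show "Polynomial.coeff (g * g') i \<in> W" for i
      unfolding coeff_mult using g g' by (intro L.O_sum L.O_mult) auto
  qed
qed

lemma const_BW: "w \<in> W \<Longrightarrow> [:w:] \<in> BW"
  by (rule BWI[of "[:w:]"]) (auto simp: coeff_pCons split: nat.splits)

lemma Y_BW: "Y \<in> BW"
  by (rule BWI[of "[:0, 1:]"]) (auto simp: coeff_pCons pcompose_pCons split: nat.splits)

lemma truncate:
  obtains N where "\<And>u. u \<in> BW \<Longrightarrow> \<exists>r. (\<forall>i. Polynomial.coeff r i \<in> W) \<and>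
    (\<forall>i\<ge>N. Polynomial.coeff r i = 0) \<and> kL dvd u - pcompose r Y"
proof -
  obtain P where P: "Polynomial.lead_coeff P = 1" "\<And>i. Polynomial.coeff P i \<in> \<O>" "k dvd pcompose P yy"
    using integral_yy by blast
  define Q where "Q = map_poly \<iota> P"
  define N where "N = Polynomial.degree P"
  have Q: "Polynomial.coeff Q N = 1" "\<And>i. Polynomial.coeff Q i \<in> W" "\<And>i. i > N \<Longrightarrow> Polynomial.coeff Q i = 0"
    using P unfolding Q_def N_def by (auto simp: coeff_eq_0)
  have QY: "kL dvd pcompose Q Y"
    using \<iota>p.hom_dvd[OF P(3)] unfolding Q_def Y_def kL_def by (simp add: \<iota>.map_poly_pcompose)
  have red: "\<exists>r. (\<forall>i. Polynomial.coeff r i \<in> W) \<and> (\<forall>i\<ge>N. Polynomial.coeff r i = 0) \<and> kL dvd pcompose g Y - pcompose r Y"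
    if "\<forall>i. Polynomial.coeff g i \<in> W" "\<forall>i\<ge>m. Polynomial.coeff g i = 0" for g m
    using that
  proof (induction m arbitrary: g)
    case 0
    then show ?case by (intro exI[of _ g]) auto
  next
    case (Suc m)
    show ?case
    proof (cases "N \<le> m")
      case False
      then show ?thesis using Suc.prems by (intro exI[of _ g]) auto
    next
      case True
      define l where "l = Polynomial.coeff g m"
      define M where "M = Polynomial.smult l (Polynomial.monom 1 (m - N) * Q)"
      define g' where "g' = g - M"
      have l: "l \<in> W" using Suc.prems unfolding l_def by blast
      have cM: "Polynomial.coeff M i = (if m - N \<le> i then l * Polynomial.coeff Q (i - (m - N)) else 0)" for i
        unfolding M_def by (simp add: coeff_monom_mult)
      have "\<forall>i. Polynomial.coeff g' i \<in> W" unfolding g'_def using Suc.prems l Q(2)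
        by (auto simp: cM intro!: L.O_diff L.O_mult)
      moreover have "Polynomial.coeff g' i = 0" if "i \<ge> m" for i
      proof (cases "i = m")
        case True
        then show ?thesis using \<open>N \<le> m\<close> Q(1) unfolding g'_def by (simp add: cM l_def)
      next
        case False
        then have "Polynomial.coeff g i = 0" "Polynomial.coeff Q (i - (m - N)) = 0"
          using that Suc.prems \<open>N \<le> m\<close> by (auto intro: Q(3))
        then show ?thesis unfolding g'_def by (simp add: cM)
      qed
      ultimately obtain r where r: "\<forall>i. Polynomial.coeff r i \<in> W" "\<forall>i\<ge>N. Polynomial.coeff r i = 0"
        "kL dvd pcompose g' Y - pcompose r Y" using Suc.IH[of g'] by blast
      have "pcompose g Y - pcompose r Y = (pcompose g' Y - pcompose r Y) +
          Polynomial.smult l (pcompose (Polynomial.monom 1 (m - N)) Y) * pcompose Q Y"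
        unfolding g'_def M_def by (simp add: pcompose_diff pcompose_smult pcompose_mult)
      then have "kL dvd pcompose g Y - pcompose r Y" using r(3) QY by (simp only: dvd_add dvd_mult)
      then show ?thesis using r by blast
    qed
  qed
  show ?thesis
  proof (rule that[of N])
    fix u assume "u \<in> BW"
    then obtain g where g: "\<forall>i. Polynomial.coeff g i \<in> W" "kL dvd u - pcompose g Y" unfolding BW_def by blast
    have "\<forall>i\<ge>Suc (Polynomial.degree g). Polynomial.coeff g i = 0" by (simp add: coeff_eq_0)
    then obtain r where r: "\<forall>i. Polynomial.coeff r i \<in> W" "\<forall>i\<ge>N. Polynomial.coeff r i = 0"
      "kL dvd pcompose g Y - pcompose r Y" using red g by blast
    have "u - pcompose r Y = (u - pcompose g Y) + (pcompose g Y - pcompose r Y)" by simp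
    then have "kL dvd u - pcompose r Y" using g(2) r(3) by (simp only: dvd_add)
    then show "\<exists>r. (\<forall>i. Polynomial.coeff r i \<in> W) \<and> (\<forall>i\<ge>N. Polynomial.coeff r i = 0) \<and> kL dvd u - pcompose r Y"
      using r by blast
  qed
qed

lemma galois_BW:
  obtains xs where "galois_quotient BW ZW (map_poly \<sigma>) a xs"
proof -
  obtain xs :: "('l \<times> 'l) list" where xs: "set xs \<subseteq> W \<times> W"
    "\<And>j. j < a \<Longrightarrow> (\<Sum>(b, c)\<leftarrow>xs. b * (\<sigma> ^^ j) c) = (if j = 0 then 1 else 0)"
    using galois_basis by blast
  define ys where "ys = map (\<lambda>(b, c). ([:b:], [:c:])) xs"
  have pow_const: "(map_poly \<sigma> ^^ j) [:c:] = [:(\<sigma> ^^ j) c:]" for j c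
    by (rule poly_eqI) (simp add: coeff_\<sigma>_power coeff_pCons \<sigma>_power_hom split: nat.splits)
  have "galois_quotient BW ZW (map_poly \<sigma>) a ys"
  proof
    show "subring_set BW" by (rule subring_BW)
    show "ZW \<subseteq> BW" unfolding ZW_def by (auto intro: BWI[of 0])
    show "map_poly \<sigma> x \<in> BW" if x: "x \<in> BW" for x
    proof -
      obtain g where g: "\<forall>i. Polynomial.coeff g i \<in> W" "kL dvd x - pcompose g Y" using x unfolding BW_def by blast
      have "kL dvd map_poly \<sigma> x - pcompose (map_poly \<sigma> g) Y"
        using \<sigma>p.hom_dvd[OF g(2)] by (simp add: \<sigma>_kL \<sigma>_Y \<sigma>p.hom_minus \<sigma>.map_poly_pcompose)
      then show ?thesis using g(1) by (intro BWI[of "map_poly \<sigma> g"]) auto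
    qed
    show "map_poly \<sigma> x \<in> ZW" if "x \<in> ZW" for x
      using \<sigma>p.hom_dvd[of kL x] that unfolding ZW_def \<sigma>_kL by simp
    show "set ys \<subseteq> BW \<times> BW" using xs(1) const_BW unfolding ys_def by auto
    show "(\<Sum>(b, c)\<leftarrow>ys. b * (map_poly \<sigma> ^^ j) c) = (if j = 0 then 1 else 0)" if "j < a" for j
    proof -
      have "(\<Sum>(b, c)\<leftarrow>map (\<lambda>(b, c). ([:b:], [:c:])) zs. b * (map_poly \<sigma> ^^ j) c) = [:\<Sum>(b, c)\<leftarrow>zs. b * (\<sigma> ^^ j) c:]" for zs
        by (induction zs) (auto simp: pow_const)
      then show ?thesis unfolding ys_def using xs(2)[OF that] by (simp add: pCons_one)
    qed
  qed (use a_pos in \<open>auto simp: ZW_def \<sigma>p.hom_add \<sigma>p.hom_mult \<sigma>p_order\<close>)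
  then show ?thesis by (rule that)
qed

lemma of_nat_power_poly: "of_nat n ^ m * u = Polynomial.smult (of_nat n ^ m) (u :: 'l poly)"
  by (simp add: of_nat_poly poly_const_pow)

lemma complete_galois_BW:
  obtains xs t where "complete_galois_ring BW ZW (map_poly \<sigma>) a xs p t"
proof -
  obtain xs where "galois_quotient BW ZW (map_poly \<sigma>) a xs" by (rule galois_BW)
  then interpret galois_quotient BW ZW "map_poly \<sigma>" a xs .
  obtain t where t: "t \<in> W" "trace t = 1" by (rule trace_one)
  obtain N where N: "\<And>u. u \<in> BW \<Longrightarrow> \<exists>r. (\<forall>i. Polynomial.coeff r i \<in> W) \<and>
    (\<forall>i\<ge>N. Polynomial.coeff r i = 0) \<and> kL dvd u - pcompose r Y" by (rule truncate) blast
  have "complete_galois_ring BW ZW (map_poly \<sigma>) a xs p [:t:]"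
  proof
    show "x \<in> ZW" if "of_nat p * x \<in> ZW" for x
      using that of_nat_power_poly[of p 1 x] unfolding ZW_def by (simp add: dvd_smult_iff)
    show "[:t:] \<in> BW" using const_BW t by blast
    have "(map_poly \<sigma> ^^ j) [:c:] = [:(\<sigma> ^^ j) c:]" for j c
      by (rule poly_eqI) (simp add: coeff_\<sigma>_power coeff_pCons \<sigma>_power_hom split: nat.splits)
    then have "(\<Sum>j<a. (map_poly \<sigma> ^^ j) [:t:]) = [:\<Sum>j<a. (\<sigma> ^^ j) t:]" 
      by (intro poly_eqI) (simp add: coeff_sum coeff_pCons split: nat.splits)
    then show "(\<Sum>j<a. (map_poly \<sigma> ^^ j) [:t:]) = 1" using t(2) by (simp add: trace_def pCons_one)
  next
    obtain Y0 where Y0: "finite Y0" "\<And>w. w \<in> W \<Longrightarrow> \<exists>y\<in>Y0. \<exists>t\<in>W. w = y + of_nat p * t" "0 \<in> Y0"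
      using W_finite_mod_p by blast
    define S where "S = (\<lambda>f. pcompose (\<Sum>i<N. Polynomial.monom (f i) i) Y) ` ({..<N} \<rightarrow>\<^sub>E Y0)"
    have "finite S" unfolding S_def using Y0(1) by (simp add: finite_PiE)
    moreover have "\<exists>y\<in>S. \<exists>b\<in>BW. \<exists>z\<in>ZW. u - y = of_nat p * b + z" if u: "u \<in> BW" for u
    proof -
      obtain r where r: "\<forall>i. Polynomial.coeff r i \<in> W" "\<forall>i\<ge>N. Polynomial.coeff r i = 0" "kL dvd u - pcompose r Y"
        using N[OF u] by blast
      have "\<forall>i. \<exists>y t. y \<in> Y0 \<and> t \<in> W \<and> Polynomial.coeff r i = y + of_nat p * t" using Y0(2) r(1) by blast
      then obtain y t where yt: "\<And>i. y i \<in> Y0" "\<And>i. t i \<in> W" "\<And>i. Polynomial.coeff r i = y i + of_nat p * t i"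
        by metis
      define q where "q = (\<Sum>i<N. Polynomial.monom (y i) i)"
      define T where "T = (\<Sum>i<N. Polynomial.monom (t i) i)"
      have cT: "Polynomial.coeff T i = (if i < N then t i else 0)"
        and cq: "Polynomial.coeff q i = (if i < N then y i else 0)" for i
        unfolding T_def q_def by (simp_all add: coeff_sum if_distrib cong: if_cong)
      have "r = q + Polynomial.smult (of_nat p) T"
        by (rule poly_eqI) (use r(2) yt(3) in \<open>auto simp: cT cq\<close>)
      then have "u - pcompose q Y = of_nat p * pcompose T Y + (u - pcompose r Y)"
        using of_nat_power_poly[of p 1] by (simp add: pcompose_add pcompose_smult)
      moreover have "pcompose T Y \<in> BW" by (rule BWI[of T]) (use yt(2) in \<open>auto simp: cT\<close>)
      moreover have "pcompose q Y \<in> S" unfolding S_def q_def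
        by (rule image_eqI[of _ _ "\<lambda>i\<in>{..<N}. y i"]) (use yt(1) in auto)
      ultimately show ?thesis using r(3) unfolding ZW_def by blast
    qed
    ultimately show "\<exists>Y. finite Y \<and> (\<forall>x\<in>BW. \<exists>y\<in>Y. \<exists>b\<in>BW. \<exists>z\<in>ZW. x - y = of_nat p * b + z)" by blast
  next
    fix f :: "nat \<Rightarrow> 'l poly" assume f: "\<And>n. f n \<in> BW"
    then have "\<forall>n. \<exists>r. (\<forall>i. Polynomial.coeff r i \<in> W) \<and> (\<forall>i\<ge>N. Polynomial.coeff r i = 0) \<and> kL dvd f n - pcompose r Y"
      using N by blast
    from choice[OF this] obtain r where r: "\<And>n i. Polynomial.coeff (r n) i \<in> W"
      "\<And>n i. i \<ge> N \<Longrightarrow> Polynomial.coeff (r n) i = 0" "\<And>n. kL dvd f n - pcompose (r n) Y" by blast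
    have "\<forall>i. \<exists>x\<in>W. \<forall>n. \<exists>t\<in>W. x - (\<Sum>m<n. of_nat p ^ m * Polynomial.coeff (r m) i) = of_nat p ^ n * t"
      using W_complete[of "\<lambda>m. Polynomial.coeff (r m) _"] r(1) by blast
    then obtain x t where x: "\<And>i. x i \<in> W" "\<And>i n. t i n \<in> W"
      "\<And>i n. x i - (\<Sum>m<n. of_nat p ^ m * Polynomial.coeff (r m) i) = of_nat p ^ n * t i n"
      unfolding Bex_def by metis
    define X' where "X' = (\<Sum>i<N. Polynomial.monom (x i) i)"
    define T where "T = (\<lambda>n. \<Sum>i<N. Polynomial.monom (t i n) i)"
    have cT: "Polynomial.coeff (T n) i = (if i < N then t i n else 0)"
      and cX: "Polynomial.coeff X' i = (if i < N then x i else 0)" for i n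
      unfolding T_def X'_def by (simp_all add: coeff_sum if_distrib cong: if_cong)
    show "\<exists>x\<in>BW. \<forall>n. \<exists>b\<in>BW. \<exists>z\<in>ZW. x - (\<Sum>m<n. of_nat p ^ m * f m) = of_nat p ^ n * b + z"
    proof (rule bexI[of _ "pcompose X' Y"], intro allI)
      show "pcompose X' Y \<in> BW" by (rule BWI[of X']) (use x(1) in \<open>auto simp: cX\<close>)
      fix n
      have TB: "pcompose (T n) Y \<in> BW" by (rule BWI[of "T n"]) (use x(2) in \<open>auto simp: cT\<close>)
      have rZ: "- (\<Sum>m<n. of_nat p ^ m * (f m - pcompose (r m) Y)) \<in> ZW"
        unfolding ZW_def using r(3) by (auto intro!: dvd_sum dvd_mult)
      have "X' - (\<Sum>m<n. Polynomial.smult (of_nat p ^ m) (r m)) = Polynomial.smult (of_nat p ^ n) (T n)"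
        by (rule poly_eqI) (use x(3) r(2) in \<open>auto simp: cX cT coeff_sum\<close>)
      then have "pcompose X' Y - (\<Sum>m<n. of_nat p ^ m * pcompose (r m) Y) = of_nat p ^ n * pcompose (T n) Y"
        unfolding of_nat_power_poly by (metis (mono_tags, lifting) pcompose_diff pcompose_smult pcompose_sum sum.cong)
      then have "pcompose X' Y - (\<Sum>m<n. of_nat p ^ m * f m) =
          of_nat p ^ n * pcompose (T n) Y + - (\<Sum>m<n. of_nat p ^ m * (f m - pcompose (r m) Y))"
        by (simp add: algebra_simps sum_subtractf)
      then show "\<exists>b\<in>BW. \<exists>z\<in>ZW. pcompose X' Y - (\<Sum>m<n. of_nat p ^ m * f m) = of_nat p ^ n * b + z"
        using TB rZ by blast
    qed
  next
    fix x assume x: "\<And>n. \<exists>b\<in>BW. \<exists>z\<in>ZW. x = of_nat p ^ n * b + z"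
    obtain M where M: "\<forall>c\<in>(\<Union>i<N. set (coeffs (Y ^ i mod kL))). of_nat p ^ M * c \<in> W"
      using L.clear_denominators[of "\<Union>i<N. set (coeffs (Y ^ i mod kL))"] by auto
    have M': "of_nat p ^ M * Polynomial.coeff (Y ^ i mod kL) j \<in> W" if "i < N" for i j
    proof (cases "Polynomial.coeff (Y ^ i mod kL) j = 0")
      case False
      then have "Polynomial.coeff (Y ^ i mod kL) j \<in> set (coeffs (Y ^ i mod kL))"
        by (metis coeff_in_coeffs le_degree coeff_0)
      then show ?thesis using M that by blast
    qed simp
    have "Polynomial.coeff (x mod kL) j = 0" for j
    proof -
      have "of_nat p ^ M * Polynomial.coeff (x mod kL) j = 0"
      proof (rule L.zero_if_divisible)
        fix n
        obtain b z where b: "b \<in> BW" "z \<in> ZW" "x = of_nat p ^ n * b + z" using x by blast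
        obtain r where r: "\<forall>i. Polynomial.coeff r i \<in> W" "\<forall>i\<ge>N. Polynomial.coeff r i = 0" "kL dvd b - pcompose r Y"
          using N[OF b(1)] by blast
        have "kL dvd of_nat p ^ n * (b - pcompose r Y) + z" using r(3) b(2) unfolding ZW_def by simp
        moreover have "x - of_nat p ^ n * pcompose r Y = of_nat p ^ n * (b - pcompose r Y) + z"
          unfolding b(3) by (simp add: algebra_simps)
        ultimately have "x mod kL = (of_nat p ^ n * pcompose r Y) mod kL" by (simp add: mod_eq_dvd_iff)
        also have "\<dots> = Polynomial.smult (of_nat p ^ n) (\<Sum>i<N. Polynomial.smult (Polynomial.coeff r i) (Y ^ i mod kL))"
        proof -
          have "pcompose r Y = (\<Sum>i<N. Polynomial.smult (Polynomial.coeff r i) (Y ^ i))"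
            by (rule pcompose_truncated) (use r(2) in blast)
          then have "pcompose r Y mod kL = (\<Sum>i<N. Polynomial.smult (Polynomial.coeff r i) (Y ^ i mod kL))"
            by (simp only: poly_sum_mod mod_smult_left)
          then show ?thesis by (simp only: of_nat_power_poly mod_smult_left)
        qed
        finally have "of_nat p ^ M * Polynomial.coeff (x mod kL) j =
            of_nat p ^ n * (\<Sum>i<N. Polynomial.coeff r i * (of_nat p ^ M * Polynomial.coeff (Y ^ i mod kL) j))"
          by (simp add: coeff_sum sum_distrib_left ac_simps)
        moreover have "(\<Sum>i<N. Polynomial.coeff r i * (of_nat p ^ M * Polynomial.coeff (Y ^ i mod kL) j)) \<in> W"
          by (rule L.O_sum, rule L.O_mult[OF r(1)[rule_format] M']) simp
        ultimately show "\<exists>t\<in>W. of_nat p ^ M * Polynomial.coeff (x mod kL) j = of_nat p ^ n * t" by blast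
      qed
      moreover have "p \<noteq> 0" using p_pos by (rule gr_implies_not0)
      ultimately show ?thesis by simp
    qed
    then have "x mod kL = 0" by (intro poly_eqI) simp
    then show "x \<in> ZW" unfolding ZW_def by (simp add: mod_eq_0_iff_dvd)
  qed
  then show ?thesis by (rule that)
qed

lemma inverse_BW: "map_poly \<iota> yi \<in> BW"
proof -
  obtain P where P: "Polynomial.lead_coeff P = 1" "\<And>i. Polynomial.coeff P i \<in> \<O>" "k dvd pcompose P yi"
    using integral_yi by blast
  define n where "n = Polynomial.degree P"
  define G where "G = - (\<Sum>i<n. Polynomial.monom (Polynomial.coeff P i) (n - 1 - i))"
  have pw: "k dvd yy ^ i * yi ^ i - 1" for i
  proof (induction i)
    case (Suc i)
    have "yy ^ Suc i * yi ^ Suc i - 1 = yy ^ i * yi ^ i * (yy * yi - 1) + (yy ^ i * yi ^ i - 1)" by (simp add: algebra_simps)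
    then show ?case using Suc unit by (simp only: dvd_add dvd_mult)
  qed simp
  have "k dvd yi - pcompose G yy"
  proof (cases "n = 0")
    case True
    then have "P = 1" using P(1) unfolding n_def by (metis degree_eq_zeroE lead_coeff_pCons(2) one_pCons)
    then have "k dvd 1" using P(3) by (simp add: pcompose_1)
    then show ?thesis by (meson dvd_trans one_dvd)
  next
    case False
    have "pcompose P yi = (\<Sum>i<Suc n. Polynomial.smult (Polynomial.coeff P i) (yi ^ i))"
      by (rule pcompose_truncated) (simp add: n_def coeff_eq_0)
    also have "\<dots> = (\<Sum>i<n. Polynomial.smult (Polynomial.coeff P i) (yi ^ i)) + yi ^ n"
      using P(1) by (simp add: n_def)
    finally have Pe: "pcompose P yi = (\<Sum>i<n. Polynomial.smult (Polynomial.coeff P i) (yi ^ i)) + yi ^ n" .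
    have monom: "pcompose (Polynomial.monom c i) yy = Polynomial.smult c (yy ^ i)" for c i
      by (induction i) (auto simp: monom_Suc pcompose_pCons monom_0)
    have Ge: "pcompose G yy = - (\<Sum>i<n. Polynomial.smult (Polynomial.coeff P i) (yy ^ (n - 1 - i)))"
      unfolding G_def by (simp add: pcompose_uminus pcompose_sum monom)
    obtain m where m: "n = Suc m" using False by (cases n) auto
    have "yy ^ (n - 1) * Polynomial.smult c (yi ^ i) = Polynomial.smult c (yy ^ (n - 1 - i) * (yy ^ i * yi ^ i))"
      if "i < n" for i c
    proof -
      have "yy ^ (n - 1) = yy ^ (n - 1 - i) * yy ^ i" using that by (simp flip: power_add)
      then show ?thesis by (simp only: mult.assoc mult_smult_right)
    qed
    then have S: "yy ^ (n - 1) * (\<Sum>i<n. Polynomial.smult (Polynomial.coeff P i) (yi ^ i)) =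
        (\<Sum>i<n. Polynomial.smult (Polynomial.coeff P i) (yy ^ (n - 1 - i) * (yy ^ i * yi ^ i)))"
      unfolding sum_distrib_left by (intro sum.cong) auto
    have "yi - pcompose G yy = yy ^ (n - 1) * pcompose P yi - yi * (yy ^ (n - 1) * yi ^ (n - 1) - 1) -
        (\<Sum>i<n. Polynomial.smult (Polynomial.coeff P i) (yy ^ (n - 1 - i) * (yy ^ i * yi ^ i - 1)))"
      unfolding Ge Pe distrib_left S unfolding m
      by (simp add: algebra_simps smult_diff_right sum_subtractf)
    also have "k dvd \<dots>"
      by (rule dvd_diff[OF dvd_diff[OF dvd_mult[OF P(3)] dvd_mult[OF pw]]], rule dvd_sum, rule dvd_smult,
        rule dvd_mult, rule pw)
    finally show ?thesis .
  qed
  then have "kL dvd map_poly \<iota> yi - pcompose (map_poly \<iota> G) Y"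
    using \<iota>p.hom_dvd[of k "yi - pcompose G yy"] unfolding kL_def Y_def
    by (simp add: \<iota>p.hom_minus \<iota>.map_poly_pcompose)
  moreover have "Polynomial.coeff G i \<in> \<O>" for i
    unfolding G_def by (auto simp: coeff_sum intro!: O_minus O_sum P(2))
  ultimately show ?thesis by (intro BWI[of "map_poly \<iota> G"]) auto
qed

theorem norm_equation:
  obtains \<beta> \<beta>' where "\<beta> \<in> BW" "\<beta>' \<in> BW" "kL dvd \<beta> * \<beta>' - 1"
    "kL dvd (\<Prod>j<a. (map_poly \<sigma> ^^ j) \<beta>) - Y"
proof -
  obtain xs t where "complete_galois_ring BW ZW (map_poly \<sigma>) a xs p t" by (rule complete_galois_BW)
  then interpret C: complete_galois_ring BW ZW "map_poly \<sigma>" a xs p t .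
  have kunit: "kL dvd Y * map_poly \<iota> yi - 1"
    using \<iota>p.hom_dvd[OF unit] unfolding kL_def Y_def by (simp add: \<iota>p.hom_minus \<iota>p.hom_mult)
  obtain \<beta> where \<beta>: "\<beta> \<in> BW" "C.eqv (C.norm_s \<beta>) Y"
  proof (rule C.norm_surjective_complete[OF Y_BW inverse_BW])
    show "C.eqv (Y * map_poly \<iota> yi) 1" unfolding C.eqv_def unfolding ZW_def using kunit by simp
    show "C.eqv (map_poly \<sigma> Y) Y" unfolding \<sigma>_Y by (rule C.eqv_refl)
  qed
  have n: "kL dvd C.norm_s \<beta> - Y" using \<beta>(2) unfolding C.eqv_def unfolding ZW_def by simp
  obtain y where y: "y \<in> BW" "C.norm_s \<beta> = \<beta> * y" using C.norm_factor[OF \<beta>(1)] by blast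
  have "\<beta> * (y * map_poly \<iota> yi) - 1 = (C.norm_s \<beta> - Y) * map_poly \<iota> yi + (Y * map_poly \<iota> yi - 1)"
    unfolding y(2) by (simp add: algebra_simps)
  then have "kL dvd \<beta> * (y * map_poly \<iota> yi) - 1" using n kunit by (simp only: dvd_add dvd_mult2)
  moreover have "y * map_poly \<iota> yi \<in> BW" using y(1) inverse_BW by (rule C.B_rules(4))
  ultimately show ?thesis using that \<beta>(1) n unfolding C.norm_s_def by blast
qed

end

section \<open>The algebra \<open>K[x]/(h)\<close>\<close>

lemma poly_bezout:
  fixes u w :: "'b::field poly"
  shows "\<exists>s t. s * u + t * w dvd u \<and> s * u + t * w dvd w"
proof (induction "if w = 0 then 0 else Suc (Polynomial.degree w)" arbitrary: u w rule: less_induct)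
  case less
  show ?case
  proof (cases "w = 0")
    case True
    then show ?thesis by (intro exI[of _ 1] exI[of _ 0]) simp
  next
    case False
    then have "(if u mod w = 0 then 0 else Suc (Polynomial.degree (u mod w))) < (if w = 0 then 0 else Suc (Polynomial.degree w))"
      using degree_mod_less[OF False, of u] by auto
    from less[OF this] obtain s t where st: "s * w + t * (u mod w) dvd w" "s * w + t * (u mod w) dvd u mod w" by blast
    have "t * u + (s - t * q) * w = s * w + t * (u - q * w)" for q by (simp add: algebra_simps)
    from this[of "u div w"] have eq: "t * u + (s - t * (u div w)) * w = s * w + t * (u mod w)"
      by (simp only: minus_div_mult_eq_mod)
    have "s * w + t * (u mod w) dvd u div w * w + u mod w" using st by (intro dvd_add dvd_mult)
    then have "s * w + t * (u mod w) dvd u" by simp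
    then show ?thesis using st(1) by (intro exI[of _ t] exI[of _ "s - t * (u div w)"]) (simp add: eq)
  qed
qed

lemma coprime_bezout:
  fixes u w :: "'b::field poly"
  assumes "coprime u w" obtains s t where "s * u + t * w = 1"
proof -
  obtain s t where st: "s * u + t * w dvd u" "s * u + t * w dvd w" using poly_bezout by blast
  then have "s * u + t * w dvd 1" using assms by (metis coprime_common_divisor)
  then obtain r where r: "1 = (s * u + t * w) * r" by (rule dvdE)
  then have "(s * r) * u + (t * r) * w = 1" by (simp add: algebra_simps)
  then show ?thesis by (rule that)
qed

lemma coprime_pderiv_of_squarefree:
  fixes h :: "int poly"
  assumes "squarefree h" "h \<noteq> 0"
  shows "coprime (map_poly of_int h :: 'b::field_char_0 poly) (pderiv (map_poly of_int h))"
proof -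
  interpret rat: field_hom "of_rat :: rat \<Rightarrow> 'b" by unfold_locales (auto simp: of_rat_add of_rat_mult)
  interpret ratp: map_poly_inj_idom_hom "of_rat :: rat \<Rightarrow> 'b" ..
  have "square_free h"
    unfolding square_free_def
  proof (intro conjI allI impI notI)
    fix q assume q: "Polynomial.degree q > 0" "q * q dvd h"
    then have "q dvd 1" using assms(1) unfolding squarefree_def power2_eq_square by blast
    then obtain r where r: "q * r = 1" by (metis dvdE)
    then have "q \<noteq> 0" "r \<noteq> 0" by auto
    then have "Polynomial.degree (q * r) = Polynomial.degree q + Polynomial.degree r" by (rule degree_mult_eq)
    then show False using q(1) unfolding r by simp
  qed (use assms(2) in simp)
  then have "square_free (map_poly rat_of_int h)" by (rule square_free_int_rat)
  then have "separable (map_poly rat_of_int h)" by (rule square_free_imp_separable)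
  then have "coprime (map_poly rat_of_int h) (pderiv (map_poly rat_of_int h))"
    unfolding separable_def .
  from coprime_bezout[OF this]
  obtain s t where "s * map_poly rat_of_int h + t * pderiv (map_poly rat_of_int h) = 1" .
  then have "map_poly of_rat (s * map_poly rat_of_int h + t * pderiv (map_poly rat_of_int h)) = (1 :: 'b poly)" by simp
  moreover have "map_poly of_rat (map_poly rat_of_int h) = (map_poly of_int h :: 'b poly)"
    by (rule poly_eqI) simp
  moreover have pd: "map_poly of_rat (pderiv f) = (pderiv (map_poly of_rat f) :: 'b poly)" for f
    by (rule poly_eqI) (simp add: coeff_pderiv of_rat_mult of_rat_add)
  ultimately have "map_poly of_rat s * map_poly of_int h + map_poly of_rat t * pderiv (map_poly of_int h) = (1 :: 'b poly)"
    by (simp add: ratp.hom_add ratp.hom_mult pd)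
  then show ?thesis by (metis coprimeI dvd_add dvd_mult)
qed

lemma dvd_if_roots:
  fixes k z :: "'k::field_char_0 poly"
  assumes sep: "coprime k (pderiv k)" and k: "k \<noteq> 0"
    and roots: "\<And>\<rho>. poly (map_poly to_ac k) \<rho> = 0 \<Longrightarrow> poly (map_poly to_ac z) \<rho> = 0"
  shows "k dvd z"
proof -
  obtain s0 t0 where d0: "s0 * k + t0 * z dvd k" "s0 * k + t0 * z dvd z" using poly_bezout by blast
  define d where "d = s0 * k + t0 * z"
  obtain k' where k': "k = d * k'" using d0(1) unfolding d_def by (rule dvdE)
  show ?thesis
  proof (cases "Polynomial.degree k' = 0")
    case True
    then obtain c where "k' = [:c:]" by (rule degree_eq_zeroE)
    then have c: "c \<noteq> 0" "k = Polynomial.smult c d" using k k' by auto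
    then have "d = k * [:inverse c:]" by simp
    then have "k dvd d" by (rule dvdI)
    then show ?thesis using d0(2)[folded d_def] by (rule dvd_trans)
  next
    case False
    then have "Polynomial.degree (map_poly to_ac k') > 0" by simp
    then obtain \<rho> where \<rho>: "poly (map_poly to_ac k') \<rho> = 0" using alg_closed_imp_poly_has_root by blast
    have kr: "poly (map_poly to_ac k) \<rho> = 0" unfolding k' using \<rho> by (simp add: to_acp.hom_mult)
    then have zr: "poly (map_poly to_ac z) \<rho> = 0" by (rule roots)
    have dr: "poly (map_poly to_ac d) \<rho> = 0"
      unfolding d_def using kr zr by (simp add: to_acp.hom_add to_acp.hom_mult)
    obtain s t where "s * k + t * pderiv k = 1" using coprime_bezout[OF sep] by blast
    then have "s * (d * k') + t * (d * pderiv k' + k' * pderiv d) = 1" unfolding k' by (simp add: pderiv_mult)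
    then have "poly (map_poly to_ac (s * (d * k') + t * (d * pderiv k' + k' * pderiv d))) \<rho> = 1" by simp
    then show ?thesis using dr \<rho> by (simp add: to_acp.hom_add to_acp.hom_mult)
  qed
qed

context
  fixes h :: "int poly"
begin

abbreviation modulus :: "'b::field_char_0 poly" where "modulus \<equiv> map_poly of_int h"

lemma quot_alg_simps [simp]:
  "carrier (quot_alg h :: 'b::field_char_0 poly ring) = {u. u mod modulus = u}"
  "u \<otimes>\<^bsub>quot_alg h\<^esub> w = (u * w) mod modulus" "u \<oplus>\<^bsub>quot_alg h\<^esub> w = u + w"
  "\<zero>\<^bsub>quot_alg h\<^esub> = 0" "\<one>\<^bsub>quot_alg h\<^esub> = 1 mod modulus"
  by (simp_all add: quot_alg_def)

lemma comm_monoid_quot_alg: "comm_monoid (quot_alg h :: 'b::field_char_0 poly ring)"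
  by (rule comm_monoidI) (auto simp: mod_mult_left_eq mod_mult_right_eq ac_simps)

lemma cring_quot_alg: "cring (quot_alg h :: 'b::field_char_0 poly ring)"
proof (rule cringI)
  show "abelian_group (quot_alg h :: 'b poly ring)"
  proof (rule abelian_groupI)
    fix x :: "'b poly" assume "x \<in> carrier (quot_alg h)"
    then show "\<exists>y\<in>carrier (quot_alg h). y \<oplus>\<^bsub>quot_alg h\<^esub> x = \<zero>\<^bsub>quot_alg h\<^esub>"
      by (intro bexI[of _ "- x"]) (auto simp: poly_mod_minus_left)
  qed (auto simp: poly_mod_add_left)
  show "comm_monoid (quot_alg h :: 'b poly ring)" by (rule comm_monoid_quot_alg)
qed (auto simp: mod_mult_left_eq distrib_right poly_mod_add_left)

lemma a_minus_quot_alg: "x \<in> carrier (quot_alg h) \<Longrightarrow> y \<in> carrier (quot_alg h) \<Longrightarrow>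
    x \<ominus>\<^bsub>quot_alg h\<^esub> y = x - (y :: 'b::field_char_0 poly)"
proof -
  assume y: "y \<in> carrier (quot_alg h)"
  interpret cring "quot_alg h :: 'b poly ring" by (rule cring_quot_alg)
  have "\<ominus>\<^bsub>quot_alg h\<^esub> y = - y"
    by (rule minus_equality) (use y in \<open>auto simp: poly_mod_minus_left\<close>)
  then show ?thesis by (simp add: a_minus_def)
qed

definition xinv :: "'b::field_char_0 poly" where
  "xinv = Polynomial.smult (- inverse (of_int (Polynomial.coeff h 0))) (map_poly of_int (poly_shift 1 h))"

lemma x_xinv:
  assumes "Polynomial.coeff h 0 \<noteq> 0"
  shows "modulus dvd [:0, 1:] * xinv - (1 :: 'b::field_char_0 poly)"
proof -
  define T :: "'b poly" where "T = map_poly of_int (poly_shift 1 h)"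
  define c :: 'b where "c = of_int (Polynomial.coeff h 0)"
  have "pCons (Polynomial.coeff h 0) (poly_shift 1 h) = h"
    by (rule poly_eqI) (simp add: coeff_pCons coeff_poly_shift split: nat.splits)
  then have "(modulus :: 'b poly) = map_poly of_int (pCons (Polynomial.coeff h 0) (poly_shift 1 h))" by simp
  also have "\<dots> = pCons c T" unfolding c_def T_def by (simp add: of_int_hom.map_poly_pCons_hom)
  finally have m: "(modulus :: 'b poly) = pCons c T" .
  have c: "c \<noteq> 0" using assms unfolding c_def by simp
  have "[:0, 1:] * xinv - (1 :: 'b poly) = Polynomial.smult (- inverse c) (pCons c T)"
  proof (rule poly_eqI)
    fix i
    show "Polynomial.coeff ([:0, 1:] * xinv - (1 :: 'b poly)) i = Polynomial.coeff (Polynomial.smult (- inverse c) (pCons c T)) i"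
      unfolding xinv_def T_def[symmetric] c_def[symmetric] using c by (cases i) simp_all
  qed
  then show ?thesis unfolding m by (simp only: dvd_smult dvd_refl)
qed

lemma xinv_hom:
  assumes "field_hom f" shows "map_poly f (xinv :: 'b::field_char_0 poly) = (xinv :: 'c::field_char_0 poly)"
    "map_poly f (modulus :: 'b poly) = (modulus :: 'c poly)"
proof -
  interpret f: field_hom f by fact
  show "map_poly f (xinv :: 'b poly) = xinv"
    unfolding xinv_def by (rule poly_eqI) (simp add: f.hom_mult f.hom_uminus f.hom_inverse f.hom_of_int)
  show "map_poly f (modulus :: 'b poly) = modulus"
    by (rule poly_eqI) (simp add: f.hom_of_int)
qed

end

section \<open>The slope condition\<close>

locale slope_setting = unramified p v \<iota> vL a \<sigma>
  for p and v :: "'k::field_char_0 \<Rightarrow> ereal" and \<iota> :: "'k \<Rightarrow> 'l::field_char_0" and vL a \<sigma> +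
  fixes h :: "int poly" and S :: "real set"
  assumes h_nonzero: "h \<noteq> 0" and h_coeff_0: "Polynomial.coeff h 0 \<noteq> 0" and h_squarefree: "squarefree h"
    and S: "S = {0} \<or> S = {1}"
begin

abbreviation H :: "'k poly" where "H \<equiv> map_poly of_int h"

text \<open>
  On the slope 0 part the unit in \<open>R\<close> is \<open>\<pi>\<close>, on the slope 1 part it is \<open>q/\<pi>\<close>.
\<close>

definition zz :: "'k poly" where
  "zz = (if S = {0} then [:0, 1:] else Polynomial.smult (of_nat p ^ a) (xinv h))"
definition zi :: "'k poly" where
  "zi = (if S = {0} then xinv h else Polynomial.smult (inverse (of_nat p ^ a)) [:0, 1:])"

lemma zz_zi: "H dvd zz * zi - 1"
proof -
  have q: "(of_nat p ^ a :: 'k) \<noteq> 0" using gr_implies_not0[OF p_pos] by simp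
  have "zz * zi = [:0, 1:] * xinv h"
  proof (cases "S = {0}")
    case False
    have "zz * zi = Polynomial.smult (inverse (of_nat p ^ a) * of_nat p ^ a) (xinv h * [:0, 1:])"
      unfolding zz_def zi_def using False by (simp only: if_False mult_smult_left mult_smult_right smult_smult)
    also have "\<dots> = xinv h * [:0, 1:]" by (simp only: left_inverse[OF q] smult_1_left)
    also have "\<dots> = [:0, 1:] * xinv h" by (rule mult.commute)
    finally show ?thesis .
  qed (unfold zz_def zi_def, simp)
  then show ?thesis using x_xinv[OF h_coeff_0, where 'b = 'k] by (simp only:)
qed

definition wb :: "('k poly \<Rightarrow> ereal) \<Rightarrow> 'k poly \<Rightarrow> ereal" where "wb w u = w (u mod H)"

context
  fixes w assumes w: "w \<in> places p v h"
begin

lemma wb_mult: "wb w (u1 * u2) = wb w u1 + wb w u2"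
proof -
  have "w ((u1 mod H) \<otimes>\<^bsub>quot_alg h\<^esub> (u2 mod H)) = w (u1 mod H) + w (u2 mod H)"
    using w unfolding places_def normalized_valuation_def by auto
  then show ?thesis unfolding wb_def by (simp add: mod_mult_eq)
qed

lemma wb_add: "min (wb w u1) (wb w u2) \<le> wb w (u1 + u2)"
proof -
  have "min (w (u1 mod H)) (w (u2 mod H)) \<le> w ((u1 mod H) \<oplus>\<^bsub>quot_alg h\<^esub> (u2 mod H))"
    using w unfolding places_def normalized_valuation_def by auto
  then show ?thesis unfolding wb_def by (simp add: poly_mod_add_left)
qed

lemma wb_range: "wb w u = \<infinity> \<or> (\<exists>k::int. wb w u = ereal (of_int k))"
proof -
  have "w ` carrier (quot_alg h) = insert \<infinity> (range (\<lambda>k::int. ereal (of_int k)))"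
    using w unfolding places_def normalized_valuation_def by auto
  moreover have "u mod H \<in> carrier (quot_alg h)" by simp
  ultimately have "w (u mod H) \<in> insert \<infinity> (range (\<lambda>k::int. ereal (of_int k)))" by blast
  then show ?thesis unfolding wb_def by auto
qed

lemma wb_zero: "wb w 0 = \<infinity>" and wb_one: "wb w 1 = 0"
  using w unfolding places_def normalized_valuation_def wb_def by auto

lemma wb_const: "wb w [:c:] = wb w [:of_nat p:] * v c" and wb_p_pos: "0 < wb w [:of_nat p:]"
  using w unfolding places_def wb_def scalar_def by blast+

lemma wb_cong: "H dvd u1 - u2 \<Longrightarrow> wb w u1 = wb w u2"
  unfolding wb_def using mod_eq_dvd_iff[of u1 H u2] by simp

lemma wb_p_finite: obtains e :: int where "wb w [:of_nat p:] = ereal (of_int e)" "0 < e"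
proof -
  have "wb w [:of_nat p:] \<noteq> \<infinity>"
  proof
    assume inf: "wb w [:of_nat p:] = \<infinity>"
    have "v (inverse (of_nat p)) = -1" using v_power_int[of "-1"] by (simp add: one_ereal_def)
    then have "wb w [:inverse (of_nat p):] = - \<infinity>" using wb_const[of "inverse (of_nat p)"] inf by simp
    then show False using wb_range[of "[:inverse (of_nat p):]"] by auto
  qed
  then show ?thesis using wb_range[of "[:of_nat p:]"] wb_p_pos that by auto
qed

lemma wb_x: obtains m :: int where "wb w [:0, 1:] = ereal (of_int m)" "wb w (xinv h) = ereal (of_int (- m))"
proof -
  have "wb w ([:0, 1:] * xinv h) = 0"
    using wb_cong[OF x_xinv[OF h_coeff_0]] wb_one by simp
  then have "wb w [:0, 1:] + wb w (xinv h) = 0" unfolding wb_mult .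
  then show ?thesis using wb_range[of "[:0, 1:]"] wb_range[of "xinv h"] that by (auto simp: zero_ereal_def)
qed

lemma wb_unit:
  assumes "slope p a h w \<in> S" shows "wb w zz = 0" "wb w zi = 0"
proof -
  obtain e :: int where e: "wb w [:of_nat p:] = ereal (of_int e)" "0 < e" by (rule wb_p_finite)
  obtain m :: int where m: "wb w [:0, 1:] = ereal (of_int m)" "wb w (xinv h) = ereal (of_int (- m))" by (rule wb_x)
  have sl: "slope p a h w = of_int m / (real a * of_int e)"
    unfolding slope_def frob_def scalar_def using e m unfolding wb_def by simp
  have smult: "wb w (Polynomial.smult c u) = wb w [:of_nat p:] * v c + wb w u" for c u
    using wb_mult[of "[:c:]" u] wb_const[of c] by simp
  have v1: "v (of_nat p ^ a) = ereal (real a)" by (rule v_p_power)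
  have v2: "v (inverse (of_nat p ^ a)) = ereal (- real a)"
    using v_power_int[of "- int a"] by (simp add: power_int_minus)
  show zz0: "wb w zz = 0"
  proof (cases "S = {0}")
    case True
    then have "m = 0" using sl assms e(2) a_pos by simp
    then show ?thesis using True m unfolding zz_def by (simp add: zero_ereal_def)
  next
    case False
    then have "of_int m = real a * of_int e" using sl assms S e(2) a_pos by (simp add: field_simps)
    then show ?thesis using False m e v1 unfolding zz_def by (simp add: smult zero_ereal_def)
  qed
  have "wb w zz + wb w zi = 0" using wb_cong[OF zz_zi] wb_one wb_mult by metis
  then show "wb w zi = 0" using zz0 by simp
qed

end

definition g :: "'k poly" where
  "g = (SOME g. g \<noteq> 0 \<and> g mod H \<in> E_part p a v h S \<and>
     (\<forall>u. u \<noteq> 0 \<longrightarrow> u mod H \<in> E_part p a v h S \<longrightarrow> Polynomial.degree g \<le> Polynomial.degree u))"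

lemma E_part_iff: "u mod H \<in> E_part p a v h S \<longleftrightarrow> (\<forall>w\<in>places p v h. slope p a h w \<notin> S \<longrightarrow> wb w u = \<infinity>)"
  unfolding E_part_def wb_def by simp

lemma H_nonzero: "H \<noteq> 0" using h_nonzero by simp

lemma g_nonzero: "g \<noteq> 0" and g_E: "g mod H \<in> E_part p a v h S"
  and g_min: "u \<noteq> 0 \<Longrightarrow> u mod H \<in> E_part p a v h S \<Longrightarrow> Polynomial.degree g \<le> Polynomial.degree u"
proof -
  define Q where "Q = (\<lambda>u :: 'k poly. u \<noteq> 0 \<and> u mod H \<in> E_part p a v h S)"
  have "Q H" unfolding Q_def E_part_iff using H_nonzero wb_zero wb_cong[of _ H 0] by auto
  then have "\<exists>x. Q x \<and> (\<forall>y. Q y \<longrightarrow> Polynomial.degree x \<le> Polynomial.degree y)"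
    by (rule ex_has_least_nat)
  then have "\<exists>g. g \<noteq> 0 \<and> g mod H \<in> E_part p a v h S \<and>
     (\<forall>u. u \<noteq> 0 \<longrightarrow> u mod H \<in> E_part p a v h S \<longrightarrow> Polynomial.degree g \<le> Polynomial.degree u)"
    unfolding Q_def by blast
  from someI_ex[OF this, folded g_def]
  show "g \<noteq> 0" "g mod H \<in> E_part p a v h S"
    "u \<noteq> 0 \<Longrightarrow> u mod H \<in> E_part p a v h S \<Longrightarrow> Polynomial.degree g \<le> Polynomial.degree u" by auto
qed

lemma E_part_dvd: "u mod H \<in> E_part p a v h S \<longleftrightarrow> g dvd u"
proof
  have mult: "(u * g) mod H \<in> E_part p a v h S" for u
    using g_E wb_mult[of _ u g] wb_range[of _ u] unfolding E_part_iff by fastforce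
  show "u mod H \<in> E_part p a v h S" if "g dvd u" using that mult by (metis dvdE mult.commute)
  assume u: "u mod H \<in> E_part p a v h S"
  have "(u mod g) mod H \<in> E_part p a v h S"
    unfolding E_part_iff
  proof (intro ballI impI)
    fix w assume w: "w \<in> places p v h" "slope p a h w \<notin> S"
    have "wb w u = \<infinity>" "wb w ((- (u div g)) * g) = \<infinity>" using u mult[of "- (u div g)"] w unfolding E_part_iff by auto
    then have "wb w (u + (- (u div g)) * g) = \<infinity>"
      using wb_add[OF w(1), of u "(- (u div g)) * g"] by simp
    then show "wb w (u mod g) = \<infinity>" by (simp add: minus_div_mult_eq_mod[symmetric])
  qed
  then have "u mod g = 0" using g_min[of "u mod g"] degree_mod_less[OF g_nonzero, of u] by force
  then show "g dvd u" by (simp add: mod_eq_0_iff_dvd)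
qed

lemma E_eq: "E_part p a v h S = {x. x mod H = x \<and> g dvd x}"
proof (rule equalityI; rule subsetI)
  fix x assume x: "x \<in> E_part p a v h S"
  then have m: "x mod H = x" unfolding E_part_def by simp
  then show "x \<in> {x. x mod H = x \<and> g dvd x}" using x E_part_dvd[of x] by simp
next
  fix x assume "x \<in> {x. x mod H = x \<and> g dvd x}"
  then show "x \<in> E_part p a v h S" using E_part_dvd[of x] by simp
qed

definition k :: "'k poly" where "k = H div g"

lemma H_factor: "H = g * k"
proof -
  have "H mod H \<in> E_part p a v h S" unfolding E_part_iff using wb_zero wb_cong[of _ H 0] by auto
  then show ?thesis unfolding E_part_dvd k_def by simp
qed

lemma k_nz: "k \<noteq> 0"
  using H_factor H_nonzero by auto

lemma coprime_g_k: "coprime g k" and coprime_k_pderiv: "coprime k (pderiv k)"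
proof -
  have *: "coprime (g * k) (g * pderiv k + k * pderiv g)"
    using coprime_pderiv_of_squarefree[OF h_squarefree h_nonzero, where 'b = 'k] unfolding H_factor by (simp add: pderiv_mult)
  show "coprime g k" by (rule coprimeI) (use * in \<open>meson coprime_common_divisor dvd_add dvd_mult dvd_mult2\<close>)
  show "coprime k (pderiv k)" by (rule coprimeI) (use * in \<open>meson coprime_common_divisor dvd_add dvd_mult dvd_mult2\<close>)
qed

text \<open>
  At a root of \<open>k\<close> the generator \<open>g\<close> does not vanish, so all places above this root have slope in \<open>S\<close>,
  and \<open>zz\<close> and \<open>zi\<close> have value 0 there.
\<close>

lemma integral_at_root:
  assumes "poly (map_poly to_ac k) \<rho> = 0"
  shows "integral (poly (map_poly to_ac zz) \<rho>)" "integral (poly (map_poly to_ac zi) \<rho>)"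
proof -
  interpret r: root_of_modulus p v h \<rho>
    by unfold_locales (use h_nonzero assms in \<open>simp_all add: H_factor to_acp.hom_mult\<close>)
  obtain s t where st: "s * g + t * k = 1" using coprime_bezout[OF coprime_g_k] by blast
  have "r.ev (s * g + t * k) = r.ev s * r.ev g + r.ev t * r.ev k" by simp
  then have gnz: "r.ev g \<noteq> 0" unfolding st using assms by (auto simp: r.ev_def)
  have *: "integral (r.ev u)" if u: "\<And>w. w \<in> places p v h \<Longrightarrow> slope p a h w \<in> S \<Longrightarrow> wb w u = 0" for u
  proof (rule ccontr)
    assume "\<not> integral (r.ev u)"
    then obtain w where w: "w \<in> places p v h" "w (u mod H) < 0"
      "\<And>u. u \<in> carrier (quot_alg h) \<Longrightarrow> w u = \<infinity> \<longleftrightarrow> r.ev u = 0" using r.non_integral_place by blast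
    have "wb w g \<noteq> \<infinity>" using w(3)[of "g mod H"] gnz unfolding wb_def by simp
    then have "slope p a h w \<in> S" using g_E w(1) unfolding E_part_iff by blast
    then show False using u[OF w(1)] w(2) unfolding wb_def by simp
  qed
  show "integral (poly (map_poly to_ac zz) \<rho>)" "integral (poly (map_poly to_ac zi) \<rho>)"
    using *[of zz] *[of zi] wb_unit unfolding r.ev_def by auto
qed

lemma integral_equation:
  assumes "\<And>\<rho>. poly (map_poly to_ac k) \<rho> = 0 \<Longrightarrow> integral (poly (map_poly to_ac z) \<rho>)"
  shows "\<exists>P. Polynomial.lead_coeff P = 1 \<and> (\<forall>i. Polynomial.coeff P i \<in> \<O>) \<and> k dvd pcompose P z"
proof -
  define R where "R = {\<rho>. poly (map_poly to_ac k) \<rho> = 0}"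
  have "finite R" unfolding R_def using k_nz by (intro poly_roots_finite) simp
  have "\<forall>\<rho>\<in>R. \<exists>P. Polynomial.lead_coeff P = 1 \<and> (\<forall>i. Polynomial.coeff P i \<in> \<O>) \<and>
      poly (map_poly to_ac P) (poly (map_poly to_ac z) \<rho>) = 0"
    using assms unfolding R_def integral_def by blast
  from bchoice[OF this] obtain P where P: "\<And>\<rho>. \<rho> \<in> R \<Longrightarrow> Polynomial.lead_coeff (P \<rho>) = 1"
    "\<And>\<rho> i. \<rho> \<in> R \<Longrightarrow> Polynomial.coeff (P \<rho>) i \<in> \<O>"
    "\<And>\<rho>. \<rho> \<in> R \<Longrightarrow> poly (map_poly to_ac (P \<rho>)) (poly (map_poly to_ac z) \<rho>) = 0" by blast
  define Q where "Q = (\<Prod>\<rho>\<in>R. P \<rho>)"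
  have "Polynomial.lead_coeff Q = 1" unfolding Q_def lead_coeff_prod using P(1) by simp
  moreover have "Polynomial.coeff Q i \<in> \<O>" for i
  proof -
    have "\<forall>i. Polynomial.coeff (\<Prod>\<rho>\<in>R'. P \<rho>) i \<in> \<O>" if "finite R'" "R' \<subseteq> R" for R'
      using that
    proof (induction R' rule: finite_induct)
      case (insert \<rho> R')
      have c1: "Polynomial.coeff (P \<rho>) i \<in> \<O>" "Polynomial.coeff (\<Prod>\<rho>\<in>R'. P \<rho>) i \<in> \<O>" for i
        using insert P(2) by auto
      then have "Polynomial.coeff (P \<rho> * (\<Prod>\<rho>\<in>R'. P \<rho>)) i \<in> \<O>" for i
        unfolding coeff_mult by (intro O_sum O_mult) auto
      then show ?case using insert(1,2) by simp
    next
      case empty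
      have "Polynomial.coeff 1 i \<in> \<O>" for i by (cases i) simp_all
      then show ?case by simp
    qed
    then show ?thesis unfolding Q_def using \<open>finite R\<close> by blast
  qed
  moreover have "k dvd pcompose Q z"
  proof (rule dvd_if_roots[OF coprime_k_pderiv k_nz])
    fix \<rho> assume "poly (map_poly to_ac k) \<rho> = 0"
    then have \<rho>: "\<rho> \<in> R" unfolding R_def by simp
    have "Q = P \<rho> * (\<Prod>\<rho>\<in>R - {\<rho>}. P \<rho>)" unfolding Q_def using \<open>finite R\<close> \<rho> by (simp add: prod.remove)
    then show "poly (map_poly to_ac (pcompose Q z)) \<rho> = 0"
      using P(3)[OF \<rho>] by (simp add: to_ac.map_poly_pcompose poly_pcompose to_acp.hom_mult)
  qed
  ultimately show ?thesis by blast
qed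

lemma unit_root_factor: "unit_root_factor p v \<iota> vL a \<sigma> k zz zi"
proof unfold_locales
  show "k \<noteq> 0" by (rule k_nz)
  show "k dvd zz * zi - 1" using zz_zi H_factor by (metis dvd_mult_left mult.commute)
  show "\<exists>P. Polynomial.lead_coeff P = 1 \<and> (\<forall>i. Polynomial.coeff P i \<in> \<O>) \<and> k dvd pcompose P zz"
    by (rule integral_equation[OF integral_at_root(1)])
  show "\<exists>P. Polynomial.lead_coeff P = 1 \<and> (\<forall>i. Polynomial.coeff P i \<in> \<O>) \<and> k dvd pcompose P zi"
    by (rule integral_equation[OF integral_at_root(2)])
qed

end

context slope_setting
begin

context
  fixes w assumes w: "w \<in> places p v h"
begin

lemma wb_smult: "wb w (Polynomial.smult c u) = wb w [:of_nat p:] * v c + wb w u"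
  using wb_mult[OF w, of "[:c:]" u] wb_const[OF w, of c] by simp

lemma v_inverse_p_power: "v (inverse (of_nat p ^ n)) = ereal (- real n)"
  using v_power_int[of "- int n"] by (simp add: power_int_minus)

lemma wb_x_power: obtains m :: int where "\<And>s. wb w ([:0, 1:] ^ s) = ereal (of_int m * real s)"
proof -
  obtain m :: int where m: "wb w [:0, 1:] = ereal (of_int m)" using wb_x[OF w] by blast
  have "wb w ([:0, 1:] ^ s) = ereal (of_int m * real s)" for s
  proof (induction s)
    case (Suc s)
    have "wb w ([:0, 1:] ^ Suc s) = wb w [:0, 1:] + wb w ([:0, 1:] ^ s)" unfolding power_Suc by (rule wb_mult[OF w])
    then show ?case unfolding Suc m by (simp add: algebra_simps)
  qed (simp add: wb_one[OF w])
  then show ?thesis by (rule that)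
qed

lemma monom_x: "Polynomial.monom c s = Polynomial.smult c ([:0, 1:] ^ s)"
  by (simp add: monom_altdef)

lemma wb_integral_bound:
  "\<exists>D::real. \<forall>u. (\<forall>i. Polynomial.coeff u i \<in> \<O>) \<longrightarrow> (\<forall>i\<ge>s. Polynomial.coeff u i = 0) \<longrightarrow> ereal D \<le> wb w u"
proof (induction s)
  case 0
  show ?case
  proof (intro exI allI impI)
    fix u :: "'k poly" assume "\<forall>i\<ge>0. Polynomial.coeff u i = 0"
    then have "u = 0" by (intro poly_eqI) simp
    then show "ereal 0 \<le> wb w u" using wb_zero[OF w] by simp
  qed
next
  case (Suc s)
  then obtain D :: real where D: "\<And>u. (\<forall>i. Polynomial.coeff u i \<in> \<O>) \<Longrightarrow> (\<forall>i\<ge>s. Polynomial.coeff u i = 0) \<Longrightarrow> ereal D \<le> wb w u"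
    by blast
  obtain m :: int where m: "\<And>s. wb w ([:0, 1:] ^ s) = ereal (of_int m * real s)" using wb_x_power by blast
  show ?case
  proof (intro exI allI impI)
    fix u assume u: "\<forall>i. Polynomial.coeff u i \<in> \<O>" "\<forall>i\<ge>Suc s. Polynomial.coeff u i = 0"
    define c where "c = Polynomial.coeff u s"
    define u' where "u' = u - Polynomial.monom c s"
    have "\<forall>i. Polynomial.coeff u' i \<in> \<O>" unfolding u'_def using u(1) by (auto simp: c_def intro: O_diff)
    moreover have "Polynomial.coeff u' i = 0" if "i \<ge> s" for i
      unfolding u'_def using u(2) that by (cases "i = s") (simp_all add: c_def)
    ultimately have 1: "ereal D \<le> wb w u'" using D by blast
    have "0 \<le> v c" using u(1) unfolding c_def val_ring_def by simp
    then have "0 \<le> wb w [:of_nat p:] * v c" using wb_p_pos[OF w] by (intro ereal_0_le_mult) auto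
    then have "0 + ereal (of_int m * real s) \<le> wb w [:of_nat p:] * v c + ereal (of_int m * real s)"
      by (rule add_right_mono)
    then have 2: "ereal (of_int m * real s) \<le> wb w (Polynomial.monom c s)" unfolding monom_x wb_smult m by simp
    have "min (wb w u') (wb w (Polynomial.monom c s)) \<le> wb w (u' + Polynomial.monom c s)" by (rule wb_add[OF w])
    moreover have "u' + Polynomial.monom c s = u" unfolding u'_def by simp
    moreover have "ereal (min D (of_int m * real s)) \<le> min (wb w u') (wb w (Polynomial.monom c s))"
      using 1 2 by (simp add: min_le_iff_disj)
    ultimately show "ereal (min D (of_int m * real s)) \<le> wb w u" by (metis order_trans)
  qed
qed

text \<open>
  Over a complete field all norms on a finite-dimensional space are equivalent: on polynomials of
  degree below that of the kernel of \<open>w\<close>, the valuation \<open>w\<close> controls the coefficients. Otherwise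
  some \<open>x\<^sup>s\<close> is a limit of combinations of lower powers; these converge coefficientwise, and the
  limit is a polynomial relation of too small degree.
\<close>

lemma wb_controls_coefficients:
  assumes minimal: "\<And>u. u \<noteq> 0 \<Longrightarrow> Polynomial.degree u < d \<Longrightarrow> wb w u \<noteq> \<infinity>" and "s \<le> d"
  shows "\<exists>C::nat. \<forall>u. (\<forall>i\<ge>s. Polynomial.coeff u i = 0) \<longrightarrow> 0 \<le> wb w u \<longrightarrow>
    (\<forall>j. of_nat p ^ C * Polynomial.coeff u j \<in> \<O>)"
  using assms(2)
proof (induction s)
  case 0
  have "u = 0" if "\<forall>i\<ge>0. Polynomial.coeff u i = 0" for u :: "'k poly" using that by (intro poly_eqI) simp
  then show ?case by auto
next
  case (Suc s)
  obtain C where C: "\<And>u j. (\<forall>i\<ge>s. Polynomial.coeff u i = 0) \<Longrightarrow> 0 \<le> wb w u \<Longrightarrow> of_nat p ^ C * Polynomial.coeff u j \<in> \<O>"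
    using Suc.IH Suc.prems Suc_leD by blast
  obtain e :: int where e: "wb w [:of_nat p:] = ereal (of_int e)" "0 < e" using wb_p_finite[OF w] by blast
  obtain m :: int where m: "\<And>s. wb w ([:0, 1:] ^ s) = ereal (of_int m * real s)" using wb_x_power by blast
  obtain D :: real where D: "\<And>u. (\<forall>i. Polynomial.coeff u i \<in> \<O>) \<Longrightarrow> (\<forall>i\<ge>s. Polynomial.coeff u i = 0) \<Longrightarrow> ereal D \<le> wb w u"
    using wb_integral_bound[of s] by blast
  have wb_pn: "wb w (Polynomial.smult (of_nat p ^ n) u) = ereal (of_int e * real n) + wb w u" for n u
    unfolding wb_smult e(1) v_p_power by simp
  have wb_ipn: "wb w (Polynomial.smult (inverse (of_nat p ^ n)) u) = ereal (- (of_int e * real n)) + wb w u" for n u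
    unfolding wb_smult e(1) v_inverse_p_power by simp
  have p0: "(of_nat p :: 'k) \<noteq> 0" using gr_implies_not0[OF p_pos] by simp
  have "\<exists>n::nat. \<forall>u. (\<forall>i\<ge>s. Polynomial.coeff u i = 0) \<longrightarrow> \<not> ereal (of_int e * real n) \<le> wb w (u + [:0, 1:] ^ s)"
  proof (rule ccontr)
    assume "\<not> ?thesis"
    then have "\<forall>n. \<exists>u. (\<forall>i\<ge>s. Polynomial.coeff u i = 0) \<and> ereal (of_int e * real n) \<le> wb w (u + [:0, 1:] ^ s)" by blast
    from choice[OF this] obtain V where V0: "\<And>n. \<forall>i\<ge>s. Polynomial.coeff (V n) i = 0"
      and V: "\<And>n. ereal (of_int e * real n) \<le> wb w (V n + [:0, 1:] ^ s)" by blast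
    define T where "T = (\<lambda>n. Polynomial.smult (of_nat p ^ C) (Polynomial.smult (inverse (of_nat p ^ n)) (V (Suc n) - V n)))"
    have T0: "Polynomial.coeff (T n) i = 0" if "i \<ge> s" for n i unfolding T_def using V0 that by simp
    have TO: "Polynomial.coeff (T n) j \<in> \<O>" for n j
    proof -
      have n: "ereal (of_int e * real n) \<le> wb w (V (Suc n) + [:0, 1:] ^ s)"
      proof -
        have "of_int e * real n \<le> of_int e * real (Suc n)" using e(2) by simp
        then have "ereal (of_int e * real n) \<le> ereal (of_int e * real (Suc n))" by (simp only: ereal_less_eq)
        then show ?thesis using V[of "Suc n"] by (rule order_trans)
      qed
      have "ereal (of_int e * real n) \<le> wb w (- (V n + [:0, 1:] ^ s))"
      proof -
        have "v (- 1) = 0" using v_minus[of 1] v_one by simp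
        then have "wb w (Polynomial.smult (- 1) (V n + [:0, 1:] ^ s)) = wb w (V n + [:0, 1:] ^ s)"
          unfolding wb_smult by simp
        then show ?thesis using V[of n] by simp
      qed
      then have "ereal (of_int e * real n) \<le> min (wb w (V (Suc n) + [:0, 1:] ^ s)) (wb w (- (V n + [:0, 1:] ^ s)))" using n by simp
      also have "\<dots> \<le> wb w ((V (Suc n) + [:0, 1:] ^ s) + (- (V n + [:0, 1:] ^ s)))" by (rule wb_add[OF w])
      also have "(V (Suc n) + [:0, 1:] ^ s) + (- (V n + [:0, 1:] ^ s)) = V (Suc n) - V n" by simp
      finally have "0 \<le> ereal (- (of_int e * real n)) + wb w (V (Suc n) - V n)"
        using wb_range[OF w, of "V (Suc n) - V n"] by auto
      then have "0 \<le> wb w (Polynomial.smult (inverse (of_nat p ^ n)) (V (Suc n) - V n))" unfolding wb_ipn .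
      from C[OF _ this, of j] V0 show ?thesis unfolding T_def by (simp add: mult.assoc)
    qed
    have "\<forall>j. \<exists>x\<in>\<O>. \<forall>n. \<exists>t\<in>\<O>. x - (\<Sum>m<n. of_nat p ^ m * Polynomial.coeff (T m) j) = of_nat p ^ n * t"
    proof
      fix j show "\<exists>x\<in>\<O>. \<forall>n. \<exists>t\<in>\<O>. x - (\<Sum>m<n. of_nat p ^ m * Polynomial.coeff (T m) j) = of_nat p ^ n * t"
        by (rule series_converges) (rule TO)
    qed
    then obtain x t where xt: "\<And>j n. t j n \<in> \<O>"
      "\<And>j n. x j - (\<Sum>m<n. of_nat p ^ m * Polynomial.coeff (T m) j) = of_nat p ^ n * t j n"
      unfolding Bex_def by metis
    have tel: "Polynomial.smult (of_nat p ^ C) (V n) =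
        Polynomial.smult (of_nat p ^ C) (V 0) + (\<Sum>m<n. Polynomial.smult (of_nat p ^ m) (T m))" for n
    proof (induction n)
      case (Suc n)
      have "Polynomial.smult (of_nat p ^ n) (T n) = Polynomial.smult (of_nat p ^ C) (V (Suc n) - V n)"
        unfolding T_def using p0 by (simp add: field_simps)
      then show ?case using Suc by (simp add: smult_diff_right)
    qed simp
    define X' where "X' = (\<Sum>j<s. Polynomial.monom (x j) j)"
    define T' where "T' = (\<lambda>n. \<Sum>j<s. Polynomial.monom (t j n) j)"
    have cX: "Polynomial.coeff X' j = (if j < s then x j else 0)"
      and cT: "Polynomial.coeff (T' n) j = (if j < s then t j n else 0)" for j n
      unfolding X'_def T'_def by (simp_all add: coeff_sum if_distrib cong: if_cong)
    define V' where "V' = V 0 + Polynomial.smult (inverse (of_nat p ^ C)) X'"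
    have V'0: "Polynomial.coeff V' i = 0" if "i \<ge> s" for i unfolding V'_def using V0 that by (simp add: cX)
    have diff: "V' - V n = Polynomial.smult (inverse (of_nat p ^ C)) (Polynomial.smult (of_nat p ^ n) (T' n))" for n
    proof -
      have "X' - (\<Sum>m<n. Polynomial.smult (of_nat p ^ m) (T m)) = Polynomial.smult (of_nat p ^ n) (T' n)"
      proof (rule poly_eqI)
        fix j
        show "Polynomial.coeff (X' - (\<Sum>m<n. Polynomial.smult (of_nat p ^ m) (T m))) j =
            Polynomial.coeff (Polynomial.smult (of_nat p ^ n) (T' n)) j"
          using xt(2)[of j n] T0[of j] by (cases "j < s") (simp_all add: cX cT coeff_sum)
      qed
      moreover have "Polynomial.smult (of_nat p ^ C) (V' - V n) = X' - (\<Sum>m<n. Polynomial.smult (of_nat p ^ m) (T m))"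
        unfolding smult_diff_right tel[of n] unfolding V'_def using p0 by (simp add: smult_add_right)
      ultimately have "Polynomial.smult (inverse (of_nat p ^ C)) (Polynomial.smult (of_nat p ^ C) (V' - V n)) =
          Polynomial.smult (inverse (of_nat p ^ C)) (Polynomial.smult (of_nat p ^ n) (T' n))" by simp
      then show ?thesis using p0 by simp
    qed
    have big: "ereal (of_int e * real n - \<bar>D\<bar> - of_int e * real C) \<le> wb w (V' + [:0, 1:] ^ s)" for n
    proof -
      have "ereal D \<le> wb w (T' n)" by (rule D) (use xt(1) in \<open>auto simp: cT\<close>)
      then have "ereal (- (of_int e * real C)) + (ereal (of_int e * real n) + ereal D) \<le> wb w (V' - V n)"
        unfolding diff wb_ipn wb_pn by (intro add_left_mono)
      then have 1: "ereal (of_int e * real n - \<bar>D\<bar> - of_int e * real C) \<le> wb w (V' - V n)"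
        by (rule order_trans[rotated]) simp
      have "0 \<le> real_of_int e * real C" using e(2) by simp
      then have "of_int e * real n - \<bar>D\<bar> - of_int e * real C \<le> of_int e * real n" by linarith
      then have 2: "ereal (of_int e * real n - \<bar>D\<bar> - of_int e * real C) \<le> wb w (V n + [:0, 1:] ^ s)"
        using V[of n] by (metis ereal_less_eq(3) order_trans)
      have "min (wb w (V' - V n)) (wb w (V n + [:0, 1:] ^ s)) \<le> wb w ((V' - V n) + (V n + [:0, 1:] ^ s))"
        by (rule wb_add[OF w])
      moreover have "(V' - V n) + (V n + [:0, 1:] ^ s) = V' + [:0, 1:] ^ s" by simp
      ultimately have "min (wb w (V' - V n)) (wb w (V n + [:0, 1:] ^ s)) \<le> wb w (V' + [:0, 1:] ^ s)" by (simp only:)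
      moreover have "ereal (of_int e * real n - \<bar>D\<bar> - of_int e * real C) \<le> min (wb w (V' - V n)) (wb w (V n + [:0, 1:] ^ s))"
        using 1 2 by (rule min.boundedI)
      ultimately show ?thesis by (rule order_trans[rotated])
    qed
    define U where "U = V' + [:0, 1:] ^ s"
    have cU: "Polynomial.coeff U i = (if i = s then 1 else 0)" if "i \<ge> s" for i
      unfolding U_def using V'0[OF that] by (simp flip: monom_altdef[of 1, simplified])
    have "U \<noteq> 0" using cU[of s] by auto
    moreover have "Polynomial.degree U \<le> s" by (rule degree_le) (use cU in auto)
    then have "Polynomial.degree U < d" using Suc.prems by simp
    ultimately have "wb w U \<noteq> \<infinity>" by (rule minimal)
    then obtain r :: int where r: "wb w U = ereal (of_int r)" using wb_range[OF w] by blast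
    obtain n :: nat where "(of_int r + \<bar>D\<bar> + of_int e * real C) / of_int e < real n" using reals_Archimedean2 by blast
    then have "of_int r + \<bar>D\<bar> + of_int e * real C < of_int e * real n" using e(2) by (simp add: field_simps)
    then show False using big[of n] unfolding U_def[symmetric] r by simp
  qed
  then obtain C' :: nat where C': "\<And>u. (\<forall>i\<ge>s. Polynomial.coeff u i = 0) \<Longrightarrow> \<not> ereal (of_int e * real C') \<le> wb w (u + [:0, 1:] ^ s)"
    by blast
  define C'' where "C'' = C' + nat \<bar>m\<bar> * s"
  show ?case
  proof (intro exI allI impI)
    fix u j assume u: "\<forall>i\<ge>Suc s. Polynomial.coeff u i = 0" "0 \<le> wb w u"
    define c where "c = Polynomial.coeff u s"
    define u' where "u' = u - Polynomial.smult c ([:0, 1:] ^ s)"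
    have u'c: "Polynomial.coeff u' i = (if i = s then 0 else Polynomial.coeff u i)" for i
      unfolding u'_def monom_x[symmetric] by (simp add: c_def)
    have u'0: "\<forall>i\<ge>s. Polynomial.coeff u' i = 0" using u(1) by (simp add: u'c)
    have goal: "of_nat p ^ (C + C'') * Polynomial.coeff u j \<in> \<O>"
      if cO: "of_nat p ^ C' * c \<in> \<O>" and u'w: "0 \<le> wb w (Polynomial.smult (of_nat p ^ C'') u')"
    proof (cases "j = s")
      case True
      have "of_nat p ^ (C + C'') * Polynomial.coeff u j = of_nat p ^ (C + nat \<bar>m\<bar> * s) * (of_nat p ^ C' * c)"
        unfolding C''_def True c_def by (simp add: power_add algebra_simps)
      then show ?thesis using O_mult[OF O_power[OF O_of_nat] cO] by simp
    next
      case False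
      have "of_nat p ^ C * Polynomial.coeff (Polynomial.smult (of_nat p ^ C'') u') j \<in> \<O>"
        by (rule C[OF _ u'w]) (use u'0 in simp)
      then show ?thesis using False by (simp add: u'c power_add mult.assoc)
    qed
    show "of_nat p ^ (C + C'') * Polynomial.coeff u j \<in> \<O>"
    proof (cases "c = 0")
      case True
      then have "u' = u" unfolding u'_def by simp
      have "0 \<le> ereal (of_int e * real C'')" using e(2) by simp
      then have "0 + 0 \<le> ereal (of_int e * real C'') + wb w u" using u(2) by (rule add_mono)
      then show ?thesis using True \<open>u' = u\<close> by (intro goal) (simp_all add: wb_pn)
    next
      case False
      have eq: "u = Polynomial.smult c (Polynomial.smult (inverse c) u' + [:0, 1:] ^ s)"
        using False unfolding u'_def by (simp add: smult_add_right smult_diff_right)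
      obtain vc :: int where vc: "v c = ereal (of_int vc)" using v_nonzero[OF False] by blast
      have "\<not> ereal (of_int e * real C') \<le> wb w (Polynomial.smult (inverse c) u' + [:0, 1:] ^ s)"
        by (rule C') (use u'0 in simp)
      moreover have "wb w u = ereal (of_int e * of_int vc) + wb w (Polynomial.smult (inverse c) u' + [:0, 1:] ^ s)"
        by (subst eq) (simp only: wb_smult[of c "Polynomial.smult (inverse c) u' + [:0, 1:] ^ s"] e vc times_ereal.simps)
      ultimately have "0 < of_int e * of_int vc + of_int e * real C'"
        using u(2) wb_range[OF w, of "Polynomial.smult (inverse c) u' + [:0, 1:] ^ s"] by auto
      then have "0 < of_int e * (of_int vc + real C')" by (simp add: algebra_simps)
      then have vcC: "- real C' < of_int vc" using e(2) by (simp add: zero_less_mult_iff)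
      then have cO: "of_nat p ^ C' * c \<in> \<O>" unfolding val_ring_def by (simp add: v_mult v_p_power vc)
      have "0 \<le> wb w (Polynomial.smult (of_nat p ^ C'') u')"
      proof -
        have "v (- c) = ereal (of_int vc)" using v_minus vc by simp
        then have 1: "wb w (Polynomial.smult (of_nat p ^ C'') (Polynomial.smult (- c) ([:0, 1:] ^ s))) =
            ereal (of_int e * real C'' + of_int e * of_int vc + of_int m * real s)"
          unfolding wb_pn unfolding wb_smult[of "- c"] m e(1) by simp
        have "0 \<le> of_int e * (real C'' + of_int vc) + of_int m * real s"
        proof -
          have "real (nat \<bar>m\<bar> * s) \<le> real C'' + of_int vc" using vcC unfolding C''_def by simp
          moreover have "1 * real (nat \<bar>m\<bar> * s) \<le> of_int e * real (nat \<bar>m\<bar> * s)" using e(2) by (intro mult_right_mono) auto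
          ultimately have "real (nat \<bar>m\<bar> * s) \<le> of_int e * (real C'' + of_int vc)"
            using e(2) by (smt (verit) mult_left_mono of_int_0_le_iff)
          moreover have "- real (nat \<bar>m\<bar> * s) \<le> of_int m * real s"
          proof -
            have "- \<bar>of_int m\<bar> * real s \<le> of_int m * real s" by (intro mult_right_mono) auto
            then show ?thesis by simp
          qed
          ultimately show ?thesis by simp
        qed
        then have 2: "0 \<le> wb w (Polynomial.smult (of_nat p ^ C'') (Polynomial.smult (- c) ([:0, 1:] ^ s)))"
          unfolding 1 by (simp add: algebra_simps)
        have "0 \<le> ereal (of_int e * real C'')" using e(2) by simp
        then have "0 + 0 \<le> ereal (of_int e * real C'') + wb w u" using u(2) by (rule add_mono)
        then have 3: "0 \<le> wb w (Polynomial.smult (of_nat p ^ C'') u)" by (simp add: wb_pn)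
        have "Polynomial.smult (of_nat p ^ C'') u' = Polynomial.smult (of_nat p ^ C'') u +
            Polynomial.smult (of_nat p ^ C'') (Polynomial.smult (- c) ([:0, 1:] ^ s))"
          unfolding u'_def by (simp add: smult_diff_right)
        moreover have "0 \<le> min (wb w (Polynomial.smult (of_nat p ^ C'') u))
            (wb w (Polynomial.smult (of_nat p ^ C'') (Polynomial.smult (- c) ([:0, 1:] ^ s))))"
          using 3 2 by (rule min.boundedI)
        ultimately show ?thesis using wb_add[OF w, of "Polynomial.smult (of_nat p ^ C'') u"
            "Polynomial.smult (of_nat p ^ C'') (Polynomial.smult (- c) ([:0, 1:] ^ s))"]
          by (metis order_trans)
      qed
      then show ?thesis using cO by (intro goal)
    qed
  qed
qed

end

lemma wb_same_kernel:
  assumes w: "w \<in> places p v h" and w1: "w1 \<in> places p v h" and f: "f \<noteq> 0" "wb w f = \<infinity>" "wb w1 f = \<infinity>"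
    and minimal: "\<And>u. u \<noteq> 0 \<Longrightarrow> Polynomial.degree u < Polynomial.degree f \<Longrightarrow> wb w u \<noteq> \<infinity>"
    and u: "wb w u = 0"
  shows "0 \<le> wb w1 u"
proof -
  have red: "wb w' z = wb w' (z mod f)" if w': "w' \<in> places p v h" "wb w' f = \<infinity>" for w' z
  proof -
    have inf: "wb w' (q * f) = \<infinity>" for q using wb_mult[OF w'(1), of q f] w'(2) wb_range[OF w'(1), of q] by auto
    have "min (wb w' (z div f * f)) (wb w' (z mod f)) \<le> wb w' (z div f * f + z mod f)" by (rule wb_add[OF w'(1)])
    then have 1: "wb w' (z mod f) \<le> wb w' z" by (simp add: inf)
    have "min (wb w' ((- (z div f)) * f)) (wb w' z) \<le> wb w' ((- (z div f)) * f + z)" by (rule wb_add[OF w'(1)])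
    moreover have "(- (z div f)) * f + z = z mod f" using minus_div_mult_eq_mod[of z f] by (simp add: algebra_simps)
    ultimately have "wb w' z \<le> wb w' (z mod f)" using inf[of "- (z div f)"] by simp
    then show ?thesis using 1 by (rule antisym)
  qed
  define d where "d = Polynomial.degree f"
  obtain C :: nat where C: "\<And>u j. (\<forall>i\<ge>d. Polynomial.coeff u i = 0) \<Longrightarrow> 0 \<le> wb w u \<Longrightarrow> of_nat p ^ C * Polynomial.coeff u j \<in> \<O>"
    using wb_controls_coefficients[OF w minimal, of d d] unfolding d_def by blast
  obtain D :: real where D: "\<And>u. (\<forall>i. Polynomial.coeff u i \<in> \<O>) \<Longrightarrow> (\<forall>i\<ge>d. Polynomial.coeff u i = 0) \<Longrightarrow> ereal D \<le> wb w1 u"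
    using wb_integral_bound[OF w1, of d] by blast
  obtain e :: int where e: "wb w1 [:of_nat p:] = ereal (of_int e)" "0 < e" using wb_p_finite[OF w1] by blast
  have small: "Polynomial.coeff (z mod f) i = 0" if "i \<ge> d" for z i
  proof (cases "z mod f = 0")
    case False
    then have "Polynomial.degree (z mod f) < d" using degree_mod_less[OF f(1), of z] unfolding d_def by auto
    then show ?thesis using that by (intro coeff_eq_0) simp
  qed simp
  have bound: "ereal D \<le> ereal (of_int e * real C) + wb w1 (u ^ n)" for n
  proof -
    have "wb w (u ^ n) = 0"
    proof (induction n)
      case (Suc n)
      then show ?case using wb_mult[OF w, of u "u ^ n"] u by simp
    qed (simp add: wb_one[OF w])
    then have "0 \<le> wb w (u ^ n mod f)" using red[OF w f(2), of "u ^ n"] by simp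
    then have "ereal D \<le> wb w1 (Polynomial.smult (of_nat p ^ C) (u ^ n mod f))"
      using C[of "u ^ n mod f"] small by (intro D) auto
    also have "\<dots> = ereal (of_int e * real C) + wb w1 (u ^ n mod f)"
      unfolding wb_smult[OF w1] e(1) v_p_power by simp
    finally show ?thesis using red[OF w1 f(3), of "u ^ n"] by simp
  qed
  show ?thesis
  proof (cases "wb w1 u = \<infinity>")
    case False
    then obtain r :: int where r: "wb w1 u = ereal (of_int r)" using wb_range[OF w1] by blast
    have pw: "wb w1 (u ^ n) = ereal (real n * of_int r)" for n
    proof (induction n)
      case (Suc n)
      then show ?case using wb_mult[OF w1, of u "u ^ n"] r by (simp add: algebra_simps)
    qed (simp add: wb_one[OF w1] zero_ereal_def)
    have "\<not> r < 0"
    proof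
      assume "r < 0"
      obtain n :: nat where n: "of_int e * real C - D < real n" using reals_Archimedean2 by blast
      have "real n * of_int r \<le> real n * (- 1)" using \<open>r < 0\<close> by (intro mult_left_mono) auto
      then show False using bound[of n] n unfolding pw by simp
    qed
    then show ?thesis using r by simp
  qed simp
qed

text \<open>
  The extension of \<open>v\<close> to each field factor of \<open>E\<^sub>p\<close> is unique, at least as far as the slope is
  concerned; so the places with slope in \<open>S\<close> are exactly those on the factor \<open>K[x]/(k)\<close>.
\<close>

lemma wb_k:
  assumes w: "w \<in> places p v h" and zz: "wb w zz = 0"
  shows "wb w k = \<infinity>"
proof (rule ccontr)
  assume k: "wb w k \<noteq> \<infinity>"
  have "wb w H = \<infinity>" using wb_cong[OF w, of H 0] wb_zero[OF w] by simp
  then have g: "wb w g = \<infinity>" using k wb_mult[OF w, of g k] unfolding H_factor by simp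
  define Q where "Q = (\<lambda>f. f \<noteq> 0 \<and> wb w f = \<infinity>)"
  have "Q g" unfolding Q_def using g g_nonzero by simp
  then have "\<exists>f. Q f \<and> (\<forall>f'. Q f' \<longrightarrow> Polynomial.degree f \<le> Polynomial.degree f')" by (rule ex_has_least_nat)
  then obtain f where f: "f \<noteq> 0" "wb w f = \<infinity>" and least: "\<And>u. u \<noteq> 0 \<Longrightarrow> wb w u = \<infinity> \<Longrightarrow> Polynomial.degree f \<le> Polynomial.degree u"
    unfolding Q_def by blast
  have "wb w (g mod f) = \<infinity>"
  proof -
    have "wb w ((- (g div f)) * f) = \<infinity>" using wb_mult[OF w, of "- (g div f)" f] f(2) wb_range[OF w, of "- (g div f)"] by auto
    then have "wb w (g + (- (g div f)) * f) = \<infinity>" using wb_add[OF w, of g "(- (g div f)) * f"] g by simp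
    moreover have "g + (- (g div f)) * f = g mod f" using minus_div_mult_eq_mod[of g f] by (simp add: algebra_simps)
    ultimately show ?thesis by simp
  qed
  then have "g mod f = 0" using least[of "g mod f"] degree_mod_less[OF f(1), of g] by force
  then obtain g1 where g1: "g = f * g1" by (metis dvdE mod_eq_0_iff_dvd)
  have df: "Polynomial.degree f \<noteq> 0"
  proof
    assume "Polynomial.degree f = 0"
    then obtain c where c: "f = [:c:]" by (rule degree_eq_zeroE)
    then have "c \<noteq> 0" using f(1) by simp
    then have "wb w (f * [:inverse c:]) = 0" unfolding c using wb_one[OF w] by simp
    then show False using wb_mult[OF w, of f "[:inverse c:]"] f(2) wb_range[OF w, of "[:inverse c:]"] by auto
  qed
  have g1nz: "g1 \<noteq> 0" using g1 g_nonzero by auto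
  then have "Polynomial.degree g1 < Polynomial.degree g" unfolding g1 using f(1) df by (simp add: degree_mult_eq)
  then have "g1 mod H \<notin> E_part p a v h S" using g_min[OF g1nz] by linarith
  then obtain w1 where w1: "w1 \<in> places p v h" "slope p a h w1 \<notin> S" "wb w1 g1 \<noteq> \<infinity>" unfolding E_part_iff by blast
  have "wb w1 g = \<infinity>" using g_E w1 unfolding E_part_iff by blast
  then have f1: "wb w1 f = \<infinity>" using wb_mult[OF w1(1), of f g1] w1(3) unfolding g1 by simp
  have min: "\<And>u. u \<noteq> 0 \<Longrightarrow> Polynomial.degree u < Polynomial.degree f \<Longrightarrow> wb w u \<noteq> \<infinity>" using least by (meson linorder_not_less)
  have sum0: "wb w' zz + wb w' zi = 0" if "w' \<in> places p v h" for w'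
    using wb_cong[OF that zz_zi] wb_one[OF that] wb_mult[OF that] by metis
  have zi: "wb w zi = 0" using sum0[OF w] zz by simp
  have "0 \<le> wb w1 zz" "0 \<le> wb w1 zi"
    using wb_same_kernel[OF w w1(1) f f1 min zz] wb_same_kernel[OF w w1(1) f f1 min zi] by simp_all
  then have zz1: "wb w1 zz = 0" using sum0[OF w1(1)] by (cases "wb w1 zz"; cases "wb w1 zi") auto
  obtain e :: int where e: "wb w1 [:of_nat p:] = ereal (of_int e)" "0 < e" using wb_p_finite[OF w1(1)] by blast
  obtain m :: int where m: "wb w1 [:0, 1:] = ereal (of_int m)" "wb w1 (xinv h) = ereal (of_int (- m))"
    using wb_x[OF w1(1)] by blast
  have sl: "slope p a h w1 = of_int m / (real a * of_int e)"
    unfolding slope_def frob_def scalar_def using e m unfolding wb_def by simp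
  show False
  proof (cases "S = {0}")
    case True
    then have "m = 0" using zz1 m unfolding zz_def by (simp add: zero_ereal_def)
    then show False using sl w1(2) True by simp
  next
    case False
    then have "of_int e * real a - of_int m = 0"
      using zz1 m e wb_smult[OF w1(1), of "of_nat p ^ a" "xinv h"] v_p_power[of a] unfolding zz_def by (simp add: zero_ereal_def)
    then have "of_int m = real a * of_int e" by (simp add: mult.commute)
    then have "slope p a h w1 = 1" unfolding sl using e(2) a_pos by (simp only:) simp
    then show False using w1(2) False S by simp
  qed
qed

end

section \<open>The ring \<open>R\<^sub>p\<^sup>*\<close>\<close>

context slope_setting
begin

abbreviation Rp :: "'k poly ring" where "Rp \<equiv> (quot_alg h)\<lparr>carrier := R_p p a v h\<rparr>"

lemma field_hom_of_rat: "field_hom (of_rat :: rat \<Rightarrow> 'k)"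
  by unfold_locales (auto simp: of_rat_add of_rat_mult)

lemma R_p_reduced: "x \<in> R_p p a v h \<Longrightarrow> x mod H = x"
  unfolding R_p_def by (induction rule: lin_span.induct) (simp_all add: poly_mod_add_left)

lemma R_p_base:
  assumes c: "c \<in> \<O>" and u: "u mod map_poly of_int h \<in> R_order p a h"
  shows "([:c:] * map_poly of_rat u) mod H \<in> R_p p a v h"
proof -
  interpret rat: field_hom "of_rat :: rat \<Rightarrow> 'k" by (rule field_hom_of_rat)
  interpret ratp: map_poly_inj_idom_hom "of_rat :: rat \<Rightarrow> 'k" ..
  have "map_poly of_int h dvd u mod map_poly of_int h - u"
    by (simp add: mod_eq_dvd_iff[symmetric])
  then have "map_poly of_rat (map_poly of_int h) dvd map_poly (of_rat :: rat \<Rightarrow> 'k) (u mod map_poly of_int h - u)"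
    by (rule ratp.hom_dvd)
  then have "H dvd map_poly of_rat (u mod map_poly of_int h) - map_poly of_rat u"
    unfolding xinv_hom(2)[OF field_hom_of_rat] ratp.hom_minus .
  then have "map_poly of_rat (u mod map_poly of_int h) mod H = map_poly of_rat u mod H" by (simp only: mod_eq_dvd_iff)
  then have "([:c:] * map_poly of_rat u) mod H = ([:c:] mod H * map_poly of_rat (u mod map_poly of_int h)) mod H"
    by (intro mod_mult_cong) simp_all
  moreover have "(scalar h c \<otimes>\<^bsub>quot_alg h\<^esub> map_poly of_rat (u mod map_poly of_int h)) \<oplus>\<^bsub>quot_alg h\<^esub> \<zero>\<^bsub>quot_alg h\<^esub> \<in> R_p p a v h"
    unfolding R_p_def using c u by (intro lin_span.step lin_span.zero imageI)
  ultimately show ?thesis by (simp add: scalar_def)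
qed

lemma R_p_one: "1 mod H \<in> R_p p a v h" and R_p_p: "[:of_nat p:] mod H \<in> R_p p a v h"
  and R_p_zz: "zz mod H \<in> R_p p a v h"
proof -
  interpret rat: field_hom "of_rat :: rat \<Rightarrow> 'k" by (rule field_hom_of_rat)
  interpret ratp: map_poly_inj_idom_hom "of_rat :: rat \<Rightarrow> 'k" ..
  have one: "1 mod map_poly of_int h \<in> R_order p a h"
    unfolding R_order_def using generate_ring.one[of "quot_alg h :: rat poly ring"] by simp
  have x: "[:0, 1:] mod map_poly of_int h \<in> R_order p a h"
    unfolding R_order_def frob_def by (rule generate_ring.incl) simp
  have "inv\<^bsub>quot_alg h\<^esub> (frob h :: rat poly) = xinv h mod map_poly of_int h"
  proof (rule comm_monoid.comm_inv_char[OF comm_monoid_quot_alg])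
    show "(frob h :: rat poly) \<otimes>\<^bsub>quot_alg h\<^esub> (xinv h mod map_poly of_int h) = \<one>\<^bsub>quot_alg h\<^esub>"
      unfolding frob_def quot_alg_simps mod_mult_eq mod_eq_dvd_iff by (rule x_xinv[OF h_coeff_0])
  qed (simp_all add: frob_def)
  then have "(Polynomial.smult (of_nat (p ^ a)) (xinv h)) mod map_poly of_int h =
      scalar h (of_nat (p ^ a)) \<otimes>\<^bsub>quot_alg h\<^esub> inv\<^bsub>quot_alg h\<^esub> (frob h :: rat poly)"
    unfolding scalar_def by (simp add: mod_mult_eq)
  moreover have "scalar h (of_nat (p ^ a)) \<otimes>\<^bsub>quot_alg h\<^esub> inv\<^bsub>quot_alg h\<^esub> (frob h) \<in> R_order p a h"
    unfolding R_order_def by (rule generate_ring.incl) blast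
  ultimately have y: "(Polynomial.smult (of_nat (p ^ a)) (xinv h)) mod map_poly of_int h \<in> R_order p a h" by simp
  show "1 mod H \<in> R_p p a v h" using R_p_base[OF O_one one] by simp
  show "[:of_nat p:] mod H \<in> R_p p a v h" using R_p_base[OF O_of_nat[of p] one] by simp
  show "zz mod H \<in> R_p p a v h"
  proof (cases "S = {0}")
    case True
    then show ?thesis using R_p_base[OF O_one x] unfolding zz_def by simp
  next
    case False
    have sm: "map_poly of_rat (Polynomial.smult c u) = Polynomial.smult (of_rat c) (map_poly (of_rat :: rat \<Rightarrow> 'k) u)" for c u
      by (rule poly_eqI) (simp add: of_rat_mult)
    have "map_poly of_rat (Polynomial.smult (of_nat (p ^ a)) (xinv h :: rat poly)) = Polynomial.smult (of_nat p ^ a) (xinv h :: 'k poly)"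
      unfolding sm xinv_hom(1)[OF field_hom_of_rat] by (simp add: of_rat_power)
    then show ?thesis using False R_p_base[OF O_one y] unfolding zz_def by simp
  qed
qed

text \<open>
  The element \<open>zz\<close> of \<open>R\<^sub>p\<close> is a unit at all places above a maximal ideal as soon as it is one at
  one of them: otherwise \<open>zz\<close> itself or \<open>p zz\<^sup>N\<close> with large \<open>N\<close> has positive value at exactly one of
  two places with the same center.
\<close>

lemma wb_zz_same_center:
  assumes ring: "ring Rp" and w: "w \<in> places p v h" and w0: "w0 \<in> places p v h" "slope p a h w0 \<in> S"
    and eq: "center (carrier Rp) w = center (carrier Rp) w0"
  shows "wb w zz = 0"
proof -
  have iff: "0 < wb w u \<longleftrightarrow> 0 < wb w0 u" if "u mod H \<in> R_p p a v h" for u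
    using eq that unfolding center_def wb_def by auto
  have zz0: "wb w0 zz = 0" by (rule wb_unit(1)[OF w0])
  have zz1: "\<not> 0 < wb w zz" using iff[OF R_p_zz] zz0 by simp
  have pz: "([:of_nat p:] * zz ^ n) mod H \<in> R_p p a v h \<and> wb w0 ([:of_nat p:] * zz ^ n) = wb w0 [:of_nat p:]" for n
  proof (induction n)
    case (Suc n)
    have "(([:of_nat p:] * zz ^ n) mod H) \<otimes>\<^bsub>Rp\<^esub> (zz mod H) \<in> carrier Rp"
      using Suc R_p_zz by (intro ring.ring_simprules(5)[OF ring]) auto
    moreover have eq: "[:of_nat p:] * zz ^ Suc n = ([:of_nat p:] * zz ^ n) * zz" by (simp add: ac_simps)
    ultimately show ?case unfolding eq using Suc wb_mult[OF w0(1), of "[:of_nat p:] * zz ^ n" zz] zz0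
      by (simp add: mod_mult_eq del: mult_pCons_left)
  qed (simp add: R_p_p)
  have pos: "0 < wb w ([:of_nat p:] * zz ^ n)" for n
    using iff[of "[:of_nat p:] * zz ^ n"] pz[of n] wb_p_pos[OF w0(1)] by simp
  obtain e :: int where e: "wb w [:of_nat p:] = ereal (of_int e)" "0 < e" using wb_p_finite[OF w] by blast
  obtain r :: int where r: "wb w zz = ereal (of_int r)" "r \<le> 0"
    using wb_range[OF w, of zz] zz1 by auto
  have pw: "wb w ([:of_nat p:] * zz ^ n) = ereal (of_int e + real n * of_int r)" for n
  proof (induction n)
    case (Suc n)
    have eq: "[:of_nat p:] * zz ^ Suc n = ([:of_nat p:] * zz ^ n) * zz" by (simp add: ac_simps)
    then show ?case unfolding eq using Suc wb_mult[OF w, of "[:of_nat p:] * zz ^ n" zz] r(1)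
      by (simp add: algebra_simps del: mult_pCons_left)
  qed (simp add: e)
  have "real (nat e) = of_int e" using e(2) by simp
  then have "of_int e + of_int e * of_int r > (0 :: real)" using pos[of "nat e"] unfolding pw by simp
  then have "of_int e * of_int r > (- of_int e :: real)" by linarith
  then have "e * (r + 1) > 0" by (simp flip: of_int_mult of_int_minus add: algebra_simps)
  then have "r = 0" using e(2) r(2) by (simp add: zero_less_mult_iff)
  then show ?thesis using r(1) by (simp add: zero_ereal_def)
qed

text \<open>
  Powers of ideals are formed in the monoid of all ideals of \<open>Rp\<close>; that they are ideals again needs
  \<open>Rp\<close> to be a commutative ring, which comes with the existence of a maximal ideal.
\<close>

lemma ideal_power:
  assumes "maximalideal m Rp" shows "ideal (m [^]\<^bsub>ideals_set Rp\<^esub> (n::nat)) Rp"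
proof -
  interpret m: maximalideal m Rp by fact
  have "cring Rp"
  proof (intro cring.intro m.ring_axioms m.monoid_comm_monoidI)
    show "x \<otimes>\<^bsub>Rp\<^esub> y = y \<otimes>\<^bsub>Rp\<^esub> x" for x y by (simp add: mult.commute)
  qed
  then interpret I: comm_monoid "ideals_set Rp" by (rule cring.ideals_set_is_comm_monoid)
  have "m [^]\<^bsub>ideals_set Rp\<^esub> n \<in> carrier (ideals_set Rp)"
    by (rule I.nat_pow_closed) (simp add: ideals_set_def m.is_ideal)
  then show ?thesis by (simp add: ideals_set_def)
qed

text \<open>
  The constant sequence 1 represents \<open>e\<close> in each completion, since \<open>k\<close> vanishes at all places above
  the maximal ideals in question.
\<close>

lemma R_part_one:
  assumes e: "e mod H = e" "g dvd e" "k dvd e - 1"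
  shows "e \<in> R_part p a v h S"
  unfolding R_part_def Let_def
proof (intro CollectI conjI allI impI)
  show "e \<in> E_part p a v h S" using e unfolding E_eq by simp
  fix m assume m: "maximalideal m Rp \<and> (\<exists>w\<in>places p v h. slope p a h w \<in> S \<and> m = center (carrier Rp) w)"
  then obtain w0 where w0: "w0 \<in> places p v h" "slope p a h w0 \<in> S" "m = center (carrier Rp) w0" by blast
  interpret m: maximalideal m Rp using m by blast
  show "\<exists>r. (\<forall>n::nat. r n \<in> carrier Rp \<and> r (Suc n) \<ominus>\<^bsub>quot_alg h\<^esub> r n \<in> m [^]\<^bsub>ideals_set Rp\<^esub> n) \<and>
      (\<forall>w\<in>places p v h. m = center (carrier Rp) w \<longrightarrow> (\<lambda>n. w (e \<ominus>\<^bsub>quot_alg h\<^esub> r n)) \<longlonglongrightarrow> \<infinity>)"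
  proof (intro exI[of _ "\<lambda>_. 1 mod H"] conjI allI ballI impI)
    fix n :: nat
    show "1 mod H \<in> carrier Rp" using R_p_one by simp
    have "0 \<in> m [^]\<^bsub>ideals_set Rp\<^esub> n"
      using additive_subgroup.zero_closed[OF ideal.axioms(1)[OF ideal_power[of m n]]] m by simp
    then show "1 mod H \<ominus>\<^bsub>quot_alg h\<^esub> 1 mod H \<in> m [^]\<^bsub>ideals_set Rp\<^esub> n" by (simp add: a_minus_quot_alg)
  next
    fix w assume w: "w \<in> places p v h" "m = center (carrier Rp) w"
    have "wb w zz = 0" using w(2) w0(3) by (intro wb_zz_same_center[OF m.ring_axioms w(1) w0(1,2)]) simp
    then have k: "wb w k = \<infinity>" by (rule wb_k[OF w(1)])
    obtain q where q: "e - 1 = k * q" using e(3) by (rule dvdE)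
    have "wb w (e - 1) = \<infinity>" unfolding q using wb_mult[OF w(1), of k q] k wb_range[OF w(1), of q] by auto
    moreover have "w (e \<ominus>\<^bsub>quot_alg h\<^esub> 1 mod H) = wb w (e - 1)"
      unfolding wb_def using e(1) by (simp add: a_minus_quot_alg poly_mod_diff_left)
    ultimately show "(\<lambda>n. w (e \<ominus>\<^bsub>quot_alg h\<^esub> 1 mod H)) \<longlonglongrightarrow> \<infinity>" by simp
  qed
qed

lemma R_part_zz:
  assumes x: "x \<in> R_part p a v h S"
  shows "(zz * x) mod H \<in> R_part p a v h S"
  unfolding R_part_def Let_def
proof (intro CollectI conjI allI impI)
  have xE: "x \<in> E_part p a v h S" using x unfolding R_part_def Let_def by blast
  then have x': "x mod H = x" "g dvd x" unfolding E_eq by auto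
  then show "(zz * x) mod H \<in> E_part p a v h S" unfolding E_part_dvd by simp
  fix m assume m: "maximalideal m Rp \<and> (\<exists>w\<in>places p v h. slope p a h w \<in> S \<and> m = center (carrier Rp) w)"
  then obtain w0 where w0: "w0 \<in> places p v h" "slope p a h w0 \<in> S" "m = center (carrier Rp) w0" by blast
  interpret m: maximalideal m Rp using m by blast
  have "\<exists>r. (\<forall>n::nat. r n \<in> carrier Rp \<and> r (Suc n) \<ominus>\<^bsub>quot_alg h\<^esub> r n \<in> m [^]\<^bsub>ideals_set Rp\<^esub> n) \<and>
      (\<forall>w\<in>places p v h. m = center (carrier Rp) w \<longrightarrow> (\<lambda>n. w (x \<ominus>\<^bsub>quot_alg h\<^esub> r n)) \<longlonglongrightarrow> \<infinity>)"
    using x m unfolding R_part_def Let_def by blast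
  then obtain r where r: "\<And>n. r n \<in> carrier Rp" "\<And>n. r (Suc n) \<ominus>\<^bsub>quot_alg h\<^esub> r n \<in> m [^]\<^bsub>ideals_set Rp\<^esub> (n::nat)"
    "\<And>w. w \<in> places p v h \<Longrightarrow> m = center (carrier Rp) w \<Longrightarrow> (\<lambda>n. w (x \<ominus>\<^bsub>quot_alg h\<^esub> r n)) \<longlonglongrightarrow> \<infinity>" by blast
  have rr: "r n mod H = r n" for n using r(1)[of n] R_p_reduced by simp
  show "\<exists>r. (\<forall>n::nat. r n \<in> carrier Rp \<and> r (Suc n) \<ominus>\<^bsub>quot_alg h\<^esub> r n \<in> m [^]\<^bsub>ideals_set Rp\<^esub> n) \<and>
      (\<forall>w\<in>places p v h. m = center (carrier Rp) w \<longrightarrow> (\<lambda>n. w ((zz * x) mod H \<ominus>\<^bsub>quot_alg h\<^esub> r n)) \<longlonglongrightarrow> \<infinity>)"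
  proof (intro exI[of _ "\<lambda>n. (zz * r n) mod H"] conjI allI ballI impI)
    fix n :: nat
    have "(zz mod H) \<otimes>\<^bsub>Rp\<^esub> r n \<in> carrier Rp" by (rule m.m_closed) (use R_p_zz r(1) in auto)
    then show "(zz * r n) mod H \<in> carrier Rp" by (simp add: mod_mult_left_eq)
    interpret I: ideal "m [^]\<^bsub>ideals_set Rp\<^esub> n" Rp by (rule ideal_power) (use m in blast)
    have "(zz mod H) \<otimes>\<^bsub>Rp\<^esub> (r (Suc n) \<ominus>\<^bsub>quot_alg h\<^esub> r n) \<in> m [^]\<^bsub>ideals_set Rp\<^esub> n"
      by (rule I.I_l_closed[OF r(2)]) (simp add: R_p_zz)
    then show "(zz * r (Suc n)) mod H \<ominus>\<^bsub>quot_alg h\<^esub> (zz * r n) mod H \<in> m [^]\<^bsub>ideals_set Rp\<^esub> n"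
      using rr by (simp add: a_minus_quot_alg mod_mult_left_eq right_diff_distrib poly_mod_diff_left)
  next
    fix w assume w: "w \<in> places p v h" "m = center (carrier Rp) w"
    have zz: "wb w zz = 0" using w(2) w0(3) by (intro wb_zz_same_center[OF m.ring_axioms w(1) w0(1,2)]) simp
    have "w ((zz * x) mod H \<ominus>\<^bsub>quot_alg h\<^esub> (zz * r n) mod H) = w (x \<ominus>\<^bsub>quot_alg h\<^esub> r n)" for n
    proof -
      have "w ((zz * x) mod H \<ominus>\<^bsub>quot_alg h\<^esub> (zz * r n) mod H) = wb w (zz * (x - r n))"
        unfolding wb_def by (simp add: a_minus_quot_alg right_diff_distrib poly_mod_diff_left)
      also have "\<dots> = wb w (x - r n)" using wb_mult[OF w(1), of zz "x - r n"] zz by simp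
      also have "\<dots> = w (x \<ominus>\<^bsub>quot_alg h\<^esub> r n)"
        unfolding wb_def using x'(1) rr by (simp add: a_minus_quot_alg poly_mod_diff_left)
      finally show ?thesis .
    qed
    then show "(\<lambda>n. w ((zz * x) mod H \<ominus>\<^bsub>quot_alg h\<^esub> (zz * r n) mod H)) \<longlonglongrightarrow> \<infinity>"
      using r(3)[OF w] by simp
  qed
qed

end

section \<open>Frobenius and Verschiebung\<close>

lemma map_poly_mod:
  fixes f :: "'b::field_char_0 \<Rightarrow> 'c::field_char_0"
  assumes "field_hom f" shows "map_poly f (u mod w) = map_poly f u mod map_poly f w"
proof (cases "w = 0 \<or> u mod w = 0")
  case True
  interpret f: field_hom f by fact
  interpret fp: map_poly_inj_idom_hom f ..
  show ?thesis
  proof (cases "w = 0")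
    case False
    then have "w dvd u" using True by (simp add: mod_eq_0_iff_dvd)
    then have "map_poly f w dvd map_poly f u" by (rule fp.hom_dvd)
    then show ?thesis using \<open>w dvd u\<close> by (simp add: mod_eq_0_iff_dvd)
  qed simp
next
  case False
  interpret f: field_hom f by fact
  interpret fp: map_poly_inj_idom_hom f ..
  have "u = u div w * w + u mod w" by simp
  then have "map_poly f u = map_poly f (u div w) * map_poly f w + map_poly f (u mod w)"
    by (metis fp.hom_add fp.hom_mult)
  then have "map_poly f u mod map_poly f w = map_poly f (u mod w) mod map_poly f w" by simp
  also have "\<dots> = map_poly f (u mod w)"
    using degree_mod_less[of w u] False by (intro mod_poly_less) simp
  finally show ?thesis by simp
qed

lemma lin_span_add:
  assumes "x \<in> lin_span (quot_alg h) C T" "y \<in> lin_span (quot_alg h) C T"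
  shows "x + y \<in> lin_span (quot_alg h :: 'b::field_char_0 poly ring) C T"
  using assms(1)
proof (induction rule: lin_span.induct)
  case (step c s z)
  then have "(c \<otimes>\<^bsub>quot_alg h\<^esub> s) \<oplus>\<^bsub>quot_alg h\<^esub> (z + y) \<in> lin_span (quot_alg h) C T" by (intro lin_span.step)
  then show ?case by (simp add: add.assoc)
qed (use assms(2) in simp)

lemma lin_span_base:
  assumes "c \<in> C" "s \<in> T" shows "(c * s) mod modulus h \<in> lin_span (quot_alg h :: 'b::field_char_0 poly ring) C T"
proof -
  have "(c \<otimes>\<^bsub>quot_alg h\<^esub> s) \<oplus>\<^bsub>quot_alg h\<^esub> \<zero>\<^bsub>quot_alg h\<^esub> \<in> lin_span (quot_alg h :: 'b poly ring) C T"
    using assms by (intro lin_span.step lin_span.zero)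
  then show ?thesis by simp
qed

lemma lin_span_zero: "0 \<in> lin_span (quot_alg h :: 'b::field_char_0 poly ring) C T"
  using lin_span.zero[of "quot_alg h :: 'b poly ring"] by simp

lemma lin_span_sum:
  "(\<And>i. i \<in> I \<Longrightarrow> f i \<in> lin_span (quot_alg h :: 'b::field_char_0 poly ring) C T) \<Longrightarrow> sum f I \<in> lin_span (quot_alg h) C T"
  by (induction I rule: infinite_finite_induct) (auto intro: lin_span_add lin_span_zero)

lemma lin_span_subset:
  assumes "0 \<in> J" "\<And>x y. x \<in> J \<Longrightarrow> y \<in> J \<Longrightarrow> x + y \<in> J"
    and "\<And>c s. c \<in> C \<Longrightarrow> s \<in> T \<Longrightarrow> (c * s) mod modulus h \<in> J"
  shows "lin_span (quot_alg h :: 'b::field_char_0 poly ring) C T \<subseteq> J"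
proof
  fix x assume "x \<in> lin_span (quot_alg h :: 'b poly ring) C T"
  then show "x \<in> J" by (induction rule: lin_span.induct) (use assms in auto)
qed

context slope_setting
begin

sublocale U: unit_root_factor p v \<iota> vL a \<sigma> k zz zi by (rule unit_root_factor)

abbreviation HL :: "'l poly" where "HL \<equiv> map_poly of_int h"
abbreviation \<Delta> :: "'k poly \<Rightarrow> 'l poly" where "\<Delta> \<equiv> map_poly \<iota>"
abbreviation sp :: "'l poly \<Rightarrow> 'l poly" where "sp \<equiv> map_poly \<sigma>"

text \<open>The factor \<open>A\<^sup>*\<close> of \<open>L[x]/(h)\<close>; reduction modulo \<open>k\<close> identifies it with \<open>L[x]/(k)\<close>.\<close>

definition AA :: "'l poly set" where "AA = {z. z mod HL = z \<and> \<Delta> g dvd z}"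

definition act :: "'l poly \<Rightarrow> 'l poly \<Rightarrow> 'l poly" where "act u z = (u * z) mod HL"

lemma otimes_act: "u \<otimes>\<^bsub>quot_alg h\<^esub> z = act u z" by (simp add: act_def)

lemma HL_eq: "HL = \<Delta> H" "HL = sp HL" "HL = \<Delta> g * U.kL"
proof -
  show "HL = \<Delta> H" using xinv_hom(2)[OF \<iota>.field_hom_axioms] by simp
  then show "HL = \<Delta> g * U.kL" unfolding U.kL_def by (simp add: H_factor \<iota>p.hom_mult)
  show "HL = sp HL" using xinv_hom(2)[OF \<sigma>.field_hom_axioms] by simp
qed

lemma dvd_HL: assumes "\<Delta> g dvd z" "U.kL dvd z" shows "HL dvd z"
proof -
  obtain s t where "s * g + t * k = 1" using coprime_bezout[OF coprime_g_k] by blast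
  then have st: "\<Delta> s * \<Delta> g + \<Delta> t * U.kL = 1" unfolding U.kL_def by (metis \<iota>p.hom_add \<iota>p.hom_mult \<iota>p.hom_one)
  obtain q q' where q: "z = \<Delta> g * q" "z = U.kL * q'" using assms by (meson dvdE)
  have "z = \<Delta> s * \<Delta> g * z + \<Delta> t * U.kL * z" unfolding distrib_right[symmetric] st by simp
  also have "\<dots> = \<Delta> s * \<Delta> g * (U.kL * q') + \<Delta> t * U.kL * (\<Delta> g * q)" by (simp only: q[symmetric])
  also have "\<dots> = HL * (\<Delta> s * q' + \<Delta> t * q)" unfolding HL_eq(3) by (simp add: algebra_simps)
  finally show ?thesis by (rule dvdI)
qed

lemma AA_reduced: "z \<in> AA \<Longrightarrow> z mod HL = z" unfolding AA_def by simp

lemma AA_eqI: assumes "x \<in> AA" "y \<in> AA" "x mod U.kL = y mod U.kL" shows "x = y"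
proof -
  have "\<Delta> g dvd x - y" using assms unfolding AA_def by auto
  moreover have "U.kL dvd x - y" using assms(3) by (simp add: mod_eq_dvd_iff)
  ultimately have "HL dvd x - y" by (rule dvd_HL)
  then have "x mod HL = y mod HL" by (simp add: mod_eq_dvd_iff)
  then show ?thesis using assms AA_reduced by simp
qed

lemma AA_mod: "\<Delta> g dvd z \<Longrightarrow> z mod HL \<in> AA"
  unfolding AA_def by (simp add: dvd_mod HL_eq(3))

lemma mod_HL_kL: "z mod HL mod U.kL = z mod U.kL"
  by (rule mod_mod_cancel) (simp add: HL_eq(3))

lemma AA_closed: "0 \<in> AA" "x \<in> AA \<Longrightarrow> y \<in> AA \<Longrightarrow> x + y \<in> AA" "x \<in> AA \<Longrightarrow> Polynomial.smult c x \<in> AA"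
  "x \<in> AA \<Longrightarrow> act u x \<in> AA" "x \<in> AA \<Longrightarrow> sp x \<in> AA"
proof -
  show "0 \<in> AA" "x \<in> AA \<Longrightarrow> y \<in> AA \<Longrightarrow> x + y \<in> AA" "x \<in> AA \<Longrightarrow> Polynomial.smult c x \<in> AA"
    unfolding AA_def by (auto simp: poly_mod_add_left mod_smult_left intro: dvd_smult)
  show "x \<in> AA \<Longrightarrow> act u x \<in> AA" unfolding act_def by (rule AA_mod) (simp add: AA_def)
  assume x: "x \<in> AA"
  then have "sp (\<Delta> g) dvd sp x" unfolding AA_def by (intro \<sigma>p.hom_dvd) simp
  moreover have "sp x mod HL = sp x"
    using map_poly_mod[OF \<sigma>.field_hom_axioms, of x HL] AA_reduced[OF x] by (simp flip: HL_eq(2))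
  ultimately show "sp x \<in> AA" unfolding AA_def by (simp add: \<sigma>p_\<iota>)
qed

lemma act_act: "act u (act u' z) = act (u * u') z"
  unfolding act_def by (simp add: mod_mult_right_eq mult.assoc)

lemma act_commute: "act u z = act z u" unfolding act_def by (simp add: mult.commute)

lemma act_add: "act u (y + z) = act u y + act u z" "act (u + u') z = act u z + act u' z"
  unfolding act_def by (simp_all add: algebra_simps poly_mod_add_left)

lemma act_smult: "act u (Polynomial.smult c z) = Polynomial.smult c (act u z)"
  "act (Polynomial.smult c u) z = Polynomial.smult c (act u z)"
  unfolding act_def by (simp_all add: mod_smult_left)

lemma act_zero: "act u 0 = 0" "act 0 u = 0" unfolding act_def by simp_all

lemma act_mod: "act (u mod HL) z = act u z" unfolding act_def by (rule mod_mult_left_eq)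

lemma act_one: "z \<in> AA \<Longrightarrow> act 1 z = z" unfolding act_def by (simp add: AA_reduced)

lemma act_scalar: "z \<in> AA \<Longrightarrow> act (scalar h c) z = Polynomial.smult c z"
  unfolding scalar_def act_mod by (simp add: act_def mod_smult_left AA_reduced)

lemma act_mod_kL: "act u z mod U.kL = (u * z) mod U.kL"
  unfolding act_def by (rule mod_HL_kL)

lemma act_cong: assumes "z \<in> AA" "u mod U.kL = u' mod U.kL" shows "act u z = act u' z"
proof (rule AA_eqI)
  show "act u z mod U.kL = act u' z mod U.kL"
    unfolding act_mod_kL using assms(2) by (metis mod_mult_left_eq)
qed (use assms AA_closed in auto)

lemma sp_act: "sp (act u z) = act (sp u) (sp z)"
  unfolding act_def by (simp add: map_poly_mod[OF \<sigma>.field_hom_axioms] \<sigma>p.hom_mult flip: HL_eq(2))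

lemma sp_smult: "sp (Polynomial.smult c z) = Polynomial.smult (\<sigma> c) (sp z)"
  by (rule poly_eqI) (simp add: \<sigma>.hom_mult)

lemma spj: "z \<in> AA \<Longrightarrow> (sp ^^ j) z \<in> AA" "(sp ^^ j) (act u z) = act ((sp ^^ j) u) ((sp ^^ j) z)"
  by (induction j) (auto simp: sp_act AA_closed)

lemma \<Delta>_mod: "\<Delta> (u mod H) = \<Delta> u mod HL"
  using map_poly_mod[OF \<iota>.field_hom_axioms, of u H] by (simp flip: HL_eq(1))

lemma \<Delta>_AA: "\<Delta> x \<in> AA \<longleftrightarrow> x \<in> E_part p a v h S"
proof -
  have "\<Delta> g dvd \<Delta> x \<longleftrightarrow> g dvd x"
    by (simp add: dvd_eq_mod_eq_0 map_poly_mod[OF \<iota>.field_hom_axioms, symmetric])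
  moreover have "\<Delta> x mod HL = \<Delta> x \<longleftrightarrow> x mod H = x" unfolding \<Delta>_mod[symmetric] by simp
  ultimately show ?thesis unfolding AA_def E_eq by simp
qed

lemma act_\<Delta>: "act (\<Delta> x) (\<Delta> y) = \<Delta> ((x * y) mod H)"
  unfolding \<Delta>_mod act_def by (simp add: \<iota>p.hom_mult)

lemma sp_fixed: assumes "sp y = y" obtains x where "y = \<Delta> x"
proof -
  have "\<exists>x. Polynomial.coeff y i = \<iota> x" for i
    using \<sigma>_fixed[of "Polynomial.coeff y i"] assms by (metis \<sigma>.hom_zero coeff_map_poly rangeE)
  then have "\<forall>i. \<exists>x. Polynomial.coeff y i = \<iota> x" by blast
  from choice[OF this] obtain f where f: "\<And>i. Polynomial.coeff y i = \<iota> (f i)" by blast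
  have "y = \<Delta> (\<Sum>i\<le>Polynomial.degree y. Polynomial.monom (f i) i)"
  proof (rule poly_eqI)
    fix i
    have "\<iota> (f i) = 0" if "i > Polynomial.degree y" using f[of i] that by (simp add: coeff_eq_0)
    then show "Polynomial.coeff y i = Polynomial.coeff (\<Delta> (\<Sum>i\<le>Polynomial.degree y. Polynomial.monom (f i) i)) i"
      by (simp add: coeff_sum if_distrib f cong: if_cong)
  qed
  then show ?thesis by (rule that)
qed

text \<open>
  The idempotent of \<open>E\<^sub>p\<close> that cuts out \<open>E\<^sub>p\<^sup>*\<close>, the unit element of \<open>R\<^sub>p\<^sup>*\<close>.
\<close>

lemma projector:
  obtains e where "e \<in> R_part p a v h S" "\<Delta> e \<in> AA" "\<And>z. z \<in> AA \<Longrightarrow> act z (\<Delta> e) = z"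
proof -
  obtain s t where st: "s * g + t * k = 1" using coprime_bezout[OF coprime_g_k] by blast
  define e where "e = (s * g) mod H"
  have "g dvd e" unfolding e_def by (simp add: dvd_mod H_factor)
  have "e - 1 = (s * g - 1) - H * ((s * g) div H)" unfolding e_def by (simp add: minus_mult_div_eq_mod[symmetric])
  also have "s * g - 1 = - t * k" using st by (simp add: algebra_simps)
  finally have ek: "k dvd e - 1" by (simp add: H_factor)
  have eR: "e \<in> R_part p a v h S" by (rule R_part_one[OF _ \<open>g dvd e\<close> ek]) (simp add: e_def)
  have eA: "\<Delta> e \<in> AA" unfolding \<Delta>_AA E_eq using \<open>g dvd e\<close> by (simp add: e_def)
  have "U.kL dvd \<Delta> e - 1" using \<iota>p.hom_dvd[OF ek] by (simp add: U.kL_def \<iota>p.hom_minus)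
  then have "\<Delta> e mod U.kL = 1 mod U.kL" by (simp add: mod_eq_dvd_iff)
  then have "act z (\<Delta> e) = z" if "z \<in> AA" for z
    using act_cong[OF that, of "\<Delta> e" 1] that by (simp add: act_one act_commute)
  then show ?thesis using eR eA that by blast
qed

definition e where "e = (SOME e. e \<in> R_part p a v h S \<and> \<Delta> e \<in> AA \<and> (\<forall>z. z \<in> AA \<longrightarrow> act z (\<Delta> e) = z))"

lemma e_R: "e \<in> R_part p a v h S" and e_AA: "\<Delta> e \<in> AA" and act_e: "z \<in> AA \<Longrightarrow> act z (\<Delta> e) = z"
proof -
  have "\<exists>e. e \<in> R_part p a v h S \<and> \<Delta> e \<in> AA \<and> (\<forall>z. z \<in> AA \<longrightarrow> act z (\<Delta> e) = z)" using projector by blast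
  from someI_ex[OF this, folded e_def]
  show "e \<in> R_part p a v h S" "\<Delta> e \<in> AA" "z \<in> AA \<Longrightarrow> act z (\<Delta> e) = z" by auto
qed

abbreviation EE :: "'k poly set" where "EE \<equiv> E_part p a v h S"
abbreviation RR :: "'k poly set" where "RR \<equiv> R_part p a v h S"
abbreviation WR :: "'l poly set" where "WR \<equiv> tensor h \<iota> W RR"

lemma act_assoc: "act (act u r) z = act u (act r z)"
  unfolding act_act by (simp add: act_def mod_mult_left_eq)

lemma RR_EE: "RR \<subseteq> EE" unfolding R_part_def Let_def by blast

text \<open>
  Products of representing sequences represent the product: the limit is continuous because the
  values of \<open>x\<close> and \<open>y\<close> at each place are bounded below.
\<close>

lemma R_part_mult:
  assumes x: "x \<in> R_part p a v h S" and y: "y \<in> R_part p a v h S"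
  shows "(x * y) mod H \<in> R_part p a v h S"
  unfolding R_part_def Let_def
proof (intro CollectI conjI allI impI)
  have "x \<in> E_part p a v h S" "y \<in> E_part p a v h S" using x y unfolding R_part_def Let_def by blast+
  then have xH: "x mod H = x" "y mod H = y" and "g dvd x" unfolding E_eq by auto
  then show "(x * y) mod H \<in> E_part p a v h S" unfolding E_part_dvd by simp
  fix m assume m: "maximalideal m Rp \<and> (\<exists>w\<in>places p v h. slope p a h w \<in> S \<and> m = center (carrier Rp) w)"
  interpret m: maximalideal m Rp using m by blast
  have seq: "\<exists>r. (\<forall>n::nat. r n \<in> carrier Rp \<and> r (Suc n) \<ominus>\<^bsub>quot_alg h\<^esub> r n \<in> m [^]\<^bsub>ideals_set Rp\<^esub> n) \<and>
      (\<forall>w\<in>places p v h. m = center (carrier Rp) w \<longrightarrow> (\<lambda>n. w (x \<ominus>\<^bsub>quot_alg h\<^esub> r n)) \<longlonglongrightarrow> \<infinity>)"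
    if "x \<in> R_part p a v h S" for x using that m unfolding R_part_def Let_def by blast
  obtain r where r: "\<And>n. r n \<in> carrier Rp" "\<And>n. r (Suc n) \<ominus>\<^bsub>quot_alg h\<^esub> r n \<in> m [^]\<^bsub>ideals_set Rp\<^esub> (n::nat)"
    "\<And>w. w \<in> places p v h \<Longrightarrow> m = center (carrier Rp) w \<Longrightarrow> (\<lambda>n. w (x \<ominus>\<^bsub>quot_alg h\<^esub> r n)) \<longlonglongrightarrow> \<infinity>"
    using seq[OF x] by blast
  obtain s where s: "\<And>n. s n \<in> carrier Rp" "\<And>n. s (Suc n) \<ominus>\<^bsub>quot_alg h\<^esub> s n \<in> m [^]\<^bsub>ideals_set Rp\<^esub> (n::nat)"
    "\<And>w. w \<in> places p v h \<Longrightarrow> m = center (carrier Rp) w \<Longrightarrow> (\<lambda>n. w (y \<ominus>\<^bsub>quot_alg h\<^esub> s n)) \<longlonglongrightarrow> \<infinity>"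
    using seq[OF y] by blast
  have red: "r n mod H = r n" "s n mod H = s n" for n using r(1)[of n] s(1)[of n] R_p_reduced by auto
  show "\<exists>r. (\<forall>n::nat. r n \<in> carrier Rp \<and> r (Suc n) \<ominus>\<^bsub>quot_alg h\<^esub> r n \<in> m [^]\<^bsub>ideals_set Rp\<^esub> n) \<and>
      (\<forall>w\<in>places p v h. m = center (carrier Rp) w \<longrightarrow> (\<lambda>n. w ((x * y) mod H \<ominus>\<^bsub>quot_alg h\<^esub> r n)) \<longlonglongrightarrow> \<infinity>)"
  proof (intro exI[of _ "\<lambda>n. (r n * s n) mod H"] conjI allI ballI impI)
    fix n :: nat
    have "r n \<otimes>\<^bsub>Rp\<^esub> s n \<in> carrier Rp" by (rule m.m_closed[OF r(1) s(1)])
    then show "(r n * s n) mod H \<in> carrier Rp" by simp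
    interpret I: ideal "m [^]\<^bsub>ideals_set Rp\<^esub> n" Rp by (rule ideal_power) (use m in blast)
    have "(r (Suc n) \<otimes>\<^bsub>Rp\<^esub> (s (Suc n) \<ominus>\<^bsub>quot_alg h\<^esub> s n)) \<oplus>\<^bsub>Rp\<^esub> ((r (Suc n) \<ominus>\<^bsub>quot_alg h\<^esub> r n) \<otimes>\<^bsub>Rp\<^esub> s n)
        \<in> m [^]\<^bsub>ideals_set Rp\<^esub> n"
      by (intro I.a_closed I.I_l_closed[OF s(2) r(1)] I.I_r_closed[OF r(2) s(1)])
    moreover have "r (Suc n) * (s (Suc n) - s n) + (r (Suc n) - r n) * s n = r (Suc n) * s (Suc n) - r n * s n"
      by (simp add: algebra_simps)
    ultimately show "(r (Suc n) * s (Suc n)) mod H \<ominus>\<^bsub>quot_alg h\<^esub> (r n * s n) mod H \<in> m [^]\<^bsub>ideals_set Rp\<^esub> n"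
      using red by (simp add: a_minus_quot_alg flip: poly_mod_add_left poly_mod_diff_left)
  next
    fix w assume w: "w \<in> places p v h" "m = center (carrier Rp) w"
    have mult_ge: "ereal (\<alpha> + \<beta>) \<le> wb w (u * u')" if "ereal \<alpha> \<le> wb w u" "ereal \<beta> \<le> wb w u'" for \<alpha> \<beta> u u'
      using add_mono[OF that] by (simp add: wb_mult[OF w(1)])
    have add_ge: "ereal \<alpha> \<le> wb w (u + u')" if "ereal \<alpha> \<le> wb w u" "ereal \<alpha> \<le> wb w u'" for \<alpha> u u'
      using min.boundedI[OF that] wb_add[OF w(1), of u u'] by (rule order_trans)
    have low: "\<exists>K\<ge>0. ereal (- K) \<le> wb w u" for u
    proof (cases "wb w u = \<infinity>")
      case False
      then obtain k :: int where "wb w u = ereal (of_int k)" using wb_range[OF w(1)] by blast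
      then show ?thesis by (intro exI[of _ "\<bar>of_int k\<bar>"]) simp
    qed (auto intro: exI[of _ 0])
    obtain K L where KL: "K \<ge> 0" "ereal (- K) \<le> wb w x" "L \<ge> 0" "ereal (- L) \<le> wb w (- y)" using low by meson
    have wr: "w (x \<ominus>\<^bsub>quot_alg h\<^esub> r n) = wb w (r n - x)" "w (y \<ominus>\<^bsub>quot_alg h\<^esub> s n) = wb w (y - s n)" for n
    proof -
      have "v (- 1) = 0" using v_minus[of 1] v_one by simp
      then have "wb w (Polynomial.smult (- 1) (x - r n)) = wb w (x - r n)" unfolding wb_smult[OF w(1)] by simp
      then have "wb w (r n - x) = wb w (x - r n)" by simp
      then show "w (x \<ominus>\<^bsub>quot_alg h\<^esub> r n) = wb w (r n - x)" "w (y \<ominus>\<^bsub>quot_alg h\<^esub> s n) = wb w (y - s n)"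
        unfolding wb_def using xH red by (simp_all add: a_minus_quot_alg poly_mod_diff_left)
    qed
    note lim = r(3)[OF w, unfolded wr Lim_PInfty] s(3)[OF w, unfolded wr Lim_PInfty]
    have eq: "w ((x * y) mod H \<ominus>\<^bsub>quot_alg h\<^esub> (r n * s n) mod H) = wb w (x * (y - s n) + ((r n - x) * (- y) + (r n - x) * (y - s n)))" for n
    proof -
      have "x * (y - s n) + ((r n - x) * (- y) + (r n - x) * (y - s n)) = x * y - r n * s n" by (simp add: algebra_simps)
      then show ?thesis unfolding wb_def by (simp add: a_minus_quot_alg poly_mod_diff_left)
    qed
    show "(\<lambda>n. w ((x * y) mod H \<ominus>\<^bsub>quot_alg h\<^esub> (r n * s n) mod H)) \<longlonglongrightarrow> \<infinity>"
      unfolding eq Lim_PInfty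
    proof
      fix B :: real
      obtain N1 where N1: "\<And>n. n \<ge> N1 \<Longrightarrow> ereal (\<bar>B\<bar> + K + L) \<le> wb w (r n - x)" using lim(1) by blast
      obtain N2 where N2: "\<And>n. n \<ge> N2 \<Longrightarrow> ereal (\<bar>B\<bar> + K + L) \<le> wb w (y - s n)" using lim(2) by blast
      show "\<exists>N. \<forall>n\<ge>N. ereal B \<le> wb w (x * (y - s n) + ((r n - x) * (- y) + (r n - x) * (y - s n)))"
      proof (intro exI[of _ "max N1 N2"] allI impI)
        fix n assume "n \<ge> max N1 N2"
        then have n: "ereal (\<bar>B\<bar> + K + L) \<le> wb w (r n - x)" "ereal (\<bar>B\<bar> + K + L) \<le> wb w (y - s n)" using N1 N2 by auto
        have le: "ereal B \<le> u" if "ereal \<beta> \<le> u" "B \<le> \<beta>" for \<beta> u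
          using that(2) by (intro order_trans[OF _ that(1)]) simp
        show "ereal B \<le> wb w (x * (y - s n) + ((r n - x) * (- y) + (r n - x) * (y - s n)))"
          using KL(1,3) by (intro add_ge le[OF mult_ge[OF KL(2) n(2)]] le[OF mult_ge[OF n(1) KL(4)]] le[OF mult_ge[OF n]]) auto
      qed
    qed
  qed
qed

lemma tensor_add: "x \<in> tensor h \<iota> C N \<Longrightarrow> y \<in> tensor h \<iota> C N \<Longrightarrow> x + y \<in> tensor h \<iota> C N"
  and tensor_zero: "0 \<in> tensor h \<iota> C N"
  and tensor_sum: "(\<And>i. i \<in> I \<Longrightarrow> f i \<in> tensor h \<iota> C N) \<Longrightarrow> sum f I \<in> tensor h \<iota> C N"
  unfolding tensor_def by (rule lin_span_add lin_span_zero lin_span_sum; simp)+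

lemma tensor_base: "c \<in> C \<Longrightarrow> x \<in> N \<Longrightarrow> x \<in> EE \<Longrightarrow> Polynomial.smult c (\<Delta> x) \<in> tensor h \<iota> C N"
  unfolding tensor_def using lin_span_base[of "scalar h c" "scalar h ` C" "\<Delta> x" "\<Delta> ` N" h] act_scalar[of "\<Delta> x" c]
  by (simp add: act_def \<Delta>_AA)

lemma tensor_subset:
  assumes "N \<subseteq> EE" "0 \<in> J" "\<And>x y. x \<in> J \<Longrightarrow> y \<in> J \<Longrightarrow> x + y \<in> J"
    and base: "\<And>c x. c \<in> C \<Longrightarrow> x \<in> N \<Longrightarrow> Polynomial.smult c (\<Delta> x) \<in> J"
  shows "tensor h \<iota> C N \<subseteq> J"
  unfolding tensor_def
proof (rule lin_span_subset)
  fix c s assume "c \<in> scalar h ` C" "s \<in> \<Delta> ` N"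
  then obtain c' x where cx: "c = scalar h c'" "c' \<in> C" "s = \<Delta> x" "x \<in> N" by blast
  have "\<Delta> x \<in> AA" using cx assms(1) by (auto simp: \<Delta>_AA)
  then have "(c * s) mod HL = Polynomial.smult c' (\<Delta> x)" unfolding act_def[symmetric] cx by (rule act_scalar)
  then show "(c * s) mod HL \<in> J" using base cx by simp
qed (use assms in auto)

lemma subset_CollectD: "A \<subseteq> {z. P z} \<Longrightarrow> z \<in> A \<Longrightarrow> P z" by blast

text \<open>
  What is needed of a lattice: it is a module over \<open>W[zz]\<close>, the ring that contains the unit by which
  \<open>F\<close> differs from \<open>\<sigma>\<close>.
\<close>

definition submodule :: "'l poly set \<Rightarrow> bool" where
  "submodule J \<longleftrightarrow> J \<subseteq> AA \<and> 0 \<in> J \<and> (\<forall>x\<in>J. \<forall>y\<in>J. x + y \<in> J) \<and>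
    (\<forall>w\<in>W. \<forall>z\<in>J. Polynomial.smult w z \<in> J) \<and> (\<forall>z\<in>J. act (\<Delta> zz) z \<in> J)"

lemma submodule_sum: "submodule J \<Longrightarrow> (\<And>i. i \<in> I \<Longrightarrow> f i \<in> J) \<Longrightarrow> sum f I \<in> J"
  by (induction I rule: infinite_finite_induct) (auto simp: submodule_def)

lemma submodule_BW:
  assumes J: "submodule J" and \<beta>: "\<beta> \<in> U.BW" and z: "z \<in> J"
  shows "act \<beta> z \<in> J"
proof -
  have zA: "z \<in> AA" using J z unfolding submodule_def by blast
  obtain q where q: "\<forall>i. Polynomial.coeff q i \<in> W" "U.kL dvd \<beta> - pcompose q U.Y"
    using \<beta> unfolding U.BW_def by blast
  have "act (pcompose q U.Y) z \<in> J" using q(1)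
  proof (induction q)
    case 0
    then show ?case using J by (simp add: act_zero submodule_def)
  next
    case (pCons c q)
    have c: "c \<in> W" using pCons.prems[rule_format, of 0] by simp
    have "Polynomial.coeff q i \<in> W" for i using pCons.prems[rule_format, of "Suc i"] by simp
    then have IH: "act (pcompose q U.Y) z \<in> J" by (intro pCons.IH allI)
    have "act [:c:] z = Polynomial.smult c z" using act_scalar[OF zA, of c] by (simp add: scalar_def act_mod)
    then have "act (pcompose (pCons c q) U.Y) z = Polynomial.smult c z + act (\<Delta> zz) (act (pcompose q U.Y) z)"
      by (simp add: pcompose_pCons act_add act_act U.Y_def)
    then show ?case using J c z IH unfolding submodule_def by simp
  qed
  moreover have "act \<beta> z = act (pcompose q U.Y) z"
    by (rule act_cong[OF zA]) (use q(2) in \<open>simp add: mod_eq_dvd_iff\<close>)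
  ultimately show ?thesis by simp
qed

lemma tensor_submodule:
  assumes N: "N \<subseteq> EE" and zN: "\<And>x. x \<in> N \<Longrightarrow> (zz * x) mod H \<in> N"
  shows "submodule (tensor h \<iota> W N)" "z \<in> tensor h \<iota> W N \<Longrightarrow> sp z \<in> tensor h \<iota> W N"
proof -
  have base: "Polynomial.smult c (\<Delta> x) \<in> tensor h \<iota> W N" if "c \<in> W" "x \<in> N" for c x
    using tensor_base that N by blast
  have s1: "tensor h \<iota> W N \<subseteq> AA" by (rule tensor_subset) (use N in \<open>auto simp: AA_closed \<Delta>_AA\<close>)
  have s2: "tensor h \<iota> W N \<subseteq> {z. Polynomial.smult w z \<in> tensor h \<iota> W N}" if "w \<in> W" for w
    by (rule tensor_subset) (use that N in \<open>auto simp: tensor_zero tensor_add smult_add_right intro: base\<close>)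
  have s3: "tensor h \<iota> W N \<subseteq> {z. act (\<Delta> zz) z \<in> tensor h \<iota> W N}"
    by (rule tensor_subset) (use zN N in \<open>auto simp: act_zero tensor_zero act_add tensor_add act_smult act_\<Delta> intro: base\<close>)
  show "submodule (tensor h \<iota> W N)" unfolding submodule_def
    by (intro conjI ballI s1 tensor_zero tensor_add subset_CollectD[OF s2] subset_CollectD[OF s3])
  have "tensor h \<iota> W N \<subseteq> {z. sp z \<in> tensor h \<iota> W N}"
    by (rule tensor_subset) (use N in \<open>auto simp: tensor_zero \<sigma>p.hom_add tensor_add sp_smult \<sigma>p_\<iota> intro!: base\<close>)
  then show "z \<in> tensor h \<iota> W N \<Longrightarrow> sp z \<in> tensor h \<iota> W N" by blast
qed

lemma WR_submodule: "submodule WR"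
  by (rule tensor_submodule(1)[OF RR_EE R_part_zz])

lemma smult_e_WR: "w \<in> W \<Longrightarrow> Polynomial.smult w (\<Delta> e) \<in> WR"
  using e_R RR_EE by (intro tensor_base) auto

lemma act_smult_e: "z \<in> AA \<Longrightarrow> act (Polynomial.smult w (\<Delta> e)) z = Polynomial.smult w z"
  using act_e[of z] by (simp add: act_smult act_commute)

lemma span_submodule:
  assumes T: "T \<subseteq> AA"
  shows "submodule (lin_span (quot_alg h) WR T)"
proof -
  let ?J = "lin_span (quot_alg h) WR T"
  have base: "act r t \<in> ?J" if "r \<in> WR" "t \<in> T" for r t unfolding act_def using that by (rule lin_span_base)
  have s1: "?J \<subseteq> AA" by (rule lin_span_subset) (use T in \<open>auto simp: AA_closed act_def[symmetric]\<close>)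
  have s2: "?J \<subseteq> {z. Polynomial.smult w z \<in> ?J}" if w: "w \<in> W" for w
  proof (rule lin_span_subset)
    fix r t assume rt: "r \<in> WR" "t \<in> T"
    have "Polynomial.smult w r \<in> WR" using WR_submodule w rt unfolding submodule_def by blast
    then show "(r * t) mod HL \<in> {z. Polynomial.smult w z \<in> ?J}"
      using base rt by (simp add: act_def[symmetric] flip: act_smult(2))
  qed (auto simp: lin_span_zero lin_span_add smult_add_right)
  have s3: "?J \<subseteq> {z. act (\<Delta> zz) z \<in> ?J}"
  proof (rule lin_span_subset)
    fix r t assume rt: "r \<in> WR" "t \<in> T"
    have "act (\<Delta> zz) r \<in> WR" using WR_submodule rt unfolding submodule_def by blast
    then show "(r * t) mod HL \<in> {z. act (\<Delta> zz) z \<in> ?J}"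
      using base rt by (simp add: act_def[symmetric] flip: act_assoc)
  qed (auto simp: lin_span_zero lin_span_add act_zero act_add)
  show ?thesis unfolding submodule_def
    by (intro conjI ballI s1 lin_span_zero lin_span_add subset_CollectD[OF s2] subset_CollectD[OF s3])
qed

lemma WR_mult: assumes r: "r \<in> WR" and s: "s \<in> WR" shows "act r s \<in> WR"
proof -
  have WR: "0 \<in> WR" "\<And>x y. x \<in> WR \<Longrightarrow> y \<in> WR \<Longrightarrow> x + y \<in> WR"
    "\<And>w z. w \<in> W \<Longrightarrow> z \<in> WR \<Longrightarrow> Polynomial.smult w z \<in> WR" using WR_submodule unfolding submodule_def by auto
  have \<Delta>_WR: "\<Delta> x \<in> WR" if "x \<in> RR" for x using tensor_base[of 1 W x RR] that RR_EE by auto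
  have 1: "act (\<Delta> x) z \<in> WR" if x: "x \<in> RR" and z: "z \<in> WR" for x z
  proof -
    have "WR \<subseteq> {z. act (\<Delta> x) z \<in> WR}"
      by (rule tensor_subset[OF RR_EE]) (use x WR in \<open>auto simp: act_zero act_add act_smult act_\<Delta> intro!: WR(3) \<Delta>_WR R_part_mult\<close>)
    then show ?thesis using z by (rule subset_CollectD)
  qed
  have "WR \<subseteq> {r. act r s \<in> WR}"
    by (rule tensor_subset[OF RR_EE]) (use s WR 1 in \<open>auto simp: act_zero act_add act_smult\<close>)
  then show ?thesis using r by (rule subset_CollectD)
qed

lemma span_WR_stable:
  assumes r: "r \<in> WR" and z: "z \<in> lin_span (quot_alg h) WR T"
  shows "act r z \<in> lin_span (quot_alg h) WR T"
proof -
  let ?L = "lin_span (quot_alg h) WR T"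
  have "?L \<subseteq> {z. act r z \<in> ?L}"
  proof (rule lin_span_subset)
    fix s t assume st: "s \<in> WR" "t \<in> T"
    have "act (act r s) t \<in> ?L" unfolding act_def[of "act r s" t] using WR_mult[OF r st(1)] st(2) by (rule lin_span_base)
    then show "(s * t) mod HL \<in> {z. act r z \<in> ?L}" by (simp add: act_assoc act_def[of s t, symmetric])
  qed (auto simp: lin_span_zero lin_span_add act_zero act_add)
  then show ?thesis using z by (rule subset_CollectD)
qed

text \<open>Galois descent for \<open>L\<close> over \<open>\<rat>\<^sub>p\<close>, with integral coefficients: traces are fixed by \<open>\<sigma>\<close>.\<close>

definition Tr :: "'l poly \<Rightarrow> 'l poly" where "Tr u = (\<Sum>j<a. (sp ^^ j) u)"

lemma coeff_Tr: "Polynomial.coeff (Tr u) i = trace (Polynomial.coeff u i)"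
  unfolding Tr_def trace_def by (simp add: coeff_sum coeff_\<sigma>_power)

lemma Tr_fixed: "sp (Tr u) = Tr u"
  by (rule poly_eqI) (simp add: coeff_Tr trace_fixed)

lemma descent:
  assumes J: "submodule J" and sp: "\<And>z. z \<in> J \<Longrightarrow> sp z \<in> J" and y: "y \<in> J"
  shows "y \<in> tensor h \<iota> W {x \<in> EE. \<Delta> x \<in> J}"
proof -
  obtain m :: nat and b c where bc: "\<And>i. i < m \<Longrightarrow> b i \<in> W" "\<And>i. i < m \<Longrightarrow> c i \<in> W"
    "\<And>j. j < a \<Longrightarrow> (\<Sum>i<m. b i * (\<sigma> ^^ j) (c i)) = (if j = 0 then 1 else 0)"
    using indexed_galois_basis by blast
  have "y = (\<Sum>i<m. Polynomial.smult (b i) (Tr (Polynomial.smult (c i) y)))"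
    by (rule poly_eqI) (simp add: coeff_sum coeff_Tr trace_expansion[OF bc(3), symmetric])
  moreover have "Polynomial.smult (b i) (Tr (Polynomial.smult (c i) y)) \<in> tensor h \<iota> W {x \<in> EE. \<Delta> x \<in> J}" if i: "i < m" for i
  proof -
    have "Polynomial.smult (c i) y \<in> J" using J bc(2)[OF i] y unfolding submodule_def by blast
    then have "(sp ^^ j) (Polynomial.smult (c i) y) \<in> J" for j by (induction j) (auto intro: sp)
    then have Tr: "Tr (Polynomial.smult (c i) y) \<in> J" unfolding Tr_def by (intro submodule_sum[OF J])
    obtain x where x: "Tr (Polynomial.smult (c i) y) = \<Delta> x" using sp_fixed[OF Tr_fixed] by blast
    have "x \<in> EE" using Tr J unfolding x submodule_def by (auto simp: \<Delta>_AA)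
    then show ?thesis unfolding x using Tr x bc(1)[OF i] by (intro tensor_base) auto
  qed
  ultimately show ?thesis using tensor_sum[of "{..<m}" "\<lambda>i. Polynomial.smult (b i) (Tr (Polynomial.smult (c i) y))"] by auto
qed

lemma AA_submodule: "submodule AA" unfolding submodule_def by (simp add: AA_closed)

lemma AA_W: "z \<in> AA \<Longrightarrow> z \<in> tensor h \<iota> W EE"
  using descent[OF AA_submodule AA_closed(5)] by (simp add: \<Delta>_AA cong: conj_cong)

lemma AA_eq: "tensor h \<iota> UNIV EE = AA"
proof
  show "tensor h \<iota> UNIV EE \<subseteq> AA" by (rule tensor_subset) (auto simp: AA_closed \<Delta>_AA)
  have "tensor h \<iota> W EE \<subseteq> tensor h \<iota> UNIV EE"
    by (rule tensor_subset) (auto simp: tensor_zero tensor_add intro: tensor_base)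
  then show "AA \<subseteq> tensor h \<iota> UNIV EE" using AA_W by blast
qed

text \<open>
  The Frobenius is \<open>z \<mapsto> c b z\<^sup>\<sigma>\<close> with a unit \<open>b\<close> of \<open>W[zz]\<close> such that \<open>c\<^sup>a N(b) = \<pi>\<close>: on the slope 0
  part \<open>c = 1\<close> and \<open>N(b) = \<pi>\<close>, on the slope 1 part \<open>c = p\<close> and \<open>N(b) = \<pi>/q\<close>.
\<close>

definition frobenius_datum :: "'l poly \<Rightarrow> 'l poly \<Rightarrow> nat \<Rightarrow> nat \<Rightarrow> bool" where
  "frobenius_datum b b' c c' \<longleftrightarrow> b \<in> U.BW \<and> b' \<in> U.BW \<and> U.kL dvd b * b' - 1 \<and> c * c' = p \<and> (c = 1 \<or> c' = 1) \<and>
    U.kL dvd Polynomial.smult (of_nat c ^ a) (\<Prod>j<a. (sp ^^ j) b) - [:0, 1:]"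

lemma x_eq: "S = {0} \<Longrightarrow> \<Delta> zz = [:0, 1:]"
  "S \<noteq> {0} \<Longrightarrow> Polynomial.smult (of_nat p ^ a) (\<Delta> zi) = [:0, 1:]"
proof -
  have "\<iota> (inverse (of_nat p ^ a)) = inverse (of_nat p ^ a)" by (simp add: \<iota>.hom_inverse \<iota>.hom_power)
  moreover have "(of_nat p ^ a :: 'l) \<noteq> 0" using gr_implies_not0[OF p_pos] by simp
  ultimately show "S \<noteq> {0} \<Longrightarrow> Polynomial.smult (of_nat p ^ a) (\<Delta> zi) = [:0, 1:]" unfolding zi_def by simp
  show "S = {0} \<Longrightarrow> \<Delta> zz = [:0, 1:]" unfolding zz_def by simp
qed

lemma ex_frobenius_datum: obtains b b' c c' where "frobenius_datum b b' c c'"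
proof -
  obtain \<beta> \<beta>' where \<beta>: "\<beta> \<in> U.BW" "\<beta>' \<in> U.BW" "U.kL dvd \<beta> * \<beta>' - 1"
    "U.kL dvd (\<Prod>j<a. (sp ^^ j) \<beta>) - U.Y" using U.norm_equation by blast
  show ?thesis
  proof (cases "S = {0}")
    case True
    then have "U.Y = [:0, 1:]" unfolding U.Y_def by (rule x_eq(1))
    then have "frobenius_datum \<beta> \<beta>' 1 p" unfolding frobenius_datum_def using \<beta> by simp
    then show ?thesis by (rule that)
  next
    case False
    define N N' Zi where "N = (\<Prod>j<a. (sp ^^ j) \<beta>)" and "N' = (\<Prod>j<a. (sp ^^ j) \<beta>')" and "Zi = \<Delta> zi"
    have spn: "(sp ^^ j) (u * u') = (sp ^^ j) u * (sp ^^ j) u'" "(sp ^^ j) (u - u') = (sp ^^ j) u - (sp ^^ j) u'"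
      "(sp ^^ j) 1 = 1" "(sp ^^ j) U.kL = U.kL" for j u u'
      by (induction j) (simp_all add: \<sigma>p.hom_mult \<sigma>p.hom_minus U.\<sigma>_kL)
    have inv: "U.kL dvd (sp ^^ j) \<beta> * (sp ^^ j) \<beta>' - 1" for j
    proof -
      obtain q where "\<beta> * \<beta>' - 1 = U.kL * q" using \<beta>(3) by (rule dvdE)
      then have "(sp ^^ j) (\<beta> * \<beta>' - 1) = (sp ^^ j) (U.kL * q)" by simp
      then show ?thesis unfolding spn by simp
    qed
    have "U.kL dvd (\<Prod>j<n. (sp ^^ j) \<beta>) * (\<Prod>j<n. (sp ^^ j) \<beta>') - 1" for n
    proof (induction n)
      case (Suc n)
      let ?P = "\<Prod>j<n. (sp ^^ j) \<beta>" and ?P' = "\<Prod>j<n. (sp ^^ j) \<beta>'"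
      have "(\<Prod>j<Suc n. (sp ^^ j) \<beta>) * (\<Prod>j<Suc n. (sp ^^ j) \<beta>') - 1 =
          (?P * ?P' - 1) * ((sp ^^ n) \<beta> * (sp ^^ n) \<beta>') + ((sp ^^ n) \<beta> * (sp ^^ n) \<beta>' - 1)"
        unfolding prod.lessThan_Suc by (simp add: algebra_simps)
      then show ?case using Suc inv[of n] by (simp only: dvd_add dvd_mult2)
    qed simp
    then have NN: "U.kL dvd N * N' - 1" unfolding N_def N'_def .
    have "U.kL dvd U.Y * Zi - 1" using \<iota>p.hom_dvd[OF U.unit] unfolding U.kL_def U.Y_def Zi_def
      by (simp add: \<iota>p.hom_mult \<iota>p.hom_minus)
    moreover have "N' - Zi = (N * N' - 1) * Zi - N' * ((N - U.Y) * Zi + (U.Y * Zi - 1))" by (simp add: algebra_simps)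
    ultimately have "U.kL dvd N' - Zi" using NN \<beta>(4)[folded N_def] by (simp only: dvd_diff dvd_add dvd_mult dvd_mult2)
    then have "U.kL dvd Polynomial.smult (of_nat p ^ a) (N' - Zi)" by (rule dvd_smult)
    moreover have "Polynomial.smult (of_nat p ^ a) Zi = [:0, 1:]" unfolding Zi_def by (rule x_eq(2)[OF False])
    ultimately have "U.kL dvd Polynomial.smult (of_nat p ^ a) N' - [:0, 1:]" by (simp add: smult_diff_right)
    then have "frobenius_datum \<beta>' \<beta> p 1" unfolding frobenius_datum_def using \<beta> N'_def by (simp add: mult.commute)
    then show ?thesis by (rule that)
  qed
qed

end

context slope_setting
begin

context
  fixes b b' :: "'l poly" and c c' :: nat
  assumes dat: "frobenius_datum b b' c c'"
begin

definition FF :: "'l poly \<Rightarrow> 'l poly" where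
  "FF z = act (act (Polynomial.smult (of_nat c) b) (\<Delta> e)) (sp z)"

abbreviation VV :: "'l poly \<Rightarrow> 'l poly" where "VV \<equiv> verschiebung p h AA FF"

lemma c_nonzero: "(of_nat c :: 'l) \<noteq> 0" and p_eq: "(of_nat p :: 'l) = of_nat c * of_nat c'"
proof -
  have "c * c' = p" using dat unfolding frobenius_datum_def by blast
  then show "(of_nat p :: 'l) = of_nat c * of_nat c'" by (metis of_nat_mult)
  show "(of_nat c :: 'l) \<noteq> 0" using \<open>c * c' = p\<close> by (metis mult_0 of_nat_eq_0_iff gr_implies_not0 p_pos)
qed

lemma FF_eq: "z \<in> AA \<Longrightarrow> FF z = Polynomial.smult (of_nat c) (act b (sp z))"
  using act_e[OF AA_closed(5), of z] by (simp add: FF_def act_assoc act_commute[of "\<Delta> e"] act_smult)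

lemma FF_AA: "z \<in> AA \<Longrightarrow> FF z \<in> AA"
  by (simp add: FF_eq AA_closed)

lemma act_b: "y \<in> AA \<Longrightarrow> act b (act b' y) = y" "y \<in> AA \<Longrightarrow> act b' (act b y) = y"
proof -
  have "(b * b') mod U.kL = 1 mod U.kL" using dat unfolding frobenius_datum_def by (simp add: mod_eq_dvd_iff)
  then show "act b (act b' y) = y" "act b' (act b y) = y" if "y \<in> AA"
    using act_cong[OF that, of "b * b'" 1] act_one[OF that] by (simp_all add: act_act mult.commute)
qed

lemma spj_sp: "(sp ^^ (a - 1)) (sp z) = z" "sp ((sp ^^ (a - 1)) z) = z"
proof -
  have a: "Suc (a - 1) = a" using a_pos by simp
  have "(sp ^^ (a - 1)) (sp z) = (sp ^^ Suc (a - 1)) z" by (simp only: funpow_Suc_right o_apply)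
  then show "(sp ^^ (a - 1)) (sp z) = z" unfolding a \<sigma>p_order .
  have "sp ((sp ^^ (a - 1)) z) = (sp ^^ Suc (a - 1)) z" by simp
  then show "sp ((sp ^^ (a - 1)) z) = z" unfolding a \<sigma>p_order .
qed

lemma spj_smult: "(sp ^^ j) (Polynomial.smult (of_nat n) z) = Polynomial.smult (of_nat n) ((sp ^^ j) z)"
  by (induction j) (simp_all add: sp_smult)

lemma VV_eq: assumes y: "y \<in> AA"
  shows "VV y = Polynomial.smult (of_nat c') ((sp ^^ (a - 1)) (act b' y))"
proof -
  define G where "G = (\<lambda>y. Polynomial.smult (inverse (of_nat c)) ((sp ^^ (a - 1)) (act b' y)))"
  have G: "G y \<in> AA" unfolding G_def using y by (intro AA_closed spj)
  have "FF (G y) = y" unfolding FF_eq[OF G] unfolding G_def using c_nonzero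
    by (simp add: sp_smult \<sigma>.hom_inverse spj_sp act_smult act_b y del: One_nat_def)
  moreover have "G (FF z) = z" if "z \<in> AA" for z
    using c_nonzero that unfolding FF_eq[OF that] G_def
    by (simp add: act_smult act_b AA_closed spj_smult spj_sp del: One_nat_def)
  then have "inj_on FF AA" by (rule inj_on_inverseI)
  ultimately have "inv_into AA FF y = G y" using G by (intro inv_into_f_eq)
  then have "VV y = Polynomial.smult (of_nat p) (G y)"
    unfolding verschiebung_def otimes_act using act_scalar[OF G] by simp
  moreover have "(of_nat p * inverse (of_nat c) :: 'l) = of_nat c'"
    unfolding p_eq by (metis c_nonzero mult.commute mult.left_commute mult.right_neutral right_inverse)
  ultimately show ?thesis unfolding G_def by (simp only: smult_smult)
qed

lemma FF_power: "z \<in> AA \<Longrightarrow> (FF ^^ n) z = Polynomial.smult (of_nat c ^ n) (act (\<Prod>j<n. (sp ^^ j) b) ((sp ^^ n) z))"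
proof (induction n)
  case 0
  then show ?case by (simp add: act_one)
next
  case (Suc n)
  let ?P = "\<Prod>j<n. (sp ^^ j) b"
  have "(\<Prod>j<Suc n. (sp ^^ j) b) = b * sp ?P"
    by (subst prod.lessThan_Suc_shift) (simp add: \<sigma>p.hom_prod)
  moreover have "Polynomial.smult (of_nat c ^ n) (act ?P ((sp ^^ n) z)) \<in> AA" using Suc.prems by (intro AA_closed spj)
  ultimately show ?case using Suc
    by (simp add: FF_eq sp_smult \<sigma>.hom_power sp_act act_smult act_act del: prod.lessThan_Suc)
qed

lemma frobenius_property_FF: "frobenius_property a h \<sigma> AA FF"
  unfolding frobenius_property_def otimes_act quot_alg_simps(3)
proof (intro conjI ballI allI)
  show "\<exists>\<alpha>\<in>AA. \<forall>z\<in>AA. FF z = act \<alpha> (sp z)"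
    unfolding FF_def using AA_closed(4)[OF e_AA] by (intro bexI[of _ "act (Polynomial.smult (of_nat c) b) (\<Delta> e)"]) auto
  show "FF (y + z) = FF y + FF z" for y z unfolding FF_def by (simp add: \<sigma>p.hom_add act_add)
  show "FF (act (scalar h q) z) = act (scalar h (\<sigma> q)) (FF z)" if "z \<in> AA" for q z
    using that FF_AA[OF that] by (simp add: act_scalar) (simp add: FF_def sp_smult act_smult)
  show "(FF ^^ a) z = act (frob h) z" if z: "z \<in> AA" for z
  proof -
    have "(FF ^^ a) z = act (Polynomial.smult (of_nat c ^ a) (\<Prod>j<a. (sp ^^ j) b)) z"
      by (simp add: FF_power[OF z] act_smult \<sigma>p_order)
    also have "\<dots> = act [:0, 1:] z" using dat unfolding frobenius_datum_def
      by (intro act_cong[OF z]) (simp add: mod_eq_dvd_iff)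
    finally show ?thesis by (simp add: frob_def act_mod)
  qed
qed

lemma WFV_idealD:
  assumes "WFV_ideal p v \<iota> h WR AA FF J"
  shows "submodule J" "lin_span (quot_alg h) (scalar h ` range \<iota>) J = AA"
    "z \<in> J \<Longrightarrow> FF z \<in> J" "z \<in> J \<Longrightarrow> VV z \<in> J"
proof -
  obtain T where "T \<subseteq> AA" "J = lin_span (quot_alg h) WR T"
    using assms unfolding WFV_ideal_def fractional_ideal_def by blast
  then show "submodule J" by (simp add: span_submodule)
  show "lin_span (quot_alg h) (scalar h ` range \<iota>) J = AA" "z \<in> J \<Longrightarrow> FF z \<in> J" "z \<in> J \<Longrightarrow> VV z \<in> J"
    using assms unfolding WFV_ideal_def fractional_ideal_def by auto
qed

text \<open>
  One of \<open>F\<close> and \<open>V\<close> is \<open>\<sigma>\<close> or \<open>\<sigma>\<^sup>-\<^sup>1\<close> up to a unit of \<open>W[zz]\<close>; therefore a lattice that is stable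
  under both is stable under \<open>\<sigma>\<close>.
\<close>

lemma WFV_ideal_sp:
  assumes J: "WFV_ideal p v \<iota> h WR AA FF J" and z: "z \<in> J"
  shows "sp z \<in> J"
proof -
  note J = WFV_idealD[OF J]
  have JA: "y \<in> J \<Longrightarrow> y \<in> AA" for y using J(1) unfolding submodule_def by blast
  have b: "b \<in> U.BW" "b' \<in> U.BW" "c = 1 \<or> c' = 1" using dat unfolding frobenius_datum_def by auto
  from b(3) show ?thesis
  proof
    assume "c = 1"
    then have "FF z = act b (sp z)" unfolding FF_eq[OF JA[OF z]] by simp
    then have "act b' (FF z) = sp z" using JA[OF z] by (simp add: act_b AA_closed)
    then show ?thesis using submodule_BW[OF J(1) b(2) J(3)[OF z]] by simp
  next
    assume c': "c' = 1"
    have roll: "(sp ^^ (a - 1)) y \<in> J" if y: "y \<in> J" for y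
    proof -
      have "VV (act b y) = (sp ^^ (a - 1)) y" using JA[OF y] c' by (simp add: VV_eq act_b AA_closed)
      then show ?thesis using J(4)[OF submodule_BW[OF J(1) b(1) y]] by simp
    qed
    define y where "y = ((sp ^^ (a - 1)) ^^ (a - 1)) z"
    have "((sp ^^ (a - 1)) ^^ n) z \<in> J" for n by (induction n) (simp_all add: z roll del: One_nat_def)
    then have "y \<in> J" unfolding y_def .
    have "(sp ^^ (a - 1)) y = ((sp ^^ (a - 1)) ^^ Suc (a - 1)) z" unfolding y_def by simp
    also have "\<dots> = (sp ^^ ((a - 1) * a)) z" unfolding funpow_mult using a_pos by simp
    also have "\<dots> = ((sp ^^ a) ^^ (a - 1)) z" unfolding funpow_mult by (simp add: mult.commute)
    also have "\<dots> = z"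
    proof -
      have "((sp ^^ a) ^^ n) z = z" for n by (induction n) (simp_all add: \<sigma>p_order)
      then show ?thesis .
    qed
    finally have "sp z = y" using spj_sp(2)[of y] by simp
    then show ?thesis using \<open>y \<in> J\<close> by simp
  qed
qed

lemma WFV_ideal_descends:
  assumes J: "WFV_ideal p v \<iota> h WR AA FF J"
  shows "J = tensor h \<iota> W {x \<in> EE. \<Delta> x \<in> J \<inter> \<Delta> ` EE}"
proof -
  have eq: "{x \<in> EE. \<Delta> x \<in> J \<inter> \<Delta> ` EE} = {x \<in> EE. \<Delta> x \<in> J}" by blast
  have sub: "submodule J" by (rule WFV_idealD(1)[OF J])
  show ?thesis unfolding eq
  proof
    show "J \<subseteq> tensor h \<iota> W {x \<in> EE. \<Delta> x \<in> J}" using descent[OF sub WFV_ideal_sp[OF J]] by blast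
    show "tensor h \<iota> W {x \<in> EE. \<Delta> x \<in> J} \<subseteq> J"
      by (rule tensor_subset) (use sub in \<open>auto simp: submodule_def\<close>)
  qed
qed

lemma EE_closed: "0 \<in> EE" "x \<in> EE \<Longrightarrow> y \<in> EE \<Longrightarrow> x + y \<in> EE" "x \<in> EE \<Longrightarrow> (u * x) mod H \<in> EE"
  "x \<in> EE \<Longrightarrow> (scalar h q * x) mod H = Polynomial.smult q x"
  unfolding E_eq by (auto simp: poly_mod_add_left dvd_mod H_factor scalar_def mod_mult_left_eq mod_smult_left)

text \<open>
  Generators of \<open>W \<otimes> I\<close> over \<open>W\<^sub>R\<close> come from generators of \<open>I\<close> over \<open>R\<^sub>p\<^sup>*\<close>, and generators over \<open>\<int>\<^sub>p\<close>
  are products of those of \<open>W\<close> and of \<open>I\<close>. Stability under \<open>F\<close> and \<open>V\<close> follows from that under \<open>\<sigma>\<close>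
  and \<open>W[zz]\<close>.
\<close>

lemma WFV_ideal_tensor:
  assumes I: "fractional_ideal (quot_alg h) (scalar h ` \<O>) (range (scalar h)) RR EE I"
  shows "WFV_ideal p v \<iota> h WR AA FF (tensor h \<iota> W I)"
proof -
  obtain T1 where T1: "finite T1" "T1 \<subseteq> EE" "I = lin_span (quot_alg h) RR T1"
    using I unfolding fractional_ideal_def by blast
  obtain T2 where T2: "finite T2" "T2 \<subseteq> EE" "I = lin_span (quot_alg h) (scalar h ` \<O>) T2"
    using I unfolding fractional_ideal_def by blast
  have QI: "lin_span (quot_alg h) (range (scalar h)) I = EE" using I unfolding fractional_ideal_def by blast
  have IE: "I \<subseteq> EE" unfolding T1(3) by (rule lin_span_subset) (use T1(2) in \<open>auto intro: EE_closed\<close>)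
  have rt: "(r * t) mod H \<in> I" if "r \<in> RR" "t \<in> T1" for r t unfolding T1(3) using that by (rule lin_span_base)
  have "I \<subseteq> {x. (zz * x) mod H \<in> I}"
    unfolding T1(3)
  proof (rule lin_span_subset)
    fix r t assume r: "r \<in> RR" "t \<in> T1"
    have "(((zz * r) mod H) * t) mod H \<in> lin_span (quot_alg h) RR T1" using R_part_zz[OF r(1)] r(2) by (rule lin_span_base)
    then show "(r * t) mod H \<in> {x. (zz * x) mod H \<in> lin_span (quot_alg h) RR T1}"
      by (simp add: mod_mult_left_eq mod_mult_right_eq mult.assoc)
  qed (auto simp: lin_span_zero lin_span_add distrib_left poly_mod_add_left)
  then have zI: "\<And>x. x \<in> I \<Longrightarrow> (zz * x) mod H \<in> I" by (rule subset_CollectD)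
  let ?J = "tensor h \<iota> W I"
  have sub: "submodule ?J" and spJ: "\<And>z. z \<in> ?J \<Longrightarrow> sp z \<in> ?J" using tensor_submodule[OF IE zI] by auto
  have J: "?J \<subseteq> AA" "0 \<in> ?J" "\<And>x y. x \<in> ?J \<Longrightarrow> y \<in> ?J \<Longrightarrow> x + y \<in> ?J"
    "\<And>w z. w \<in> W \<Longrightarrow> z \<in> ?J \<Longrightarrow> Polynomial.smult w z \<in> ?J" using sub unfolding submodule_def by auto
  have base: "Polynomial.smult w (\<Delta> x) \<in> ?J" if "w \<in> W" "x \<in> I" for w x using that IE by (intro tensor_base) auto
  have gen1: "?J = lin_span (quot_alg h) WR (\<Delta> ` T1)" (is "_ = ?L")
  proof
    have s: "I \<subseteq> {x. Polynomial.smult w (\<Delta> x) \<in> ?L}" if w: "w \<in> W" for w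
      unfolding T1(3)
    proof (rule lin_span_subset)
      fix r t assume r: "r \<in> RR" "t \<in> T1"
      have "Polynomial.smult w (\<Delta> r) \<in> WR" using w r RR_EE by (intro tensor_base) auto
      then have "act (Polynomial.smult w (\<Delta> r)) (\<Delta> t) \<in> ?L" unfolding act_def using r by (intro lin_span_base) auto
      then show "(r * t) mod H \<in> {x. Polynomial.smult w (\<Delta> x) \<in> ?L}" by (simp add: act_smult act_\<Delta>)
    qed (auto simp: lin_span_zero lin_span_add \<iota>p.hom_add smult_add_right)
    show "?J \<subseteq> ?L" by (rule tensor_subset[OF IE lin_span_zero lin_span_add subset_CollectD[OF s]])
    show "?L \<subseteq> ?J"
    proof (rule lin_span_subset[OF J(2,3)])
      fix r s assume rs: "r \<in> WR" "s \<in> \<Delta> ` T1"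
      then obtain t where t: "t \<in> T1" "s = \<Delta> t" by blast
      have "WR \<subseteq> {r. act r (\<Delta> t) \<in> ?J}"
        by (rule tensor_subset[OF RR_EE]) (use t J in \<open>auto simp: act_zero act_add act_smult act_\<Delta> intro!: base rt\<close>)
      then have "act r (\<Delta> t) \<in> ?J" using rs(1) by (rule subset_CollectD)
      then show "(r * s) mod HL \<in> ?J" unfolding t(2) act_def .
    qed
  qed
  obtain m :: nat and bb where bb: "\<And>i. i < m \<Longrightarrow> bb i \<in> W"
    "\<And>w. w \<in> W \<Longrightarrow> \<exists>d. (\<forall>i. d i \<in> \<O>) \<and> w = (\<Sum>i<m. bb i * \<iota> (d i))" using W_generators by blast
  define T' where "T' = (\<lambda>(i, t). Polynomial.smult (bb i) (\<Delta> t)) ` ({..<m} \<times> T2)"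
  have T2I: "t \<in> I" if "t \<in> T2" for t
  proof -
    have "(scalar h 1 * t) mod H \<in> I" unfolding T2(3) using that by (intro lin_span_base) auto
    then show ?thesis using EE_closed(4)[of t 1] that T2(2) by auto
  qed
  have T'J: "T' \<subseteq> ?J" unfolding T'_def using bb(1) T2I by (auto intro: base)
  have gen2: "?J = lin_span (quot_alg h) (scalar h ` \<iota> ` \<O>) T'" (is "_ = ?L")
  proof
    have scal: "Polynomial.smult (\<iota> q) s \<in> ?L" if "q \<in> \<O>" "s \<in> T'" for q s
    proof -
      have "s \<in> AA" using that T'J J(1) by blast
      then have "act (scalar h (\<iota> q)) s = Polynomial.smult (\<iota> q) s" by (rule act_scalar)
      moreover have "(scalar h (\<iota> q) * s) mod HL \<in> ?L" using that by (intro lin_span_base) auto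
      ultimately show ?thesis by (simp add: act_def)
    qed
    have s: "I \<subseteq> {x. Polynomial.smult w (\<Delta> x) \<in> ?L}" if w: "w \<in> W" for w
      unfolding T2(3)
    proof (rule lin_span_subset)
      fix q' t assume q: "q' \<in> scalar h ` \<O>" "t \<in> T2"
      then obtain q where q': "q' = scalar h q" "q \<in> \<O>" by blast
      obtain d where d: "\<And>i. d i \<in> \<O>" "w = (\<Sum>i<m. bb i * \<iota> (d i))" using bb(2)[OF w] by blast
      have "Polynomial.smult w (\<Delta> (Polynomial.smult q t)) = (\<Sum>i<m. Polynomial.smult (\<iota> (d i * q)) (Polynomial.smult (bb i) (\<Delta> t)))"
      proof (rule poly_eqI)
        fix j
        have "w * (\<iota> q * \<iota> (Polynomial.coeff t j)) = (\<Sum>i<m. \<iota> (d i) * \<iota> q * (bb i * \<iota> (Polynomial.coeff t j)))"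
          unfolding d(2) sum_distrib_right by (intro sum.cong refl) (simp only: ac_simps)
        then show "Polynomial.coeff (Polynomial.smult w (\<Delta> (Polynomial.smult q t))) j =
            Polynomial.coeff (\<Sum>i<m. Polynomial.smult (\<iota> (d i * q)) (Polynomial.smult (bb i) (\<Delta> t))) j"
          by (simp only: coeff_sum coeff_smult coeff_map_poly \<iota>.hom_zero \<iota>.hom_mult)
      qed
      also have "\<dots> \<in> ?L" using d(1) q' q by (intro lin_span_sum scal O_mult) (auto simp: T'_def)
      finally have "Polynomial.smult w (\<Delta> (Polynomial.smult q t)) \<in> ?L" .
      moreover have "(q' * t) mod H = Polynomial.smult q t" unfolding q'(1) using q T2(2) by (intro EE_closed(4)) auto
      ultimately show "(q' * t) mod H \<in> {x. Polynomial.smult w (\<Delta> x) \<in> ?L}" by simp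
    qed (auto simp: lin_span_zero lin_span_add \<iota>p.hom_add smult_add_right)
    show "?J \<subseteq> ?L" by (rule tensor_subset[OF IE lin_span_zero lin_span_add subset_CollectD[OF s]])
    show "?L \<subseteq> ?J"
    proof (rule lin_span_subset[OF J(2,3)])
      fix q' s assume q: "q' \<in> scalar h ` \<iota> ` \<O>" "s \<in> T'"
      then obtain q where q': "q' = scalar h (\<iota> q)" "q \<in> \<O>" by blast
      have "s \<in> ?J" "s \<in> AA" using q(2) T'J J(1) by auto
      then show "(q' * s) mod HL \<in> ?J" unfolding q'(1) act_def[symmetric] using q'(2) J(4) by (simp add: act_scalar)
    qed
  qed
  have gen3: "lin_span (quot_alg h) (scalar h ` range \<iota>) ?J = AA" (is "?L = _")
  proof
    show "?L \<subseteq> AA"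
      by (rule lin_span_subset) (use J(1) in \<open>auto simp: AA_closed act_def[symmetric]\<close>)
    have scal: "Polynomial.smult (\<iota> q) s \<in> ?L" if "s \<in> ?J" for q s
    proof -
      have "s \<in> AA" using that J(1) by blast
      then have "act (scalar h (\<iota> q)) s = Polynomial.smult (\<iota> q) s" by (rule act_scalar)
      moreover have "(scalar h (\<iota> q) * s) mod HL \<in> ?L" using that by (intro lin_span_base) auto
      ultimately show ?thesis by (simp add: act_def)
    qed
    have s: "lin_span (quot_alg h) (range (scalar h)) I \<subseteq> {x. Polynomial.smult w (\<Delta> x) \<in> ?L}" if w: "w \<in> W" for w
    proof (rule lin_span_subset)
      fix q' :: "'k poly" and s assume q: "q' \<in> range (scalar h)" "s \<in> I"
      then obtain q where q': "q' = scalar h q" by blast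
      have "(q' * s) mod H = Polynomial.smult q s" unfolding q'(1) using q IE by (intro EE_closed(4)) auto
      moreover have "Polynomial.smult w (\<Delta> (Polynomial.smult q s)) = Polynomial.smult (\<iota> q) (Polynomial.smult w (\<Delta> s))"
        by (rule poly_eqI) (simp add: \<iota>.hom_mult ac_simps)
      ultimately show "(q' * s) mod H \<in> {x. Polynomial.smult w (\<Delta> x) \<in> ?L}"
        using scal[OF base[OF w q(2)]] by simp
    qed (auto simp: lin_span_zero lin_span_add \<iota>p.hom_add smult_add_right)
    have "tensor h \<iota> W EE \<subseteq> ?L"
      by (rule tensor_subset[OF order_refl lin_span_zero lin_span_add subset_CollectD[OF s[unfolded QI]]])
    then show "AA \<subseteq> ?L" using AA_W by blast
  qed
  have b: "b \<in> U.BW" "b' \<in> U.BW" using dat unfolding frobenius_datum_def by auto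
  have spjJ: "(sp ^^ j) z \<in> ?J" if "z \<in> ?J" for j z by (induction j) (simp_all add: that spJ)
  have "FF z \<in> ?J" if z: "z \<in> ?J" for z
  proof -
    have "z \<in> AA" using z J(1) by blast
    then show ?thesis using J(4)[OF _ submodule_BW[OF sub b(1) spJ[OF z]]] by (simp add: FF_eq)
  qed
  moreover have "VV z \<in> ?J" if z: "z \<in> ?J" for z
  proof -
    have "z \<in> AA" using z J(1) by blast
    then show ?thesis using J(4)[OF _ spjJ[OF submodule_BW[OF sub b(2) z]]] by (simp add: VV_eq)
  qed
  moreover have "fractional_ideal (quot_alg h) (scalar h ` \<iota> ` \<O>) (scalar h ` range \<iota>) WR AA ?J"
    unfolding fractional_ideal_def
  proof (intro conjI exI)
    show "finite (\<Delta> ` T1)" "\<Delta> ` T1 \<subseteq> AA" using T1 by (auto simp: \<Delta>_AA)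
    show "finite T'" unfolding T'_def using T2(1) by simp
    show "T' \<subseteq> AA" using T'J J(1) by blast
  qed (rule gen1 gen2 gen3)+
  ultimately show ?thesis unfolding WFV_ideal_def by blast
qed

text \<open>
  A lattice spans \<open>A\<^sup>*\<close> over \<open>\<rat>\<^sub>p\<close>; clearing denominators needs only a power of \<open>p\<close>.
\<close>

lemma Q_multiple:
  assumes J: "submodule J" and z: "z \<in> lin_span (quot_alg h) (scalar h ` range \<iota>) J"
  shows "\<exists>N. Polynomial.smult (of_nat p ^ N) z \<in> J"
proof -
  have J': "J \<subseteq> AA" "0 \<in> J" "\<And>x y. x \<in> J \<Longrightarrow> y \<in> J \<Longrightarrow> x + y \<in> J"
    "\<And>w z. w \<in> W \<Longrightarrow> z \<in> J \<Longrightarrow> Polynomial.smult w z \<in> J" using J unfolding submodule_def by auto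
  have pW: "(of_nat p ^ N :: 'l) \<in> W" for N by (intro L.O_power L.O_of_nat)
  have "lin_span (quot_alg h) (scalar h ` range \<iota>) J \<subseteq> {z. \<exists>N. Polynomial.smult (of_nat p ^ N) z \<in> J}"
  proof (rule lin_span_subset)
    show "0 \<in> {z. \<exists>N. Polynomial.smult (of_nat p ^ N) z \<in> J}" using J'(2) by simp
    fix x y assume "x \<in> {z. \<exists>N. Polynomial.smult (of_nat p ^ N) z \<in> J}" "y \<in> {z. \<exists>N. Polynomial.smult (of_nat p ^ N) z \<in> J}"
    then obtain N M where NM: "Polynomial.smult (of_nat p ^ N) x \<in> J" "Polynomial.smult (of_nat p ^ M) y \<in> J" by blast
    have "Polynomial.smult (of_nat p ^ (N + M)) (x + y) =
        Polynomial.smult (of_nat p ^ M) (Polynomial.smult (of_nat p ^ N) x) + Polynomial.smult (of_nat p ^ N) (Polynomial.smult (of_nat p ^ M) y)"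
      by (simp add: smult_add_right power_add mult.commute)
    also have "\<dots> \<in> J" by (intro J' pW NM)
    finally show "x + y \<in> {z. \<exists>N. Polynomial.smult (of_nat p ^ N) z \<in> J}" by blast
  next
    fix q' s assume q: "q' \<in> scalar h ` range \<iota>" "s \<in> J"
    then obtain q where q': "q' = scalar h (\<iota> q)" by blast
    obtain N where N: "of_nat p ^ N * q \<in> \<O>" using clear_denominator by blast
    have "Polynomial.smult (\<iota> (of_nat p ^ N * q)) s \<in> J" using N q(2) by (intro J') auto
    moreover have "act q' s = Polynomial.smult (\<iota> q) s" unfolding q' using q(2) J'(1) by (intro act_scalar) auto
    ultimately have "Polynomial.smult (of_nat p ^ N) (act q' s) \<in> J" by (simp add: \<iota>.hom_mult \<iota>.hom_power)
    then show "(q' * s) mod HL \<in> {z. \<exists>N. Polynomial.smult (of_nat p ^ N) z \<in> J}" unfolding act_def by blast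
  qed
  then show ?thesis using z by (rule subset_CollectD)
qed

lemma BW_add: "u \<in> U.BW \<Longrightarrow> u' \<in> U.BW \<Longrightarrow> u + u' \<in> U.BW"
  and BW_mult: "u \<in> U.BW \<Longrightarrow> u' \<in> U.BW \<Longrightarrow> u * u' \<in> U.BW"
proof -
  note B = U.subring_BW[unfolded subring_set_def]
  show "u \<in> U.BW \<Longrightarrow> u' \<in> U.BW \<Longrightarrow> u * u' \<in> U.BW" using B by blast
  assume u: "u \<in> U.BW" "u' \<in> U.BW"
  have "1 - 1 \<in> U.BW" using B by blast
  then have "(1 - 1) - u' \<in> U.BW" using B u by blast
  then have "u - ((1 - 1) - u') \<in> U.BW" using B u by blast
  then show "u + u' \<in> U.BW" by simp
qed

text \<open>
  On both parts \<open>x\<close> is integral over \<open>W\<close> up to a power of \<open>p\<close>: it is \<open>zz\<close> or \<open>q zz\<^sup>-\<^sup>1\<close>, so \<open>W[zz]\<close> is a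
  lattice in \<open>L[x]/(k)\<close>.
\<close>

lemma BW_multiple: "\<exists>M. Polynomial.smult (of_nat p ^ M) u \<in> U.BW"
proof -
  have pW: "(of_nat p ^ N :: 'l) \<in> W" for N by (intro L.O_power L.O_of_nat)
  have x: "[:0, 1:] \<in> U.BW"
  proof (cases "S = {0}")
    case True
    then show ?thesis using U.Y_BW unfolding U.Y_def x_eq(1)[OF True] by simp
  next
    case False
    have "[:of_nat p ^ a:] * \<Delta> zi \<in> U.BW" by (intro BW_mult U.const_BW pW U.inverse_BW)
    then show ?thesis using x_eq(2)[OF False] by simp
  qed
  show ?thesis
  proof (induction u)
    case 0
    have "[:0:] \<in> U.BW" by (rule U.const_BW) simp
    then show ?case by simp
  next
    case (pCons d u)
    then obtain M2 where M2: "Polynomial.smult (of_nat p ^ M2) u \<in> U.BW" by blast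
    obtain M1 where M1: "of_nat p ^ M1 * d \<in> W" using L.clear_denominator by blast
    have "[:of_nat p ^ M1 * d:] * [:of_nat p ^ M2:] + [:of_nat p ^ M1:] * ([:0, 1:] * Polynomial.smult (of_nat p ^ M2) u) \<in> U.BW"
      by (intro BW_add BW_mult U.const_BW pW M1 M2 x)
    also have "[:of_nat p ^ M1 * d:] * [:of_nat p ^ M2:] + [:of_nat p ^ M1:] * ([:0, 1:] * Polynomial.smult (of_nat p ^ M2) u) =
        Polynomial.smult (of_nat p ^ (M1 + M2)) (pCons d u)"
      by (simp add: power_add ac_simps)
    finally show ?case by blast
  qed
qed

lemma WR_multiple: assumes z: "z \<in> AA" shows "\<exists>M. Polynomial.smult (of_nat p ^ M) z \<in> WR"
proof -
  obtain M where M: "Polynomial.smult (of_nat p ^ M) z \<in> U.BW" using BW_multiple by blast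
  have "\<Delta> e \<in> WR" using smult_e_WR[OF L.O_one] by simp
  then have "act (Polynomial.smult (of_nat p ^ M) z) (\<Delta> e) \<in> WR" by (rule submodule_BW[OF WR_submodule M])
  then show ?thesis using act_e[OF z] by (auto simp: act_smult)
qed

lemma act_FF: "z \<in> AA \<Longrightarrow> act (\<Delta> x) (FF z) = FF (act (\<Delta> x) z)"
  by (simp add: FF_eq AA_closed sp_act \<sigma>p_\<iota> act_smult act_act mult.commute)

lemma act_VV: assumes "z \<in> AA" shows "act (\<Delta> x) (VV z) = VV (act (\<Delta> x) z)"
proof -
  have "(sp ^^ j) (\<Delta> x) = \<Delta> x" for j by (induction j) (simp_all add: \<sigma>p_\<iota>)
  then have "act (\<Delta> x) ((sp ^^ (a - 1)) (act b' z)) = (sp ^^ (a - 1)) (act b' (act (\<Delta> x) z))"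
    using spj(2)[of "a - 1" "\<Delta> x" "act b' z"] by (simp only: act_act mult.commute)
  then show ?thesis unfolding VV_eq[OF assms] VV_eq[OF AA_closed(4)[OF assms]] act_smult(1) by (simp only:)
qed

lemma Delta_hom_maps:
  assumes J1: "WFV_ideal p v \<iota> h WR AA FF J1" and J2: "WFV_ideal p v \<iota> h WR AA FF J2"
    and x: "x \<in> Delta_hom h \<iota> EE (J1 \<inter> \<Delta> ` EE) (J2 \<inter> \<Delta> ` EE)" and z: "z \<in> J1"
  shows "act (\<Delta> x) z \<in> J2"
proof -
  have J: "0 \<in> J2" "\<And>x y. x \<in> J2 \<Longrightarrow> y \<in> J2 \<Longrightarrow> x + y \<in> J2"
    "\<And>w z. w \<in> W \<Longrightarrow> z \<in> J2 \<Longrightarrow> Polynomial.smult w z \<in> J2"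
    using WFV_idealD(1)[OF J2] unfolding submodule_def by auto
  have "tensor h \<iota> W {x \<in> EE. \<Delta> x \<in> J1 \<inter> \<Delta> ` EE} \<subseteq> {z. act (\<Delta> x) z \<in> J2}"
  proof (rule tensor_subset)
    fix w y assume wy: "w \<in> W" "y \<in> {x \<in> EE. \<Delta> x \<in> J1 \<inter> \<Delta> ` EE}"
    then have "act (\<Delta> x) (\<Delta> y) \<in> J2" using x unfolding Delta_hom_def otimes_act by blast
    then show "Polynomial.smult w (\<Delta> y) \<in> {z. act (\<Delta> x) z \<in> J2}" using J(3) wy(1) by (simp add: act_smult)
  qed (use J in \<open>auto simp: act_zero act_add\<close>)
  then show ?thesis using subsetD[OF equalityD1[OF WFV_ideal_descends[OF J1]] z] by (rule subset_CollectD)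
qed

lemma act_in_WFV_hom:
  assumes J1: "WFV_ideal p v \<iota> h WR AA FF J1" and J2: "WFV_ideal p v \<iota> h WR AA FF J2"
    and x: "x \<in> Delta_hom h \<iota> EE (J1 \<inter> \<Delta> ` EE) (J2 \<inter> \<Delta> ` EE)"
  shows "(\<lambda>z\<in>J1. act (\<Delta> x) z) \<in> WFV_hom p h WR AA FF J1 J2"
proof -
  note D = WFV_idealD[OF J1]
  have JA: "z \<in> J1 \<Longrightarrow> z \<in> AA" for z using D(1) unfolding submodule_def by blast
  have add: "y + z \<in> J1" if "y \<in> J1" "z \<in> J1" for y z using D(1) that unfolding submodule_def by blast
  obtain T where T: "J1 = lin_span (quot_alg h) WR T" "T \<subseteq> AA"
    using J1 unfolding WFV_ideal_def fractional_ideal_def by blast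
  have eq: "act r (act (\<Delta> x) z) = act (\<Delta> x) (act r z)" for r z by (simp add: act_act mult.commute)
  have 3: "(\<lambda>z\<in>J1. act (\<Delta> x) z) (act r z) = act r ((\<lambda>z\<in>J1. act (\<Delta> x) z) z)" if "r \<in> WR" "z \<in> J1" "act r z \<in> J1" for r z
    using that by (simp add: eq)
  show ?thesis
    unfolding WFV_hom_def otimes_act quot_alg_simps(3)
  proof (intro CollectI conjI ballI)
    show "(\<lambda>z\<in>J1. act (\<Delta> x) z) \<in> J1 \<rightarrow>\<^sub>E J2" using Delta_hom_maps[OF J1 J2 x] by auto
    show "(\<lambda>z\<in>J1. act (\<Delta> x) z) (y + z) = (\<lambda>z\<in>J1. act (\<Delta> x) z) y + (\<lambda>z\<in>J1. act (\<Delta> x) z) z" if "y \<in> J1" "z \<in> J1" for y z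
      using that add by (simp add: act_add)
    show "(\<lambda>z\<in>J1. act (\<Delta> x) z) (FF z) = FF ((\<lambda>z\<in>J1. act (\<Delta> x) z) z)" if "z \<in> J1" for z
      using that D(3) JA by (simp add: act_FF)
    show "(\<lambda>z\<in>J1. act (\<Delta> x) z) (VV z) = VV ((\<lambda>z\<in>J1. act (\<Delta> x) z) z)" if "z \<in> J1" for z
      using that D(4) JA by (simp add: act_VV)
    show "(\<lambda>z\<in>J1. act (\<Delta> x) z) (act r z) = act r ((\<lambda>z\<in>J1. act (\<Delta> x) z) z)" if rz: "r \<in> WR" "z \<in> J1" for r z
      using 3[OF rz] span_WR_stable[OF rz(1), of z T] rz(2) unfolding T(1)[symmetric] by blast
  qed
qed

text \<open>
  A homomorphism is multiplication by its value at the unit element of \<open>A\<^sup>*\<close>, which makes sense after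
  multiplication by a power of \<open>p\<close>; commutation with \<open>F\<close> means that this value is fixed by \<open>\<sigma>\<close>.
\<close>

lemma WFV_hom_is_act:
  assumes J1: "WFV_ideal p v \<iota> h WR AA FF J1" and J2: "WFV_ideal p v \<iota> h WR AA FF J2"
    and f: "f \<in> WFV_hom p h WR AA FF J1 J2"
  obtains x where "x \<in> EE" "\<And>z. z \<in> J1 \<Longrightarrow> f z = act (\<Delta> x) z"
proof -
  note D1 = WFV_idealD[OF J1] and D2 = WFV_idealD[OF J2]
  have J1A: "z \<in> J1 \<Longrightarrow> z \<in> AA" and J2A: "z \<in> J2 \<Longrightarrow> z \<in> AA" for z
    using D1(1) D2(1) unfolding submodule_def by blast+
  have f_J2: "f z \<in> J2" if "z \<in> J1" for z using f that unfolding WFV_hom_def by blast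
  have f_lin: "f (act r z) = act r (f z)" if "r \<in> WR" "z \<in> J1" for r z
    using f that unfolding WFV_hom_def otimes_act by blast
  have f_F: "f (FF z) = FF (f z)" if "z \<in> J1" for z using f that unfolding WFV_hom_def by blast
  have pW: "(of_nat p ^ N :: 'l) \<in> W" for N by (intro L.O_power L.O_of_nat)
  have pn0: "(of_nat p ^ N :: 'l) \<noteq> 0" for N using gr_implies_not0[OF p_pos] by simp
  have f_smult: "f (Polynomial.smult w z) = Polynomial.smult w (f z)" if "w \<in> W" "z \<in> J1" for w z
    using f_lin[OF smult_e_WR[OF that(1)] that(2)] act_smult_e[OF J1A[OF that(2)]] act_smult_e[OF J2A[OF f_J2[OF that(2)]]]
    by simp
  obtain N where N: "Polynomial.smult (of_nat p ^ N) (\<Delta> e) \<in> J1"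
    using Q_multiple[OF D1(1), of "\<Delta> e"] e_AA D1(2) by auto
  define z0 where "z0 = Polynomial.smult (of_nat p ^ N) (\<Delta> e)"
  define y where "y = Polynomial.smult (inverse (of_nat p ^ N)) (f z0)"
  have z0: "z0 \<in> J1" using N unfolding z0_def .
  have yA: "y \<in> AA" unfolding y_def using J2A[OF f_J2[OF z0]] by (rule AA_closed)
  have fz0: "f z0 = Polynomial.smult (of_nat p ^ N) y" unfolding y_def using pn0[of N] by (simp del: of_nat_power)
  have f_y: "f z = act y z" if z: "z \<in> J1" for z
  proof -
    obtain M where M: "Polynomial.smult (of_nat p ^ M) z \<in> WR" using WR_multiple[OF J1A[OF z]] by blast
    have "act (Polynomial.smult (of_nat p ^ M) z) z0 = Polynomial.smult (of_nat p ^ (M + N)) z"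
      unfolding z0_def using act_e[OF J1A[OF z]] by (simp add: act_smult power_add mult.commute)
    then have "f (Polynomial.smult (of_nat p ^ (M + N)) z) = act (Polynomial.smult (of_nat p ^ M) z) (f z0)"
      using f_lin[OF M z0] by simp
    also have "\<dots> = Polynomial.smult (of_nat p ^ (M + N)) (act y z)"
      unfolding fz0 by (simp add: act_smult power_add act_commute[of z] mult.commute)
    finally have "Polynomial.smult (of_nat p ^ (M + N)) (f z) = Polynomial.smult (of_nat p ^ (M + N)) (act y z)"
      unfolding f_smult[OF pW z] .
    then have "Polynomial.smult (of_nat p ^ (M + N)) (f z - act y z) = 0" unfolding smult_diff_right by (rule right_minus_eq[THEN iffD2])
    then have "f z - act y z = 0" using pn0[of "M + N"] unfolding smult_eq_0_iff by blast
    then show ?thesis by (simp only: right_minus_eq)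
  qed
  have "sp y = y"
  proof -
    have "act y (FF z0) = FF (act y z0)" using f_F[OF z0] f_y[OF z0] f_y[OF D1(3)[OF z0]] by simp
    then have "Polynomial.smult (of_nat c) (act b (act y (sp z0))) = Polynomial.smult (of_nat c) (act b (act (sp y) (sp z0)))"
      unfolding FF_eq[OF J1A[OF z0]] FF_eq[OF AA_closed(4)[OF J1A[OF z0]]] sp_act
      by (simp only: act_smult act_act mult.commute)
    then have "Polynomial.smult (of_nat c) (act b (act y (sp z0)) - act b (act (sp y) (sp z0))) = 0"
      unfolding smult_diff_right by (rule right_minus_eq[THEN iffD2])
    then have "act b (act y (sp z0)) = act b (act (sp y) (sp z0))"
      using c_nonzero unfolding smult_eq_0_iff right_minus_eq by blast
    then have "act b' (act b (act y (sp z0))) = act b' (act b (act (sp y) (sp z0)))" by (rule arg_cong)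
    then have 1: "act y (sp z0) = act (sp y) (sp z0)" using J1A[OF z0] by (simp add: act_b AA_closed)
    have spz0: "sp z0 = Polynomial.smult (of_nat p ^ N) (\<Delta> e)"
      unfolding z0_def by (simp add: sp_smult \<sigma>p_\<iota> \<sigma>.hom_power)
    have "Polynomial.smult (of_nat p ^ N) y = Polynomial.smult (of_nat p ^ N) (sp y)"
      using 1 act_e[OF yA] act_e[OF AA_closed(5)[OF yA]] unfolding spz0 act_smult(1) by (simp only:)
    then have "Polynomial.smult (of_nat p ^ N) (y - sp y) = 0" unfolding smult_diff_right by (rule right_minus_eq[THEN iffD2])
    then have "y - sp y = 0" using pn0[of N] unfolding smult_eq_0_iff by blast
    then show ?thesis by simp
  qed
  then obtain x where x: "y = \<Delta> x" using sp_fixed by blast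
  have "x \<in> EE" using yA unfolding x \<Delta>_AA .
  then show ?thesis using f_y that unfolding x by blast
qed

lemma Delta_hom_bij:
  assumes J1: "WFV_ideal p v \<iota> h WR AA FF J1" and J2: "WFV_ideal p v \<iota> h WR AA FF J2"
  shows "bij_betw (\<lambda>x. \<lambda>z\<in>J1. act (\<Delta> x) z) (Delta_hom h \<iota> EE (J1 \<inter> \<Delta> ` EE) (J2 \<inter> \<Delta> ` EE)) (WFV_hom p h WR AA FF J1 J2)"
proof (rule bij_betw_imageI)
  note D1 = WFV_idealD[OF J1]
  have J1A: "z \<in> J1 \<Longrightarrow> z \<in> AA" for z using D1(1) unfolding submodule_def by blast
  obtain N where N: "Polynomial.smult (of_nat p ^ N) (\<Delta> e) \<in> J1"
    using Q_multiple[OF D1(1), of "\<Delta> e"] e_AA D1(2) by auto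
  show "inj_on (\<lambda>x. \<lambda>z\<in>J1. act (\<Delta> x) z) (Delta_hom h \<iota> EE (J1 \<inter> \<Delta> ` EE) (J2 \<inter> \<Delta> ` EE))"
  proof (rule inj_onI)
    fix x x' assume "x \<in> Delta_hom h \<iota> EE (J1 \<inter> \<Delta> ` EE) (J2 \<inter> \<Delta> ` EE)" "x' \<in> Delta_hom h \<iota> EE (J1 \<inter> \<Delta> ` EE) (J2 \<inter> \<Delta> ` EE)"
      and eq: "(\<lambda>z\<in>J1. act (\<Delta> x) z) = (\<lambda>z\<in>J1. act (\<Delta> x') z)"
    then have xA: "\<Delta> x \<in> AA" "\<Delta> x' \<in> AA" unfolding Delta_hom_def \<Delta>_AA by auto
    have "act (\<Delta> x) (Polynomial.smult (of_nat p ^ N) (\<Delta> e)) = act (\<Delta> x') (Polynomial.smult (of_nat p ^ N) (\<Delta> e))"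
      using fun_cong[OF eq, of "Polynomial.smult (of_nat p ^ N) (\<Delta> e)"] N by simp
    then have "Polynomial.smult (of_nat p ^ N) (\<Delta> x) = Polynomial.smult (of_nat p ^ N) (\<Delta> x')"
      unfolding act_smult(1) act_e[OF xA(1)] act_e[OF xA(2)] .
    then have "Polynomial.smult (of_nat p ^ N) (\<Delta> x - \<Delta> x') = 0" unfolding smult_diff_right by (rule right_minus_eq[THEN iffD2])
    moreover have "(of_nat p ^ N :: 'l) \<noteq> 0" using gr_implies_not0[OF p_pos] by simp
    ultimately have "\<Delta> x - \<Delta> x' = 0" unfolding smult_eq_0_iff by blast
    then have "\<Delta> x = \<Delta> x'" by (simp only: right_minus_eq)
    then show "x = x'" by simp
  qed
  show "(\<lambda>x. \<lambda>z\<in>J1. act (\<Delta> x) z) ` Delta_hom h \<iota> EE (J1 \<inter> \<Delta> ` EE) (J2 \<inter> \<Delta> ` EE) = WFV_hom p h WR AA FF J1 J2"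
  proof (intro equalityI subsetI)
    fix f assume f: "f \<in> WFV_hom p h WR AA FF J1 J2"
    obtain x where x: "x \<in> EE" "\<And>z. z \<in> J1 \<Longrightarrow> f z = act (\<Delta> x) z" using WFV_hom_is_act[OF J1 J2 f] by blast
    have fE: "f \<in> J1 \<rightarrow>\<^sub>E J2" using f unfolding WFV_hom_def by blast
    have "act (\<Delta> x) z \<in> J2 \<inter> \<Delta> ` EE" if z: "z \<in> J1 \<inter> \<Delta> ` EE" for z
    proof
      show "act (\<Delta> x) z \<in> J2" using x(2)[of z] fE z by (metis IntD1 PiE_mem)
      obtain x' where "z = \<Delta> x'" "x' \<in> EE" using z by blast
      then show "act (\<Delta> x) z \<in> \<Delta> ` EE" by (simp add: act_\<Delta> EE_closed)
    qed
    then have "x \<in> Delta_hom h \<iota> EE (J1 \<inter> \<Delta> ` EE) (J2 \<inter> \<Delta> ` EE)" unfolding Delta_hom_def otimes_act using x(1) by blast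
    moreover have "f = (\<lambda>z\<in>J1. act (\<Delta> x) z)"
    proof (rule PiE_ext[OF fE])
      show "(\<lambda>z\<in>J1. act (\<Delta> x) z) \<in> J1 \<rightarrow>\<^sub>E J2" using Delta_hom_maps[OF J1 J2 calculation] by auto
    qed (use x(2) in simp)
    ultimately show "f \<in> (\<lambda>x. \<lambda>z\<in>J1. act (\<Delta> x) z) ` Delta_hom h \<iota> EE (J1 \<inter> \<Delta> ` EE) (J2 \<inter> \<Delta> ` EE)" by blast
  qed (use act_in_WFV_hom[OF J1 J2] in blast)
qed

end

end

section \<open>The equivalence\<close>

theorem proposition4p16:
  fixes p a n :: nat
    and h :: "int poly"
    and G :: "(nat \<Rightarrow> 'c::{field,finite} alg_closure) monoid"
    and v :: "'k::field_char_0 \<Rightarrow> ereal"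
    and \<iota> :: "'k \<Rightarrow> 'l::field_char_0"
    and vL :: "'l \<Rightarrow> ereal"
    and \<sigma> :: "'l \<Rightarrow> 'l"
    and S :: "real set"
    and \<Delta> :: "'k poly \<Rightarrow> 'l poly"
    and W :: "'l set"
    and E R :: "'k poly set"
    and A WR :: "'l poly set"
  assumes "Factorial_Ring.prime p" and "CARD('c) = p ^ a"
    and "abelian_variety n G" and "frobenius_char_poly G h" and "squarefree h"
    and "padic_field p v" and "unramified_extension v \<iota> vL a" and "frobenius_automorphism p \<iota> vL \<sigma>"
    and "S = {0} \<or> S = {1}"
  defines "\<Delta> \<equiv> map_poly \<iota>" and "W \<equiv> val_ring vL"
    and "E \<equiv> E_part p a v h S" and "R \<equiv> R_part p a v h S"
    and "A \<equiv> tensor h \<iota> UNIV E" and "WR \<equiv> tensor h \<iota> W R"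
  shows "\<exists>F :: 'l poly \<Rightarrow> 'l poly. frobenius_property a h \<sigma> A F \<and>
    (\<forall>I. fractional_ideal (quot_alg h) (scalar h ` val_ring v) (range (scalar h)) R E I \<longrightarrow>
       WFV_ideal p v \<iota> h WR A F (tensor h \<iota> W I)) \<and>
    (\<forall>J. WFV_ideal p v \<iota> h WR A F J \<longrightarrow>
       J = tensor h \<iota> W {x \<in> E. \<Delta> x \<in> J \<inter> \<Delta> ` E}) \<and>
    (\<forall>J1 J2. WFV_ideal p v \<iota> h WR A F J1 \<and> WFV_ideal p v \<iota> h WR A F J2 \<longrightarrow>
       bij_betw (\<lambda>x. \<lambda>z\<in>J1. \<Delta> x \<otimes>\<^bsub>quot_alg h\<^esub> z)
         (Delta_hom h \<iota> E (J1 \<inter> \<Delta> ` E) (J2 \<inter> \<Delta> ` E))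
         (WFV_hom p h WR A F J1 J2))"
proof -
  have h0: "Polynomial.coeff h 0 \<noteq> 0" using assms(1-4) by (rule frobenius_char_poly_coeff_0)
  then have hn: "h \<noteq> 0" by auto
  interpret s: slope_setting p v \<iota> vL a \<sigma> h S
    by unfold_locales (fact assms h0 hn)+
  obtain b b' c c' where d: "s.frobenius_datum b b' c c'" using s.ex_frobenius_datum by blast
  have A: "A = s.AA" unfolding A_def E_def by (rule s.AA_eq)
  show ?thesis
    unfolding A WR_def E_def R_def \<Delta>_def W_def s.otimes_act
  proof (intro exI[of _ "s.FF b c"] conjI allI impI)
    show "frobenius_property a h \<sigma> s.AA (s.FF b c)" by (rule s.frobenius_property_FF[OF d])
  next
    fix I assume "fractional_ideal (quot_alg h) (scalar h ` val_ring v) (range (scalar h)) (R_part p a v h S) (E_part p a v h S) I"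
    then show "WFV_ideal p v \<iota> h (tensor h \<iota> (val_ring vL) (R_part p a v h S)) s.AA (s.FF b c) (tensor h \<iota> (val_ring vL) I)"
      by (rule s.WFV_ideal_tensor[OF d])
  next
    fix J assume "WFV_ideal p v \<iota> h (tensor h \<iota> (val_ring vL) (R_part p a v h S)) s.AA (s.FF b c) J"
    then show "J = tensor h \<iota> (val_ring vL) {x \<in> E_part p a v h S. map_poly \<iota> x \<in> J \<inter> map_poly \<iota> ` E_part p a v h S}"
      by (rule s.WFV_ideal_descends[OF d])
  next
    fix J1 J2 assume "WFV_ideal p v \<iota> h (tensor h \<iota> (val_ring vL) (R_part p a v h S)) s.AA (s.FF b c) J1 \<and>
      WFV_ideal p v \<iota> h (tensor h \<iota> (val_ring vL) (R_part p a v h S)) s.AA (s.FF b c) J2"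
    then have J: "WFV_ideal p v \<iota> h (tensor h \<iota> (val_ring vL) (R_part p a v h S)) s.AA (s.FF b c) J1"
      "WFV_ideal p v \<iota> h (tensor h \<iota> (val_ring vL) (R_part p a v h S)) s.AA (s.FF b c) J2" by simp_all
    show "bij_betw (\<lambda>x. \<lambda>z\<in>J1. s.act (map_poly \<iota> x) z)
        (Delta_hom h \<iota> (E_part p a v h S) (J1 \<inter> map_poly \<iota> ` E_part p a v h S) (J2 \<inter> map_poly \<iota> ` E_part p a v h S))
        (WFV_hom p h (tensor h \<iota> (val_ring vL) (R_part p a v h S)) s.AA (s.FF b c) J1 J2)"
      by (rule s.Delta_hom_bij[OF d J])
  qed
qed

end
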